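(* Let $\kappa\in(2,\infty)$ and let $\Gamma\subset\mathbb{R}^2$ be a convex closed $C^\infty$ curve with finitely many points of vanishing curvature, of maximal order $\kappa-2$. Let $f\in C^\infty(\Gamma)$, let the weight profile $\theta$ have regularity order $q\ge0$, and let $\alpha\in[0,1]$. For a rotation $\eta\in\mathrm{SO}(2)$ and a translation $\boldsymbol\xi\in[0,1]^2$ let $\mathcal{I}_h(f;\eta,\boldsymbol\xi)$ denote the implicit boundary integral with tube width $\varepsilon$ on the transformed boundary $\eta\Gamma+h\boldsymbol\xi$. There is $\varepsilon_0>0$ such that if $\varepsilon=\varepsilon(h)=\Theta(h^\alpha)$ with $\varepsilon\le\varepsilon_0$, then, as $h\to0^+$, $$\int_{[0,1]^2}\int_{\mathrm{SO}(2)}\left|\mathcal{I}_h(f;\eta,\boldsymbol\xi)-\mathcal{I}(f)\right|^2d\eta\,d\boldsymbol\xi=\mathcal{O}\left(h^{1+2(q+1)(1-\alpha)}\right),$$ where $d\eta$ is the normalized Haar measure on $\mathrm{SO}(2)$.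
   Context: Setting ($d=2$): $\Gamma$ is the boundary of a bounded convex domain $\Omega\subset\mathbb{R}^2$, with outward unit normal $\mathbf{n}$. The curvature vanishes to order $\kappa'-2$ ($\kappa'>2$) at $\mathbf{z}\in\Gamma$ if, after a rigid motion placing $\mathbf{z}$ at the origin, $\Gamma$ is locally the graph $\{(x,g(x)):|x|\le r\}$ for some $r>0$, with $g(x)=|x|^{\kappa'}a(x)$, $a\in C^\infty[-r,r]$, $a(x)\ne0$ for all $x\in[-r,r]$. "Maximal order $\kappa-2$" means that at each of the finitely many points of vanishing curvature the curvature vanishes to some order $\kappa'-2$ with $2<\kappa'\le\kappa$. The tube is $T_\varepsilon=\{\mathbf{x}\in\mathbb{R}^2: \mathrm{dist}(\mathbf{x},\Gamma)\le\varepsilon\}$, with $\varepsilon$ always assumed small enough that every $\mathbf{x}\in T_\varepsilon$ has a unique closest point $P_\Gamma(\mathbf{x})\in\Gamma$. The signed distance is $d_\Gamma(\mathbf{x})=\mathbf{n}(P_\Gamma(\mathbf{x}))\cdot(\mathbf{x}-P_\Gamma(\mathbf{x}))$. $J_\varepsilon(\mathbf{x},s)=1-s\,k(\mathbf{x})$, where $k(\mathbf{x})$ is the signed curvature at $\mathbf{x}$ of the level curve $\{d_\Gamma=s\}$ (positive for circles); this is the Jacobian of $P_\Gamma$ restricted to that level curve. Weight profile of regularity order $q\in\{0,1,2,\dots\}$: a fixed function $\theta:\mathbb{R}\to\mathbb{R}$ with $\mathrm{supp}\,\theta=[-1,1]$, $\int_{-1}^1\theta=1$; if $q\ge1$, $\theta\in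 C^{q-1}(\mathbb{R})$ and $\theta^{(q)}$ is piecewise $C^1$; if $q=0$, $\theta\in L^\infty$ is piecewise $C^1$ (piecewise $C^1$: finitely many pieces, $C^1$ up to the closure on each). $\theta_\varepsilon(s)=\varepsilon^{-1}\theta(s/\varepsilon)$. Let $\mathcal{Q}_\Gamma(\mathbf{x})=f(P_\Gamma(\mathbf{x}))\,\theta_\varepsilon(d_\Gamma(\mathbf{x}))\,J_\varepsilon(\mathbf{x},d_\Gamma(\mathbf{x}))$, extended by zero outside $T_\varepsilon$. $\mathcal{I}(f)=\int_\Gamma f\,d\sigma$, and (the integrand being transported with the curve) $\mathcal{I}_h(f;\eta,\boldsymbol\xi)=h^2\sum_{\mathbf{w}\in\mathbb{Z}^2}\mathcal{Q}_\Gamma\left(h\eta^{-1}(\mathbf{w}-\boldsymbol\xi)\right)$. $\varepsilon=\Theta(h^\alpha)$ means $c_1h^\alpha\le\varepsilon\le c_2h^\alpha$ with constants $c_1,c_2>0$; the constants in $\mathcal{O}$ are independent of $h$. *)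

theory Defs
  imports "HOL-Analysis.Analysis" "HOL-Library.Landau_Symbols"
begin

text \<open>Derivatives are taken within \<open>S\<close>, hence one-sided at the endpoints of a compact interval.\<close>

definition nth_vderiv :: "nat \<Rightarrow> real set \<Rightarrow> (real \<Rightarrow> 'a::real_normed_vector) \<Rightarrow> real \<Rightarrow> 'a" where
  "nth_vderiv k S f = ((\<lambda>g t. vector_derivative g (at t within S)) ^^ k) f"

definition Ck_on :: "nat \<Rightarrow> real set \<Rightarrow> (real \<Rightarrow> 'a::real_normed_vector) \<Rightarrow> bool" where
  "Ck_on k S f \<longleftrightarrow>
     (\<forall>j<k. \<forall>t\<in>S. nth_vderiv j S f differentiable (at t within S)) \<and>
     continuous_on S (nth_vderiv k S f)"

definition smooth_on :: "real set \<Rightarrow> (real \<Rightarrow> 'a::real_normed_vector) \<Rightarrow> bool" where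
  "smooth_on S f \<longleftrightarrow> (\<forall>k. Ck_on k S f)"

text \<open>Finitely many pieces, \<open>C\<^sup>1\<close> up to the closure on each; the values at the
  breakpoints \<open>B\<close> are arbitrary.\<close>

definition piecewise_C1 :: "(real \<Rightarrow> real) \<Rightarrow> bool" where
  "piecewise_C1 g \<longleftrightarrow>
     (\<exists>B. finite B \<and>
       (\<forall>a b. a < b \<and> {a<..<b} \<inter> B = {} \<longrightarrow>
         (\<exists>G. Ck_on 1 {a..b} G \<and> (\<forall>x\<in>{a<..<b}. G x = g x))))"

definition smooth_closed_param :: "(real^2) set \<Rightarrow> (real \<Rightarrow> real^2) \<Rightarrow> bool" where
  "smooth_closed_param \<Gamma> \<gamma> \<longleftrightarrow>
     smooth_on UNIV \<gamma> \<and> (\<forall>t. \<gamma> (t + 1) = \<gamma> t) \<and>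
     (\<forall>t. vector_derivative \<gamma> (at t) \<noteq> 0) \<and>
     inj_on \<gamma> {0..<1} \<and> \<gamma> ` {0..1} = \<Gamma>"

definition smooth_closed_curve :: "(real^2) set \<Rightarrow> bool" where
  "smooth_closed_curve \<Gamma> \<longleftrightarrow> (\<exists>\<gamma>. smooth_closed_param \<Gamma> \<gamma>)"

definition smooth_on_curve :: "(real^2) set \<Rightarrow> (real^2 \<Rightarrow> real) \<Rightarrow> bool" where
  "smooth_on_curve \<Gamma> f \<longleftrightarrow> (\<forall>\<gamma>. smooth_closed_param \<Gamma> \<gamma> \<longrightarrow> smooth_on UNIV (f \<circ> \<gamma>))"

text \<open>Integral with respect to arc length; it does not depend on the parametrization chosen.\<close>

definition curve_integral :: "(real^2) set \<Rightarrow> (real^2 \<Rightarrow> real) \<Rightarrow> real" where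
  "curve_integral \<Gamma> f =
     (let \<gamma> = (SOME \<gamma>. smooth_closed_param \<Gamma> \<gamma>)
      in integral {0..1} (\<lambda>t. f (\<gamma> t) * norm (vector_derivative \<gamma> (at t))))"

definition cross2 :: "real^2 \<Rightarrow> real^2 \<Rightarrow> real" where
  "cross2 u v = u $ 1 * v $ 2 - u $ 2 * v $ 1"

text \<open>Signed curvature at \<open>x\<close> of a set \<open>S\<close> that is a regular curve near \<open>x\<close>, oriented so that
  the normal \<open>\<nu>\<close> points to the right of the direction of travel. With \<open>\<nu>\<close> the outward normal the
  orientation is counterclockwise, so a circle of radius \<open>R\<close> has curvature \<open>1/R\<close>.\<close>

definition signed_curvature :: "(real^2) set \<Rightarrow> real^2 \<Rightarrow> real^2 \<Rightarrow> real" where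
  "signed_curvature S \<nu> x =
     (THE k. \<exists>\<gamma> \<delta>. \<delta> > 0 \<and> Ck_on 2 {-\<delta><..<\<delta>} \<gamma> \<and> \<gamma> ` {-\<delta><..<\<delta>} \<subseteq> S \<and> \<gamma> 0 = x \<and>
        (let v = nth_vderiv 1 {-\<delta><..<\<delta>} \<gamma> 0; w = nth_vderiv 2 {-\<delta><..<\<delta>} \<gamma> 0
         in cross2 \<nu> v > 0 \<and> k = cross2 v w / norm v ^ 3))"

text \<open>The curvature vanishes to order \<open>p\<close> at \<open>z\<close>: after the rigid motion \<open>y \<mapsto> R (y - z)\<close> the
  curve agrees in a neighbourhood \<open>V\<close> of the origin with a graph of \<open>|x| powr (p + 2) * a x\<close>.\<close>

definition curvature_vanishes_to_order :: "(real^2) set \<Rightarrow> real^2 \<Rightarrow> real \<Rightarrow> bool" where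
  "curvature_vanishes_to_order \<Gamma> z p \<longleftrightarrow>
     (\<exists>(R :: real^2 \<Rightarrow> real^2) r a V.
        orthogonal_transformation R \<and> r > 0 \<and>
        smooth_on {-r..r} a \<and> (\<forall>x\<in>{-r..r}. a x \<noteq> (0::real)) \<and> open V \<and> 0 \<in> V \<and>
        ((\<lambda>y. R (y - z)) ` \<Gamma>) \<inter> V =
          {vector [x, \<bar>x\<bar> powr (p + 2) * a x] | x. x \<in> {-r..r}} \<inter> V)"

definition tube :: "(real^2) set \<Rightarrow> real \<Rightarrow> (real^2) set" where
  "tube \<Gamma> \<epsilon> = {x. infdist x \<Gamma> \<le> \<epsilon>}"

definition tube_admissible :: "(real^2) set \<Rightarrow> real \<Rightarrow> bool" where
  "tube_admissible \<Gamma> \<epsilon> \<longleftrightarrow>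
     (\<forall>x\<in>tube \<Gamma> \<epsilon>. \<exists>!p. p \<in> \<Gamma> \<and> (\<forall>y\<in>\<Gamma>. dist x p \<le> dist x y))"

definition outward_unit_normal :: "(real^2) set \<Rightarrow> real^2 \<Rightarrow> real^2" where
  "outward_unit_normal \<Omega> z =
     (THE \<nu>. norm \<nu> = 1 \<and>
        (\<forall>\<gamma> v. (\<gamma> has_vector_derivative v) (at (0::real)) \<and> \<gamma> 0 = z \<and> range \<gamma> \<subseteq> frontier \<Omega>
               \<longrightarrow> \<nu> \<bullet> v = 0) \<and>
        (\<forall>\<^sub>F t in at_right 0. z + t *\<^sub>R \<nu> \<notin> closure \<Omega>))"

definition signed_distance :: "(real^2) set \<Rightarrow> real^2 \<Rightarrow> real" where
  "signed_distance \<Omega> x =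
     outward_unit_normal \<Omega> (closest_point (frontier \<Omega>) x) \<bullet> (x - closest_point (frontier \<Omega>) x)"

definition boundary_curvature :: "(real^2) set \<Rightarrow> real^2 \<Rightarrow> real" where
  "boundary_curvature \<Omega> z = signed_curvature (frontier \<Omega>) (outward_unit_normal \<Omega> z) z"

text \<open>The unit normal at \<open>x\<close> of the level curve of the signed distance through \<open>x\<close> is the outward
  normal of \<open>\<Omega>\<close> at the projection of \<open>x\<close>.\<close>

definition level_curvature :: "(real^2) set \<Rightarrow> real^2 \<Rightarrow> real" where
  "level_curvature \<Omega> x =
     signed_curvature {y. signed_distance \<Omega> y = signed_distance \<Omega> x}
       (outward_unit_normal \<Omega> (closest_point (frontier \<Omega>) x)) x"

definition proj_jacobian :: "(real^2) set \<Rightarrow> real^2 \<Rightarrow> real \<Rightarrow> real" where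
  "proj_jacobian \<Omega> x s = 1 - s * level_curvature \<Omega> x"

text \<open>For \<open>q \<ge> 1\<close> the function \<open>g\<close> is the \<open>q\<close>-th derivative of \<open>\<theta>\<close>, which need not exist at the
  finitely many points of \<open>B\<close>.\<close>

definition weight_profile :: "nat \<Rightarrow> (real \<Rightarrow> real) \<Rightarrow> bool" where
  "weight_profile q \<theta> \<longleftrightarrow>
     closure {s. \<theta> s \<noteq> 0} = {-1..1} \<and> (\<theta> has_integral 1) {-1..1} \<and>
     (if q = 0
      then \<theta> \<in> borel_measurable lborel \<and> (\<exists>M. AE s in lborel. \<bar>\<theta> s\<bar> \<le> M) \<and> piecewise_C1 \<theta>
      else Ck_on (q - 1) UNIV \<theta> \<and>
        (\<exists>B g. finite B \<and>
           (\<forall>s. s \<notin> B \<longrightarrow> (nth_vderiv (q - 1) UNIV \<theta> has_real_derivative g s) (at s)) \<and>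
           piecewise_C1 g))"

definition scaled_profile :: "(real \<Rightarrow> real) \<Rightarrow> real \<Rightarrow> real \<Rightarrow> real" where
  "scaled_profile \<theta> \<epsilon> s = \<theta> (s / \<epsilon>) / \<epsilon>"

definition ibi_integrand ::
  "(real^2) set \<Rightarrow> (real^2 \<Rightarrow> real) \<Rightarrow> (real \<Rightarrow> real) \<Rightarrow> real \<Rightarrow> real^2 \<Rightarrow> real" where
  "ibi_integrand \<Omega> f \<theta> \<epsilon> x =
     (if x \<in> tube (frontier \<Omega>) \<epsilon>
      then f (closest_point (frontier \<Omega>) x) * scaled_profile \<theta> \<epsilon> (signed_distance \<Omega> x)
             * proj_jacobian \<Omega> x (signed_distance \<Omega> x)
      else 0)"

definition int_lattice :: "(real^2) set" where
  "int_lattice = {w. \<forall>i. w $ i \<in> \<int>}"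

text \<open>The lattice sum for the boundary \<open>\<eta>\<Gamma> + h\<xi>\<close>, with the integrand pulled back to \<open>\<Gamma>\<close>. Only finitely
  many terms are nonzero when \<open>h > 0\<close> and \<open>\<eta>\<close> is a rotation, because the tube is bounded.\<close>

definition ibi ::
  "(real^2) set \<Rightarrow> (real^2 \<Rightarrow> real) \<Rightarrow> (real \<Rightarrow> real) \<Rightarrow> real \<Rightarrow> real \<Rightarrow> real^2^2 \<Rightarrow> real^2 \<Rightarrow> real" where
  "ibi \<Omega> f \<theta> \<epsilon> h \<eta> \<xi> =
     h\<^sup>2 * (\<Sum>\<^sub>\<infinity>w\<in>int_lattice. ibi_integrand \<Omega> f \<theta> \<epsilon> (h *\<^sub>R (matrix_inv \<eta> *v (w - \<xi>))))"

definition unit_square :: "(real^2) set" where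
  "unit_square = {\<xi>. \<forall>i. \<xi> $ i \<in> {0..1}}"

definition SO2 :: "(real^2^2) set" where
  "SO2 = {A. rotation_matrix A}"

definition rot :: "real \<Rightarrow> real^2^2" where
  "rot t = vector [vector [cos t, - sin t], vector [sin t, cos t]]"

text \<open>The image of the uniform distribution on angles. By the lemmas below this is a left-invariant
  probability measure on \<open>SO2\<close>, hence the normalized Haar measure.\<close>

definition SO2_haar :: "(real^2^2) measure" where
  "SO2_haar = distr (uniform_measure lborel {0..<2*pi}) (restrict_space borel SO2) rot"

lemma rot_entries [simp]:
  "rot t $ 1 $ 1 = cos t" "rot t $ 1 $ 2 = - sin t" "rot t $ 2 $ 1 = sin t" "rot t $ 2 $ 2 = cos t"
  by (simp_all add: rot_def)

lemma rot_mult: "rot s ** rot t = rot (s + t)"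
  by (simp add: vec_eq_iff forall_2 matrix_matrix_mult_def sum_2 cos_add sin_add)

lemma rot_in_SO2: "rot t \<in> SO2"
proof -
  have "transpose (rot t) ** rot t = mat 1" "rot t ** transpose (rot t) = mat 1"
    by (simp_all add: vec_eq_iff forall_2 matrix_matrix_mult_def sum_2 transpose_def mat_def
        flip: power2_eq_square)
  moreover have "det (rot t) = 1"
    by (simp add: det_2 flip: power2_eq_square)
  ultimately show ?thesis
    by (simp add: SO2_def rotation_matrix_def orthogonal_matrix_def)
qed

lemma SO2_eq_range_rot: "SO2 = rot ` {0..<2*pi}"
proof (intro equalityI subsetI)
  fix A assume "A \<in> SO2"
  then have A: "transpose A ** A = mat 1" "A ** transpose A = mat 1" "det A = 1"
    by (auto simp: SO2_def rotation_matrix_def orthogonal_matrix_def)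
  have e: "A$1$1 * A$1$1 + A$2$1 * A$2$1 = 1" "A$1$1 * A$1$2 + A$2$1 * A$2$2 = 0"
      "A$1$2 * A$1$2 + A$2$2 * A$2$2 = 1"
    using A(1) by (simp_all add: vec_eq_iff forall_2 matrix_matrix_mult_def sum_2 transpose_def mat_def)
  have d: "A$1$1 * A$2$2 - A$1$2 * A$2$1 = 1"
    using A(3) by (simp add: det_2)
  have "A$2$2 = A$1$1" "A$1$2 = - A$2$1"
    using e d by algebra+
  moreover obtain t where "0 \<le> t" "t < 2 * pi" "A$1$1 = cos t" "A$2$1 = sin t"
    using sincos_total_2pi[of "A$1$1" "A$2$1"] e(1) by (metis power2_eq_square)
  ultimately have "A = rot t"
    by (simp add: vec_eq_iff forall_2)
  with \<open>0 \<le> t\<close> \<open>t < 2 * pi\<close> show "A \<in> rot ` {0..<2*pi}" by auto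
qed (auto simp: rot_in_SO2)

lemma rot_measurable: "rot \<in> borel \<rightarrow>\<^sub>M restrict_space borel SO2"
proof -
  have eq: "rot = (\<lambda>t. \<chi> i j. if i = 1 then (if j = 1 then cos t else - sin t)
                              else (if j = 1 then sin t else cos t))"
    by (auto simp: fun_eq_iff vec_eq_iff forall_2)
  have "continuous_on UNIV rot"
    unfolding eq
  proof (intro continuous_on_vec_lambda)
    fix i j :: 2
    show "continuous_on UNIV (\<lambda>t::real. if i = 1 then (if j = 1 then cos t else - sin t)
                                 else (if j = 1 then sin t else cos t))"
      by (cases "i = 1"; cases "j = 1") (auto intro!: continuous_intros)
  qed
  then have "rot \<in> borel_measurable borel"
    by (simp add: borel_measurable_continuous_onI)
  then show ?thesis
    by (simp add: measurable_restrict_space2_iff rot_in_SO2)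
qed

lemma space_SO2_haar [simp]: "space SO2_haar = SO2"
  and sets_SO2_haar: "sets SO2_haar = sets (restrict_space borel SO2)"
  by (simp_all add: SO2_haar_def space_restrict_space)

lemma emeasure_SO2_haar:
  assumes "X \<in> sets SO2_haar"
  shows "emeasure SO2_haar X
           = emeasure lborel {t \<in> {0..<2*pi}. rot t \<in> X} / emeasure lborel {0..<2*pi}"
proof -
  have X: "X \<in> sets (restrict_space borel SO2)"
    using assms by (simp add: sets_SO2_haar)
  have m: "rot -` X \<in> sets borel"
    using measurable_sets[OF rot_measurable X] by simp
  have r: "rot \<in> uniform_measure lborel {0..<2*pi} \<rightarrow>\<^sub>M restrict_space borel SO2"
    using rot_measurable by (simp add: measurable_def)
  have "emeasure SO2_haar X = emeasure (uniform_measure lborel {0..<2*pi}) (rot -` X)"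
    using emeasure_distr[OF r X] by (simp add: SO2_haar_def)
  also have "\<dots> = emeasure lborel ({0..<2*pi} \<inter> rot -` X) / emeasure lborel {0..<2*pi}"
    using m by (intro emeasure_uniform_measure) auto
  also have "{0..<2*pi} \<inter> rot -` X = {t \<in> {0..<2*pi}. rot t \<in> X}"
    by auto
  finally show ?thesis .
qed

lemma emeasure_space_SO2_haar: "emeasure SO2_haar (space SO2_haar) = 1"
proof -
  have "SO2 \<in> sets SO2_haar"
    using sets.top[of SO2_haar] by simp
  moreover have "{t \<in> {0..<2*pi}. rot t \<in> SO2} = {0..<2*pi}"
    by (auto simp: rot_in_SO2)
  ultimately have "emeasure SO2_haar SO2
      = emeasure lborel {0..<2*pi} / emeasure lborel {0..<2*pi}"
    by (simp only: emeasure_SO2_haar)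
  also have "\<dots> = 1"
    by (intro ennreal_divide_self) auto
  finally show ?thesis
    by simp
qed

lemma emeasure_periodic_shift:
  fixes F :: "real set"
  assumes F: "F \<in> sets borel" and per: "\<And>t. t + p \<in> F \<longleftrightarrow> t \<in> F" and s: "0 \<le> s" "s \<le> p"
  shows "emeasure lborel {t \<in> {0..<p}. t + s \<in> F} = emeasure lborel {t \<in> {0..<p}. t \<in> F}"
proof -
  have shift: "emeasure lborel {t. t + a \<in> X} = emeasure lborel X" if "X \<in> sets borel" for a X
  proof -
    have "emeasure lborel X = emeasure (distr lborel borel ((+) a)) X"
      by (simp add: lborel_distr_plus)
    also have "\<dots> = emeasure lborel ((+) a -` X \<inter> space lborel)"
      using that by (intro emeasure_distr) auto
    also have "(+) a -` X \<inter> space lborel = {t. t + a \<in> X}"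
      by (auto simp: add.commute)
    finally show ?thesis by simp
  qed
  have "{t \<in> {0..<p}. t + s \<in> F} = {t. t + s \<in> F \<inter> {s..<s + p}}"
    by auto
  then have "emeasure lborel {t \<in> {0..<p}. t + s \<in> F} = emeasure lborel (F \<inter> {s..<s + p})"
    using shift[of "F \<inter> {s..<s + p}" s] F by simp
  also have "F \<inter> {s..<s + p} = (F \<inter> {s..<p}) \<union> (F \<inter> {p..<p + s})"
    using s by auto
  also have "emeasure lborel \<dots> = emeasure lborel (F \<inter> {s..<p}) + emeasure lborel (F \<inter> {p..<p + s})"
    using F by (intro plus_emeasure[symmetric]) auto
  also have "emeasure lborel (F \<inter> {p..<p + s}) = emeasure lborel {t. t + p \<in> F \<inter> {p..<p + s}}"
    using shift[of "F \<inter> {p..<p + s}" p] F by simp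
  also have "{t. t + p \<in> F \<inter> {p..<p + s}} = F \<inter> {0..<s}"
    using per by auto
  also have "emeasure lborel (F \<inter> {s..<p}) + emeasure lborel (F \<inter> {0..<s})
      = emeasure lborel ((F \<inter> {s..<p}) \<union> (F \<inter> {0..<s}))"
    using F by (intro plus_emeasure) auto
  also have "(F \<inter> {s..<p}) \<union> (F \<inter> {0..<s}) = {t \<in> {0..<p}. t \<in> F}"
    using s by auto
  finally show ?thesis .
qed

lemma SO2_haar_left_invariant:
  assumes "B \<in> SO2"
  shows "distr SO2_haar SO2_haar (\<lambda>A. B ** A) = SO2_haar"
proof (rule measure_eqI)
  obtain s where s: "0 \<le> s" "s < 2*pi" "B = rot s"
    using assms by (auto simp: SO2_eq_range_rot)
  have closed: "B ** A \<in> SO2" if "A \<in> SO2" for A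
    using that s(3) by (metis SO2_eq_range_rot imageE rot_in_SO2 rot_mult)
  have "continuous_on UNIV (\<lambda>A::real^2^2. B ** A)"
    unfolding matrix_matrix_mult_def
    by (intro continuous_on_vec_lambda continuous_intros)
  then have "(\<lambda>A::real^2^2. B ** A) \<in> borel_measurable borel"
    by (rule borel_measurable_continuous_onI)
  then have "(\<lambda>A. B ** A) \<in> restrict_space borel SO2 \<rightarrow>\<^sub>M restrict_space borel SO2"
    using closed by (auto simp: measurable_restrict_space2_iff space_restrict_space
        intro!: measurable_restrict_space1)
  then have m: "(\<lambda>A. B ** A) \<in> SO2_haar \<rightarrow>\<^sub>M SO2_haar"
    by (simp add: measurable_cong_sets[OF sets_SO2_haar sets_SO2_haar])
  fix X assume "X \<in> sets (distr SO2_haar SO2_haar (\<lambda>A. B ** A))"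
  then have X: "X \<in> sets SO2_haar" by simp
  let ?Y = "(\<lambda>A. B ** A) -` X \<inter> space SO2_haar"
  have Y: "?Y \<in> sets SO2_haar"
    using m X by (rule measurable_sets)
  have F: "rot -` X \<in> sets borel"
    using measurable_sets[OF rot_measurable] X by (simp add: sets_SO2_haar)
  have "emeasure (distr SO2_haar SO2_haar (\<lambda>A. B ** A)) X = emeasure SO2_haar ?Y"
    using m X by (rule emeasure_distr)
  also have "\<dots> = emeasure lborel {t \<in> {0..<2*pi}. t + s \<in> rot -` X} / emeasure lborel {0..<2*pi}"
    using Y by (simp add: emeasure_SO2_haar s(3) rot_mult rot_in_SO2 add.commute)
  also have "emeasure lborel {t \<in> {0..<2*pi}. t + s \<in> rot -` X}
      = emeasure lborel {t \<in> {0..<2*pi}. t \<in> rot -` X}"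
    using F s(1,2) by (intro emeasure_periodic_shift) (auto simp: rot_def)
  also have "\<dots> / emeasure lborel {0..<2*pi} = emeasure SO2_haar X"
    using X by (simp add: emeasure_SO2_haar)
  finally show "emeasure (distr SO2_haar SO2_haar (\<lambda>A. B ** A)) X = emeasure SO2_haar X" .
qed simp

end

theory Submission
  imports Defs
begin

text \<open>For a fixed rotation the lattice sum is a periodic function of the translation. Its Fourier
  coefficients are the values of the Fourier transform of the integrand at the dual lattice points
  \<open>m\<close>, scaled by \<open>1/h\<close> and rotated, and its mean is \<open>\<I>(f)\<close>; by Parseval the mean square error over
  the translations is the sum of the squared moduli over \<open>m \<noteq> 0\<close>. The integrand is only bounded and
  almost everywhere continuous, so Parseval is used through Fejer means and Fatou's lemma.

  In tubular coordinates \<open>\<gamma>(t) + s n(t)\<close> the factor \<open>J\<close> cancels the Jacobian, so the transform at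
  frequency \<open>R\<close> in direction \<open>p\<close> is an integral over \<open>t\<close> whose phase has derivative \<open>R \<tau>\<close> times the
  speed, where \<open>\<tau>\<close> and \<open>\<nu>\<close> are the components of the direction along tangent and normal, multiplied by the
  transform of \<open>\<theta>\<close> at \<open>\<epsilon> R \<nu>\<close>, which decays to order \<open>q + 1\<close>. Since \<open>\<tau>\<^sup>2 + \<nu>\<^sup>2 = 1\<close>, either integration
  by parts in \<open>t\<close> or this decay can be used. The remaining factor \<open>1/R\<close> comes from the average of
  the square over all directions \<open>p\<close>, a \<open>T T*\<close> argument that does not see the curvature: after
  expanding the square, the integral over \<open>p\<close> decays in the distance of the two points of the curve.\<close>

section \<open>Averaging an oscillatory integral over directions\<close>

text \<open>The width of the tube and the frequency are independent parameters: \<epsilon> may be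
  fixed, comparable to h, or anything between. Every bound is therefore proved in R and \<epsilon>
  jointly, uniformly over the parallel curves up to a fixed distance e below the reach. The mean
  square of the transform is of order R^-1 (\<epsilon> R)^-2(q+1); with R = 2 pi |m| / h this
  becomes h (h / \<epsilon>)^(2(q+1)) times |m|^-3 or better, and any exponent above 2 is summable
  over the plane lattice, so q = 0 is covered as well. The obstacle is a direction normal to the
  curve: there the phase is stationary, and pointwise decay would depend on the order of contact
  between the curve and its tangent. Multiplying by a binomial expansion of 1 = (\<tau>^2 +
  \<nu>^2)^N separates the two sources of decay without cutoff functions. A second obstacle is that
  normal and curvature are definite descriptions ranging over all curves in a set, so that their
  values have to be identified with those of a moving frame. The numerical constants are convenient
  rather than sharp.\<close>

text \<open>The weight vanishes to second order at both ends of the arc, so that two integrations by parts in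
  the angle leave no boundary terms.\<close>

definition arc_weight :: "real \<Rightarrow> real" where
  "arc_weight p = ((p - pi/6) * (5*pi/6 - p))\<^sup>2"

definition arc_weight' :: "real \<Rightarrow> real" where
  "arc_weight' p = 2 * ((p - pi/6) * (5*pi/6 - p)) * (pi - 2*p)"

definition arc_weight'' :: "real \<Rightarrow> real" where
  "arc_weight'' p = 2 * (pi - 2*p)\<^sup>2 - 4 * ((p - pi/6) * (5*pi/6 - p))"

lemma arc_weight_deriv:
  "(arc_weight has_real_derivative arc_weight' p) (at p within S)"
  "(arc_weight' has_real_derivative arc_weight'' p) (at p within S)"
proof -
  have *: "((\<lambda>p. ((p - a) * (b - p))\<^sup>2) has_real_derivative 2 * ((p - a) * (b - p)) * (a + b - 2*p)) (at p within S)"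
    "((\<lambda>p. 2 * ((p - a) * (b - p)) * (a + b - 2*p)) has_real_derivative
      2 * (a + b - 2*p)\<^sup>2 - 4 * ((p - a) * (b - p))) (at p within S)" for a b :: real
    by (auto intro!: derivative_eq_intros simp: power2_eq_square algebra_simps)
  have "pi/6 + 5*pi/6 = pi" by simp
  with *[of "pi/6" "5*pi/6"] show
    "(arc_weight has_real_derivative arc_weight' p) (at p within S)"
    "(arc_weight' has_real_derivative arc_weight'' p) (at p within S)"
    unfolding arc_weight_def[abs_def] arc_weight'_def[abs_def] arc_weight''_def by simp_all
qed

lemma arc_weight_bounds:
  assumes "p \<in> {pi/6..5*pi/6}"
  shows "\<bar>arc_weight p\<bar> \<le> 100" "\<bar>arc_weight' p\<bar> \<le> 100" "\<bar>arc_weight'' p\<bar> \<le> 100"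
proof -
  define m where "m = (p - pi/6) * (5*pi/6 - p)"
  define d where "d = pi - 2*p"
  have pi4: "pi < 4" "pi > 0" using pi_less_4 by auto
  have d: "\<bar>d\<bar> \<le> 3" using assms pi4 by (auto simp: d_def abs_le_iff)
  have m0: "0 \<le> m" using assms by (simp add: m_def)
  have "(p - pi/6) \<le> 3" "5*pi/6 - p \<le> 3" "0 \<le> p - pi/6" "0 \<le> 5*pi/6 - p"
    using assms pi4 by auto
  then have m9: "m \<le> 9" unfolding m_def using mult_mono[of "p - pi/6" 3 "5*pi/6 - p" 3] by auto
  have "m\<^sup>2 \<le> 9\<^sup>2" using m0 m9 by (intro power_mono) auto
  then show "\<bar>arc_weight p\<bar> \<le> 100" by (simp add: arc_weight_def m_def)
  have "\<bar>m * d\<bar> \<le> 9 * 3" unfolding abs_mult using d m0 m9 by (intro mult_mono) auto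
  then show "\<bar>arc_weight' p\<bar> \<le> 100"
    unfolding arc_weight'_def by (simp add: m_def[symmetric] d_def[symmetric] abs_mult mult.commute[of "\<bar>d\<bar>"])
  have "d\<^sup>2 \<le> 9" "0 \<le> d\<^sup>2" using power_mono[OF d, of 2] by simp_all
  then have "\<bar>2 * d\<^sup>2 - 4 * m\<bar> \<le> 100" using m0 m9 by linarith
  then show "\<bar>arc_weight'' p\<bar> \<le> 100" by (simp add: arc_weight''_def m_def d_def)
qed

text \<open>On the inner arc both factors are at least pi/6 > 1/2, so passing from the unweighted
  square mean to the weighted one costs only a factor 16.\<close>

lemma arc_weight_ge:
  assumes "p \<in> {pi/3..2*pi/3}"
  shows "arc_weight p \<ge> 1/16"
proof -
  have "1/2 \<le> p - pi/6" "1/2 \<le> 5*pi/6 - p" using assms pi_gt3 by auto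
  then have "1/2 * (1/2) \<le> (p - pi/6) * (5*pi/6 - p)" by (intro mult_mono) auto
  then have "(1/4)\<^sup>2 \<le> ((p - pi/6) * (5*pi/6 - p))\<^sup>2" by (intro power_mono) auto
  then show ?thesis by (simp add: arc_weight_def power2_eq_square)
qed

text \<open>Together with |y| <= x/4 this keeps the angular derivative - x sin p + y cos p of the
  phase away from 0 on the whole arc.\<close>

lemma sin_ge_half:
  assumes "p \<in> {pi/6..5*pi/6}" shows "sin p \<ge> 1/2"
proof (cases "p \<le> pi/2")
  case True
  then have "sin (pi/6) \<le> sin p" using assms by (intro sin_monotone_2pi_le) auto
  then show ?thesis by (simp add: sin_30)
next
  case False
  then have "sin (pi/6) \<le> sin (pi - p)" using assms by (intro sin_monotone_2pi_le) auto
  then show ?thesis by (simp add: sin_30)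
qed

text \<open>Up to end points these arcs are the complement of the two inner arcs around pi/2 and 3
  pi/2. For such directions the phase is not stationary along a piece of curve that runs close to
  the x-axis.\<close>

lemma cos_abs_ge_half:
  assumes "p \<in> {0..pi/3} \<union> {2*pi/3..4*pi/3} \<union> {5*pi/3..2*pi}"
  shows "\<bar>cos p\<bar> \<ge> 1/2"
proof -
  have A: "cos q \<ge> 1/2" if "0 \<le> q" "q \<le> pi/3" for q
    using cos_monotone_0_pi_le[of q "pi/3"] that by (auto simp: cos_60)
  consider "0 \<le> p \<and> p \<le> pi/3" | "2*pi/3 \<le> p \<and> p \<le> pi" | "pi \<le> p \<and> p \<le> 4*pi/3" | "5*pi/3 \<le> p \<and> p \<le> 2*pi"
    using assms by fastforce
  then show ?thesis
  proof cases
    case 1 then show ?thesis using A[of p] by auto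
  next
    case 2 then show ?thesis using A[of "pi - p"] by auto
  next
    case 3 then show ?thesis using A[of "p - pi"] by (auto simp: cos_diff)
  next
    case 4 then show ?thesis using A[of "2*pi - p"] by (auto simp: cos_diff)
  qed
qed

text \<open>The kernel of the T T* argument: what the squared modulus of an oscillatory integral
  leaves, after averaging over directions, at two points of the curve with difference (x,
  y).\<close>

definition arc_kernel :: "real \<Rightarrow> real \<Rightarrow> complex" where
  "arc_kernel x y = integral {pi/6..5*pi/6} (\<lambda>p. of_real (arc_weight p) * cis (-(x * cos p + y * sin p)))"

lemma arc_kernel_trivial: "norm (arc_kernel x y) \<le> 300"
proof -
  have c: "continuous_on {pi/6..5*pi/6} arc_weight"
    unfolding arc_weight_def[abs_def] by (intro continuous_intros)
  have "norm (arc_kernel x y) \<le> 100 * (5*pi/6 - pi/6)"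
    unfolding arc_kernel_def
    by (rule integral_bound)
      (auto intro!: continuous_intros c simp: norm_mult arc_weight_bounds(1))
  also have "\<dots> \<le> 300" using pi_less_4 by simp
  finally show ?thesis .
qed

text \<open>The phase P satisfies P'' = - P and |P'| >= x/4, so two integrations by parts in the
  angle are possible. Two are wanted because x^-2, unlike x^-1, is integrable at infinity.\<close>

lemma arc_kernel_decay_pos:
  assumes x: "x > 0" and y: "\<bar>y\<bar> \<le> x / 4"
  shows "norm (arc_kernel x y) \<le> 3000000 / x\<^sup>2"
proof -
  let ?I = "{pi/6..5*pi/6}"
  define P where "P p = x * cos p + y * sin p" for p
  define P' where "P' p = - x * sin p + y * cos p" for p
  define e where "e p = cis (- P p)" for p
  define w where "w = arc_weight" define w' where "w' = arc_weight'" define w'' where "w'' = arc_weight''"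
  \<comment> \<open>The successive quotients by \<open>P'\<close>. In the derivative
    \<open>u2'\<close> the two terms containing the product of \<open>w'\<close> and
    \<open>P\<close> have cancelled, because P'' = - P.\<close>
  define u1 where "u1 p = w p / P' p" for p
  define u1' where "u1' p = (w' p * P' p + w p * P p) / (P' p)\<^sup>2" for p
  define u2 where "u2 p = (w' p * P' p + w p * P p) / (P' p)^3" for p
  define u2' where "u2' p = ((w'' p * P' p + w p * P' p) * P' p + 3 * P p * (w' p * P' p + w p * P p)) / (P' p)^4" for p
  have dP: "(P has_real_derivative P' p) (at p within S)" for p S
    unfolding P_def[abs_def] P'_def by (auto intro!: derivative_eq_intros)
  have dP': "(P' has_real_derivative (- P p)) (at p within S)" for p S
    unfolding P_def P'_def[abs_def] by (auto intro!: derivative_eq_intros)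
  have dw: "(w has_real_derivative w' p) (at p within S)" "(w' has_real_derivative w'' p) (at p within S)" for p S
    unfolding w_def w'_def w''_def by (rule arc_weight_deriv)+
  have P'lb: "\<bar>P' p\<bar> \<ge> x/4" if "p \<in> ?I" for p
  proof -
    have "x * (1/2) \<le> x * sin p" using sin_ge_half[OF that] x by (intro mult_left_mono) auto
    moreover have "\<bar>y * cos p\<bar> \<le> x/4 * 1" unfolding abs_mult using y x by (intro mult_mono) auto
    ultimately show ?thesis unfolding P'_def by auto
  qed
  have P'0: "P' p \<noteq> 0" if "p \<in> ?I" for p using P'lb[OF that] x by auto
  have Pub: "\<bar>P p\<bar> \<le> 2*x" for p
  proof -
    have "\<bar>x * cos p\<bar> \<le> x * 1" unfolding abs_mult using x by (intro mult_mono) auto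
    moreover have "\<bar>y * sin p\<bar> \<le> x/4 * 1" unfolding abs_mult using y x by (intro mult_mono) auto
    ultimately show ?thesis unfolding P_def using x by auto
  qed
  have P'ub: "\<bar>P' p\<bar> \<le> 2*x" for p
  proof -
    have "\<bar>x * sin p\<bar> \<le> x * 1" unfolding abs_mult using x by (intro mult_mono) auto
    moreover have "\<bar>y * cos p\<bar> \<le> x/4 * 1" unfolding abs_mult using y x by (intro mult_mono) auto
    ultimately show ?thesis unfolding P'_def using x by auto
  qed
  have du1: "(u1 has_real_derivative u1' p) (at p within ?I)" if "p \<in> ?I" for p
    unfolding u1_def[abs_def] u1'_def using P'0[OF that]
    by (auto intro!: derivative_eq_intros dw dP' simp: power2_eq_square field_simps)
  have du2: "(u2 has_real_derivative u2' p) (at p within ?I)" if "p \<in> ?I" for p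
    unfolding u2_def[abs_def] u2'_def using P'0[OF that]
    apply (auto intro!: derivative_eq_intros dw dP' dP)
    apply (simp add: divide_simps)
    apply algebra
    done
  have de: "(e has_vector_derivative (- P' p) *\<^sub>R (\<i> * e p)) (at p within S)" for p S
    unfolding e_def[abs_def] has_vector_derivative_def
    by (rule has_derivative_eq_rhs, rule has_derivative_cis)
       (auto intro!: derivative_eq_intros dP[unfolded has_field_derivative_def] simp: e_def)
  \<comment> \<open>One primitive carries out both integrations by parts: its derivative is
    \<open>w\<close> times \<open>e\<close> plus the remainder \<open>u2'\<close> times
    \<open>e\<close>. It vanishes at both ends of the arc because the weight and its first
    derivative do.\<close>
  define W where "W p = (\<i> * of_real (u1 p) + of_real (u2 p)) * e p" for p
  have dW: "(W has_vector_derivative (of_real (w p) * e p + of_real (u2' p) * e p)) (at p within ?I)"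
    if "p \<in> ?I" for p
  proof -
    have "(W has_vector_derivative ((\<i> * of_real (u1 p) + of_real (u2 p)) * ((- P' p) *\<^sub>R (\<i> * e p))
         + (\<i> * of_real (u1' p) + of_real (u2' p)) * e p)) (at p within ?I)"
      unfolding W_def[abs_def]
      by (intro has_vector_derivative_mult has_vector_derivative_add has_vector_derivative_mult_right
          has_vector_derivative_of_real de du1[OF that] du2[OF that])
    moreover have "u1 p * P' p = w p" "u2 p * P' p = u1' p"
      using P'0[OF that] by (auto simp: u1_def u2_def u1'_def power2_eq_square power3_eq_cube divide_simps)
    then have "(\<i> * of_real (u1 p) + of_real (u2 p)) * ((- P' p) *\<^sub>R (\<i> * e p))
         + (\<i> * of_real (u1' p) + of_real (u2' p)) * e p = of_real (w p) * e p + of_real (u2' p) * e p"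
      by (simp add: scaleR_conv_of_real algebra_simps flip: of_real_mult)
    ultimately show ?thesis by simp
  qed
  have "((\<lambda>p. of_real (w p) * e p + of_real (u2' p) * e p) has_integral (W (5*pi/6) - W (pi/6))) ?I"
    by (rule fundamental_theorem_of_calculus) (use dW in auto)
  moreover have "W (5*pi/6) = 0" "W (pi/6) = 0"
    by (simp_all add: W_def u1_def u2_def w_def w'_def arc_weight_def arc_weight'_def)
  ultimately have hi: "((\<lambda>p. of_real (w p) * e p + of_real (u2' p) * e p) has_integral 0) ?I" by simp
  have cw: "continuous_on ?I w" "continuous_on ?I w'" "continuous_on ?I w''"
    unfolding w_def w'_def w''_def arc_weight_def[abs_def] arc_weight'_def[abs_def] arc_weight''_def[abs_def] by (intro continuous_intros)+
  have cP: "continuous_on ?I P" "continuous_on ?I P'" unfolding P_def[abs_def] P'_def[abs_def] by (intro continuous_intros)+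
  have ce: "continuous_on ?I e" unfolding e_def[abs_def] by (intro continuous_intros cP)
  have cu2': "continuous_on ?I u2'"
    unfolding u2'_def[abs_def] by (intro continuous_intros cw cP) (use P'0 in auto)
  have "(\<lambda>p. of_real (u2' p) * e p) integrable_on ?I"
    by (intro integrable_continuous_interval continuous_intros cu2' ce)
  then have h2: "((\<lambda>p. of_real (u2' p) * e p) has_integral integral ?I (\<lambda>p. of_real (u2' p) * e p)) ?I" by blast
  from has_integral_diff[OF hi h2] have "integral ?I (\<lambda>p. of_real (w p) * e p) = - integral ?I (\<lambda>p. of_real (u2' p) * e p)"
    by (simp add: integral_unique)
  then have K: "arc_kernel x y = - integral ?I (\<lambda>p. of_real (u2' p) * e p)"
    by (simp add: arc_kernel_def w_def e_def P_def)
  \<comment> \<open>The numerator is bounded by 3200 x^2, from 100 for the weights and 2 x for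
    \<open>P\<close> and \<open>P'\<close>; the denominator is at least (x/4)^4, and 3200 * 256 =
    819200.\<close>
  have bu: "\<bar>u2' p\<bar> \<le> 819200 / x\<^sup>2 " if "p \<in> ?I" for p
  proof -
    have b: "\<bar>w p\<bar> \<le> 100" "\<bar>w' p\<bar> \<le> 100" "\<bar>w'' p\<bar> \<le> 100"
      using arc_weight_bounds[OF that] by (auto simp: w_def w'_def w''_def)
    have "\<bar>(w'' p * P' p + w p * P' p) * P' p + 3 * P p * (w' p * P' p + w p * P p)\<bar>
       \<le> \<bar>(w'' p * P' p + w p * P' p) * P' p\<bar> + \<bar>3 * P p * (w' p * P' p + w p * P p)\<bar>" by (rule abs_triangle_ineq)
    also have "\<dots> \<le> (100 * (2*x) + 100 * (2*x)) * (2*x) + 3 * (2*x) * (100 * (2*x) + 100 * (2*x))"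
    proof -
      have m: "\<bar>a * c\<bar> \<le> 100 * (2*x)" if "\<bar>a\<bar> \<le> 100" "\<bar>c\<bar> \<le> 2*x" for a c
        unfolding abs_mult using that by (intro mult_mono) auto
      have "\<bar>w'' p * P' p + w p * P' p\<bar> \<le> 100 * (2*x) + 100 * (2*x)"
        "\<bar>w' p * P' p + w p * P p\<bar> \<le> 100 * (2*x) + 100 * (2*x)"
        using m[OF b(3) P'ub[of p]] m[OF b(1) P'ub[of p]] m[OF b(2) P'ub[of p]] m[OF b(1) Pub[of p]]
        by (auto intro: order_trans[OF abs_triangle_ineq])
      then show ?thesis
        unfolding abs_mult using Pub[of p] P'ub[of p] x by (intro add_mono mult_mono) auto
    qed
    also have "\<dots> = 3200 * x\<^sup>2" by (simp add: power2_eq_square)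
    finally have num: "\<bar>(w'' p * P' p + w p * P' p) * P' p + 3 * P p * (w' p * P' p + w p * P p)\<bar> \<le> 3200 * x\<^sup>2" .
    have "(x/4)^4 \<le> \<bar>P' p\<bar>^4" using P'lb[OF that] x by (intro power_mono) auto
    then have "\<bar>u2' p\<bar> \<le> (3200 * x\<^sup>2) / (x/4)^4"
      unfolding u2'_def abs_divide power_abs using num x by (intro frac_le) auto
    also have "\<dots> = 819200 / x\<^sup>2" using x by (simp add: field_simps power2_eq_square eval_nat_numeral)
    finally show ?thesis .
  qed
  have "norm (integral ?I (\<lambda>p. of_real (u2' p) * e p)) \<le> 819200 / x\<^sup>2 * (5*pi/6 - pi/6)"
    by (rule integral_bound) (auto intro!: continuous_intros cu2' ce bu cP simp: norm_mult e_def)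
  also have "\<dots> \<le> 3000000 / x\<^sup>2" using pi_less_4 x by (simp add: divide_simps)
  finally show ?thesis using K by simp
qed

lemma arc_kernel_minus: "arc_kernel (- x) (- y) = cnj (arc_kernel x y)"
  unfolding arc_kernel_def integral_cnj by (simp add: cis_cnj algebra_simps)

text \<open>The trivial bound serves small x and the decay serves large x. Together they give the
  profile 1/(1 + r^2), whose primitive is the arctangent.\<close>

lemma arc_kernel_bound:
  assumes x: "\<bar>x\<bar> \<ge> r" "0 \<le> r" and y: "\<bar>y\<bar> \<le> \<bar>x\<bar> / 4"
  shows "norm (arc_kernel x y) \<le> 4000000 / (1 + r\<^sup>2)"
proof -
  have main: "norm (arc_kernel x y) * (1 + x\<^sup>2) \<le> 4000000"
  proof (cases "x = 0")
    case True then show ?thesis using arc_kernel_trivial[of x y] by simp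
  next
    case False
    have "norm (arc_kernel x y) \<le> 3000000 / x\<^sup>2"
    proof (cases "x > 0")
      case True then show ?thesis using arc_kernel_decay_pos[of x y] y by simp
    next
      case f: False
      then have "norm (arc_kernel (-x) (-y)) \<le> 3000000 / (-x)\<^sup>2"
        using arc_kernel_decay_pos[of "-x" "-y"] y False by simp
      then show ?thesis by (simp add: arc_kernel_minus)
    qed
    then have "norm (arc_kernel x y) * x\<^sup>2 \<le> 3000000" using False by (simp add: field_simps)
    then show ?thesis using arc_kernel_trivial[of x y] by (simp add: algebra_simps)
  qed
  have "r\<^sup>2 \<le> x\<^sup>2" using power_mono[OF x(1,2), of 2] by simp
  then have "norm (arc_kernel x y) * (1 + r\<^sup>2) \<le> norm (arc_kernel x y) * (1 + x\<^sup>2)"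
    by (intro mult_left_mono) auto
  with main have "norm (arc_kernel x y) * (1 + r\<^sup>2) \<le> 4000000" by linarith
  moreover have "1 + r\<^sup>2 > 0" by (simp add: add_pos_nonneg)
  ultimately show ?thesis by (simp add: pos_le_divide_eq)
qed

lemma integral_cauchy_kernel:
  assumes "a \<le> b" "l > 0"
  shows "(\<lambda>u. 1 / (1 + (l * (t - u))\<^sup>2)) integrable_on {a..b::real}"
    "integral {a..b} (\<lambda>u. 1 / (1 + (l * (t - u))\<^sup>2)) \<le> pi / l"
proof -
  have "((\<lambda>u. 1 / (1 + (l * (t - u))\<^sup>2)) has_integral (- arctan (l * (t - b)) / l - (- arctan (l * (t - a)) / l))) {a..b}"
    using assms
    by (intro fundamental_theorem_of_calculus)
       (auto intro!: derivative_eq_intros simp: has_real_derivative_iff_has_vector_derivative[symmetric] inverse_eq_divide)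
  moreover have "- arctan (l * (t - b)) / l - (- arctan (l * (t - a)) / l) \<le> pi / l"
  proof -
    have "arctan (l * (t - a)) - arctan (l * (t - b)) \<le> pi"
      using arctan_lbound[of "l * (t - b)"] arctan_ubound[of "l * (t - a)"] by linarith
    then have "(arctan (l * (t - a)) - arctan (l * (t - b))) / l \<le> pi / l"
      using assms(2) by (intro divide_right_mono) auto
    then show ?thesis by (simp add: diff_divide_distrib)
  qed
  ultimately show "(\<lambda>u. 1 / (1 + (l * (t - u))\<^sup>2)) integrable_on {a..b::real}"
    "integral {a..b} (\<lambda>u. 1 / (1 + (l * (t - u))\<^sup>2)) \<le> pi / l"
    by (auto simp: integral_unique)
qed

text \<open>Fourier transform of a weighted curve (X, Y) in the unit direction (cos p, sin p); the
  size of the frequency is absorbed into X and Y.\<close>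

definition osc :: "real \<Rightarrow> real \<Rightarrow> (real \<Rightarrow> real) \<Rightarrow> (real \<Rightarrow> real) \<Rightarrow> (real \<Rightarrow> real) \<Rightarrow> real \<Rightarrow> complex" where
  "osc a b g X Y p = integral {a..b} (\<lambda>t. of_real (g t) * cis (- (X t * cos p + Y t * sin p)))"

lemma continuous_on_osc:
  assumes "continuous_on {a..b} g" "continuous_on {a..b} X" "continuous_on {a..b} Y"
  shows "continuous_on S (osc a b g X Y)"
proof -
  have [continuous_intros]: "continuous_on (S \<times> {a..b}) (\<lambda>z. f (snd z))" if "continuous_on {a..b} f" for f :: "real \<Rightarrow> real"
    by (rule continuous_on_compose2[OF that]) (auto intro!: continuous_intros)
  have "continuous_on (S \<times> cbox a b) (\<lambda>(p,t). of_real (g t) * cis (- (X t * cos p + Y t * sin p)))"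
    by (auto simp: split_beta intro!: continuous_intros assms)
  from integral_continuous_on_param[OF this] show ?thesis
    unfolding osc_def[abs_def] by simp
qed

text \<open>The square expands into a double integral of \<open>arc_kernel\<close> at the difference of two points, and the
  kernel is integrable in one of them with mass \<open>O(1/l)\<close>.\<close>

lemma osc_arc_bound:
  assumes ab: "a \<le> b" and l: "l > 0"
    and cont: "continuous_on {a..b} g" "continuous_on {a..b} X" "continuous_on {a..b} Y"
    and G: "\<And>t. t \<in> {a..b} \<Longrightarrow> \<bar>g t\<bar> \<le> G"
    and X: "\<And>t u. t \<in> {a..b} \<Longrightarrow> u \<in> {a..b} \<Longrightarrow> \<bar>X t - X u\<bar> \<ge> l * \<bar>t - u\<bar>"
    and Y: "\<And>t u. t \<in> {a..b} \<Longrightarrow> u \<in> {a..b} \<Longrightarrow> \<bar>Y t - Y u\<bar> \<le> \<bar>X t - X u\<bar> / 4"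
  shows "integral {pi/3..2*pi/3} (\<lambda>p. (norm (osc a b g X Y p))\<^sup>2) \<le> 300000000 * G\<^sup>2 * (b - a) / l"
proof -
  let ?I = "{pi/6..5*pi/6}" and ?J = "{pi/3..2*pi/3}"
  define A where "A = osc a b g X Y"
  define h where "h p t u = of_real (arc_weight p * g t * g u) * cis (- ((X t - X u) * cos p + (Y t - Y u) * sin p))" for p t u
  have cA: "continuous_on S A" for S unfolding A_def by (rule continuous_on_osc[OF cont])
  have cw: "continuous_on S arc_weight" for S unfolding arc_weight_def[abs_def] by (intro continuous_intros)
  have w0: "arc_weight p \<ge> 0" for p by (simp add: arc_weight_def)
  have c3: "continuous_on S (\<lambda>z. h (f1 z) (f2 z) (f3 z))"
    if "continuous_on S f1" "continuous_on S f2" "continuous_on S f3" "f2 ` S \<subseteq> {a..b}" "f3 ` S \<subseteq> {a..b}"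
    for S :: "'z::t2_space set" and f1 f2 f3
  proof -
    have [continuous_intros]: "continuous_on S (\<lambda>z. f (f2 z))" "continuous_on S (\<lambda>z. f (f3 z))"
      if "continuous_on {a..b} f" for f :: "real \<Rightarrow> real"
      using continuous_on_compose2[OF that \<open>continuous_on S f2\<close>] continuous_on_compose2[OF that \<open>continuous_on S f3\<close>] \<open>f2 ` S \<subseteq> {a..b}\<close> \<open>f3 ` S \<subseteq> {a..b}\<close> by auto
    have [continuous_intros]: "continuous_on S (\<lambda>z. arc_weight (f1 z))"
      by (rule continuous_on_compose2[OF cw that(1)]) auto
    show ?thesis unfolding h_def by (auto intro!: continuous_intros cont that(1))
  qed
  have I0: "(\<lambda>p. arc_weight p * (norm (A p))\<^sup>2) integrable_on ?I"
    by (intro integrable_continuous_interval continuous_intros cA cw)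
  have J0: "(\<lambda>p. (norm (A p))\<^sup>2) integrable_on ?J"
    by (intro integrable_continuous_interval continuous_intros cA cw)
  have J1: "(\<lambda>p. arc_weight p * (norm (A p))\<^sup>2) integrable_on ?J"
    by (intro integrable_continuous_interval continuous_intros cA cw)
  have "integral ?J (\<lambda>p. (norm (A p))\<^sup>2) * (1/16) = integral ?J (\<lambda>p. (norm (A p))\<^sup>2 * (1/16))"
    by simp
  also have "\<dots> \<le> integral ?J (\<lambda>p. arc_weight p * (norm (A p))\<^sup>2)"
  proof (rule integral_le[OF _ J1])
    show "(\<lambda>p. (norm (A p))\<^sup>2 * (1/16)) integrable_on ?J"
      by (intro integrable_continuous_interval continuous_intros cA)
    fix p assume "p \<in> ?J"
    then show "(norm (A p))\<^sup>2 * (1/16) \<le> arc_weight p * (norm (A p))\<^sup>2"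
      using mult_right_mono[OF arc_weight_ge[of p], of "(norm (A p))\<^sup>2"] by simp
  qed
  also have "\<dots> \<le> integral ?I (\<lambda>p. arc_weight p * (norm (A p))\<^sup>2)"
    by (rule integral_subset_le[OF _ J1 I0]) (auto simp: w0)
  finally have 1: "integral ?J (\<lambda>p. (norm (A p))\<^sup>2) \<le> 16 * integral ?I (\<lambda>p. arc_weight p * (norm (A p))\<^sup>2)" by simp
  \<comment> \<open>Written over pairs (t, u), the direction p occurs only in the phase difference
    and in the weight, so that it can be integrated first.\<close>
  have AA: "of_real (arc_weight p * (norm (A p))\<^sup>2) = integral {a..b} (\<lambda>t. integral {a..b} (\<lambda>u. h p t u))" for p
  proof -
    define F where "F t = of_real (g t) * cis (- (X t * cos p + Y t * sin p))" for t
    define F' where "F' u = of_real (g u) * cis (X u * cos p + Y u * sin p)" for u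
    have Ap: "A p = integral {a..b} F" by (simp add: A_def osc_def F_def[abs_def])
    have Ac: "cnj (A p) = integral {a..b} F'"
      unfolding A_def osc_def integral_cnj by (simp add: cis_cnj F'_def[abs_def] add.commute)
    have "of_real (arc_weight p * (norm (A p))\<^sup>2) = of_real (arc_weight p) * (A p * cnj (A p))"
      by (simp only: of_real_mult complex_norm_square)
    also have "\<dots> = integral {a..b} (\<lambda>t. of_real (arc_weight p) * (F t * integral {a..b} F'))"
      unfolding Ac unfolding Ap by simp
    also have "\<dots> = integral {a..b} (\<lambda>t. integral {a..b} (\<lambda>u. of_real (arc_weight p) * (F t * F' u)))"
      by simp
    also have "\<dots> = integral {a..b} (\<lambda>t. integral {a..b} (\<lambda>u. h p t u))"
    proof -
      have "of_real (arc_weight p) * (F t * F' u) = h p t u" for t u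
      proof -
        have "cis (- (X t * cos p + Y t * sin p)) * cis (X u * cos p + Y u * sin p)
          = cis (- ((X t - X u) * cos p + (Y t - Y u) * sin p))"
          by (simp add: cis_mult algebra_simps)
        then show ?thesis by (simp add: h_def F_def F'_def)
      qed
      then show ?thesis by simp
    qed
    finally show ?thesis .
  qed
  have "of_real (integral ?I (\<lambda>p. arc_weight p * (norm (A p))\<^sup>2)) = integral ?I (\<lambda>p. of_real (arc_weight p * (norm (A p))\<^sup>2) :: complex)"
    using integral_linear[OF I0 bounded_linear_of_real[where 'a = complex]] by (simp add: o_def)
  also have "\<dots> = integral ?I (\<lambda>p. integral {a..b} (\<lambda>t. integral {a..b} (\<lambda>u. h p t u)))"
    by (simp only: AA)
  also have "\<dots> = integral {a..b} (\<lambda>t. integral ?I (\<lambda>p. integral {a..b} (\<lambda>u. h p t u)))"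
  proof -
    have "continuous_on (cbox (pi/6,a) (5*pi/6,b)) (\<lambda>z. integral (cbox a b) (\<lambda>u. h (fst z) (snd z) u))"
      by (rule integral_continuous_on_param) (auto simp: split_beta cbox_Pair_eq intro!: c3 continuous_intros)
    then have "continuous_on (cbox (pi/6,a) (5*pi/6,b)) (\<lambda>(p,t). integral {a..b} (\<lambda>u. h p t u))"
      by (simp add: split_beta)
    from integral_swap_continuous[OF this] show ?thesis by simp
  qed
  also have "\<dots> = integral {a..b} (\<lambda>t. integral {a..b} (\<lambda>u. integral ?I (\<lambda>p. h p t u)))"
  proof (rule integral_cong)
    fix t assume t: "t \<in> {a..b}"
    have "continuous_on (cbox (pi/6,a) (5*pi/6,b)) (\<lambda>(p,u). h p t u)"
      using t by (auto simp: split_beta cbox_Pair_eq intro!: c3 continuous_intros)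
    from integral_swap_continuous[OF this]
    show "integral ?I (\<lambda>p. integral {a..b} (\<lambda>u. h p t u)) = integral {a..b} (\<lambda>u. integral ?I (\<lambda>p. h p t u))" by simp
  qed
  finally have 2: "of_real (integral ?I (\<lambda>p. arc_weight p * (norm (A p))\<^sup>2)) = integral {a..b} (\<lambda>t. integral {a..b} (\<lambda>u. integral ?I (\<lambda>p. h p t u)))" .
  have hK: "integral ?I (\<lambda>p. h p t u) = of_real (g t * g u) * arc_kernel (X t - X u) (Y t - Y u)" for t u
    unfolding h_def arc_kernel_def by (subst integral_mult_right[symmetric]) (auto simp: algebra_simps intro!: integral_cong)
  have hb: "norm (integral ?I (\<lambda>p. h p t u)) \<le> G\<^sup>2 * 4000000 * (1 / (1 + (l * (t - u))\<^sup>2))" if "t \<in> {a..b}" "u \<in> {a..b}" for t u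
  proof -
    have "norm (arc_kernel (X t - X u) (Y t - Y u)) \<le> 4000000 / (1 + (l * \<bar>t - u\<bar>)\<^sup>2)"
      by (rule arc_kernel_bound[OF X[OF that] _ Y[OF that]]) (use l in auto)
    moreover have "(l * \<bar>t - u\<bar>)\<^sup>2 = (l * (t - u))\<^sup>2" by (simp add: power_mult_distrib)
    moreover have "\<bar>g t * g u\<bar> \<le> G\<^sup>2" unfolding abs_mult power2_eq_square
      using G that by (intro mult_mono) (auto intro: order_trans[OF abs_ge_zero])
    ultimately have "norm (integral ?I (\<lambda>p. h p t u)) \<le> G\<^sup>2 * (4000000 / (1 + (l * (t - u))\<^sup>2))"
      unfolding hK norm_mult norm_of_real by (intro mult_mono) auto
    then show ?thesis by simp
  qed
  have inner: "norm (integral {a..b} (\<lambda>u. integral ?I (\<lambda>p. h p t u))) \<le> G\<^sup>2 * 4000000 * (pi / l)" if t: "t \<in> {a..b}" for t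
  proof -
    have "continuous_on {a..b} (\<lambda>u. integral (cbox (pi/6) (5*pi/6)) (\<lambda>p. h p t u))"
      using t by (intro integral_continuous_on_param) (auto simp: split_beta intro!: c3 continuous_intros)
    then have "norm (integral {a..b} (\<lambda>u. integral ?I (\<lambda>p. h p t u))) \<le> integral {a..b} (\<lambda>u. G\<^sup>2 * 4000000 * (1 / (1 + (l * (t - u))\<^sup>2)))"
      using t hb integrable_on_mult_right[OF integral_cauchy_kernel(1)[OF ab l]]
      by (intro integral_norm_bound_integral integrable_continuous_interval[of a b "\<lambda>u. integral ?I (\<lambda>p. h p t u)"]) auto
    also have "\<dots> = G\<^sup>2 * 4000000 * integral {a..b} (\<lambda>u. 1 / (1 + (l * (t - u))\<^sup>2))" by (rule integral_mult_right)
    also have "\<dots> \<le> G\<^sup>2 * 4000000 * (pi / l)" using integral_cauchy_kernel(2)[OF ab l] by (intro mult_left_mono) auto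
    finally show ?thesis .
  qed
  have "norm (integral {a..b} (\<lambda>t. integral {a..b} (\<lambda>u. integral ?I (\<lambda>p. h p t u)))) \<le> G\<^sup>2 * 4000000 * (pi / l) * (b - a)"
  proof (rule integral_bound[OF ab _ inner])
    have "continuous_on {a..b} (\<lambda>t. integral (cbox a b) (\<lambda>u. integral (cbox (pi/6) (5*pi/6)) (\<lambda>p. h p t u)))"
    proof (rule integral_continuous_on_param)
      have "continuous_on ({a..b} \<times> {a..b}) (\<lambda>z. integral (cbox (pi/6) (5*pi/6)) (\<lambda>p. h p (fst z) (snd z)))"
        by (intro integral_continuous_on_param) (auto simp: split_beta intro!: c3 continuous_intros)
      then show "continuous_on ({a..b} \<times> cbox a b) (\<lambda>(t, u). integral (cbox (pi/6) (5*pi/6)) (\<lambda>p. h p t u))"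
        by (simp add: split_beta)
    qed
    then show "continuous_on {a..b} (\<lambda>t. integral {a..b} (\<lambda>u. integral ?I (\<lambda>p. h p t u)))" by simp
  qed
  then have "\<bar>integral ?I (\<lambda>p. arc_weight p * (norm (A p))\<^sup>2)\<bar> \<le> G\<^sup>2 * 4000000 * (pi / l) * (b - a)"
    unfolding 2[symmetric] norm_of_real .
  \<comment> \<open>The 16 comes from \<open>arc_weight_ge\<close>, the 4000000 from
    \<open>arc_kernel_bound\<close>, and pi / l is the mass of the Cauchy kernel.\<close>
  then have "integral ?J (\<lambda>p. (norm (A p))\<^sup>2) \<le> 16 * (G\<^sup>2 * 4000000 * (pi / l) * (b - a))" using 1 by linarith
  also have "\<dots> = 64000000 * pi * (G\<^sup>2 * (b - a) / l)" by simp
  also have "\<dots> \<le> 64000000 * 4 * (G\<^sup>2 * (b - a) / l)" using pi_less_4 ab l by (intro mult_right_mono) auto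
  also have "\<dots> \<le> 300000000 * (G\<^sup>2 * (b - a) / l)" using ab l by (intro mult_right_mono) auto
  finally show ?thesis by (simp add: A_def)
qed

text \<open>Opposite directions conjugate the transform, so the arc around 3 pi/2 costs as much as
  the arc around pi/2.\<close>

lemma osc_shift_pi: "osc a b g X Y (p + pi) = cnj (osc a b g X Y p)"
  unfolding osc_def integral_cnj by (simp add: cis_cnj)

text \<open>Turning the curve and the direction by the same angle leaves the phase unchanged. This
  allows every short piece to be taken nearly parallel to the x-axis.\<close>

lemma osc_rotate:
  "osc a b g X Y p = osc a b g (\<lambda>t. cos \<beta> * X t + sin \<beta> * Y t) (\<lambda>t. cos \<beta> * Y t - sin \<beta> * X t) (p - \<beta>)"
proof -
  have "(cos \<beta> * x + sin \<beta> * y) * cos (p - \<beta>) + (cos \<beta> * y - sin \<beta> * x) * sin (p - \<beta>)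
     = (x * cos p + y * sin p) * ((cos \<beta>)\<^sup>2 + (sin \<beta>)\<^sup>2)" for x y
    unfolding cos_diff sin_diff by algebra
  then have "(cos \<beta> * x + sin \<beta> * y) * cos (p - \<beta>) + (cos \<beta> * y - sin \<beta> * x) * sin (p - \<beta>)
     = x * cos p + y * sin p" for x y
    by simp
  then show ?thesis unfolding osc_def by simp
qed

lemma integral_periodic_shift:
  fixes f :: "real \<Rightarrow> real"
  assumes f: "continuous_on UNIV f" and per: "\<And>x. f (x + q) = f x" and b: "0 \<le> \<beta>" "\<beta> \<le> q"
  shows "integral {0..q} (\<lambda>x. f (x - \<beta>)) = integral {0..q} f"
proof -
  have i: "f integrable_on {a..b}" for a b
    by (intro integrable_continuous_interval continuous_on_subset[OF f]) auto
  have "integral {0..q} (\<lambda>x. f (x - \<beta>)) = integral {0 + (-\<beta>)..q + (-\<beta>)} f"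
    using integral_shift_Icc_real[of 0 q f "-\<beta>"] by (simp add: o_def)
  also have "\<dots> = integral {-\<beta>..0} f + integral {0..q-\<beta>} f"
    using b by (subst Henstock_Kurzweil_Integration.integral_combine[OF _ _ i]) auto
  also have "integral {-\<beta>..0} f = integral {-\<beta>..0} (\<lambda>x. f (x + q))" by (simp add: per)
  also have "\<dots> = integral {q-\<beta>..q} f"
    using integral_shift_Icc_real[of "-\<beta>" 0 f q] by (simp add: o_def add.commute)
  also have "integral {q-\<beta>..q} f + integral {0..q-\<beta>} f = integral {0..q} f"
    using b by (subst add.commute, subst Henstock_Kurzweil_Integration.integral_combine[OF _ _ i]) auto
  finally show ?thesis .
qed

text \<open>The phase derivative X' cos p + Y' sin p has modulus at least X'/2 - X'/4 >= l/4, so a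
  single integration by parts gains 1/l. The boundary terms need not vanish, as [a, b] is only a
  piece of the curve, but they are of the same order.\<close>

lemma osc_nonstationary:
  assumes ab: "a \<le> b" "b - a \<le> 1" and l: "l > 0"
    and dg: "\<And>t. (g has_real_derivative g' t) (at t)"
    and dX: "\<And>t. (X has_real_derivative X' t) (at t)" "\<And>t. (X' has_real_derivative X'' t) (at t)"
    and dY: "\<And>t. (Y has_real_derivative Y' t) (at t)" "\<And>t. (Y' has_real_derivative Y'' t) (at t)"
    and cont: "continuous_on {a..b} g'" "continuous_on {a..b} X''" "continuous_on {a..b} Y''"
    and G: "\<And>t. t \<in> {a..b} \<Longrightarrow> \<bar>g t\<bar> \<le> G" "\<And>t. t \<in> {a..b} \<Longrightarrow> \<bar>g' t\<bar> \<le> G"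
    and X: "\<And>t. t \<in> {a..b} \<Longrightarrow> X' t \<ge> l"
    and Y: "\<And>t. t \<in> {a..b} \<Longrightarrow> \<bar>Y' t\<bar> \<le> X' t / 4"
    and L: "\<And>t. t \<in> {a..b} \<Longrightarrow> \<bar>X'' t\<bar> \<le> L * l" "\<And>t. t \<in> {a..b} \<Longrightarrow> \<bar>Y'' t\<bar> \<le> L * l"
    and p: "\<bar>cos p\<bar> \<ge> 1/2"
  shows "norm (osc a b g X Y p) \<le> (12 * G + 32 * G * L) / l"
proof -
  let ?I = "{a..b}"
  define P where "P t = X t * cos p + Y t * sin p" for t
  define P' where "P' t = X' t * cos p + Y' t * sin p" for t
  define P'' where "P'' t = X'' t * cos p + Y'' t * sin p" for t
  define e where "e t = cis (- P t)" for t
  define u where "u t = g t / P' t" for t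
  define u' where "u' t = (g' t * P' t - g t * P'' t) / (P' t)\<^sup>2" for t
  have dP: "(P has_real_derivative P' t) (at t)" "(P' has_real_derivative P'' t) (at t)" for t
    unfolding P_def[abs_def] P'_def[abs_def] P''_def by (auto intro!: derivative_eq_intros dX dY)
  have P'lb: "\<bar>P' t\<bar> \<ge> l/4" if "t \<in> ?I" for t
  proof -
    have "\<bar>X' t * cos p\<bar> \<ge> X' t * (1/2)" unfolding abs_mult using X[OF that] l p by (intro mult_mono) auto
    moreover have "\<bar>Y' t * sin p\<bar> \<le> X' t / 4 * 1" unfolding abs_mult using Y[OF that] X[OF that] l by (intro mult_mono) auto
    ultimately show ?thesis unfolding P'_def using X[OF that] by linarith
  qed
  have P'0: "P' t \<noteq> 0" if "t \<in> ?I" for t using P'lb[OF that] l by auto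
  have P''ub: "\<bar>P'' t\<bar> \<le> 2 * L * l" if "t \<in> ?I" for t
  proof -
    have "\<bar>X'' t * cos p\<bar> \<le> L * l * 1" "\<bar>Y'' t * sin p\<bar> \<le> L * l * 1"
      unfolding abs_mult using L[OF that] by (intro mult_mono; force)+
    then show ?thesis unfolding P''_def by linarith
  qed
  have cg: "continuous_on ?I g" and cP: "continuous_on ?I P" "continuous_on ?I P'"
    by (meson DERIV_continuous_on dg dP has_field_derivative_at_within)+
  have cP'': "continuous_on ?I P''" unfolding P''_def[abs_def] by (intro continuous_intros cont)
  have ce: "continuous_on ?I e" unfolding e_def[abs_def] by (intro continuous_intros cP)
  have cu': "continuous_on ?I u'" unfolding u'_def[abs_def]
    by (intro continuous_intros cont cg cP cP'') (use P'0 in auto)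
  have du: "(u has_real_derivative u' t) (at t within ?I)" if "t \<in> ?I" for t
    unfolding u_def[abs_def] u'_def using P'0[OF that]
    by (auto intro!: derivative_eq_intros has_field_derivative_at_within[OF dg] has_field_derivative_at_within[OF dP(2)] simp: power2_eq_square)
  have de: "(e has_vector_derivative (- P' t) *\<^sub>R (\<i> * e t)) (at t within ?I)" for t
    unfolding e_def[abs_def] has_vector_derivative_def
    by (rule has_derivative_eq_rhs, rule has_derivative_cis)
       (auto intro!: derivative_eq_intros has_field_derivative_at_within[OF dP(1), unfolded has_field_derivative_def] simp: e_def)
  define W where "W t = \<i> * of_real (u t) * e t" for t
  have dW: "(W has_vector_derivative (of_real (g t) * e t + \<i> * of_real (u' t) * e t)) (at t within ?I)" if "t \<in> ?I" for t
  proof -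
    have "(W has_vector_derivative (\<i> * of_real (u t) * ((- P' t) *\<^sub>R (\<i> * e t)) + \<i> * of_real (u' t) * e t)) (at t within ?I)"
      unfolding W_def[abs_def]
      by (intro has_vector_derivative_mult has_vector_derivative_mult_right
          has_vector_derivative_of_real de du[OF that])
    moreover have "u t * P' t = g t" using P'0[OF that] by (simp add: u_def)
    then have eq: "\<i> * of_real (u t) * ((- P' t) *\<^sub>R (\<i> * e t)) = of_real (g t) * e t"
      by (simp add: scaleR_conv_of_real algebra_simps flip: of_real_mult)
    ultimately show ?thesis unfolding eq by simp
  qed
  have hi: "((\<lambda>t. of_real (g t) * e t + \<i> * of_real (u' t) * e t) has_integral (W b - W a)) ?I"
    by (rule fundamental_theorem_of_calculus) (use dW ab in auto)
  have c2: "continuous_on ?I (\<lambda>t. \<i> * of_real (u' t) * e t)" by (intro continuous_intros cu' ce)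
  then have h2: "((\<lambda>t. \<i> * of_real (u' t) * e t) has_integral integral ?I (\<lambda>t. \<i> * of_real (u' t) * e t)) ?I"
    by (intro integrable_integral integrable_continuous_interval)
  from has_integral_diff[OF hi h2] have "integral ?I (\<lambda>t. of_real (g t) * e t) = W b - W a - integral ?I (\<lambda>t. \<i> * of_real (u' t) * e t)"
    by (simp add: integral_unique)
  then have eq: "osc a b g X Y p = W b - W a - integral ?I (\<lambda>t. \<i> * of_real (u' t) * e t)"
    by (simp add: osc_def e_def P_def)
  have G0: "0 \<le> G" using G(1)[of a] ab by auto
  have L0: "0 \<le> L * l" using L(1)[of a] ab by auto
  then have L1: "0 \<le> L" using l by (simp add: zero_le_mult_iff)
  have bW: "norm (W t) \<le> 4 * G / l" if "t \<in> ?I" for t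
  proof -
    have "norm (W t) = \<bar>g t\<bar> / \<bar>P' t\<bar>" by (simp add: W_def norm_mult norm_divide e_def u_def)
    also have "\<dots> \<le> G / (l/4)" using G(1)[OF that] P'lb[OF that] l by (intro frac_le) auto
    finally show ?thesis by (simp add: mult.commute)
  qed
  have bu: "norm (\<i> * of_real (u' t) * e t) \<le> (4 * G + 32 * G * L) / l" if "t \<in> ?I" for t
  proof -
    have "norm (\<i> * of_real (u' t) * e t) = \<bar>u' t\<bar>" by (simp add: norm_mult e_def)
    also have "\<dots> = \<bar>g' t / P' t - g t * P'' t / (P' t)\<^sup>2\<bar>"
      using P'0[OF that] by (simp add: u'_def diff_divide_distrib power2_eq_square)
    also have "\<dots> \<le> \<bar>g' t\<bar> / \<bar>P' t\<bar> + \<bar>g t\<bar> * \<bar>P'' t\<bar> / \<bar>P' t\<bar>\<^sup>2"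
      by (rule order_trans[OF abs_triangle_ineq4]) (simp add: abs_divide abs_mult)
    also have "\<dots> \<le> G / (l/4) + G * (2 * L * l) / (l/4)\<^sup>2"
      using G[OF that] P'lb[OF that] P''ub[OF that] l G0 L1
      by (intro add_mono frac_le mult_mono power_mono mult_nonneg_nonneg) auto
    also have "\<dots> = (4 * G + 32 * G * L) / l" using l by (simp add: field_simps power2_eq_square)
    finally show ?thesis .
  qed
  have K0: "0 \<le> (4 * G + 32 * G * L) / l" using order_trans[OF norm_ge_zero bu[of a]] ab by auto
  have "norm (osc a b g X Y p) \<le> norm (W b) + norm (W a) + norm (integral ?I (\<lambda>t. \<i> * of_real (u' t) * e t))"
    unfolding eq by (meson norm_triangle_ineq4 order_trans add_right_mono)
  also have "\<dots> \<le> 4 * G / l + 4 * G / l + (4 * G + 32 * G * L) / l * (b - a)"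
    using ab by (intro add_mono bW integral_bound[OF _ c2 bu]) auto
  also have "\<dots> \<le> 4 * G / l + 4 * G / l + (4 * G + 32 * G * L) / l * 1"
    using ab K0 by (intro add_mono order_refl mult_left_mono)
  also have "\<dots> = (12 * G + 32 * G * L) / l" by (simp add: add_divide_distrib)
  finally show ?thesis .
qed

lemma MVT_lower:
  fixes f :: "real \<Rightarrow> real"
  assumes "\<And>t. (f has_real_derivative f' t) (at t)" "\<And>t. t \<in> {a..b} \<Longrightarrow> m \<le> f' t"
    and "t \<in> {a..b}" "u \<in> {a..b}" "u \<le> t"
  shows "f t - f u \<ge> m * (t - u)"
proof (cases "u = t")
  case False
  then obtain z where "u < z" "z < t" "f t - f u = (t - u) * f' z"
    using MVT2[of u t f f'] assms(1,5) by auto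
  moreover have "m * (t - u) \<le> f' z * (t - u)" using \<open>u < z\<close> \<open>z < t\<close> assms by (intro mult_right_mono) auto
  ultimately show ?thesis by (simp add: mult.commute)
qed simp

text \<open>The piece runs roughly along the x-axis, so its normal directions lie near pi/2 and 3
  pi/2. The arcs around these are handled by the averaged kernel, with rate 1/l; on the remaining
  arcs the pointwise bound 1/l is squared.\<close>

lemma osc_piece:
  assumes ab: "a \<le> b" "b - a \<le> 1" and l: "l > 0"
    and dg: "\<And>t. (g has_real_derivative g' t) (at t)"
    and dX: "\<And>t. (X has_real_derivative X' t) (at t)" "\<And>t. (X' has_real_derivative X'' t) (at t)"
    and dY: "\<And>t. (Y has_real_derivative Y' t) (at t)" "\<And>t. (Y' has_real_derivative Y'' t) (at t)"
    and cont: "continuous_on {a..b} g'" "continuous_on {a..b} X''" "continuous_on {a..b} Y''"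
    and G: "\<And>t. t \<in> {a..b} \<Longrightarrow> \<bar>g t\<bar> \<le> G" "\<And>t. t \<in> {a..b} \<Longrightarrow> \<bar>g' t\<bar> \<le> G"
    and X: "\<And>t. t \<in> {a..b} \<Longrightarrow> X' t \<ge> l"
    and Y: "\<And>t. t \<in> {a..b} \<Longrightarrow> \<bar>Y' t\<bar> \<le> X' t / 4"
    and L: "\<And>t. t \<in> {a..b} \<Longrightarrow> \<bar>X'' t\<bar> \<le> L * l" "\<And>t. t \<in> {a..b} \<Longrightarrow> \<bar>Y'' t\<bar> \<le> L * l"
  shows "integral {0..2*pi} (\<lambda>p. (norm (osc a b g X Y p))\<^sup>2) \<le> 600000000 * G\<^sup>2 / l + 8 * ((12 * G + 32 * G * L) / l)\<^sup>2"
proof -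
  define D where "D = (12 * G + 32 * G * L) / l"
  define f where "f p = (norm (osc a b g X Y p))\<^sup>2" for p
  have cc: "continuous_on {a..b} g" "continuous_on {a..b} X" "continuous_on {a..b} Y"
    by (meson DERIV_continuous_on dg dX dY has_field_derivative_at_within)+
  have cf: "continuous_on S f" for S unfolding f_def[abs_def] by (intro continuous_intros continuous_on_osc cc)
  have fi: "f integrable_on {c..d}" for c d by (intro integrable_continuous_interval cf)
  have fD: "f p \<le> D\<^sup>2" if "\<bar>cos p\<bar> \<ge> 1/2" for p
    unfolding f_def D_def
    by (intro power_mono osc_nonstationary[OF ab l dg dX dY cont G X Y L that]) auto
  have Xd: "\<bar>X t - X u\<bar> \<ge> l * \<bar>t - u\<bar>" if "t \<in> {a..b}" "u \<in> {a..b}" for t u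
    using MVT_lower[of X X' a b l t u, OF dX(1) X] MVT_lower[of X X' a b l u t, OF dX(1) X] that
    by (cases "u \<le> t") auto
  \<comment> \<open>The slope condition passes from derivatives to chords because X/4 + Y and X/4 -
    Y are both nondecreasing.\<close>
  have Yd0: "\<bar>Y t - Y u\<bar> \<le> (X t - X u) / 4" if "t \<in> {a..b}" "u \<in> {a..b}" "u \<le> t" for t u
  proof -
    have p: "0 \<le> X' v / 4 + Y' v" "0 \<le> X' v / 4 - Y' v" if "v \<in> {a..b}" for v
      using Y[OF that] unfolding abs_le_iff by simp_all
    have "0 * (t - u) \<le> (X t / 4 + Y t) - (X u / 4 + Y u)"
      by (rule MVT_lower[where f' = "\<lambda>t. X' t / 4 + Y' t" and a = a and b = b])
        (use that p in \<open>auto intro!: derivative_eq_intros dX dY\<close>)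
    moreover have "0 * (t - u) \<le> (X t / 4 - Y t) - (X u / 4 - Y u)"
      by (rule MVT_lower[where f' = "\<lambda>t. X' t / 4 - Y' t" and a = a and b = b])
        (use that p in \<open>auto intro!: derivative_eq_intros dX dY\<close>)
    ultimately show ?thesis unfolding abs_le_iff by simp
  qed
  have Yd: "\<bar>Y t - Y u\<bar> \<le> \<bar>X t - X u\<bar> / 4" if "t \<in> {a..b}" "u \<in> {a..b}" for t u
  proof (cases "u \<le> t")
    case True
    show ?thesis using Yd0[OF that True] abs_ge_self[of "X t - X u"] by simp
  next
    case False
    then have "t \<le> u" by simp
    show ?thesis using Yd0[OF that(2,1) \<open>t \<le> u\<close>] abs_ge_minus_self[of "X t - X u"]
      by (simp add: abs_minus_commute)
  qed
  have "integral {pi/3..2*pi/3} f \<le> 300000000 * G\<^sup>2 * (b - a) / l"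
    unfolding f_def by (rule osc_arc_bound[OF ab(1) l cc G(1) Xd Yd])
  also have "\<dots> \<le> 300000000 * G\<^sup>2 * 1 / l" using ab l by (intro divide_right_mono mult_left_mono) auto
  finally have 1: "integral {pi/3..2*pi/3} f \<le> 300000000 * G\<^sup>2 / l" by simp
  have "integral {pi/3..2*pi/3} f = integral {pi/3..2*pi/3} (\<lambda>p. f (p + pi))"
    using osc_shift_pi[of a b g X Y] by (simp add: f_def[abs_def])
  also have "\<dots> = integral {4*pi/3..5*pi/3} f"
    using integral_shift_Icc_real[of "pi/3" "2*pi/3" f pi] by (simp add: o_def add.commute field_simps)
  finally have 2: "integral {4*pi/3..5*pi/3} f \<le> 300000000 * G\<^sup>2 / l" using 1 by simp
  have 3: "integral {c..d} f \<le> D\<^sup>2 * (d - c)" if "c \<le> d" "{c..d} \<subseteq> {0..pi/3} \<union> {2*pi/3..4*pi/3} \<union> {5*pi/3..2*pi}" for c d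
  proof -
    have "norm (integral {c..d} f) \<le> D\<^sup>2 * (d - c)"
    proof (rule integral_bound[OF that(1) cf])
      fix p assume "p \<in> {c..d}"
      then have "\<bar>cos p\<bar> \<ge> 1/2" using that by (intro cos_abs_ge_half) blast
      then show "norm (f p) \<le> D\<^sup>2" using fD[of p] by (simp add: f_def)
    qed
    then show ?thesis by simp
  qed
  have "integral {0..2*pi} f = integral {0..pi/3} f + integral {pi/3..2*pi/3} f + integral {2*pi/3..4*pi/3} f
     + integral {4*pi/3..5*pi/3} f + integral {5*pi/3..2*pi} f"
    by (simp add: Henstock_Kurzweil_Integration.integral_combine[OF _ _ fi])
  also have "\<dots> \<le> D\<^sup>2 * (pi/3 - 0) + 300000000 * G\<^sup>2 / l + D\<^sup>2 * (4*pi/3 - 2*pi/3) + 300000000 * G\<^sup>2 / l + D\<^sup>2 * (2*pi - 5*pi/3)"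
    by (intro add_mono 1 2 3) auto
  also have "\<dots> = 600000000 * G\<^sup>2 / l + D\<^sup>2 * (4*pi/3)" by (simp add: field_simps)
  also have "\<dots> \<le> 600000000 * G\<^sup>2 / l + D\<^sup>2 * 8" using pi_less_4 by (intro add_left_mono mult_left_mono) auto
  finally show ?thesis by (simp add: f_def[abs_def] D_def)
qed

lemma osc_piece_rotated:
  assumes b: "0 \<le> \<beta>" "\<beta> \<le> 2*pi" and cont: "continuous_on {a..b} g" "continuous_on {a..b} X" "continuous_on {a..b} Y"
  shows "integral {0..2*pi} (\<lambda>p. (norm (osc a b g X Y p))\<^sup>2) =
    integral {0..2*pi} (\<lambda>p. (norm (osc a b g (\<lambda>t. cos \<beta> * X t + sin \<beta> * Y t) (\<lambda>t. cos \<beta> * Y t - sin \<beta> * X t) p))\<^sup>2)"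
proof -
  let ?f = "\<lambda>p. (norm (osc a b g (\<lambda>t. cos \<beta> * X t + sin \<beta> * Y t) (\<lambda>t. cos \<beta> * Y t - sin \<beta> * X t) p))\<^sup>2"
  have "integral {0..2*pi} (\<lambda>p. (norm (osc a b g X Y p))\<^sup>2) = integral {0..2*pi} (\<lambda>p. ?f (p - \<beta>))"
    by (subst osc_rotate[where \<beta> = \<beta>]) simp
  also have "\<dots> = integral {0..2*pi} ?f"
  proof (rule integral_periodic_shift[OF _ _ b])
    show "continuous_on UNIV ?f" by (intro continuous_intros continuous_on_osc cont)
    show "?f (p + 2*pi) = ?f p" for p by (simp add: osc_def)
  qed
  finally show ?thesis .
qed

section \<open>Periodic families and moving frames\<close>

text \<open>Amplitudes on the family of parallel curves: t runs along the curve and s labels the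
  curve at distance s. Derivatives are asked only in t, the variable of all integrations by parts;
  joint continuity over a compact range of s makes the bounds uniform in s. The derivative is
  quantified rather than named, so that closure properties follow by induction on the order.\<close>

primrec nice :: "real \<Rightarrow> nat \<Rightarrow> (real \<Rightarrow> real \<Rightarrow> real) \<Rightarrow> bool" where
  "nice e 0 g \<longleftrightarrow> continuous_on (UNIV \<times> {-e..e}) (\<lambda>(t, s). g t s) \<and> (\<forall>t s. g (t + 1) s = g t s)"
| "nice e (Suc k) g \<longleftrightarrow>
    (continuous_on (UNIV \<times> {-e..e}) (\<lambda>(t, s). g t s) \<and> (\<forall>t s. g (t + 1) s = g t s)) \<and>
    (\<exists>g'. (\<forall>t. \<forall>s\<in>{-e..e}. ((\<lambda>t. g t s) has_real_derivative g' t s) (at t)) \<and> nice e k g')"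

lemma nice_0: "nice e k g \<Longrightarrow> nice e 0 g"
  by (cases k) auto

lemma nice_SucD: "nice e (Suc k) g \<Longrightarrow> nice e k g"
proof (induction k arbitrary: g)
  case (Suc k)
  then obtain g' where g': "\<forall>t. \<forall>s\<in>{-e..e}. ((\<lambda>t. g t s) has_real_derivative g' t s) (at t)" "nice e (Suc k) g'"
    by auto
  from Suc.IH[OF g'(2)] g'(1) nice_0[OF Suc.prems] show ?case by auto
qed auto

lemma nice_SucI:
  assumes "nice e 0 g" "nice e k g'"
    and "\<forall>t. \<forall>s\<in>{-e..e}. ((\<lambda>t. g t s) has_real_derivative g' t s) (at t)"
  shows "nice e (Suc k) g"
  using assms by auto

lemma nice_derivE:
  assumes "nice e (Suc k) g"
  obtains g' where "\<And>t s. s \<in> {-e..e} \<Longrightarrow> ((\<lambda>t. g t s) has_real_derivative g' t s) (at t)" "nice e k g'"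
proof -
  from assms obtain g' where "\<forall>t. \<forall>s\<in>{-e..e}. ((\<lambda>t. g t s) has_real_derivative g' t s) (at t)" "nice e k g'"
    by auto
  then show ?thesis by (intro that[of g']) blast+
qed

lemma nice_const [intro]: "nice e k (\<lambda>t s. a)"
proof (induction k arbitrary: a)
  case (Suc k) show ?case by (auto intro!: exI[of _ "\<lambda>t s. 0"] Suc)
qed auto

lemma nice_s [intro]: "nice e k (\<lambda>t s. s)"
  by (cases k) (auto simp: split_beta intro!: continuous_intros exI[of _ "\<lambda>t s. 0"] nice_const)

lemma nice_add [intro]: "nice e k f \<Longrightarrow> nice e k g \<Longrightarrow> nice e k (\<lambda>t s. f t s + g t s)"
proof (induction k arbitrary: f g)
  case 0 then show ?case by (auto simp: split_beta intro!: continuous_intros)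
next
  case (Suc k)
  from Suc.prems obtain f' g' where d: "\<forall>t. \<forall>s\<in>{-e..e}. ((\<lambda>t. f t s) has_real_derivative f' t s) (at t)" "nice e k f'"
    "\<forall>t. \<forall>s\<in>{-e..e}. ((\<lambda>t. g t s) has_real_derivative g' t s) (at t)" "nice e k g'" by auto
  from Suc.prems have "nice e 0 (\<lambda>t s. f t s + g t s)" by (auto simp: split_beta intro!: continuous_intros)
  moreover have "\<forall>t. \<forall>s\<in>{-e..e}. ((\<lambda>t. f t s + g t s) has_real_derivative (f' t s + g' t s)) (at t)"
    using d by (auto intro!: derivative_eq_intros)
  ultimately show ?case using nice_SucI[OF _ Suc.IH[OF d(2,4)]] by blast
qed

lemma nice_mult [intro]: "nice e k f \<Longrightarrow> nice e k g \<Longrightarrow> nice e k (\<lambda>t s. f t s * g t s)"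
proof (induction k arbitrary: f g)
  case 0 then show ?case by (auto simp: split_beta intro!: continuous_intros)
next
  case (Suc k)
  from Suc.prems obtain f' g' where d: "\<forall>t. \<forall>s\<in>{-e..e}. ((\<lambda>t. f t s) has_real_derivative f' t s) (at t)" "nice e k f'"
    "\<forall>t. \<forall>s\<in>{-e..e}. ((\<lambda>t. g t s) has_real_derivative g' t s) (at t)" "nice e k g'" by auto
  have n: "nice e k f" "nice e k g" using Suc.prems nice_SucD by blast+
  from Suc.prems have "nice e 0 (\<lambda>t s. f t s * g t s)" by (auto simp: split_beta intro!: continuous_intros)
  moreover have "\<forall>t. \<forall>s\<in>{-e..e}. ((\<lambda>t. f t s * g t s) has_real_derivative (f' t s * g t s + f t s * g' t s)) (at t)"
    using d by (auto intro!: derivative_eq_intros)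
  moreover have "nice e k (\<lambda>t s. f' t s * g t s + f t s * g' t s)"
    by (intro nice_add Suc.IH d n)
  ultimately show ?case using nice_SucI by blast
qed

lemma nice_uminus [intro]: "nice e k f \<Longrightarrow> nice e k (\<lambda>t s. - f t s)"
  using nice_mult[OF nice_const[of e k "-1"], of f] by simp

lemma nice_diff [intro]: "nice e k f \<Longrightarrow> nice e k g \<Longrightarrow> nice e k (\<lambda>t s. f t s - g t s)"
  using nice_add[OF _ nice_uminus, of e k f g] by simp

lemma nice_power [intro]: "nice e k f \<Longrightarrow> nice e k (\<lambda>t s. f t s ^ n)"
  by (induction n) (auto intro: nice_const nice_mult)

text \<open>The derivative is expressed through 1 / f itself, so that the induction hypothesis
  covers it; the square root below is treated in the same way.\<close>

lemma nice_inverse [intro]: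
  "nice e k f \<Longrightarrow> (\<And>t s. s \<in> {-e..e} \<Longrightarrow> f t s \<noteq> 0) \<Longrightarrow> nice e k (\<lambda>t s. 1 / f t s)"
proof (induction k arbitrary: f)
  case 0 then show ?case by (auto simp: split_beta intro!: continuous_intros)
next
  case (Suc k)
  from Suc.prems obtain f' where d: "\<forall>t. \<forall>s\<in>{-e..e}. ((\<lambda>t. f t s) has_real_derivative f' t s) (at t)" "nice e k f'"
    by auto
  have n: "nice e k f" using Suc.prems nice_SucD by blast
  from Suc.prems have "nice e 0 (\<lambda>t s. 1 / f t s)" by (auto simp: split_beta intro!: continuous_intros)
  moreover have "\<forall>t. \<forall>s\<in>{-e..e}. ((\<lambda>t. 1 / f t s) has_real_derivative (- (f' t s * (1 / f t s) * (1 / f t s)))) (at t)"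
    using d Suc.prems(2) by (auto intro!: derivative_eq_intros simp: field_simps)
  moreover have "nice e k (\<lambda>t s. - (f' t s * (1 / f t s) * (1 / f t s)))"
    by (intro nice_uminus nice_mult Suc.IH d n Suc.prems)
  ultimately show ?case using nice_SucI by blast
qed

lemma nice_sqrt:
  "nice e k f \<Longrightarrow> (\<And>t s. s \<in> {-e..e} \<Longrightarrow> f t s > 0) \<Longrightarrow> nice e k (\<lambda>t s. sqrt (f t s))"
proof (induction k arbitrary: f)
  case 0 then show ?case by (auto simp: split_beta intro!: continuous_intros)
next
  case (Suc k)
  from Suc.prems obtain f' where d: "\<forall>t. \<forall>s\<in>{-e..e}. ((\<lambda>t. f t s) has_real_derivative f' t s) (at t)" "nice e k f'"
    by auto
  have n: "nice e k f" using Suc.prems nice_SucD by blast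
  have p: "sqrt (f t s) \<noteq> 0" if "s \<in> {-e..e}" for t s using Suc.prems(2)[OF that, of t] by simp
  from Suc.prems have "nice e 0 (\<lambda>t s. sqrt (f t s))" by (auto simp: split_beta intro!: continuous_intros)
  moreover have "\<forall>t. \<forall>s\<in>{-e..e}. ((\<lambda>t. sqrt (f t s)) has_real_derivative (f' t s * (1/2) * (1 / sqrt (f t s)))) (at t)"
  proof (intro allI ballI)
    fix t s assume s: "s \<in> {-e..e}"
    have "f t s > 0" using Suc.prems(2)[OF s] .
    then show "((\<lambda>t. sqrt (f t s)) has_real_derivative (f' t s * (1/2) * (1 / sqrt (f t s)))) (at t)"
      using d(1) s by (auto intro!: derivative_eq_intros simp: field_simps)
  qed
  moreover have "nice e k (\<lambda>t s. f' t s * (1/2) * (1 / sqrt (f t s)))"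
    by (intro nice_mult nice_const nice_inverse Suc.IH d n Suc.prems p)
  ultimately show ?case using nice_SucI by blast
qed

lemma nice_bounded:
  assumes "nice e k g"
  obtains B where "B \<ge> 0" "\<And>t s. t \<in> {0..1} \<Longrightarrow> s \<in> {-e..e} \<Longrightarrow> \<bar>g t s\<bar> \<le> B"
proof -
  have "continuous_on (UNIV \<times> {-e..e}) (\<lambda>(t, s). g t s)" using nice_0[OF assms] by simp
  then have "continuous_on ({0..1} \<times> {-e..e}) (\<lambda>(t, s). g t s)" by (rule continuous_on_subset) auto
  then have "compact ((\<lambda>(t, s). g t s) ` ({0..1} \<times> {-e..e}))"
    by (rule compact_continuous_image) (intro compact_Times compact_Icc)
  then have "bounded ((\<lambda>(t, s). g t s) ` ({0..1} \<times> {-e..e}))" by (rule compact_imp_bounded)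
  then obtain B where "B > 0" "\<forall>y\<in>(\<lambda>(t, s). g t s) ` ({0..1} \<times> {-e..e}). norm y \<le> B"
    unfolding bounded_pos by blast
  then show ?thesis by (intro that[of B]) auto
qed

lemma nice_continuous2:
  assumes "nice e k g" "continuous_on S f1" "continuous_on S f2" "f2 ` S \<subseteq> {-e..e}"
  shows "continuous_on S (\<lambda>z. g (f1 z) (f2 z))"
proof -
  have "continuous_on (UNIV \<times> {-e..e}) (\<lambda>(t, s). g t s)" using nice_0[OF assms(1)] by simp
  from continuous_on_compose2[OF this, of S "\<lambda>z. (f1 z, f2 z)"] assms(2-) show ?thesis
    by (auto intro!: continuous_intros)
qed

lemma nice_continuous:
  assumes "nice e k g" "s \<in> {-e..e}"
  shows "continuous_on S (\<lambda>t. g t s)"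
  by (rule nice_continuous2[OF assms(1), of S "\<lambda>t. t" "\<lambda>_. s"]) (use assms(2) in auto)

text \<open>\<open>(x, y)\<close> is a closed curve of speed \<open>c\<close> with unit tangent \<open>(T1, T2)\<close> and unit normal \<open>(n1, n2)\<close>;
  \<open>\<mu> / c\<close> is its curvature, so that \<open>c + s \<mu>\<close> is the speed of the parallel curve at distance \<open>s\<close>.\<close>

locale curve_frame =
  fixes x y c \<mu> T1 T2 n1 n2 :: "real \<Rightarrow> real" and e c0 :: real
  assumes e: "e > 0" and c0: "c0 > 0"
    and deriv: "(x has_real_derivative c t * T1 t) (at t)" "(y has_real_derivative c t * T2 t) (at t)"
      "(T1 has_real_derivative - (\<mu> t * n1 t)) (at t)" "(T2 has_real_derivative - (\<mu> t * n2 t)) (at t)"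
      "(n1 has_real_derivative \<mu> t * T1 t) (at t)" "(n2 has_real_derivative \<mu> t * T2 t) (at t)"
    and ortho: "(T1 t)\<^sup>2 + (T2 t)\<^sup>2 = 1" "(n1 t)\<^sup>2 + (n2 t)\<^sup>2 = 1" "T1 t * n1 t + T2 t * n2 t = 0"
    and nice_frame: "nice e k (\<lambda>t s. x t)" "nice e k (\<lambda>t s. y t)" "nice e k (\<lambda>t s. c t)" "nice e k (\<lambda>t s. \<mu> t)"
      "nice e k (\<lambda>t s. T1 t)" "nice e k (\<lambda>t s. T2 t)" "nice e k (\<lambda>t s. n1 t)" "nice e k (\<lambda>t s. n2 t)"
    and speed: "s \<in> {-e..e} \<Longrightarrow> c t + s * \<mu> t \<ge> c0"
begin

text \<open>Uniform continuity of the tangent. The tolerance 1/16 is small enough for the slope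
  condition |Y'| <= X'/4 once a piece has been rotated.\<close>

lemma partition_tangent:
  obtains N :: nat where "N > 0"
    "\<And>t u. t \<in> {0..1} \<Longrightarrow> u \<in> {0..1} \<Longrightarrow> \<bar>t - u\<bar> \<le> 1 / N \<Longrightarrow> \<bar>T1 t - T1 u\<bar> \<le> 1/16 \<and> \<bar>T2 t - T2 u\<bar> \<le> 1/16"
proof -
  have "0 \<in> {-e..e}" using e by simp
  then have u: "uniformly_continuous_on {0..1} T1" "uniformly_continuous_on {0..1} T2"
    by (intro compact_uniformly_continuous compact_Icc nice_continuous[OF nice_frame(5)] nice_continuous[OF nice_frame(6)]; assumption)+
  from u(1) obtain d1 where d1: "d1 > 0" "\<And>t u. t \<in> {0..1} \<Longrightarrow> u \<in> {0..1} \<Longrightarrow> dist u t < d1 \<Longrightarrow> dist (T1 u) (T1 t) < 1/16"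
    unfolding uniformly_continuous_on_def by (metis zero_less_divide_1_iff zero_less_numeral)
  from u(2) obtain d2 where d2: "d2 > 0" "\<And>t u. t \<in> {0..1} \<Longrightarrow> u \<in> {0..1} \<Longrightarrow> dist u t < d2 \<Longrightarrow> dist (T2 u) (T2 t) < 1/16"
    unfolding uniformly_continuous_on_def by (metis zero_less_divide_1_iff zero_less_numeral)
  obtain N where N: "N > 0" "1 / real N < min d1 d2"
    using nat_approx_posE[of "min d1 d2"] d1(1) d2(1) by (metis min_less_iff_conj zero_less_Suc)
  show ?thesis
  proof (rule that[OF N(1)])
    fix t u :: real assume "t \<in> {0..1}" "u \<in> {0..1}" "\<bar>t - u\<bar> \<le> 1 / N"
    then show "\<bar>T1 t - T1 u\<bar> \<le> 1/16 \<and> \<bar>T2 t - T2 u\<bar> \<le> 1/16"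
      using d1(2)[of u t] d2(2)[of u t] N(2) by (auto simp: dist_real_def)
  qed
qed

definition par :: "real \<Rightarrow> (real \<Rightarrow> real) \<Rightarrow> real \<Rightarrow> real \<Rightarrow> complex" where
  "par R g s p = osc 0 1 g (\<lambda>t. R * (x t + s * n1 t)) (\<lambda>t. R * (y t + s * n2 t)) p"

text \<open>Each short piece is rotated so that its initial tangent is the x-axis, and then falls
  under \<open>osc_piece\<close> with l proportional to R. The constant is independent of s, which
  later permits integration over the thickness of the tube.\<close>

lemma par_L2_bound:
  assumes g: "nice e 1 (\<lambda>t s. g t)"
  shows "\<exists>C\<ge>0. \<forall>s\<in>{-e..e}. \<forall>R\<ge>1. integral {0..2*pi} (\<lambda>p. (norm (par R g s p))\<^sup>2) \<le> C / R"
proof -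
  obtain N :: nat where N: "N > 0"
    "\<And>t u. t \<in> {0..1} \<Longrightarrow> u \<in> {0..1} \<Longrightarrow> \<bar>t - u\<bar> \<le> 1 / N \<Longrightarrow> \<bar>T1 t - T1 u\<bar> \<le> 1/16 \<and> \<bar>T2 t - T2 u\<bar> \<le> 1/16"
    by (rule partition_tangent) blast
  have e0: "0 \<in> {-e..e}" using e by simp
  obtain g' where "\<forall>t. \<forall>s\<in>{-e..e}. (g has_real_derivative g' t s) (at t)" "nice e 0 g'"
    using g by auto
  then have dg: "(g has_real_derivative g' t 0) (at t)" and ng': "nice e 0 (\<lambda>t s. g' t s)" for t
    using e0 by auto
  obtain c' where dc: "\<And>t. (c has_real_derivative c' t 0) (at t)" and nc': "nice e 0 c'"
    by (rule nice_derivE[OF nice_frame(3)[of "Suc 0"]]) (use e0 in blast)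
  obtain \<mu>' where d\<mu>: "\<And>t. (\<mu> has_real_derivative \<mu>' t 0) (at t)" and n\<mu>': "nice e 0 \<mu>'"
    by (rule nice_derivE[OF nice_frame(4)[of "Suc 0"]]) (use e0 in blast)
  obtain B1 where B1: "B1 \<ge> 0" "\<And>t s. t \<in> {0..1} \<Longrightarrow> s \<in> {-e..e} \<Longrightarrow> \<bar>g t\<bar> \<le> B1" using nice_bounded[OF g] by metis
  obtain B2 where B2: "B2 \<ge> 0" "\<And>t s. t \<in> {0..1} \<Longrightarrow> s \<in> {-e..e} \<Longrightarrow> \<bar>g' t s\<bar> \<le> B2" using nice_bounded[OF ng'] by metis
  obtain B3 where B3: "B3 \<ge> 0" "\<And>t s. t \<in> {0..1} \<Longrightarrow> s \<in> {-e..e} \<Longrightarrow> \<bar>c' t s\<bar> \<le> B3" using nice_bounded[OF nc'] by metis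
  obtain B4 where B4: "B4 \<ge> 0" "\<And>t s. t \<in> {0..1} \<Longrightarrow> s \<in> {-e..e} \<Longrightarrow> \<bar>\<mu>' t s\<bar> \<le> B4" using nice_bounded[OF n\<mu>'] by metis
  obtain B5 where B5: "B5 \<ge> 0" "\<And>t s. t \<in> {0..1} \<Longrightarrow> s \<in> {-e..e} \<Longrightarrow> \<bar>(c t + s * \<mu> t) * \<mu> t\<bar> \<le> B5"
  proof -
    have "nice e 0 (\<lambda>t s. (c t + s * \<mu> t) * \<mu> t)" by (intro nice_mult nice_add nice_s nice_frame)
    from nice_bounded[OF this] show ?thesis using that by metis
  qed
  define G where "G = B1 + B2"
  define M where "M = B3 + e * B4 + B5"
  \<comment> \<open>Chosen so that L times R c0 / 2 equals 2 R M: each component of the second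
    derivative is at most R M, and the rotation mixes two of them.\<close>
  define L where "L = 4 * M / c0"
  define C1 where "C1 = 600000000 * G\<^sup>2 / (c0/2) + 8 * ((12 * G + 32 * G * L) / (c0/2))\<^sup>2"
  have G0: "G \<ge> 0" using B1 B2 by (simp add: G_def)
  have C10: "C1 \<ge> 0" using c0 by (simp add: C1_def)
  have T1b: "\<bar>T1 t\<bar> \<le> 1" "\<bar>T2 t\<bar> \<le> 1" "\<bar>n1 t\<bar> \<le> 1" "\<bar>n2 t\<bar> \<le> 1" for t
    using ortho(1,2)[of t] by (simp_all add: abs_le_square_iff[of _ 1, simplified] flip: abs_square_le_1) (smt (verit) zero_le_power2)+
  have piece: "integral {0..2*pi} (\<lambda>p. (norm (osc a b g (\<lambda>t. R * (x t + s * n1 t)) (\<lambda>t. R * (y t + s * n2 t)) p))\<^sup>2) \<le> C1 / R"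
    if ab: "0 \<le> a" "a \<le> b" "b \<le> 1" "b - a \<le> 1 / N" and s: "s \<in> {-e..e}" and R: "R \<ge> 1" for a b s R
  proof -
    obtain \<beta> where \<beta>: "0 \<le> \<beta>" "\<beta> \<le> 2*pi" "T1 a = cos \<beta>" "T2 a = sin \<beta>"
      using sincos_total_2pi[of "T1 a" "T2 a"] ortho(1)[of a] by (metis less_imp_le)
    let ?X = "\<lambda>t. R * (x t + s * n1 t)" and ?Y = "\<lambda>t. R * (y t + s * n2 t)"
    let ?v = "\<lambda>t. c t + s * \<mu> t"
    let ?v' = "\<lambda>t. c' t 0 + s * \<mu>' t 0"
    let ?X' = "\<lambda>t. R * (?v t * T1 t)" and ?Y' = "\<lambda>t. R * (?v t * T2 t)"
    let ?X'' = "\<lambda>t. R * (?v' t * T1 t - ?v t * \<mu> t * n1 t)" and ?Y'' = "\<lambda>t. R * (?v' t * T2 t - ?v t * \<mu> t * n2 t)"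
    have dX: "(?X has_real_derivative ?X' t) (at t)" "(?X' has_real_derivative ?X'' t) (at t)"
      and dY: "(?Y has_real_derivative ?Y' t) (at t)" "(?Y' has_real_derivative ?Y'' t) (at t)" for t
      by (auto intro!: derivative_eq_intros deriv dc d\<mu> simp: algebra_simps)
    have cont: "continuous_on {a..b} g" "continuous_on {a..b} ?X" "continuous_on {a..b} ?Y"
      by (intro nice_continuous[OF g e0] continuous_intros nice_continuous[OF nice_frame(1) e0]
          nice_continuous[OF nice_frame(2) e0] nice_continuous[OF nice_frame(7) e0] nice_continuous[OF nice_frame(8) e0])+
    have cont'': "continuous_on {a..b} (\<lambda>t. g' t 0)" "continuous_on {a..b} ?X''" "continuous_on {a..b} ?Y''"
      by (intro continuous_intros nice_continuous[OF ng' e0] nice_continuous[OF nc' e0] nice_continuous[OF n\<mu>' e0]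
          nice_continuous[OF nice_frame(3) e0] nice_continuous[OF nice_frame(4) e0] nice_continuous[OF nice_frame(5) e0]
          nice_continuous[OF nice_frame(6) e0] nice_continuous[OF nice_frame(7) e0] nice_continuous[OF nice_frame(8) e0])+
    let ?l = "R * (c0 / 2)"
    have "integral {0..2*pi} (\<lambda>p. (norm (osc a b g ?X ?Y p))\<^sup>2) =
      integral {0..2*pi} (\<lambda>p. (norm (osc a b g (\<lambda>t. cos \<beta> * ?X t + sin \<beta> * ?Y t) (\<lambda>t. cos \<beta> * ?Y t - sin \<beta> * ?X t) p))\<^sup>2)"
      by (rule osc_piece_rotated[OF \<beta>(1,2) cont])
    also have "\<dots> \<le> 600000000 * G\<^sup>2 / ?l + 8 * ((12 * G + 32 * G * L) / ?l)\<^sup>2"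
    proof (rule osc_piece[where g' = "\<lambda>t. g' t 0"
          and X' = "\<lambda>t. cos \<beta> * ?X' t + sin \<beta> * ?Y' t" and X'' = "\<lambda>t. cos \<beta> * ?X'' t + sin \<beta> * ?Y'' t"
          and Y' = "\<lambda>t. cos \<beta> * ?Y' t - sin \<beta> * ?X' t" and Y'' = "\<lambda>t. cos \<beta> * ?Y'' t - sin \<beta> * ?X'' t"])
      show "a \<le> b" by fact
      show "b - a \<le> 1" using ab by simp
      show "0 < ?l" using R c0 by simp
      show "(g has_real_derivative g' t 0) (at t)" for t by (rule dg)
      show "((\<lambda>t. cos \<beta> * ?X t + sin \<beta> * ?Y t) has_real_derivative cos \<beta> * ?X' t + sin \<beta> * ?Y' t) (at t)" for t
        by (intro DERIV_add DERIV_cmult dX dY)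
      show "((\<lambda>t. cos \<beta> * ?X' t + sin \<beta> * ?Y' t) has_real_derivative cos \<beta> * ?X'' t + sin \<beta> * ?Y'' t) (at t)" for t
        by (intro DERIV_add DERIV_cmult dX dY)
      show "((\<lambda>t. cos \<beta> * ?Y t - sin \<beta> * ?X t) has_real_derivative cos \<beta> * ?Y' t - sin \<beta> * ?X' t) (at t)" for t
        by (intro DERIV_diff DERIV_cmult dX dY)
      show "((\<lambda>t. cos \<beta> * ?Y' t - sin \<beta> * ?X' t) has_real_derivative cos \<beta> * ?Y'' t - sin \<beta> * ?X'' t) (at t)" for t
        by (intro DERIV_diff DERIV_cmult dX dY)
      show "continuous_on {a..b} (\<lambda>t. g' t 0)" by (rule cont'')
      show "continuous_on {a..b} (\<lambda>t. cos \<beta> * ?X'' t + sin \<beta> * ?Y'' t)"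
        by (intro continuous_on_add continuous_on_mult continuous_on_const cont''[simplified])
      show "continuous_on {a..b} (\<lambda>t. cos \<beta> * ?Y'' t - sin \<beta> * ?X'' t)"
        by (intro continuous_on_diff continuous_on_mult continuous_on_const cont''[simplified])
      fix t assume t: "t \<in> {a..b}"
      then have t01: "t \<in> {0..1}" using ab by auto
      show "\<bar>g t\<bar> \<le> G" using B1(2)[OF t01 s] B2(1) by (simp add: G_def)
      show "\<bar>g' t 0\<bar> \<le> G" using B2(2)[OF t01 e0] B1(1) by (simp add: G_def)
      have v: "?v t \<ge> c0" using speed[OF s] .
      have tt: "\<bar>T1 t - T1 a\<bar> \<le> 1/16" "\<bar>T2 t - T2 a\<bar> \<le> 1/16" using N(2)[OF t01, of a] ab t by auto
      define dt where "dt = cos \<beta> * T1 t + sin \<beta> * T2 t"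
      \<comment> \<open>Polarization of two unit vectors: nearby tangents have inner product
        \<open>dt\<close> at least 7/8. The transversal part \<open>nt\<close> below is at most 1/8
        <= dt/4.\<close>
      have "2 * dt = 2 - (T1 t - T1 a)\<^sup>2 - (T2 t - T2 a)\<^sup>2"
        using ortho(1)[of t] ortho(1)[of a] unfolding dt_def \<beta>(3,4)[symmetric] by (simp add: power2_eq_square algebra_simps)
      moreover have "(T1 t - T1 a)\<^sup>2 \<le> (1/16)\<^sup>2" "(T2 t - T2 a)\<^sup>2 \<le> (1/16)\<^sup>2"
        using tt by (simp_all add: abs_le_square_iff[symmetric])
      ultimately have dt: "dt \<ge> 7/8" by (simp add: power2_eq_square)
      have X'eq: "cos \<beta> * ?X' t + sin \<beta> * ?Y' t = R * ?v t * dt" by (simp add: dt_def algebra_simps)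
      have "R * c0 * (1/2) \<le> R * ?v t * dt" using R c0 v dt by (intro mult_mono) auto
      then show "R * (c0/2) \<le> cos \<beta> * ?X' t + sin \<beta> * ?Y' t" unfolding X'eq by simp
      define nt where "nt = cos \<beta> * T2 t - sin \<beta> * T1 t"
      have nt: "\<bar>nt\<bar> \<le> 1/8"
      proof -
        have "nt = T1 a * (T2 t - T2 a) - T2 a * (T1 t - T1 a)" by (simp add: nt_def \<beta>(3,4) algebra_simps)
        also have "\<bar>\<dots>\<bar> \<le> \<bar>T1 a * (T2 t - T2 a)\<bar> + \<bar>T2 a * (T1 t - T1 a)\<bar>" by (rule abs_triangle_ineq4)
        also have "\<dots> \<le> 1 * (1/16) + 1 * (1/16)" unfolding abs_mult using tt T1b by (intro add_mono mult_mono) auto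
        finally show ?thesis by simp
      qed
      have Y'eq: "cos \<beta> * ?Y' t - sin \<beta> * ?X' t = R * ?v t * nt" by (simp add: nt_def algebra_simps)
      have "\<bar>R * ?v t * nt\<bar> = R * ?v t * \<bar>nt\<bar>" using R v c0 by (simp add: abs_mult)
      also have "\<dots> \<le> R * ?v t * (dt / 4)" using R v c0 nt dt by (intro mult_left_mono) auto
      finally show "\<bar>cos \<beta> * ?Y' t - sin \<beta> * ?X' t\<bar> \<le> (cos \<beta> * ?X' t + sin \<beta> * ?Y' t) / 4"
        unfolding X'eq Y'eq by simp
      have v': "\<bar>?v' t\<bar> \<le> B3 + e * B4"
      proof -
        have "\<bar>s * \<mu>' t 0\<bar> \<le> e * B4" unfolding abs_mult using s B4(2)[OF t01 e0] e by (intro mult_mono) auto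
        then show ?thesis using B3(2)[OF t01 e0] by linarith
      qed
      have bb: "\<bar>R * (?v' t * P - ?v t * \<mu> t * Q)\<bar> \<le> R * M" if "\<bar>P\<bar> \<le> 1" "\<bar>Q\<bar> \<le> 1" for P Q
      proof -
        have "\<bar>?v' t * P\<bar> \<le> (B3 + e * B4) * 1" unfolding abs_mult using that v' by (intro mult_mono) auto
        moreover have "\<bar>?v t * \<mu> t * Q\<bar> \<le> B5 * 1"
          unfolding abs_mult[of "?v t * \<mu> t"] using that B5(2)[OF t01 s] by (intro mult_mono) auto
        ultimately have "\<bar>?v' t * P - ?v t * \<mu> t * Q\<bar> \<le> M" unfolding M_def
          by (intro order_trans[OF abs_triangle_ineq4]) simp
        then show ?thesis unfolding abs_mult using R by (simp add: mult_left_mono)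
      qed
      have rr: "\<bar>cos \<beta> * P\<bar> + \<bar>sin \<beta> * Q\<bar> \<le> L * (R * (c0/2))" if "\<bar>P\<bar> \<le> R * M" "\<bar>Q\<bar> \<le> R * M" for P Q
      proof -
        have "\<bar>cos \<beta> * P\<bar> \<le> 1 * (R * M)" "\<bar>sin \<beta> * Q\<bar> \<le> 1 * (R * M)"
          unfolding abs_mult using that by (intro mult_mono; simp)+
        moreover have "L * (R * (c0/2)) = 2 * (1 * (R * M))" using c0 by (simp add: L_def)
        ultimately show ?thesis by linarith
      qed
      show "\<bar>cos \<beta> * ?X'' t + sin \<beta> * ?Y'' t\<bar> \<le> L * (R * (c0/2))"
        using rr[OF bb[OF T1b(1) T1b(3)] bb[OF T1b(2) T1b(4)], of t t t t] by linarith
      show "\<bar>cos \<beta> * ?Y'' t - sin \<beta> * ?X'' t\<bar> \<le> L * (R * (c0/2))"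
        using rr[OF bb[OF T1b(2) T1b(4)] bb[OF T1b(1) T1b(3)], of t t t t] by linarith
    qed
    also have "\<dots> \<le> C1 / R"
    proof -
      have "((12 * G + 32 * G * L) / ?l)\<^sup>2 = ((12 * G + 32 * G * L) / (c0/2))\<^sup>2 / R\<^sup>2"
        by (simp add: power_divide power_mult_distrib)
      also have "\<dots> \<le> ((12 * G + 32 * G * L) / (c0/2))\<^sup>2 / R"
        using R by (intro divide_left_mono) (auto simp: power2_eq_square)
      finally show ?thesis using R by (simp add: C1_def add_divide_distrib mult.commute)
    qed
    finally show ?thesis .
  qed
  have gc: "continuous_on {a..b} g" for a b using nice_continuous[OF g e0] .
  \<comment> \<open>The pieces are added one at a time. The constant at least doubles at each step,
    which is harmless because the number of pieces depends only on the curve.\<close>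
  have main: "\<exists>C\<ge>0. \<forall>s\<in>{-e..e}. \<forall>R\<ge>1. integral {0..2*pi} (\<lambda>p. (norm (osc 0 (j/N) g (\<lambda>t. R * (x t + s * n1 t)) (\<lambda>t. R * (y t + s * n2 t)) p))\<^sup>2) \<le> C / R"
    if "j \<le> N" for j :: nat
    using that
  proof (induction j)
    case 0 show ?case by (intro exI[of _ 0]) (simp add: osc_def)
  next
    case (Suc j)
    then obtain C where C: "C \<ge> 0" "\<forall>s\<in>{-e..e}. \<forall>R\<ge>1. integral {0..2*pi} (\<lambda>p. (norm (osc 0 (j/N) g (\<lambda>t. R * (x t + s * n1 t)) (\<lambda>t. R * (y t + s * n2 t)) p))\<^sup>2) \<le> C / R"
      by auto
    show ?case
    proof (intro exI[of _ "2 * C + 2 * C1"] conjI ballI allI impI)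
      show "0 \<le> 2 * C + 2 * C1" using C C10 by simp
      fix s R assume s: "s \<in> {-e..e}" and R: "R \<ge> (1::real)"
      let ?X = "\<lambda>t. R * (x t + s * n1 t)" and ?Y = "\<lambda>t. R * (y t + s * n2 t)"
      let ?a = "real j / N" and ?b = "real (Suc j) / N"
      have ab: "0 \<le> ?a" "?a \<le> ?b" "?b \<le> 1" "?b - ?a \<le> 1 / N" using N(1) Suc.prems
        by (auto simp: divide_simps)
      have c: "continuous_on S ?X" "continuous_on S ?Y" for S
        by (intro continuous_intros nice_continuous[OF nice_frame(1) e0] nice_continuous[OF nice_frame(2) e0]
            nice_continuous[OF nice_frame(7) e0] nice_continuous[OF nice_frame(8) e0])+
      have co: "continuous_on S (osc a b g ?X ?Y)" for S a b by (intro continuous_on_osc gc c)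
      have split: "osc 0 ?b g ?X ?Y p = osc 0 ?a g ?X ?Y p + osc ?a ?b g ?X ?Y p" for p
        unfolding osc_def
        by (rule Henstock_Kurzweil_Integration.integral_combine[symmetric, OF ab(1,2)])
          (intro integrable_continuous_interval continuous_intros gc c)
      have "(norm (z + w))\<^sup>2 \<le> 2 * (norm z)\<^sup>2 + 2 * (norm w)\<^sup>2" for z w :: complex
      proof -
        have "(norm (z + w))\<^sup>2 \<le> (norm z + norm w)\<^sup>2" by (intro power_mono norm_triangle_ineq) auto
        also have "\<dots> \<le> 2 * (norm z)\<^sup>2 + 2 * (norm w)\<^sup>2"
          using zero_le_power2[of "norm z - norm w"] by (simp add: power2_eq_square algebra_simps)
        finally show ?thesis .
      qed
      then have "integral {0..2*pi} (\<lambda>p. (norm (osc 0 ?b g ?X ?Y p))\<^sup>2)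
         \<le> integral {0..2*pi} (\<lambda>p. 2 * (norm (osc 0 ?a g ?X ?Y p))\<^sup>2 + 2 * (norm (osc ?a ?b g ?X ?Y p))\<^sup>2)"
        unfolding split
        by (intro integral_le integrable_continuous_interval continuous_intros co) auto
      also have "\<dots> = 2 * integral {0..2*pi} (\<lambda>p. (norm (osc 0 ?a g ?X ?Y p))\<^sup>2) + 2 * integral {0..2*pi} (\<lambda>p. (norm (osc ?a ?b g ?X ?Y p))\<^sup>2)"
        by (subst Henstock_Kurzweil_Integration.integral_add)
          (auto intro!: integrable_continuous_interval continuous_intros co)
      also have "\<dots> \<le> 2 * (C / R) + 2 * (C1 / R)" using C(2) s R piece[OF ab s R] by (intro add_mono mult_left_mono) auto
      finally show "integral {0..2*pi} (\<lambda>p. (norm (osc 0 ?b g ?X ?Y p))\<^sup>2) \<le> (2 * C + 2 * C1) / R"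
        by (simp add: add_divide_distrib)
    qed
  qed
  show ?thesis using main[of N] N(1) by (simp add: par_def)
qed

end

section \<open>Square means of the Fourier transform of a tube\<close>

text \<open>Cauchy-Schwarz, from the nonnegativity of the integral of (f - m)^2 with m the mean of
  f.\<close>

lemma integral_square_le:
  fixes f :: "real \<Rightarrow> real"
  assumes ab: "a \<le> b" and f: "continuous_on {a..b} f"
  shows "(integral {a..b} f)\<^sup>2 \<le> (b - a) * integral {a..b} (\<lambda>t. (f t)\<^sup>2)"
proof (cases "a = b")
  case False
  define m where "m = integral {a..b} f / (b - a)"
  have i: "f integrable_on {a..b}" "(\<lambda>t. (f t)\<^sup>2) integrable_on {a..b}"
    by (intro integrable_continuous_interval continuous_intros f)+
  have "0 \<le> integral {a..b} (\<lambda>t. (f t - m)\<^sup>2)"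
    by (intro Henstock_Kurzweil_Integration.integral_nonneg integrable_continuous_interval continuous_intros f) auto
  also have "(\<lambda>t. (f t - m)\<^sup>2) = (\<lambda>t. ((f t)\<^sup>2 - 2 * m * f t) + m\<^sup>2)"
    by (simp add: power2_eq_square algebra_simps)
  also have "integral {a..b} (\<lambda>t. ((f t)\<^sup>2 - 2 * m * f t) + m\<^sup>2)
     = (integral {a..b} (\<lambda>t. (f t)\<^sup>2) - 2 * m * integral {a..b} f) + m\<^sup>2 * (b - a)"
  proof -
    have "((\<lambda>t. ((f t)\<^sup>2 - 2 * m * f t) + m\<^sup>2) has_integral
      (integral {a..b} (\<lambda>t. (f t)\<^sup>2) - 2 * m * integral {a..b} f) + (b - a) *\<^sub>R m\<^sup>2) {a..b}"
      by (intro has_integral_add has_integral_diff has_integral_mult_right has_integral_const_real[THEN has_integral_eq_rhs] integrable_integral i) (use ab in simp)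
    then show ?thesis by (simp add: integral_unique mult.commute)
  qed
  also have "\<dots> = integral {a..b} (\<lambda>t. (f t)\<^sup>2) - (integral {a..b} f)\<^sup>2 / (b - a)"
  proof -
    have mI: "m * (b - a) = integral {a..b} f" using False by (simp add: m_def)
    have "m\<^sup>2 * (b - a) = m * integral {a..b} f" unfolding mI[symmetric] by (simp add: power2_eq_square)
    moreover have "(integral {a..b} f)\<^sup>2 / (b - a) = m * integral {a..b} f" by (simp add: m_def power2_eq_square)
    ultimately show ?thesis by simp
  qed
  finally show ?thesis using False ab by (simp add: field_simps)
qed simp

lemma norm_sum_square_le: "(norm (z + w))\<^sup>2 \<le> 2 * (norm z)\<^sup>2 + 2 * (norm w)\<^sup>2" for z w :: complex
proof -
  have "(norm (z + w))\<^sup>2 \<le> (norm z + norm w)\<^sup>2" by (intro power_mono norm_triangle_ineq) auto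
  also have "\<dots> \<le> 2 * (norm z)\<^sup>2 + 2 * (norm w)\<^sup>2"
    using zero_le_power2[of "norm z - norm w"] by (simp add: power2_eq_square algebra_simps)
  finally show ?thesis .
qed

text \<open>A Landau symbol for square means over directions, with a constant uniform in both R and
  \<epsilon>. Continuity in p is carried along so that sums and products of such families stay
  integrable.\<close>

definition L2O :: "real \<Rightarrow> (real \<Rightarrow> real \<Rightarrow> real) \<Rightarrow> (real \<Rightarrow> real \<Rightarrow> real \<Rightarrow> complex) \<Rightarrow> bool" where
  "L2O e \<delta> T \<longleftrightarrow> (\<exists>C\<ge>0. \<forall>R\<ge>1. \<forall>\<epsilon>\<in>{0<..e}. continuous_on {0..2*pi} (T R \<epsilon>) \<and>
     integral {0..2*pi} (\<lambda>p. (norm (T R \<epsilon> p))\<^sup>2) \<le> C * \<delta> R \<epsilon>)"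

lemma L2O_zero: "(\<And>R \<epsilon>. R \<ge> 1 \<Longrightarrow> \<epsilon> > 0 \<Longrightarrow> \<delta> R \<epsilon> \<ge> 0) \<Longrightarrow> L2O e \<delta> (\<lambda>R \<epsilon> p. 0)"
  unfolding L2O_def by (intro exI[of _ 0]) auto

lemma L2O_add:
  assumes "L2O e \<delta> T" "L2O e \<delta> U"
  shows "L2O e \<delta> (\<lambda>R \<epsilon> p. T R \<epsilon> p + U R \<epsilon> p)"
proof -
  obtain C where C: "C \<ge> 0" "\<And>R \<epsilon>. R \<ge> 1 \<Longrightarrow> \<epsilon> \<in> {0<..e} \<Longrightarrow> continuous_on {0..2*pi} (T R \<epsilon>)"
     "\<And>R \<epsilon>. R \<ge> 1 \<Longrightarrow> \<epsilon> \<in> {0<..e} \<Longrightarrow> integral {0..2*pi} (\<lambda>p. (norm (T R \<epsilon> p))\<^sup>2) \<le> C * \<delta> R \<epsilon>"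
    using assms(1) unfolding L2O_def by blast
  obtain D where D: "D \<ge> 0" "\<And>R \<epsilon>. R \<ge> 1 \<Longrightarrow> \<epsilon> \<in> {0<..e} \<Longrightarrow> continuous_on {0..2*pi} (U R \<epsilon>)"
     "\<And>R \<epsilon>. R \<ge> 1 \<Longrightarrow> \<epsilon> \<in> {0<..e} \<Longrightarrow> integral {0..2*pi} (\<lambda>p. (norm (U R \<epsilon> p))\<^sup>2) \<le> D * \<delta> R \<epsilon>"
    using assms(2) unfolding L2O_def by blast
  show ?thesis unfolding L2O_def
  proof (intro exI[of _ "2 * C + 2 * D"] conjI allI impI ballI)
    show "0 \<le> 2 * C + 2 * D" using C D by simp
    fix R \<epsilon> :: real assume R: "1 \<le> R" and \<epsilon>: "\<epsilon> \<in> {0<..e}"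
    note [continuous_intros] = C(2)[OF R \<epsilon>] D(2)[OF R \<epsilon>]
    show "continuous_on {0..2*pi} (\<lambda>p. T R \<epsilon> p + U R \<epsilon> p)" by (intro continuous_intros)
    have "integral {0..2*pi} (\<lambda>p. (norm (T R \<epsilon> p + U R \<epsilon> p))\<^sup>2)
      \<le> integral {0..2*pi} (\<lambda>p. 2 * (norm (T R \<epsilon> p))\<^sup>2 + 2 * (norm (U R \<epsilon> p))\<^sup>2)"
      by (intro integral_le integrable_continuous_interval continuous_intros norm_sum_square_le)
    also have "\<dots> = 2 * integral {0..2*pi} (\<lambda>p. (norm (T R \<epsilon> p))\<^sup>2) + 2 * integral {0..2*pi} (\<lambda>p. (norm (U R \<epsilon> p))\<^sup>2)"
      by (subst Henstock_Kurzweil_Integration.integral_add)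
        (auto intro!: integrable_continuous_interval continuous_intros)
    also have "\<dots> \<le> 2 * (C * \<delta> R \<epsilon>) + 2 * (D * \<delta> R \<epsilon>)"
      using C(3)[OF R \<epsilon>] D(3)[OF R \<epsilon>] by simp
    finally show "integral {0..2*pi} (\<lambda>p. (norm (T R \<epsilon> p + U R \<epsilon> p))\<^sup>2) \<le> (2 * C + 2 * D) * \<delta> R \<epsilon>"
      by (simp add: algebra_simps)
  qed
qed

lemma L2O_sum:
  assumes "\<And>R \<epsilon>. R \<ge> 1 \<Longrightarrow> \<epsilon> > 0 \<Longrightarrow> \<delta> R \<epsilon> \<ge> 0" "finite A" "\<And>j. j \<in> A \<Longrightarrow> L2O e \<delta> (T j)"
  shows "L2O e \<delta> (\<lambda>R \<epsilon> p. \<Sum>j\<in>A. T j R \<epsilon> p)"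
  using assms(2,3) by (induction rule: finite_induct) (auto intro: L2O_zero assms(1) L2O_add)

text \<open>Meant for multipliers such as a power of 1/(\<epsilon> R), which change the rate from
  \<delta> to \<delta>' uniformly in the direction.\<close>

lemma L2O_mult:
  assumes T: "L2O e \<delta> T" and K: "K \<ge> 0"
    and m: "\<And>R \<epsilon>. R \<ge> 1 \<Longrightarrow> \<epsilon> \<in> {0<..e} \<Longrightarrow> continuous_on {0..2*pi} (m R \<epsilon>)"
      "\<And>R \<epsilon> p. R \<ge> 1 \<Longrightarrow> \<epsilon> \<in> {0<..e} \<Longrightarrow> (norm (m R \<epsilon> p))\<^sup>2 * \<delta> R \<epsilon> \<le> K * \<delta>' R \<epsilon>"
    and \<delta>: "\<And>R \<epsilon>. R \<ge> 1 \<Longrightarrow> \<epsilon> \<in> {0<..e} \<Longrightarrow> \<delta> R \<epsilon> > 0"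
  shows "L2O e \<delta>' (\<lambda>R \<epsilon> p. m R \<epsilon> p * T R \<epsilon> p)"
proof -
  obtain C where C: "C \<ge> 0" "\<And>R \<epsilon>. R \<ge> 1 \<Longrightarrow> \<epsilon> \<in> {0<..e} \<Longrightarrow> continuous_on {0..2*pi} (T R \<epsilon>)"
     "\<And>R \<epsilon>. R \<ge> 1 \<Longrightarrow> \<epsilon> \<in> {0<..e} \<Longrightarrow> integral {0..2*pi} (\<lambda>p. (norm (T R \<epsilon> p))\<^sup>2) \<le> C * \<delta> R \<epsilon>"
    using assms(1) unfolding L2O_def by blast
  show ?thesis unfolding L2O_def
  proof (intro exI[of _ "C * K"] conjI allI impI ballI)
    show "0 \<le> C * K" using C K by simp
    fix R \<epsilon> :: real assume R: "1 \<le> R" and \<epsilon>: "\<epsilon> \<in> {0<..e}"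
    note [continuous_intros] = C(2)[OF R \<epsilon>] m(1)[OF R \<epsilon>]
    show "continuous_on {0..2*pi} (\<lambda>p. m R \<epsilon> p * T R \<epsilon> p)" by (intro continuous_intros)
    have d: "\<delta> R \<epsilon> > 0" by (rule \<delta>[OF R \<epsilon>])
    have "integral {0..2*pi} (\<lambda>p. (norm (m R \<epsilon> p * T R \<epsilon> p))\<^sup>2)
      \<le> integral {0..2*pi} (\<lambda>p. K * \<delta>' R \<epsilon> / \<delta> R \<epsilon> * (norm (T R \<epsilon> p))\<^sup>2)"
      unfolding norm_mult power_mult_distrib using m(2)[OF R \<epsilon>] d
      by (intro integral_le integrable_continuous_interval continuous_intros mult_right_mono)
        (auto simp: field_simps)
    also have "\<dots> = K * \<delta>' R \<epsilon> / \<delta> R \<epsilon> * integral {0..2*pi} (\<lambda>p. (norm (T R \<epsilon> p))\<^sup>2)" by simp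
    also have "\<dots> \<le> K * \<delta>' R \<epsilon> / \<delta> R \<epsilon> * (C * \<delta> R \<epsilon>)"
    proof (intro mult_left_mono C(3)[OF R \<epsilon>])
      have "0 \<le> (norm (m R \<epsilon> 0))\<^sup>2 * \<delta> R \<epsilon>" using d by simp
      then have "0 \<le> K * \<delta>' R \<epsilon>" using m(2)[OF R \<epsilon>, of 0] by (rule order_trans)
      then show "0 \<le> K * \<delta>' R \<epsilon> / \<delta> R \<epsilon>" using d by (rule divide_nonneg_pos)
    qed
    also have "\<dots> = C * K * \<delta>' R \<epsilon>" using d by simp
    finally show "integral {0..2*pi} (\<lambda>p. (norm (m R \<epsilon> p * T R \<epsilon> p))\<^sup>2) \<le> C * K * \<delta>' R \<epsilon>" .
  qed
qed

lemma L2O_pointwise: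
  assumes "K \<ge> 0" "\<And>R \<epsilon>. R \<ge> 1 \<Longrightarrow> \<epsilon> \<in> {0<..e} \<Longrightarrow> continuous_on {0..2*pi} (T R \<epsilon>)"
    "\<And>R \<epsilon> p. R \<ge> 1 \<Longrightarrow> \<epsilon> \<in> {0<..e} \<Longrightarrow> (norm (T R \<epsilon> p))\<^sup>2 \<le> K * \<delta> R \<epsilon>"
  shows "L2O e \<delta> T"
  unfolding L2O_def
proof (intro exI[of _ "K * (2*pi)"] conjI allI impI ballI)
  show "0 \<le> K * (2*pi)" using assms(1) by simp
  fix R \<epsilon> :: real assume R: "1 \<le> R" and \<epsilon>: "\<epsilon> \<in> {0<..e}"
  show c: "continuous_on {0..2*pi} (T R \<epsilon>)" using assms(2)[OF R \<epsilon>] .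
  have "norm (integral {0..2*pi} (\<lambda>p. (norm (T R \<epsilon> p))\<^sup>2)) \<le> K * \<delta> R \<epsilon> * (2*pi - 0)"
    by (intro integral_bound continuous_intros c) (use assms(3)[OF R \<epsilon>] in auto)
  then show "integral {0..2*pi} (\<lambda>p. (norm (T R \<epsilon> p))\<^sup>2) \<le> K * (2*pi) * \<delta> R \<epsilon>" by (simp add: algebra_simps)
qed

text \<open>Fourier transforms of finite measures on \<open>[-1, 1]\<close> with piecewise continuous density and
  finitely many atoms.\<close>

inductive FM :: "(real \<Rightarrow> complex) \<Rightarrow> bool" where
  zero: "FM (\<lambda>u. 0)"
| atom: "FM w \<Longrightarrow> b \<in> {-1..1} \<Longrightarrow> FM (\<lambda>u. w u + z * cis (- (u * b)))"
| density: "FM w \<Longrightarrow> -1 \<le> a \<Longrightarrow> a \<le> b \<Longrightarrow> b \<le> 1 \<Longrightarrow> continuous_on {a..b} G \<Longrightarrow>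
    FM (\<lambda>u. w u + integral {a..b} (\<lambda>s. of_real (G s) * cis (- (u * s))))"

lemma FM_add: "FM w \<Longrightarrow> FM v \<Longrightarrow> FM (\<lambda>u. v u + w u)"
proof (induction rule: FM.induct)
  case zero then show ?case by simp
next
  case (atom w b z)
  from FM.atom[OF atom.IH[OF atom.prems] atom.hyps(2), of z] show ?case by (simp add: add.assoc)
next
  case (density w a b G)
  from FM.density[OF density.IH[OF density.prems] density.hyps(2-5)] show ?case by (simp add: add.assoc)
qed

lemma FM_atom1: "b \<in> {-1..1} \<Longrightarrow> FM (\<lambda>u. z * cis (- (u * b)))"
  using FM.atom[OF FM.zero, of b z] by simp

lemma FM_density1: "-1 \<le> a \<Longrightarrow> a \<le> b \<Longrightarrow> b \<le> 1 \<Longrightarrow> continuous_on {a..b} G \<Longrightarrow>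
    FM (\<lambda>u. integral {a..b} (\<lambda>s. of_real (G s) * cis (- (u * s))))"
  using FM.density[OF FM.zero, of a b G] by simp

lemma continuous_density:
  assumes "continuous_on {a..b} G"
  shows "continuous_on S (\<lambda>u::real. integral {a..b} (\<lambda>s. of_real (G s) * cis (- (u * s))))"
proof -
  have [continuous_intros]: "continuous_on (S \<times> {a..b}) (\<lambda>z. G (snd z))"
    by (rule continuous_on_compose2[OF assms]) (auto intro!: continuous_intros)
  have "continuous_on S (\<lambda>u. integral (cbox a b) (\<lambda>s. of_real (G s) * cis (- (u * s))))"
    by (rule integral_continuous_on_param) (auto simp: split_beta intro!: continuous_intros)
  then show ?thesis by simp
qed

lemma continuous_on_FM: "FM w \<Longrightarrow> continuous_on S w"
  by (induction rule: FM.induct) (auto intro!: continuous_intros continuous_density)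

section \<open>Oscillatory integrals on the parallel curves\<close>

context curve_frame
begin

definition tau :: "real \<Rightarrow> real \<Rightarrow> real" where "tau p t = cos p * T1 t + sin p * T2 t"
definition nu :: "real \<Rightarrow> real \<Rightarrow> real" where "nu p t = cos p * n1 t + sin p * n2 t"
definition ph :: "real \<Rightarrow> real \<Rightarrow> real \<Rightarrow> real" where "ph s p t = cos p * x t + sin p * y t + s * nu p t"

lemma abs_inner_le_1:
  fixes a b :: real
  assumes "a\<^sup>2 + b\<^sup>2 = 1"
  shows "\<bar>cos p * a + sin p * b\<bar> \<le> 1"
proof -
  have "(cos p * a + sin p * b)\<^sup>2 + (cos p * b - sin p * a)\<^sup>2 = ((cos p)\<^sup>2 + (sin p)\<^sup>2) * (a\<^sup>2 + b\<^sup>2)"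
    by algebra
  also have "\<dots> = 1" using assms by simp
  finally have "(cos p * a + sin p * b)\<^sup>2 \<le> 1" using zero_le_power2[of "cos p * b - sin p * a"]
    by linarith
  then show ?thesis by (simp add: abs_square_le_1)
qed

lemma tau_le: "\<bar>tau p t\<bar> \<le> 1" and nu_le: "\<bar>nu p t\<bar> \<le> 1"
  unfolding tau_def nu_def by (intro abs_inner_le_1 ortho)+

text \<open>The tangent and the normal form an orthogonal matrix, so its columns are orthonormal as
  well as its rows.\<close>

lemma tau_nu: "(tau p t)\<^sup>2 + (nu p t)\<^sup>2 = 1"
proof -
  have "n1 t * (T1 t * n1 t + T2 t * n2 t) = 0" "n2 t * (T1 t * n1 t + T2 t * n2 t) = 0"
    using ortho(3)[of t] by simp_all
  have a: "(T1 t)\<^sup>2 + (n1 t)\<^sup>2 = 1" "(T2 t)\<^sup>2 + (n2 t)\<^sup>2 = 1" "T1 t * T2 t + n1 t * n2 t = 0"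
    using ortho[of t] by algebra+
  have "(tau p t)\<^sup>2 + (nu p t)\<^sup>2 = (cos p)\<^sup>2 * ((T1 t)\<^sup>2 + (n1 t)\<^sup>2) + (sin p)\<^sup>2 * ((T2 t)\<^sup>2 + (n2 t)\<^sup>2)
     + 2 * cos p * sin p * (T1 t * T2 t + n1 t * n2 t)"
    unfolding tau_def nu_def by algebra
  then show ?thesis using a by simp
qed

lemma periodic_frame: "x (t + 1) = x t" "y (t + 1) = y t" "n1 (t + 1) = n1 t" "n2 (t + 1) = n2 t" "T1 (t + 1) = T1 t" "T2 (t + 1) = T2 t"
  using nice_frame[of 0] by simp_all

lemma cont_frame [continuous_intros]:
  fixes f h k :: "'z::t2_space \<Rightarrow> real"
  assumes "continuous_on S f" "continuous_on S h"
  shows "continuous_on S (\<lambda>z. tau (h z) (f z))" "continuous_on S (\<lambda>z. nu (h z) (f z))"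
   and "continuous_on S k \<Longrightarrow> continuous_on S (\<lambda>z. ph (k z) (h z) (f z))"
proof -
  have e0: "0 \<in> {-e..e}" using e by simp
  have [continuous_intros]: "continuous_on S (\<lambda>z. F (f z))" if "nice e 0 (\<lambda>t s. F t)" for F
    by (rule continuous_on_compose2[OF nice_continuous[OF that e0] assms(1)]) auto
  show c: "continuous_on S (\<lambda>z. tau (h z) (f z))" "continuous_on S (\<lambda>z. nu (h z) (f z))"
   and "continuous_on S k \<Longrightarrow> continuous_on S (\<lambda>z. ph (k z) (h z) (f z))"
    unfolding tau_def nu_def ph_def using assms by (auto intro!: continuous_intros nice_frame)
qed

text \<open>The powers of \<open>tau\<close> and \<open>nu\<close> are kept as exponents because
  both factors depend on the direction; the remaining amplitude g does not, so that bounds on g are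
  automatically uniform in p.\<close>

definition wint :: "real \<Rightarrow> (real \<Rightarrow> real \<Rightarrow> real) \<Rightarrow> nat \<Rightarrow> nat \<Rightarrow> real \<Rightarrow> real \<Rightarrow> complex" where
  "wint R g a b s p = integral {0..1} (\<lambda>t. of_real (g t s * tau p t ^ a * nu p t ^ b) * cis (- (R * ph s p t)))"

lemma wint_integrand_continuous:
  fixes f1 f2 f3 :: "'z::t2_space \<Rightarrow> real"
  assumes "nice e 0 g" "continuous_on S f1" "continuous_on S f2" "continuous_on S f3" "f3 ` S \<subseteq> {-e..e}"
  shows "continuous_on S (\<lambda>z. of_real (g (f1 z) (f3 z) * tau (f2 z) (f1 z) ^ a * nu (f2 z) (f1 z) ^ b) * cis (- (R * ph (f3 z) (f2 z) (f1 z))))"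
  by (intro continuous_intros nice_continuous2[OF assms(1)] assms)

lemma wint_integrable:
  assumes "nice e 0 g" "s \<in> {-e..e}"
  shows "(\<lambda>t. of_real (g t s * tau p t ^ a * nu p t ^ b) * cis (- (R * ph s p t))) integrable_on {0..1}"
  using assms
  by (intro integrable_continuous_interval wint_integrand_continuous[of g _ "\<lambda>t. t" "\<lambda>_. p" "\<lambda>_. s"] continuous_intros) auto

lemma wint_continuous:
  fixes f2 f3 :: "'z::t2_space \<Rightarrow> real"
  assumes "nice e 0 g" "continuous_on S f2" "continuous_on S f3" "f3 ` S \<subseteq> {-e..e}"
  shows "continuous_on S (\<lambda>z. wint R g a b (f3 z) (f2 z))"
proof -
  have "continuous_on (UNIV \<times> {-e..e}) (\<lambda>z. integral (cbox 0 1) (\<lambda>t. of_real (g t (snd z) * tau (fst z) t ^ a * nu (fst z) t ^ b) * cis (- (R * ph (snd z) (fst z) t))))"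
  proof (rule integral_continuous_on_param)
    have "continuous_on ((UNIV \<times> {-e..e}) \<times> cbox 0 1) (\<lambda>z. of_real (g (snd z) (snd (fst z)) * tau (fst (fst z)) (snd z) ^ a * nu (fst (fst z)) (snd z) ^ b)
       * cis (- (R * ph (snd (fst z)) (fst (fst z)) (snd z))))"
      by (rule wint_integrand_continuous[OF assms(1), of _ snd "\<lambda>z. fst (fst z)" "\<lambda>z. snd (fst z)"])
        (auto intro!: continuous_intros)
    then show "continuous_on ((UNIV \<times> {-e..e}) \<times> cbox 0 1) (\<lambda>(z, t). of_real (g t (snd z) * tau (fst z) t ^ a * nu (fst z) t ^ b) * cis (- (R * ph (snd z) (fst z) t)))"
      by (simp add: split_beta)
  qed
  from continuous_on_compose2[OF this, of S "\<lambda>z. (f2 z, f3 z)"] assms(2-) show ?thesis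
    unfolding wint_def by (auto intro!: continuous_intros)
qed

lemma wint_trivial:
  assumes "nice e 0 g"
  shows "\<exists>C\<ge>0. \<forall>s\<in>{-e..e}. \<forall>R p. norm (wint R g a b s p) \<le> C"
proof -
  obtain B where B: "B \<ge> 0" "\<And>t s. t \<in> {0..1} \<Longrightarrow> s \<in> {-e..e} \<Longrightarrow> \<bar>g t s\<bar> \<le> B" using nice_bounded[OF assms] by metis
  have "norm (wint R g a b s p) \<le> B * (1 - 0)" if s: "s \<in> {-e..e}" for s R p
    unfolding wint_def
  proof (rule integral_bound)
    show "continuous_on {0..1} (\<lambda>t. of_real (g t s * tau p t ^ a * nu p t ^ b) * cis (- (R * ph s p t)))"
      using assms s by (intro wint_integrand_continuous[of g _ "\<lambda>t. t" "\<lambda>_. p" "\<lambda>_. s"] continuous_intros) auto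
    fix t :: real assume t: "t \<in> {0..1}"
    have "\<bar>tau p t ^ a\<bar> \<le> 1" "\<bar>nu p t ^ b\<bar> \<le> 1" using tau_le nu_le by (simp_all add: power_abs power_le_one)
    then have "\<bar>g t s\<bar> * \<bar>tau p t ^ a\<bar> * \<bar>nu p t ^ b\<bar> \<le> B * 1 * 1" using B(1) B(2)[OF t s] by (intro mult_mono) auto
    then show "norm (of_real (g t s * tau p t ^ a * nu p t ^ b) * cis (- (R * ph s p t))) \<le> B"
      by (simp add: norm_mult abs_mult norm_power power_abs)
  qed simp
  then show ?thesis using B(1) by (intro exI[of _ B]) auto
qed

text \<open>Along the curve the phase has derivative (c + s \<mu>) \<open>tau\<close>. Dividing by
  it uses up one \<open>tau\<close>, and differentiating the remaining power may turn another one
  into \<open>nu\<close>; so two powers of \<open>tau\<close> pay for one factor 1/R. Periodicity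
  removes the boundary terms.\<close>

lemma wint_ibp:
  assumes g: "nice e (Suc k) g"
  obtains g1 g2 g3 where "nice e k g1" "nice e k g2" "nice e k g3"
    "\<And>s R p. s \<in> {-e..e} \<Longrightarrow> R > 0 \<Longrightarrow> norm (wint R g (Suc (Suc a)) b s p) \<le>
      (norm (wint R g1 (Suc a) b s p) + norm (wint R g2 a (Suc b) s p) + norm (wint R g3 (Suc (Suc a)) (b - 1) s p)) / R"
proof -
  define h where "h t s = g t s * (1 / (c t + s * \<mu> t))" for t s
  have v0: "c t + s * \<mu> t \<noteq> 0" if "s \<in> {-e..e}" for t s using speed[OF that, of t] c0 by auto
  have h: "nice e (Suc k) h" unfolding h_def
    by (intro nice_mult g nice_inverse nice_add nice_s nice_frame v0)
  obtain h' where h': "\<And>t s. s \<in> {-e..e} \<Longrightarrow> ((\<lambda>t. h t s) has_real_derivative h' t s) (at t)" "nice e k h'"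
    by (rule nice_derivE[OF h]) blast
  have hk: "nice e k h" by (rule nice_SucD[OF h])
  define g2 where "g2 t s = - (real (Suc a) * \<mu> t * h t s)" for t s
  \<comment> \<open>For b = 0 the exponent b - 1 is truncated to 0, which is harmless because of the
    factor b.\<close>
  define g3 where "g3 t s = real b * \<mu> t * h t s" for t s
  have n2: "nice e k g2" unfolding g2_def by (intro nice_uminus nice_mult nice_const nice_frame hk)
  have n3: "nice e k g3" unfolding g3_def by (intro nice_mult nice_const nice_frame hk)
  show ?thesis
  proof (rule that[OF h'(2) n2 n3])
    fix s R p assume s: "s \<in> {-e..e}" and R: "R > (0::real)"
    define E where "E t = cis (- (R * ph s p t))" for t
    define H where "H t = h t s * tau p t ^ Suc a * nu p t ^ b" for t
    define H' where "H' t = h' t s * tau p t ^ Suc a * nu p t ^ b + g2 t s * tau p t ^ a * nu p t ^ Suc b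
       + g3 t s * tau p t ^ Suc (Suc a) * nu p t ^ (b - 1)" for t
    have dtau: "(tau p has_real_derivative - (\<mu> t * nu p t)) (at t)" for t
      unfolding tau_def[abs_def] nu_def by (auto intro!: derivative_eq_intros deriv simp: algebra_simps)
    have dnu: "(nu p has_real_derivative \<mu> t * tau p t) (at t)" for t
      unfolding nu_def[abs_def] tau_def by (auto intro!: derivative_eq_intros deriv simp: algebra_simps)
    have dph: "(ph s p has_real_derivative (c t + s * \<mu> t) * tau p t) (at t)" for t
      unfolding ph_def[abs_def] by (auto intro!: derivative_eq_intros deriv dnu simp: tau_def algebra_simps)
    have dH: "(H has_real_derivative H' t) (at t)" for t
      unfolding H_def[abs_def] H'_def g2_def g3_def
      by (rule derivative_eq_intros h'(1)[OF s] dtau dnu refl)+ (simp add: algebra_simps)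
    have dE: "(E has_vector_derivative (- (R * ((c t + s * \<mu> t) * tau p t))) *\<^sub>R (\<i> * E t)) (at t)" for t
      unfolding E_def[abs_def] has_vector_derivative_def
      by (rule has_derivative_eq_rhs, rule has_derivative_cis)
         (auto intro!: derivative_eq_intros dph[unfolded has_field_derivative_def] simp: E_def)
    have "((\<lambda>t. of_real (H t) * E t) has_vector_derivative (of_real (H' t) * E t - \<i> * R * (of_real (g t s * tau p t ^ Suc (Suc a) * nu p t ^ b) * E t))) (at t)" for t
    proof -
      have d: "((\<lambda>t. of_real (H t) * E t) has_vector_derivative
         (of_real (H t) * ((- (R * ((c t + s * \<mu> t) * tau p t))) *\<^sub>R (\<i> * E t)) + of_real (H' t) * E t)) (at t)"
        by (intro has_vector_derivative_mult has_vector_derivative_of_real dE dH)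
      have hg: "h t s * (c t + s * \<mu> t) = g t s" using v0[OF s] by (simp add: h_def)
      have "H t * ((c t + s * \<mu> t) * tau p t) = h t s * (c t + s * \<mu> t) * tau p t ^ Suc (Suc a) * nu p t ^ b"
        by (simp add: H_def)
      then have A: "H t * ((c t + s * \<mu> t) * tau p t) = g t s * tau p t ^ Suc (Suc a) * nu p t ^ b" unfolding hg .
      have B: "of_real (H t) * ((- (R * z)) *\<^sub>R (\<i> * E t)) = - (\<i> * R * (of_real (H t * z) * E t))" for z
        by (simp add: scaleR_conv_of_real)
      have "of_real (H t) * ((- (R * ((c t + s * \<mu> t) * tau p t))) *\<^sub>R (\<i> * E t)) =
         - (\<i> * R * (of_real (g t s * tau p t ^ Suc (Suc a) * nu p t ^ b) * E t))"
        unfolding B A ..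
      with d show ?thesis by (simp only: uminus_add_conv_diff)
    qed
    then have "((\<lambda>t. of_real (H' t) * E t - \<i> * R * (of_real (g t s * tau p t ^ Suc (Suc a) * nu p t ^ b) * E t)) has_integral
       (of_real (H 1) * E 1 - of_real (H 0) * E 0)) {0..1}"
      by (rule fundamental_theorem_of_calculus[OF zero_le_one has_vector_derivative_at_within])
    moreover have "H 1 = H 0" "E 1 = E 0"
    proof -
      have "h (0 + 1) s = h 0 s" using nice_0[OF h] by (simp only: nice.simps)
      moreover have "tau p (0 + 1) = tau p 0" "nu p (0 + 1) = nu p 0" unfolding tau_def nu_def by (simp_all only: periodic_frame)
      moreover have "x (0 + 1) = x 0" "y (0 + 1) = y 0" by (simp_all only: periodic_frame)
      ultimately show "H 1 = H 0" "E 1 = E 0" unfolding H_def E_def ph_def by simp_all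
    qed
    ultimately have i: "((\<lambda>t. of_real (H' t) * E t - \<i> * R * (of_real (g t s * tau p t ^ Suc (Suc a) * nu p t ^ b) * E t)) has_integral 0) {0..1}"
      by simp
    have I1: "((\<lambda>t. of_real (h' t s * tau p t ^ Suc a * nu p t ^ b) * E t + of_real (g2 t s * tau p t ^ a * nu p t ^ Suc b) * E t
       + of_real (g3 t s * tau p t ^ Suc (Suc a) * nu p t ^ (b - 1)) * E t - \<i> * R * (of_real (g t s * tau p t ^ Suc (Suc a) * nu p t ^ b) * E t))
       has_integral (wint R h' (Suc a) b s p + wint R g2 a (Suc b) s p + wint R g3 (Suc (Suc a)) (b - 1) s p - \<i> * R * wint R g (Suc (Suc a)) b s p)) {0..1}"
      unfolding wint_def E_def
      by (intro has_integral_add has_integral_diff has_integral_mult_right integrable_integral wint_integrable s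
          nice_0[OF h'(2)] nice_0[OF n2] nice_0[OF n3] nice_0[OF g])
    have I2: "(\<lambda>t. of_real (h' t s * tau p t ^ Suc a * nu p t ^ b) * E t + of_real (g2 t s * tau p t ^ a * nu p t ^ Suc b) * E t
       + of_real (g3 t s * tau p t ^ Suc (Suc a) * nu p t ^ (b - 1)) * E t - \<i> * R * (of_real (g t s * tau p t ^ Suc (Suc a) * nu p t ^ b) * E t))
       = (\<lambda>t. of_real (H' t) * E t - \<i> * R * (of_real (g t s * tau p t ^ Suc (Suc a) * nu p t ^ b) * E t))"
      by (simp add: H'_def distrib_right)
    have "wint R h' (Suc a) b s p + wint R g2 a (Suc b) s p + wint R g3 (Suc (Suc a)) (b - 1) s p - \<i> * R * wint R g (Suc (Suc a)) b s p = 0"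
      by (rule has_integral_unique[OF I1[unfolded I2] i])
    then have "\<i> * R * wint R g (Suc (Suc a)) b s p = wint R h' (Suc a) b s p + wint R g2 a (Suc b) s p + wint R g3 (Suc (Suc a)) (b - 1) s p"
      by simp
    then have "norm (\<i> * R * wint R g (Suc (Suc a)) b s p) = norm (wint R h' (Suc a) b s p + wint R g2 a (Suc b) s p + wint R g3 (Suc (Suc a)) (b - 1) s p)"
      by simp
    also have "\<dots> \<le> norm (wint R h' (Suc a) b s p) + norm (wint R g2 a (Suc b) s p) + norm (wint R g3 (Suc (Suc a)) (b - 1) s p)"
      by (intro order_trans[OF norm_triangle_ineq] add_right_mono norm_triangle_ineq)
    finally show "norm (wint R g (Suc (Suc a)) b s p) \<le>
      (norm (wint R h' (Suc a) b s p) + norm (wint R g2 a (Suc b) s p) + norm (wint R g3 (Suc (Suc a)) (b - 1) s p)) / R"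
      using R by (simp add: norm_mult pos_le_divide_eq mult.commute)
  qed
qed

text \<open>Iterated integration by parts, uniform in the direction: the amplitude vanishes at the
  stationary points, where \<open>tau\<close> is 0, to the order that the divisions consume.\<close>

lemma wint_decay:
  assumes "nice e M g" "2 * M \<le> a"
  shows "\<exists>C\<ge>0. \<forall>s\<in>{-e..e}. \<forall>R>0. \<forall>p. norm (wint R g a b s p) \<le> C / R ^ M"
  using assms
proof (induction M arbitrary: g a b)
  case 0 then show ?case using wint_trivial[of g a b] by auto
next
  case (Suc M)
  define a' where "a' = a - 2"
  have a': "a = Suc (Suc a')" "2 * M \<le> a'" using Suc.prems(2) by (auto simp: a'_def)
  obtain g1 g2 g3 where g: "nice e M g1" "nice e M g2" "nice e M g3"
    "\<And>s R p. s \<in> {-e..e} \<Longrightarrow> R > 0 \<Longrightarrow> norm (wint R g (Suc (Suc a')) b s p) \<le>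
      (norm (wint R g1 (Suc a') b s p) + norm (wint R g2 a' (Suc b) s p) + norm (wint R g3 (Suc (Suc a')) (b - 1) s p)) / R"
    by (rule wint_ibp[OF Suc.prems(1)]) blast
  obtain C1 where C1: "C1 \<ge> 0" "\<And>s R p. s \<in> {-e..e} \<Longrightarrow> R > 0 \<Longrightarrow> norm (wint R g1 (Suc a') b s p) \<le> C1 / R ^ M"
    using Suc.IH[OF g(1), of "Suc a'" b] a' by force
  obtain C2 where C2: "C2 \<ge> 0" "\<And>s R p. s \<in> {-e..e} \<Longrightarrow> R > 0 \<Longrightarrow> norm (wint R g2 a' (Suc b) s p) \<le> C2 / R ^ M"
    using Suc.IH[OF g(2), of a' "Suc b"] a' by force
  obtain C3 where C3: "C3 \<ge> 0" "\<And>s R p. s \<in> {-e..e} \<Longrightarrow> R > 0 \<Longrightarrow> norm (wint R g3 (Suc (Suc a')) (b - 1) s p) \<le> C3 / R ^ M"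
    using Suc.IH[OF g(3), of "Suc (Suc a')" "b - 1"] a' by force
  show ?case
  proof (intro exI[of _ "C1 + C2 + C3"] conjI ballI allI impI)
    show "0 \<le> C1 + C2 + C3" using C1 C2 C3 by simp
    fix s R p assume s: "s \<in> {-e..e}" and R: "(0::real) < R"
    have "norm (wint R g a b s p) \<le> (norm (wint R g1 (Suc a') b s p) + norm (wint R g2 a' (Suc b) s p) + norm (wint R g3 (Suc (Suc a')) (b - 1) s p)) / R"
      unfolding a'(1) by (rule g(4)[OF s R])
    also have "\<dots> \<le> (C1 / R ^ M + C2 / R ^ M + C3 / R ^ M) / R"
      using C1(2)[OF s R] C2(2)[OF s R] C3(2)[OF s R] R by (intro divide_right_mono add_mono) auto
    also have "\<dots> = (C1 + C2 + C3) / R ^ Suc M" by (simp add: add_divide_distrib mult.commute)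
    finally show "norm (wint R g a b s p) \<le> (C1 + C2 + C3) / R ^ Suc M" .
  qed
qed

text \<open>For the averaged bound the powers of \<open>tau\<close> and \<open>nu\<close> are
  harmless: one factor at a time is expanded as cos p T1 + sin p T2 (or with n1, n2). The
  trigonometric coefficients leave the integral and are at most 1, while the frame components join
  the amplitude.\<close>

lemma wint_L2:
  assumes "nice e 1 (\<lambda>t s. g t)"
  shows "\<exists>C\<ge>0. \<forall>s\<in>{-e..e}. \<forall>R\<ge>1. integral {0..2*pi} (\<lambda>p. (norm (wint R (\<lambda>t s. g t) a b s p))\<^sup>2) \<le> C / R"
  using assms
proof (induction "a + b" arbitrary: a b g)
  case 0
  have "wint R (\<lambda>t s. g t) 0 0 s p = par R g s p" for R s p
    unfolding wint_def par_def osc_def ph_def nu_def by (simp add: algebra_simps)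
  then show ?case using par_L2_bound[OF 0(2)] 0(1) by simp
next
  case (Suc m)
  have step: "\<exists>C\<ge>0. \<forall>s\<in>{-e..e}. \<forall>R\<ge>1. integral {0..2*pi} (\<lambda>p. (norm (wint R (\<lambda>t s. g t) a b s p))\<^sup>2) \<le> C / R"
    if u: "\<And>k. nice e k (\<lambda>t s. u t)" and v: "\<And>k. nice e k (\<lambda>t s. v t)" and m: "m = a' + b'"
      and eq: "\<And>R s p. s \<in> {-e..e} \<Longrightarrow> wint R (\<lambda>t s. g t) a b s p =
         of_real (cos p) * wint R (\<lambda>t s. g t * u t) a' b' s p + of_real (sin p) * wint R (\<lambda>t s. g t * v t) a' b' s p" for u v a' b'
  proof -
    have gu: "nice e 1 (\<lambda>t s. g t * u t)" and gv: "nice e 1 (\<lambda>t s. g t * v t)"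
      by (intro nice_mult Suc.prems u v)+
    obtain C where C: "C \<ge> 0" "\<And>s R. s\<in>{-e..e} \<Longrightarrow> R\<ge>1 \<Longrightarrow> integral {0..2*pi} (\<lambda>p. (norm (wint R (\<lambda>t s. g t * u t) a' b' s p))\<^sup>2) \<le> C / R"
      using Suc.hyps(1)[OF m gu] by blast
    obtain D where D: "D \<ge> 0" "\<And>s R. s\<in>{-e..e} \<Longrightarrow> R\<ge>1 \<Longrightarrow> integral {0..2*pi} (\<lambda>p. (norm (wint R (\<lambda>t s. g t * v t) a' b' s p))\<^sup>2) \<le> D / R"
      using Suc.hyps(1)[OF m gv] by blast
    show ?thesis
    proof (intro exI[of _ "2 * C + 2 * D"] conjI ballI allI impI)
      show "0 \<le> 2 * C + 2 * D" using C D by simp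
      fix s R assume s: "s \<in> {-e..e}" and R: "(1::real) \<le> R"
      have [continuous_intros]: "continuous_on {0..2*pi} (wint R (\<lambda>t s. g t * u t) a' b' s)" "continuous_on {0..2*pi} (wint R (\<lambda>t s. g t * v t) a' b' s)"
        "continuous_on {0..2*pi} (wint R (\<lambda>t s. g t) a b s)"
        using wint_continuous[OF nice_0[OF gu], of _ "\<lambda>p. p" "\<lambda>_. s"] wint_continuous[OF nice_0[OF gv], of _ "\<lambda>p. p" "\<lambda>_. s"]
          wint_continuous[OF nice_0[OF Suc.prems], of _ "\<lambda>p. p" "\<lambda>_. s"] s by (auto simp: image_subset_iff)
      have "integral {0..2*pi} (\<lambda>p. (norm (wint R (\<lambda>t s. g t) a b s p))\<^sup>2)
        \<le> integral {0..2*pi} (\<lambda>p. 2 * (norm (wint R (\<lambda>t s. g t * u t) a' b' s p))\<^sup>2 + 2 * (norm (wint R (\<lambda>t s. g t * v t) a' b' s p))\<^sup>2)"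
      proof (intro integral_le integrable_continuous_interval continuous_intros)
        fix p
        have "(norm (of_real (cos p) * z :: complex))\<^sup>2 \<le> (norm z)\<^sup>2" "(norm (of_real (sin p) * z :: complex))\<^sup>2 \<le> (norm z)\<^sup>2" for z
          unfolding norm_mult norm_of_real by (intro power_mono mult_left_le_one_le; simp)+
        then show "(norm (wint R (\<lambda>t s. g t) a b s p))\<^sup>2 \<le> 2 * (norm (wint R (\<lambda>t s. g t * u t) a' b' s p))\<^sup>2 + 2 * (norm (wint R (\<lambda>t s. g t * v t) a' b' s p))\<^sup>2"
          unfolding eq[OF s] by (intro order_trans[OF norm_sum_square_le] add_mono mult_left_mono) auto
      qed
      also have "\<dots> = 2 * integral {0..2*pi} (\<lambda>p. (norm (wint R (\<lambda>t s. g t * u t) a' b' s p))\<^sup>2) + 2 * integral {0..2*pi} (\<lambda>p. (norm (wint R (\<lambda>t s. g t * v t) a' b' s p))\<^sup>2)"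
        by (subst Henstock_Kurzweil_Integration.integral_add)
          (auto intro!: integrable_continuous_interval continuous_intros)
      also have "\<dots> \<le> 2 * (C / R) + 2 * (D / R)" using C(2)[OF s R] D(2)[OF s R] by simp
      finally show "integral {0..2*pi} (\<lambda>p. (norm (wint R (\<lambda>t s. g t) a b s p))\<^sup>2) \<le> (2 * C + 2 * D) / R"
        by (simp add: add_divide_distrib)
    qed
  qed
  have comb: "of_real (cos p) * wint R (\<lambda>t s. g t * u t) a' b' s p + of_real (sin p) * wint R (\<lambda>t s. g t * v t) a' b' s p
     = integral {0..1} (\<lambda>t. of_real (g t * (cos p * u t + sin p * v t) * tau p t ^ a' * nu p t ^ b') * cis (- (R * ph s p t)))"
    if "\<And>k. nice e k (\<lambda>t s. u t)" "\<And>k. nice e k (\<lambda>t s. v t)" "s \<in> {-e..e}" for R s p u v a' b'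
  proof -
    have n: "nice e 0 (\<lambda>t s. g t * u t)" "nice e 0 (\<lambda>t s. g t * v t)"
      by (intro nice_mult nice_0[OF Suc.prems] that)+
    have i1: "(\<lambda>t. of_real (cos p) * (of_real (g t * u t * tau p t ^ a' * nu p t ^ b') * cis (- (R * ph s p t)))) integrable_on {0..1}"
      by (rule integrable_on_mult_right, rule wint_integrable[OF n(1) that(3)])
    have i2: "(\<lambda>t. of_real (sin p) * (of_real (g t * v t * tau p t ^ a' * nu p t ^ b') * cis (- (R * ph s p t)))) integrable_on {0..1}"
      by (rule integrable_on_mult_right, rule wint_integrable[OF n(2) that(3)])
    show ?thesis unfolding wint_def integral_mult_right[symmetric]
        Henstock_Kurzweil_Integration.integral_add[OF i1 i2, symmetric]
      by (rule integral_cong) (simp add: algebra_simps)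
  qed
  show ?case
  proof (cases a)
    case 0
    then obtain b' where b': "b = Suc b'" using Suc.hyps(2) by (cases b) auto
    show ?thesis
    proof (rule step[where u = n1 and v = n2 and a' = 0 and b' = b'])
      show "m = 0 + b'" using Suc.hyps(2) 0 b' by simp
      show "wint R (\<lambda>t s. g t) a b s p = of_real (cos p) * wint R (\<lambda>t s. g t * n1 t) 0 b' s p + of_real (sin p) * wint R (\<lambda>t s. g t * n2 t) 0 b' s p"
        if "s \<in> {-e..e}" for R s p
        unfolding comb[OF nice_frame(7,8) that] unfolding wint_def 0 b' by (simp add: nu_def mult.assoc)
    qed (rule nice_frame)+
  next
    case (Suc a')
    show ?thesis
    proof (rule step[where u = T1 and v = T2 and a' = a' and b' = b])
      show "m = a' + b" using Suc.hyps(2) Suc \<open>Suc m = a + b\<close> by simp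
      show "wint R (\<lambda>t s. g t) a b s p = of_real (cos p) * wint R (\<lambda>t s. g t * T1 t) a' b s p + of_real (sin p) * wint R (\<lambda>t s. g t * T2 t) a' b s p"
        if "s \<in> {-e..e}" for R s p
        unfolding comb[OF nice_frame(5,6) that] unfolding wint_def Suc by (simp add: tau_def mult.assoc)
    qed (rule nice_frame)+
  qed
qed

end

section \<open>Fourier transform of the weight profile\<close>

definition ft :: "(real \<Rightarrow> real) \<Rightarrow> real \<Rightarrow> real \<Rightarrow> real \<Rightarrow> complex" where
  "ft g a b u = integral {a..b} (\<lambda>s. of_real (g s) * cis (- (u * s)))"

lemma cis_linear_deriv: "((\<lambda>s. cis (- (u * s))) has_vector_derivative - (\<i> * of_real u * cis (- (u * s)))) (at s within S)"
  unfolding has_vector_derivative_def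
  by (rule has_derivative_eq_rhs, rule has_derivative_cis)
    (auto intro!: derivative_eq_intros simp: scaleR_conv_of_real algebra_simps)

text \<open>A finite exceptional set is allowed, since the last derivative of a profile may fail to
  exist at breakpoints; continuity of G across them keeps the formula free of jump terms.\<close>

lemma ft_ibp:
  assumes ab: "a \<le> b" and B: "finite B" and cG: "continuous_on {a..b} G"
    and d: "\<And>s. s \<in> {a<..<b} - B \<Longrightarrow> (G has_real_derivative g s) (at s)"
  shows "((\<lambda>s. of_real (g s) * cis (- (u * s))) has_integral
      (\<i> * of_real u * ft G a b u + of_real (G b) * cis (- (u * b)) - of_real (G a) * cis (- (u * a)))) {a..b}"
proof -
  have "((\<lambda>s. of_real (G s) * (- (\<i> * of_real u * cis (- (u * s)))) + of_real (g s) * cis (- (u * s))) has_integral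
     (of_real (G b) * cis (- (u * b)) - of_real (G a) * cis (- (u * a)))) {a..b}"
  proof (rule fundamental_theorem_of_calculus_interior_strong[OF B ab])
    fix s assume "s \<in> {a<..<b} - B"
    then show "((\<lambda>s. of_real (G s) * cis (- (u * s))) has_vector_derivative
       of_real (G s) * (- (\<i> * of_real u * cis (- (u * s)))) + of_real (g s) * cis (- (u * s))) (at s)"
      by (intro has_vector_derivative_mult has_vector_derivative_of_real d cis_linear_deriv)
  next
    show "continuous_on {a..b} (\<lambda>s. of_real (G s) * cis (- (u * s)))"
      by (intro continuous_intros cG)
  qed
  moreover have "((\<lambda>s. \<i> * of_real u * (of_real (G s) * cis (- (u * s)))) has_integral (\<i> * of_real u * ft G a b u)) {a..b}"
    unfolding ft_def
    by (intro has_integral_mult_right integrable_integral integrable_continuous_interval continuous_intros cG)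
  ultimately have "((\<lambda>s. (of_real (G s) * (- (\<i> * of_real u * cis (- (u * s)))) + of_real (g s) * cis (- (u * s)))
      + \<i> * of_real u * (of_real (G s) * cis (- (u * s)))) has_integral
      (of_real (G b) * cis (- (u * b)) - of_real (G a) * cis (- (u * a))) + \<i> * of_real u * ft G a b u) {a..b}"
    by (rule has_integral_add)
  moreover have "(\<lambda>s. (of_real (G s) * (- (\<i> * of_real u * cis (- (u * s)))) + of_real (g s) * cis (- (u * s)))
      + \<i> * of_real u * (of_real (G s) * cis (- (u * s)))) = (\<lambda>s. of_real (g s) * cis (- (u * s)))"
    by (simp add: algebra_simps)
  ultimately show ?thesis by (simp add: algebra_simps)
qed

text \<open>Multiplication by i u is differentiation, and the derivative of a piecewise C1 function
  on an interval is a piecewise continuous density plus atoms at jumps and end points. The induction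
  splits the interval at an interior breakpoint; the values at the breakpoints themselves do not
  affect the integrals.\<close>

lemma piecewise_C1_FM:
  assumes "piecewise_C1 g" "-1 \<le> a" "a \<le> b" "b \<le> 1"
  shows "(\<forall>u. (\<lambda>s. of_real (g s) * cis (- (u * s))) integrable_on {a..b}) \<and> FM (ft g a b) \<and>
    (\<exists>w. FM w \<and> (\<forall>u. \<i> * of_real u * ft g a b u = w u))"
proof -
  obtain B where B: "finite B"
    "\<And>a b. a < b \<Longrightarrow> {a<..<b} \<inter> B = {} \<Longrightarrow> \<exists>G. Ck_on 1 {a..b} G \<and> (\<forall>x\<in>{a<..<b}. G x = g x)"
    using assms(1) unfolding piecewise_C1_def by blast
  show ?thesis using assms(2-)
  proof (induction "card ({a<..<b} \<inter> B)" arbitrary: a b rule: less_induct)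
    case less
    show ?case
    proof (cases "{a<..<b} \<inter> B = {}")
      case ne: True
      show ?thesis
      proof (cases "a = b")
        case True
        have "ft g a b = (\<lambda>u. 0)" unfolding ft_def True by simp
        moreover have "(\<lambda>s. of_real (g s) * cis (- (u * s))) integrable_on {a..b}" for u
          unfolding True by (rule integrable_on_refl[of _ b, unfolded box_real(2)])
        ultimately show ?thesis using FM.zero by auto
      next
        case False
        with less have "a < b" by simp
        obtain G where G: "Ck_on 1 {a..b} G" "\<And>x. x \<in> {a<..<b} \<Longrightarrow> G x = g x"
          using B(2)[OF \<open>a < b\<close> ne] by blast
        define G' where "G' t = vector_derivative G (at t within {a..b})" for t
        have dG: "(G has_vector_derivative G' t) (at t within {a..b})" if "t \<in> {a..b}" for t
          using G(1) that unfolding Ck_on_def nth_vderiv_def G'_def by (auto simp: vector_derivative_works)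
        have cG': "continuous_on {a..b} G'"
          using G(1) unfolding Ck_on_def nth_vderiv_def G'_def[abs_def] by simp
        have cG: "continuous_on {a..b} G"
          using dG by (meson continuous_on_eq_continuous_within has_vector_derivative_continuous)
        have dG2: "(G has_real_derivative G' s) (at s)" if "s \<in> {a<..<b} - {}" for s
          using dG[of s] that by (simp add: has_real_derivative_iff_has_vector_derivative at_within_Icc_at)
        have spike: "ft g a b u = ft G a b u" "(\<lambda>s. of_real (g s) * cis (- (u * s))) integrable_on {a..b}" for u
        proof -
          have eq: "of_real (G s) * cis (- (u * s)) = of_real (g s) * cis (- (u * s))" if "s \<in> {a..b} - {a, b}" for s
            using G(2)[of s] that by simp
          show "ft g a b u = ft G a b u"
            unfolding ft_def by (rule integral_spike[of "{a,b}"]) (use eq in auto)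
          have "(\<lambda>s. of_real (G s) * cis (- (u * s))) integrable_on {a..b}"
            by (intro integrable_continuous_interval continuous_intros cG)
          then show "(\<lambda>s. of_real (g s) * cis (- (u * s))) integrable_on {a..b}"
            by (rule integrable_spike[where S = "{a,b}"]) (use eq in auto)
        qed
        have ibp: "ft G' a b u = \<i> * of_real u * ft G a b u + of_real (G b) * cis (- (u * b)) - of_real (G a) * cis (- (u * a))" for u
          using ft_ibp[OF less.prems(2) finite.emptyI cG dG2, of u] unfolding ft_def by (rule integral_unique)
        define w where "w u = (ft G' a b u + (- of_real (G b)) * cis (- (u * b))) + of_real (G a) * cis (- (u * a))" for u
        have "FM (ft G' a b)" "FM (ft G a b)" unfolding ft_def[abs_def] using less.prems cG cG' by (auto intro!: FM_density1)
        then have "FM w" unfolding w_def[abs_def] using less.prems by (intro FM.atom) auto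
        moreover have "\<forall>u. \<i> * of_real u * ft g a b u = w u" by (simp add: w_def ibp spike)
        moreover have "ft g a b = ft G a b" using spike(1) by blast
        ultimately show ?thesis using spike(2) \<open>FM (ft G a b)\<close> by auto
      qed
    next
      case False
      then obtain m where "m \<in> {a<..<b} \<inter> B" by blast
      then have m: "m \<in> B" "a < m" "m < b" by auto
      have "card ({a<..<m} \<inter> B) < card ({a<..<b} \<inter> B)" "card ({m<..<b} \<inter> B) < card ({a<..<b} \<inter> B)"
        using m B(1) by (intro psubset_card_mono; auto)+
      then have I: "(\<forall>u. (\<lambda>s. of_real (g s) * cis (- (u * s))) integrable_on {a..m}) \<and> FM (ft g a m) \<and>
          (\<exists>w. FM w \<and> (\<forall>u. \<i> * of_real u * ft g a m u = w u))"
        "(\<forall>u. (\<lambda>s. of_real (g s) * cis (- (u * s))) integrable_on {m..b}) \<and> FM (ft g m b) \<and>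
          (\<exists>w. FM w \<and> (\<forall>u. \<i> * of_real u * ft g m b u = w u))"
        using less.hyps[of a m] less.hyps[of m b] less.prems m by auto
      then obtain w1 w2 where w: "FM w1" "\<forall>u. \<i> * of_real u * ft g a m u = w1 u" "FM w2" "\<forall>u. \<i> * of_real u * ft g m b u = w2 u"
        by blast
      have int: "(\<lambda>s. of_real (g s) * cis (- (u * s))) integrable_on {a..b}" for u
        using I m by (intro Henstock_Kurzweil_Integration.integrable_combine[of a m b]) auto
      have eq: "ft g a b = (\<lambda>u. ft g a m u + ft g m b u)"
        unfolding ft_def using m int by (auto intro!: ext Henstock_Kurzweil_Integration.integral_combine[symmetric])
      have "\<forall>u. \<i> * of_real u * ft g a b u = w1 u + w2 u" using w by (simp add: eq algebra_simps)
      moreover have "FM (\<lambda>u. w1 u + w2 u)" using w FM_add by blast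
      moreover have "FM (ft g a b)" unfolding eq using I FM_add by blast
      ultimately show ?thesis using int by auto
    qed
  qed
qed

lemma profile_vanishes:
  assumes "weight_profile q \<theta>" "s \<notin> {-1..1}"
  shows "\<theta> s = 0"
proof -
  have "closure {s. \<theta> s \<noteq> 0} = {-1..1}" using assms(1) by (simp add: weight_profile_def)
  then have "{s. \<theta> s \<noteq> 0} \<subseteq> {-1..1}" using closure_subset by metis
  then show ?thesis using assms(2) by blast
qed

lemma nth_vderiv_simps: "nth_vderiv 0 S f = f" "nth_vderiv (Suc k) S f t = vector_derivative (nth_vderiv k S f) (at t within S)"
  by (simp_all add: nth_vderiv_def)

lemma nth_vderiv_vanishes:
  fixes \<theta> :: "real \<Rightarrow> real"
  assumes "\<And>s. s \<notin> {-1..1} \<Longrightarrow> \<theta> s = 0" "s \<notin> {-1..1}"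
  shows "nth_vderiv j UNIV \<theta> s = 0"
  using assms(2)
proof (induction j arbitrary: s)
  case 0 then show ?case using assms(1) by (simp add: nth_vderiv_simps)
next
  case (Suc j)
  have "(nth_vderiv j UNIV \<theta> has_vector_derivative 0) (at s)"
  proof (rule has_vector_derivative_transform_within_open[of "\<lambda>_. 0"])
    show "open (- {-1..1::real})" by (simp add: open_Compl)
    show "s \<in> - {-1..1}" using Suc.prems by simp
    show "0 = nth_vderiv j UNIV \<theta> t" if "t \<in> - {-1..1}" for t using Suc.IH[of t] that by simp
  qed simp
  then show ?case by (simp add: nth_vderiv_simps vector_derivative_at)
qed

text \<open>Applied to the derivatives of the profile below order q: continuity across the ends of
  the support kills the boundary terms, so that atoms arise only in the last integration by
  parts.\<close>

lemma continuous_vanishes_at_ends: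
  fixes f :: "real \<Rightarrow> real"
  assumes "continuous_on UNIV f" "\<And>s. s \<notin> {-1..1} \<Longrightarrow> f s = 0"
  shows "f 1 = 0" "f (-1) = 0"
proof -
  have "closed {s. f s = 0}" using assms(1) by (intro closed_Collect_eq continuous_on_const)
  moreover have "- {-1..1} \<subseteq> {s. f s = 0}" using assms(2) by auto
  ultimately have "closure (- {-1..1}) \<subseteq> {s. f s = 0}" by (rule closure_minimal[rotated])
  moreover have "closure (- {-1..1::real}) = - {-1<..<1}"
    by (simp add: closure_complement)
  ultimately show "f 1 = 0" "f (-1) = 0" by auto
qed

text \<open>The first q integrations by parts leave no boundary terms and lead to the q-th
  derivative. That one is piecewise C1 and admits one more, with atoms at its jumps; this is the
  origin of q + 1.\<close>

lemma profile_FM: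
  assumes w: "weight_profile q \<theta>"
  shows "(\<forall>u. (\<lambda>s. of_real (\<theta> s) * cis (- (u * s))) integrable_on {-1..1})" "FM (ft \<theta> (-1) 1)"
    "\<exists>w. FM w \<and> (\<forall>u. (\<i> * of_real u) ^ (q + 1) * ft \<theta> (-1) 1 u = w u)"
proof -
  have "(\<forall>u. (\<lambda>s. of_real (\<theta> s) * cis (- (u * s))) integrable_on {-1..1}) \<and> FM (ft \<theta> (-1) 1) \<and>
    (\<exists>w. FM w \<and> (\<forall>u. (\<i> * of_real u) ^ (q + 1) * ft \<theta> (-1) 1 u = w u))"
  proof (cases "q = 0")
    case True
    then have "piecewise_C1 \<theta>" using w by (simp add: weight_profile_def)
    from piecewise_C1_FM[OF this, of "-1" 1] True show ?thesis by simp
  next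
    case False
    define D where "D j = nth_vderiv j UNIV \<theta>" for j
    obtain B g where ck: "Ck_on (q - 1) UNIV \<theta>" and B: "finite B"
      and dB: "\<And>s. s \<notin> B \<Longrightarrow> (D (q - 1) has_real_derivative g s) (at s)" and g: "piecewise_C1 g"
      using w False unfolding weight_profile_def D_def by auto
    have dD: "(D j has_real_derivative D (Suc j) s) (at s)" if "j < q - 1" for j s
      using ck that unfolding Ck_on_def D_def
      by (simp add: nth_vderiv_simps has_real_derivative_iff_has_vector_derivative vector_derivative_works)
    have cD: "continuous_on UNIV (D j)" if "j \<le> q - 1" for j
    proof (cases "j = q - 1")
      case True then show ?thesis using ck unfolding Ck_on_def D_def by simp
    next
      case False
      then have "j < q - 1" using that by simp
      then show ?thesis using dD by (meson DERIV_continuous_on has_field_derivative_at_within)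
    qed
    have z: "D j s = 0" if "s \<notin> {-1..1}" for j s
      unfolding D_def by (rule nth_vderiv_vanishes[OF profile_vanishes[OF w] that])
    have ends: "D j 1 = 0" "D j (-1) = 0" if "j \<le> q - 1" for j
      using continuous_vanishes_at_ends[OF cD[OF that] z] by auto
    have hat: "ft (D j) (-1) 1 u = (\<i> * of_real u) ^ j * ft \<theta> (-1) 1 u" if "j \<le> q - 1" for j u
      using that
    proof (induction j)
      case 0 show ?case by (simp add: D_def nth_vderiv_simps)
    next
      case (Suc j)
      have "((\<lambda>s. of_real (D (Suc j) s) * cis (- (u * s))) has_integral
        (\<i> * of_real u * ft (D j) (-1) 1 u + of_real (D j 1) * cis (- (u * 1)) - of_real (D j (-1)) * cis (- (u * (-1))))) {-1..1}"
        using Suc.prems by (intro ft_ibp[of _ _ "{}"] continuous_on_subset[OF cD] dD) auto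
      then have "ft (D (Suc j)) (-1) 1 u = \<i> * of_real u * ft (D j) (-1) 1 u"
        unfolding ft_def using ends[of j] Suc.prems by (simp add: integral_unique)
      then show ?case using Suc by simp
    qed
    have gi: "((\<lambda>s. of_real (g s) * cis (- (u * s))) has_integral
        (\<i> * of_real u * ft (D (q - 1)) (-1) 1 u + of_real (D (q - 1) 1) * cis (- (u * 1)) - of_real (D (q - 1) (-1)) * cis (- (u * (-1))))) {-1..1}" for u
      using dB by (intro ft_ibp[OF _ B] continuous_on_subset[OF cD]) auto
    have gq: "ft g (-1) 1 u = (\<i> * of_real u) ^ q * ft \<theta> (-1) 1 u" for u
      unfolding ft_def[of g] integral_unique[OF gi] using ends[of "q - 1"] hat[of "q - 1" u] False
      by (simp add: power_eq_if[of _ q])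
    obtain w where "FM w" "\<And>u. \<i> * of_real u * ft g (-1) 1 u = w u"
      using piecewise_C1_FM[OF g, of "-1" 1] by auto
    moreover have c\<theta>: "continuous_on {-1..1} \<theta>"
      using cD[of 0] by (auto simp: D_def nth_vderiv_simps intro: continuous_on_subset)
    moreover have "FM (ft \<theta> (-1) 1)" unfolding ft_def[abs_def] by (intro FM_density1 c\<theta>) auto
    moreover have "(\<lambda>s. of_real (\<theta> s) * cis (- (u * s))) integrable_on {-1..1}" for u
      by (intro integrable_continuous_interval continuous_intros c\<theta>)
    ultimately show ?thesis by (auto simp: gq mult.assoc intro!: exI[of _ w])
  qed
  then show "(\<forall>u. (\<lambda>s. of_real (\<theta> s) * cis (- (u * s))) integrable_on {-1..1})" "FM (ft \<theta> (-1) 1)"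
    "\<exists>w. FM w \<and> (\<forall>u. (\<i> * of_real u) ^ (q + 1) * ft \<theta> (-1) 1 u = w u)" by auto
qed

section \<open>Transform of the whole tube\<close>

lemma phase_rearrange: "v * (z * w) * w' = z * (v * (w * w'))" for v w w' z :: complex
  by simp

lemma phase_rearrange2:
  "n * w = c * (n' * v) \<Longrightarrow> f * t * n * w * z = c * (f * t * n' * v * z)" for n w c n' v f t z :: complex
proof -
  assume "n * w = c * (n' * v)"
  moreover have "f * t * n * w * z = f * t * z * (n * w)" by (simp add: mult_ac)
  ultimately show ?thesis by (simp add: mult_ac)
qed

context curve_frame
begin

text \<open>What remains of the transform of the tube after integration across it, if w is the
  transform of the profile. With w as a parameter, the profile can be exchanged for its multiple by
  a power of i u without leaving the framework.\<close>

definition osw :: "(real \<Rightarrow> complex) \<Rightarrow> (real \<Rightarrow> real) \<Rightarrow> nat \<Rightarrow> nat \<Rightarrow> real \<Rightarrow> real \<Rightarrow> real \<Rightarrow> complex" where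
  "osw w g a b R \<epsilon> p = integral {0..1} (\<lambda>t. of_real (g t * tau p t ^ a * nu p t ^ b) * w (\<epsilon> * R * nu p t) * cis (- (R * ph 0 p t)))"

lemma osw_integrand_continuous:
  fixes f1 f2 :: "'z::t2_space \<Rightarrow> real"
  assumes "nice e 0 (\<lambda>t s. g t)" "continuous_on UNIV w" "continuous_on S f1" "continuous_on S f2"
  shows "continuous_on S (\<lambda>z. of_real (g (f1 z) * tau (f2 z) (f1 z) ^ a * nu (f2 z) (f1 z) ^ b) * w (\<epsilon> * R * nu (f2 z) (f1 z)) * cis (- (R * ph 0 (f2 z) (f1 z))))"
proof -
  have e0: "0 \<in> {-e..e}" using e by simp
  have "continuous_on S (\<lambda>z. g (f1 z))"
    by (rule continuous_on_compose2[OF nice_continuous[OF assms(1) e0] assms(3)]) auto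
  moreover have "continuous_on S (\<lambda>z. w (\<epsilon> * R * nu (f2 z) (f1 z)))"
    by (rule continuous_on_compose2[OF assms(2)]) (intro continuous_intros assms, simp)
  ultimately show ?thesis by (intro continuous_intros assms)
qed

lemma osw_integrable:
  assumes "nice e 0 (\<lambda>t s. g t)" "continuous_on UNIV w"
  shows "(\<lambda>t. of_real (g t * tau p t ^ a * nu p t ^ b) * w (\<epsilon> * R * nu p t) * cis (- (R * ph 0 p t))) integrable_on {0..1}"
  by (intro integrable_continuous_interval osw_integrand_continuous[OF assms, of _ "\<lambda>t. t" "\<lambda>_. p"] continuous_intros)

lemma osw_continuous:
  assumes "nice e 0 (\<lambda>t s. g t)" "continuous_on UNIV w"
  shows "continuous_on S (osw w g a b R \<epsilon>)"
proof -
  have "continuous_on S (\<lambda>p. integral (cbox 0 1) (\<lambda>t. of_real (g t * tau p t ^ a * nu p t ^ b) * w (\<epsilon> * R * nu p t) * cis (- (R * ph 0 p t))))"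
  proof (rule integral_continuous_on_param)
    show "continuous_on (S \<times> cbox 0 1) (\<lambda>(p, t). of_real (g t * tau p t ^ a * nu p t ^ b) * w (\<epsilon> * R * nu p t) * cis (- (R * ph 0 p t)))"
      unfolding split_beta by (intro osw_integrand_continuous[OF assms] continuous_intros)
  qed
  then show ?thesis by (simp add: osw_def[abs_def])
qed

lemma osw_add:
  assumes "nice e 0 (\<lambda>t s. g t)" "continuous_on UNIV w" "continuous_on UNIV v"
  shows "osw (\<lambda>u. w u + v u) g a b R \<epsilon> p = osw w g a b R \<epsilon> p + osw v g a b R \<epsilon> p"
  unfolding osw_def
  by (subst Henstock_Kurzweil_Integration.integral_add[symmetric, OF osw_integrable[OF assms(1,2)] osw_integrable[OF assms(1,3)]])
    (simp add: algebra_simps)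

text \<open>An atom at b' concentrates the tube on the parallel curve at distance \<epsilon> b',
  because the phase is affine in s with slope \<open>nu\<close>.\<close>

lemma osw_atom:
  "osw (\<lambda>u. z * cis (- (u * b'))) g a b R \<epsilon> p = z * wint R (\<lambda>t s. g t) a b (\<epsilon> * b') p"
proof -
  have "cis (- (\<epsilon> * R * nu p t * b')) * cis (- (R * ph 0 p t)) = cis (- (R * ph (\<epsilon> * b') p t))" for t
    by (simp add: cis_mult ph_def algebra_simps)
  then show ?thesis unfolding osw_def wint_def phase_rearrange by simp
qed

text \<open>By exchange of integrals a density is a superposition of parallel curves.\<close>

lemma osw_density:
  assumes g: "nice e 0 (\<lambda>t s. g t)" and G: "continuous_on {a'..b'} G"
  shows "osw (\<lambda>u. integral {a'..b'} (\<lambda>s. of_real (G s) * cis (- (u * s)))) g a b R \<epsilon> p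
    = integral {a'..b'} (\<lambda>s. of_real (G s) * wint R (\<lambda>t s. g t) a b (\<epsilon> * s) p)"
proof -
  define k where "k t s = of_real (G s) * (of_real (g t * tau p t ^ a * nu p t ^ b) * cis (- (R * ph (\<epsilon> * s) p t)))" for t s
  have e0: "0 \<in> {-e..e}" using e by simp
  have "cis (- (\<epsilon> * R * nu p t * s)) * cis (- (R * ph 0 p t)) = cis (- (R * ph (\<epsilon> * s) p t))" for t s
    by (simp add: cis_mult ph_def algebra_simps)
  then have 1: "of_real (g t * tau p t ^ a * nu p t ^ b) * (of_real (G s) * cis (- (\<epsilon> * R * nu p t * s))) * cis (- (R * ph 0 p t)) = k t s" for t s
    unfolding k_def phase_rearrange by simp
  have "osw (\<lambda>u. integral {a'..b'} (\<lambda>s. of_real (G s) * cis (- (u * s)))) g a b R \<epsilon> p = integral {0..1} (\<lambda>t. integral {a'..b'} (k t))"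
    unfolding osw_def 1[symmetric] by simp
  also have "\<dots> = integral {a'..b'} (\<lambda>s. integral {0..1} (\<lambda>t. k t s))"
  proof -
    have [continuous_intros]: "continuous_on ({0..1} \<times> {a'..b'}) (\<lambda>z. G (snd z))"
      by (rule continuous_on_compose2[OF G]) (auto intro!: continuous_intros)
    have [continuous_intros]: "continuous_on ({0..1} \<times> {a'..b'}) (\<lambda>z. g (fst z))"
      by (rule continuous_on_compose2[OF nice_continuous[OF g e0]]) (auto intro!: continuous_intros)
    have "continuous_on (cbox (0, a') (1, b')) (\<lambda>(t, s). k t s)"
      unfolding k_def split_beta cbox_Pair_eq by (simp, intro continuous_intros)
    from integral_swap_continuous[OF this] show ?thesis by simp
  qed
  finally show ?thesis unfolding k_def wint_def by simp
qed

text \<open>Measures in \<open>FM\<close> live on [-1, 1], so for \<epsilon> <= e only parallel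
  curves at distance at most e occur, and these share one constant. Linearity in w reduces the claim
  to a single atom or density.\<close>

lemma osw_L2:
  assumes "FM w" and g: "nice e 1 (\<lambda>t s. g t)"
  shows "L2O e (\<lambda>R \<epsilon>. 1 / R) (osw w g a b)"
  using assms(1)
proof (induction rule: FM.induct)
  case zero then show ?case unfolding osw_def[abs_def] by (simp add: L2O_zero)
next
  case (atom w b' z)
  obtain C where C: "C \<ge> 0" "\<And>s R. s\<in>{-e..e} \<Longrightarrow> R\<ge>1 \<Longrightarrow> integral {0..2*pi} (\<lambda>p. (norm (wint R (\<lambda>t s. g t) a b s p))\<^sup>2) \<le> C / R"
    using wint_L2[OF g, of a b] by blast
  have "L2O e (\<lambda>R \<epsilon>. 1 / R) (\<lambda>R \<epsilon> p. z * wint R (\<lambda>t s. g t) a b (\<epsilon> * b') p)"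
    unfolding L2O_def
  proof (intro exI[of _ "(norm z)\<^sup>2 * C"] conjI allI impI ballI)
    show "0 \<le> (norm z)\<^sup>2 * C" using C(1) by simp
    fix R \<epsilon> :: real assume R: "1 \<le> R" and \<epsilon>: "\<epsilon> \<in> {0<..e}"
    have s: "\<epsilon> * b' \<in> {-e..e}"
    proof -
      have "\<bar>\<epsilon> * b'\<bar> \<le> e * 1" unfolding abs_mult using \<epsilon> atom.hyps(2) by (intro mult_mono) auto
      then show ?thesis by auto
    qed
    show "continuous_on {0..2*pi} (\<lambda>p. z * wint R (\<lambda>t s. g t) a b (\<epsilon> * b') p)"
      by (intro continuous_intros wint_continuous[OF nice_0[OF g], of _ "\<lambda>p. p" "\<lambda>_. \<epsilon> * b'"]) (use s in auto)
    show "integral {0..2*pi} (\<lambda>p. (norm (z * wint R (\<lambda>t s. g t) a b (\<epsilon> * b') p))\<^sup>2) \<le> (norm z)\<^sup>2 * C * (1 / R)"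
      using mult_left_mono[OF C(2)[OF s R], of "(norm z)\<^sup>2"] by (simp add: norm_mult power_mult_distrib)
  qed
  from L2O_add[OF atom.IH this] show ?case
    unfolding osw_atom[symmetric]
      osw_add[OF nice_0[OF g] continuous_on_FM[OF atom.hyps(1)] continuous_on_FM[OF FM_atom1[OF atom.hyps(2)]], symmetric] .
next
  case (density w a' b' G)
  obtain C where C: "C \<ge> 0" "\<And>s R. s\<in>{-e..e} \<Longrightarrow> R\<ge>1 \<Longrightarrow> integral {0..2*pi} (\<lambda>p. (norm (wint R (\<lambda>t s. g t) a b s p))\<^sup>2) \<le> C / R"
    using wint_L2[OF g, of a b] by blast
  obtain K where K: "K \<ge> 0" "\<And>s. s \<in> {a'..b'} \<Longrightarrow> \<bar>G s\<bar> \<le> K"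
  proof -
    have "bounded (G ` {a'..b'})" by (intro compact_imp_bounded compact_continuous_image density.hyps) simp
    then obtain K where "K > 0" "\<forall>y\<in>G ` {a'..b'}. norm y \<le> K" unfolding bounded_pos by blast
    then show ?thesis by (intro that[of K]) auto
  qed
  have "L2O e (\<lambda>R \<epsilon>. 1 / R) (\<lambda>R \<epsilon> p. integral {a'..b'} (\<lambda>s. of_real (G s) * wint R (\<lambda>t s. g t) a b (\<epsilon> * s) p))"
    unfolding L2O_def
  \<comment> \<open>K bounds the density. The 4 consists of two factors 2, each bounding the length
    of an interval inside [-1, 1]: one from Cauchy-Schwarz in s, one from the integration in
    s.\<close>
  proof (intro exI[of _ "K\<^sup>2 * 4 * C"] conjI allI impI ballI)
    show "0 \<le> K\<^sup>2 * 4 * C" using C(1) by simp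
    fix R \<epsilon> :: real assume R: "1 \<le> R" and \<epsilon>: "\<epsilon> \<in> {0<..e}"
    define h where "h s p = wint R (\<lambda>t s. g t) a b (\<epsilon> * s) p" for s p
    have s: "\<epsilon> * s \<in> {-e..e}" if "s \<in> {a'..b'}" for s
    proof -
      have "\<bar>\<epsilon> * s\<bar> \<le> e * 1" unfolding abs_mult using \<epsilon> that density.hyps by (intro mult_mono) auto
      then show ?thesis by auto
    qed
    have ch: "continuous_on S (\<lambda>z. h (f z) (k z))" if "continuous_on S f" "continuous_on S k" "f ` S \<subseteq> {a'..b'}"
      for S :: "'z::t2_space set" and f k
      unfolding h_def using s that by (intro wint_continuous[OF nice_0[OF g]] continuous_intros) auto
    have cG: "continuous_on S (\<lambda>z. G (f z))" if "continuous_on S f" "f ` S \<subseteq> {a'..b'}" for S :: "'z::t2_space set" and f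
      by (rule continuous_on_compose2[OF density.hyps(5) that])
    have c1: "continuous_on S (\<lambda>p. integral {a'..b'} (\<lambda>s. of_real (G s) * h s p))" for S :: "real set"
    proof -
      have "continuous_on S (\<lambda>p. integral (cbox a' b') (\<lambda>s. of_real (G s) * h s p))"
        by (rule integral_continuous_on_param) (unfold split_beta, intro continuous_intros cG ch, auto)
      then show ?thesis by simp
    qed
    then show "continuous_on {0..2*pi} (\<lambda>p. integral {a'..b'} (\<lambda>s. of_real (G s) * wint R (\<lambda>t s. g t) a b (\<epsilon> * s) p))"
      by (simp add: h_def)
    have c2: "continuous_on S (\<lambda>p. integral {a'..b'} (\<lambda>s. (norm (h s p))\<^sup>2))" for S :: "real set"
    proof -
      have "continuous_on S (\<lambda>p. integral (cbox a' b') (\<lambda>s. (norm (h s p))\<^sup>2))"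
        by (rule integral_continuous_on_param) (unfold split_beta, intro continuous_intros ch, auto)
      then show ?thesis by simp
    qed
    have pw: "(norm (integral {a'..b'} (\<lambda>s. of_real (G s) * h s p)))\<^sup>2 \<le> K\<^sup>2 * 2 * integral {a'..b'} (\<lambda>s. (norm (h s p))\<^sup>2)" for p
    proof -
      have chp: "continuous_on {a'..b'} (\<lambda>s. norm (h s p))" by (intro continuous_intros ch) auto
      have "norm (integral {a'..b'} (\<lambda>s. of_real (G s) * h s p)) \<le> integral {a'..b'} (\<lambda>s. K * norm (h s p))"
      proof (rule integral_norm_bound_integral)
        show "(\<lambda>s. of_real (G s) * h s p) integrable_on {a'..b'}"
          by (intro integrable_continuous_interval continuous_intros ch density.hyps) auto
        show "(\<lambda>s. K * norm (h s p)) integrable_on {a'..b'}"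
          by (intro integrable_continuous_interval continuous_intros chp)
        show "norm (of_real (G s) * h s p) \<le> K * norm (h s p)" if "s \<in> {a'..b'}" for s
          using K(2)[OF that] by (simp add: norm_mult mult_right_mono)
      qed
      also have "\<dots> = K * integral {a'..b'} (\<lambda>s. norm (h s p))" by simp
      finally have "(norm (integral {a'..b'} (\<lambda>s. of_real (G s) * h s p)))\<^sup>2 \<le> (K * integral {a'..b'} (\<lambda>s. norm (h s p)))\<^sup>2"
        by (intro power_mono) auto
      also have "\<dots> = K\<^sup>2 * (integral {a'..b'} (\<lambda>s. norm (h s p)))\<^sup>2" by (simp add: power_mult_distrib)
      also have "\<dots> \<le> K\<^sup>2 * ((b' - a') * integral {a'..b'} (\<lambda>s. (norm (h s p))\<^sup>2))"
        by (intro mult_left_mono integral_square_le density.hyps chp) auto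
      also have "\<dots> \<le> K\<^sup>2 * (2 * integral {a'..b'} (\<lambda>s. (norm (h s p))\<^sup>2))"
        using density.hyps chp
        by (intro mult_left_mono mult_right_mono Henstock_Kurzweil_Integration.integral_nonneg integrable_continuous_interval continuous_intros ch) auto
      finally show ?thesis by simp
    qed
    have "integral {0..2*pi} (\<lambda>p. (norm (integral {a'..b'} (\<lambda>s. of_real (G s) * h s p)))\<^sup>2)
      \<le> integral {0..2*pi} (\<lambda>p. K\<^sup>2 * 2 * integral {a'..b'} (\<lambda>s. (norm (h s p))\<^sup>2))"
      by (intro integral_le integrable_continuous_interval continuous_intros c1 c2 pw)
    also have "\<dots> = K\<^sup>2 * 2 * integral {0..2*pi} (\<lambda>p. integral {a'..b'} (\<lambda>s. (norm (h s p))\<^sup>2))" by simp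
    also have "integral {0..2*pi} (\<lambda>p. integral {a'..b'} (\<lambda>s. (norm (h s p))\<^sup>2)) = integral {a'..b'} (\<lambda>s. integral {0..2*pi} (\<lambda>p. (norm (h s p))\<^sup>2))"
    proof -
      have "continuous_on (cbox (0, a') (2*pi, b')) (\<lambda>(p, s). (norm (h s p))\<^sup>2)"
        unfolding split_beta cbox_Pair_eq by (intro continuous_intros ch) auto
      from integral_swap_continuous[OF this] show ?thesis by simp
    qed
    also have "\<dots> \<le> C / R * (b' - a')"
    proof -
      have "norm (integral {a'..b'} (\<lambda>s. integral {0..2*pi} (\<lambda>p. (norm (h s p))\<^sup>2))) \<le> C / R * (b' - a')"
      proof (rule integral_bound[OF density.hyps(3)])
        have "continuous_on {a'..b'} (\<lambda>s. integral (cbox 0 (2*pi)) (\<lambda>p. (norm (h s p))\<^sup>2))"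
          by (rule integral_continuous_on_param) (unfold split_beta, intro continuous_intros ch, auto)
        then show "continuous_on {a'..b'} (\<lambda>s. integral {0..2*pi} (\<lambda>p. (norm (h s p))\<^sup>2))" by simp
        fix r assume r: "r \<in> {a'..b'}"
        have "0 \<le> integral {0..2*pi} (\<lambda>p. (norm (h r p))\<^sup>2)"
          using r by (intro Henstock_Kurzweil_Integration.integral_nonneg integrable_continuous_interval continuous_intros ch) auto
        then show "norm (integral {0..2*pi} (\<lambda>p. (norm (h r p))\<^sup>2)) \<le> C / R"
          using C(2)[OF s[OF r] R] by (simp add: h_def)
      qed
      then show ?thesis by simp
    qed
    also have "\<dots> \<le> C / R * 2" using C(1) R density.hyps by (intro mult_left_mono) auto
    finally have "integral {0..2*pi} (\<lambda>p. (norm (integral {a'..b'} (\<lambda>s. of_real (G s) * h s p)))\<^sup>2) \<le> K\<^sup>2 * 2 * (C / R * 2)"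
      by (simp add: mult_left_mono)
    then show "integral {0..2*pi} (\<lambda>p. (norm (integral {a'..b'} (\<lambda>s. of_real (G s) * wint R (\<lambda>t s. g t) a b (\<epsilon> * s) p)))\<^sup>2) \<le> K\<^sup>2 * 4 * C * (1 / R)"
      by (simp add: h_def mult_ac)
  qed
  from L2O_add[OF density.IH this] show ?case
    unfolding osw_density[OF nice_0[OF g] density.hyps(5), symmetric]
      osw_add[OF nice_0[OF g] continuous_on_FM[OF density.hyps(1)] continuous_density[OF density.hyps(5)], symmetric] .
qed

text \<open>The same superposition as in \<open>osw_L2\<close>, now for the pointwise bound of
  \<open>wint_decay\<close>.\<close>

lemma osw_decay:
  assumes "FM w" and g: "nice e M (\<lambda>t s. g t)" and a: "2 * M \<le> a"
  shows "\<exists>C\<ge>0. \<forall>R\<ge>1. \<forall>\<epsilon>\<in>{0<..e}. \<forall>p. norm (osw w g a b R \<epsilon> p) \<le> C / R ^ M"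
proof -
  obtain C where C: "C \<ge> 0" "\<And>s R p. s\<in>{-e..e} \<Longrightarrow> R>0 \<Longrightarrow> norm (wint R (\<lambda>t s. g t) a b s p) \<le> C / R ^ M"
    using wint_decay[OF g a, of b] by blast
  show ?thesis using assms(1)
  proof (induction rule: FM.induct)
    case zero then show ?case unfolding osw_def[abs_def] by (intro exI[of _ 0]) simp
  next
    case (atom w b' z)
    then obtain D where D: "D \<ge> 0" "\<And>R \<epsilon> p. R\<ge>1 \<Longrightarrow> \<epsilon>\<in>{0<..e} \<Longrightarrow> norm (osw w g a b R \<epsilon> p) \<le> D / R ^ M" by blast
    show ?case
    proof (intro exI[of _ "D + norm z * C"] conjI allI impI ballI)
      show "0 \<le> D + norm z * C" using C D by simp
      fix R \<epsilon> p :: real assume R: "1 \<le> R" and \<epsilon>: "\<epsilon> \<in> {0<..e}"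
      have s: "\<epsilon> * b' \<in> {-e..e}"
      proof -
        have "\<bar>\<epsilon> * b'\<bar> \<le> e * 1" unfolding abs_mult using \<epsilon> atom.hyps(2) by (intro mult_mono) auto
        then show ?thesis by auto
      qed
      have "norm (osw (\<lambda>u. w u + z * cis (- (u * b'))) g a b R \<epsilon> p) \<le> norm (osw w g a b R \<epsilon> p) + norm z * norm (wint R (\<lambda>t s. g t) a b (\<epsilon> * b') p)"
        unfolding osw_add[OF nice_0[OF g] continuous_on_FM[OF atom.hyps(1)] continuous_on_FM[OF FM_atom1[OF atom.hyps(2)]]] osw_atom
        by (rule order_trans[OF norm_triangle_ineq]) (simp add: norm_mult)
      also have "\<dots> \<le> D / R ^ M + norm z * (C / R ^ M)" using R by (intro add_mono mult_left_mono D(2) R \<epsilon> C(2) s) auto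
      finally show "norm (osw (\<lambda>u. w u + z * cis (- (u * b'))) g a b R \<epsilon> p) \<le> (D + norm z * C) / R ^ M"
        by (simp add: add_divide_distrib)
    qed
  next
    case (density w a' b' G)
    then obtain D where D: "D \<ge> 0" "\<And>R \<epsilon> p. R\<ge>1 \<Longrightarrow> \<epsilon>\<in>{0<..e} \<Longrightarrow> norm (osw w g a b R \<epsilon> p) \<le> D / R ^ M" by blast
    obtain K where K: "K \<ge> 0" "\<And>s. s \<in> {a'..b'} \<Longrightarrow> \<bar>G s\<bar> \<le> K"
    proof -
      have "bounded (G ` {a'..b'})" by (intro compact_imp_bounded compact_continuous_image density.hyps) simp
      then obtain K where "K > 0" "\<forall>y\<in>G ` {a'..b'}. norm y \<le> K" unfolding bounded_pos by blast
      then show ?thesis by (intro that[of K]) auto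
    qed
    show ?case
    proof (intro exI[of _ "D + K * C * 2"] conjI allI impI ballI)
      show "0 \<le> D + K * C * 2" using C D K by simp
      fix R \<epsilon> p :: real assume R: "1 \<le> R" and \<epsilon>: "\<epsilon> \<in> {0<..e}"
      have s: "\<epsilon> * s \<in> {-e..e}" if "s \<in> {a'..b'}" for s
      proof -
        have "\<bar>\<epsilon> * s\<bar> \<le> e * 1" unfolding abs_mult using \<epsilon> that density.hyps by (intro mult_mono) auto
        then show ?thesis by auto
      qed
      have "norm (integral {a'..b'} (\<lambda>s. of_real (G s) * wint R (\<lambda>t s. g t) a b (\<epsilon> * s) p)) \<le> K * (C / R ^ M) * (b' - a')"
      proof (rule integral_bound[OF density.hyps(3)])
        show "continuous_on {a'..b'} (\<lambda>s. of_real (G s) * wint R (\<lambda>t s. g t) a b (\<epsilon> * s) p)"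
          using s by (intro continuous_intros density.hyps wint_continuous[OF nice_0[OF g]]) auto
        show "norm (of_real (G r) * wint R (\<lambda>t s. g t) a b (\<epsilon> * r) p) \<le> K * (C / R ^ M)" if "r \<in> {a'..b'}" for r
          unfolding norm_mult norm_of_real using K R C(2)[OF s[OF that]] that by (intro mult_mono) auto
      qed
      also have "\<dots> \<le> K * (C / R ^ M) * 2" using K C R density.hyps by (intro mult_left_mono) auto
      finally have 1: "norm (integral {a'..b'} (\<lambda>s. of_real (G s) * wint R (\<lambda>t s. g t) a b (\<epsilon> * s) p)) \<le> K * (C / R ^ M) * 2" .
      have "norm (osw (\<lambda>u. w u + integral {a'..b'} (\<lambda>s. of_real (G s) * cis (- (u * s)))) g a b R \<epsilon> p) \<le> D / R ^ M + K * (C / R ^ M) * 2"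
        unfolding osw_add[OF nice_0[OF g] continuous_on_FM[OF density.hyps(1)] continuous_density[OF density.hyps(5)]] osw_density[OF nice_0[OF g] density.hyps(5)]
        by (rule order_trans[OF norm_triangle_ineq]) (intro add_mono D R \<epsilon> 1)
      then show "norm (osw (\<lambda>u. w u + integral {a'..b'} (\<lambda>s. of_real (G s) * cis (- (u * s)))) g a b R \<epsilon> p) \<le> (D + K * C * 2) / R ^ M"
        by (simp add: add_divide_distrib)
    qed
  qed
qed

text \<open>The powers of \<open>tau\<close> absorb the integrations by parts along the curve, those of \<open>nu\<close> the decay
  of the transform of the profile.\<close>

lemma osw_split:
  assumes g: "nice e 0 (\<lambda>t s. g t)" and w: "continuous_on UNIV w"
  shows "osw w g 0 0 R \<epsilon> p = (\<Sum>j\<le>N. of_nat (N choose j) * osw w g (2 * (N - j)) (2 * j) R \<epsilon> p)"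
proof -
  have b: "(\<Sum>j\<le>N. of_nat (N choose j) * tau p t ^ (2 * (N - j)) * nu p t ^ (2 * j)) = 1" for t
  proof -
    have "1 = ((nu p t)\<^sup>2 + (tau p t)\<^sup>2) ^ N" using tau_nu[of p t] by (simp add: add.commute)
    also have "\<dots> = (\<Sum>j\<le>N. of_nat (N choose j) * ((nu p t)\<^sup>2) ^ j * ((tau p t)\<^sup>2) ^ (N - j))" by (rule binomial_ring)
    finally show ?thesis by (simp add: mult_ac flip: power_mult)
  qed
  have "osw w g 0 0 R \<epsilon> p = integral {0..1} (\<lambda>t. \<Sum>j\<le>N. of_nat (N choose j) * (of_real (g t * tau p t ^ (2 * (N - j)) * nu p t ^ (2 * j)) * w (\<epsilon> * R * nu p t) * cis (- (R * ph 0 p t))))"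
    unfolding osw_def
  proof (rule integral_cong)
    fix t :: real
    have "of_real (g t * tau p t ^ 0 * nu p t ^ 0) * w (\<epsilon> * R * nu p t) * cis (- (R * ph 0 p t))
      = of_real (g t * (\<Sum>j\<le>N. of_nat (N choose j) * tau p t ^ (2 * (N - j)) * nu p t ^ (2 * j))) * w (\<epsilon> * R * nu p t) * cis (- (R * ph 0 p t))"
      unfolding b by simp
    also have "\<dots> = (\<Sum>j\<le>N. of_nat (N choose j) * (of_real (g t * tau p t ^ (2 * (N - j)) * nu p t ^ (2 * j)) * w (\<epsilon> * R * nu p t) * cis (- (R * ph 0 p t))))"
      by (simp add: sum_distrib_left sum_distrib_right mult_ac)
    finally show "of_real (g t * tau p t ^ 0 * nu p t ^ 0) * w (\<epsilon> * R * nu p t) * cis (- (R * ph 0 p t)) = \<dots>" .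
  qed
  also have "\<dots> = (\<Sum>j\<le>N. of_nat (N choose j) * osw w g (2 * (N - j)) (2 * j) R \<epsilon> p)"
  proof -
    have i: "(\<lambda>t. of_nat (N choose j) * (of_real (g t * tau p t ^ (2 * (N - j)) * nu p t ^ (2 * j)) * w (\<epsilon> * R * nu p t) * cis (- (R * ph 0 p t)))) integrable_on {0..1}" for j
      by (rule integrable_on_mult_right, rule osw_integrable[OF g w])
    show ?thesis unfolding osw_def
      by (subst integral_sum) (simp_all only: finite_atMost i integral_mult_right)
  qed
  finally show ?thesis .
qed

text \<open>In each term of the binomial expansion there are two cases. If \<open>nu\<close> occurs
  at least q + 1 times, these factors join the transform of the profile to form (i \<epsilon> R
  nu)^(q+1) times it, again the transform of a measure, at the price (\<epsilon> R)^-(q+1).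
  Otherwise \<open>tau\<close> occurs often enough for the pointwise decay R^-(q+2).\<close>

lemma tube_transform_L2:
  assumes F: "\<And>k. nice e k (\<lambda>t s. F t)" and \<theta>: "weight_profile q \<theta>"
  shows "L2O e (\<lambda>R \<epsilon>. 1 / (R * (\<epsilon> * R) ^ (2 * (q + 1)))) (osw (ft \<theta> (-1) 1) F 0 0)"
proof -
  let ?\<delta> = "\<lambda>R \<epsilon> :: real. 1 / (R * (\<epsilon> * R) ^ (2 * (q + 1)))"
  let ?w = "ft \<theta> (-1) 1"
  obtain v where v: "FM v" "\<And>u. (\<i> * of_real u) ^ (q + 1) * ?w u = v u"
    using profile_FM(3)[OF \<theta>] by blast
  have w: "FM ?w" by (rule profile_FM(2)[OF \<theta>])
  \<comment> \<open>With this N, the inequality 2 j <= q forces 2 (N - j) >= 2 (q + 2), enough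
    powers of \<open>tau\<close> for q + 2 integrations by parts.\<close>
  define N where "N = 2 * q + 2"
  have summand: "L2O e ?\<delta> (\<lambda>R \<epsilon> p. of_nat (N choose j) * osw ?w F (2 * (N - j)) (2 * j) R \<epsilon> p)" if j: "j \<le> N" for j
  proof (cases "q + 1 \<le> 2 * j")
    case True
    have eq: "osw ?w F (2 * (N - j)) (2 * j) R \<epsilon> p = (1 / (\<i> * of_real (\<epsilon> * R)) ^ (q + 1)) * osw v F (2 * (N - j)) (2 * j - (q + 1)) R \<epsilon> p"
      if "R \<ge> 1" "\<epsilon> > 0" for R \<epsilon> p
    proof -
      have nz: "\<i> * of_real (\<epsilon> * R) \<noteq> 0" using that by simp
      have "of_real (nu p t ^ (2 * j)) * ?w (\<epsilon> * R * nu p t) = (1 / (\<i> * of_real (\<epsilon> * R)) ^ (q + 1)) * (of_real (nu p t ^ (2 * j - (q + 1))) * v (\<epsilon> * R * nu p t))" for t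
      proof -
        have "nu p t ^ (2 * j) = nu p t ^ (2 * j - (q + 1)) * nu p t ^ (q + 1)" using True by (metis le_add_diff_inverse2 power_add)
        moreover have "v (\<epsilon> * R * nu p t) = (\<i> * of_real (\<epsilon> * R)) ^ (q + 1) * of_real (nu p t ^ (q + 1)) * ?w (\<epsilon> * R * nu p t)"
          unfolding v(2)[symmetric] by (simp add: power_mult_distrib mult_ac)
        ultimately show ?thesis using nz by (simp add: divide_simps mult_ac del: power_Suc)
      qed
      then have "of_real (F t * tau p t ^ (2 * (N - j)) * nu p t ^ (2 * j)) * ?w (\<epsilon> * R * nu p t) * cis (- (R * ph 0 p t))
         = (1 / (\<i> * of_real (\<epsilon> * R)) ^ (q + 1)) * (of_real (F t * tau p t ^ (2 * (N - j)) * nu p t ^ (2 * j - (q + 1))) * v (\<epsilon> * R * nu p t) * cis (- (R * ph 0 p t)))" for t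
        unfolding of_real_mult by (rule phase_rearrange2)
      then show ?thesis unfolding osw_def by (simp only: integral_mult_right)
    qed
    have "L2O e ?\<delta> (\<lambda>R \<epsilon> p. (of_nat (N choose j) * (1 / (\<i> * of_real (\<epsilon> * R)) ^ (q + 1))) * osw v F (2 * (N - j)) (2 * j - (q + 1)) R \<epsilon> p)"
    proof (rule L2O_mult[OF osw_L2[OF v(1) F], where K = "(real (N choose j))\<^sup>2"])
      fix R \<epsilon> p :: real assume "1 \<le> R" "\<epsilon> \<in> {0<..e}"
      then have "(norm (of_nat (N choose j) * (1 / (\<i> * of_real (\<epsilon> * R)) ^ (q + 1)) :: complex))\<^sup>2 = (real (N choose j))\<^sup>2 * (1 / (\<epsilon> * R) ^ (2 * (q + 1)))"
        by (simp add: norm_mult norm_divide norm_power power_mult_distrib power_divide flip: power_mult)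
          (simp add: power2_eq_square mult_ac)
      then show "(norm (of_nat (N choose j) * (1 / (\<i> * of_real (\<epsilon> * R)) ^ (q + 1)) :: complex))\<^sup>2 * (1 / R) \<le> (real (N choose j))\<^sup>2 * ?\<delta> R \<epsilon>"
        by (simp add: mult.commute)
    qed auto
    then show ?thesis unfolding L2O_def by (simp add: eq mult.assoc)
  next
    case False
    have M: "2 * (q + 2) \<le> 2 * (N - j)" using False by (simp add: N_def)
    obtain C where C: "C \<ge> 0" "\<And>R \<epsilon> p. R \<ge> 1 \<Longrightarrow> \<epsilon> \<in> {0<..e} \<Longrightarrow> norm (osw ?w F (2 * (N - j)) (2 * j) R \<epsilon> p) \<le> C / R ^ (q + 2)"
      using osw_decay[OF w F M, of "2 * j"] by blast
    show ?thesis
    proof (rule L2O_pointwise[where K = "(real (N choose j) * C)\<^sup>2 * e ^ (2 * (q + 1))"])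
      show "0 \<le> (real (N choose j) * C)\<^sup>2 * e ^ (2 * (q + 1))" using e by simp
      fix R \<epsilon> p :: real assume R: "1 \<le> R" and \<epsilon>: "\<epsilon> \<in> {0<..e}"
      show "continuous_on {0..2*pi} (\<lambda>p. of_nat (N choose j) * osw ?w F (2 * (N - j)) (2 * j) R \<epsilon> p)"
        by (intro continuous_intros osw_continuous F continuous_on_FM w)
      have "norm (of_nat (N choose j) * osw ?w F (2 * (N - j)) (2 * j) R \<epsilon> p) \<le> real (N choose j) * (C / R ^ (q + 2))"
        unfolding norm_mult using C(2)[OF R \<epsilon>] by (intro mult_mono) auto
      then have "(norm (of_nat (N choose j) * osw ?w F (2 * (N - j)) (2 * j) R \<epsilon> p))\<^sup>2 \<le> (real (N choose j) * (C / R ^ (q + 2)))\<^sup>2"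
        by (intro power_mono) auto
      also have "\<dots> = (real (N choose j) * C)\<^sup>2 * (1 / R ^ (2 * (q + 2)))"
        by (simp add: power_mult_distrib power_divide flip: power_mult) (simp add: mult.commute eval_nat_numeral)
      \<comment> \<open>Decay in R alone suffices here because \<epsilon> <= e: a factor R^-2(q+1)
        is at most e^(2(q+1)) times (\<epsilon> R)^-2(q+1).\<close>
      also have "\<dots> \<le> (real (N choose j) * C)\<^sup>2 * (e ^ (2 * (q + 1)) * ?\<delta> R \<epsilon>)"
      proof (rule mult_left_mono)
        have "1 / R ^ (2 * (q + 2)) \<le> 1 / (R * R ^ (2 * (q + 1)))"
        proof (rule divide_left_mono)
          have "R ^ (1 + 2 * (q + 1)) \<le> R ^ (2 * (q + 2))" using R by (intro power_increasing) auto
          then show "R * R ^ (2 * (q + 1)) \<le> R ^ (2 * (q + 2))" by simp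
        qed (use R in auto)
        also have "\<dots> = \<epsilon> ^ (2 * (q + 1)) * ?\<delta> R \<epsilon>" using \<epsilon> by (simp add: power_mult_distrib)
        also have "\<dots> \<le> e ^ (2 * (q + 1)) * ?\<delta> R \<epsilon>" using \<epsilon> R by (intro mult_right_mono power_mono) auto
        finally show "1 / R ^ (2 * (q + 2)) \<le> e ^ (2 * (q + 1)) * ?\<delta> R \<epsilon>" .
      qed simp
      finally show "(norm (of_nat (N choose j) * osw ?w F (2 * (N - j)) (2 * j) R \<epsilon> p))\<^sup>2 \<le> (real (N choose j) * C)\<^sup>2 * e ^ (2 * (q + 1)) * ?\<delta> R \<epsilon>"
        by (simp add: mult.assoc)
    qed
  qed
  have "L2O e ?\<delta> (\<lambda>R \<epsilon> p. \<Sum>j\<in>{..N}. of_nat (N choose j) * osw ?w F (2 * (N - j)) (2 * j) R \<epsilon> p)"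
  proof (rule L2O_sum)
    show "0 \<le> ?\<delta> R \<epsilon>" if "1 \<le> R" "0 < \<epsilon>" for R \<epsilon> using that by (intro divide_nonneg_nonneg) auto
    show "L2O e ?\<delta> (\<lambda>R \<epsilon> p. of_nat (N choose j) * osw ?w F (2 * (N - j)) (2 * j) R \<epsilon> p)" if "j \<in> {..N}" for j
      using summand that by simp
  qed simp
  moreover have "osw ?w F 0 0 = (\<lambda>R \<epsilon> p. \<Sum>j\<in>{..N}. of_nat (N choose j) * osw ?w F (2 * (N - j)) (2 * j) R \<epsilon> p)"
    by (intro ext osw_split F continuous_on_FM w)
  ultimately show ?thesis by simp
qed

end

section \<open>Lattice sums and Fejer means\<close>

abbreviation vec2 :: "real \<Rightarrow> real \<Rightarrow> real^2" where "vec2 x y \<equiv> vector [x, y]"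

lemma borel_measurable_nth2 [measurable]: "(\<lambda>x::real^2. x $ i) \<in> borel_measurable borel"
  by (intro borel_measurable_continuous_onI continuous_intros)

lemma continuous_vec2 [continuous_intros]:
  assumes "continuous_on S f" "continuous_on S g"
  shows "continuous_on S (\<lambda>z. vec2 (f z) (g z))"
proof -
  have eq: "(\<lambda>z. vec2 (f z) (g z)) = (\<lambda>z. \<chi> i. if i = 1 then f z else g z)"
    by (auto simp: fun_eq_iff vec_eq_iff forall_2)
  show ?thesis
    unfolding eq
  proof (intro continuous_on_vec_lambda)
    fix i :: 2
    show "continuous_on S (\<lambda>z. if i = 1 then f z else g z)" using assms by (cases "i = 1") auto
  qed
qed

lemma vec2_measurable [measurable]: "(\<lambda>z. vec2 (fst z) (snd z)) \<in> borel_measurable (borel \<Otimes>\<^sub>M borel)"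
  unfolding borel_prod by (intro borel_measurable_continuous_onI continuous_intros)

lemma vec2_eta: "vec2 (x $ 1) (x $ 2) = x"
  by (simp add: vec_eq_iff forall_2)

text \<open>Identifies Lebesgue measure on the vector type with a product measure, so that Fubini
  can be used in coordinates.\<close>

lemma lborel_vec2: "distr (lborel \<Otimes>\<^sub>M lborel) borel (\<lambda>z. vec2 (fst z) (snd z)) = lborel"
proof (rule lborel_eqI[symmetric])
  fix l u :: "real^2"
  assume "\<And>b. b \<in> Basis \<Longrightarrow> l \<bullet> b \<le> u \<bullet> b"
  then have le: "l $ i \<le> u $ i" for i
    using axis_in_Basis_iff[of i "1::real"] by (metis Basis_real_def cart_eq_inner_axis insertI1)
  have "emeasure (distr (lborel \<Otimes>\<^sub>M lborel) borel (\<lambda>z. vec2 (fst z) (snd z))) (box l u)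
    = emeasure (lborel \<Otimes>\<^sub>M lborel) ((\<lambda>z. vec2 (fst z) (snd z)) -` box l u \<inter> space (lborel \<Otimes>\<^sub>M lborel))"
    by (intro emeasure_distr) auto
  also have "(\<lambda>z. vec2 (fst z) (snd z)) -` box l u \<inter> space (lborel \<Otimes>\<^sub>M lborel) = {l$1<..<u$1} \<times> {l$2<..<u$2}"
    by (auto simp: mem_box_cart forall_2 space_pair_measure)
  also have "emeasure (lborel \<Otimes>\<^sub>M lborel) \<dots> = emeasure lborel {l$1<..<u$1} * emeasure lborel {l$2<..<u$2}"
    by (intro lborel.emeasure_pair_measure_Times) auto
  also have "\<dots> = ennreal ((u$1 - l$1) * (u$2 - l$2))" using le by (simp add: ennreal_mult)
  also have "(u$1 - l$1) * (u$2 - l$2) = (\<Prod>b\<in>Basis. (u - l) \<bullet> b)"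
  proof -
    have "(\<Prod>b\<in>Basis. (u - l) \<bullet> b) = (\<Prod>i\<in>(UNIV::2 set). (u - l) \<bullet> axis i 1)"
      by (simp add: Basis_vec_def UNION_singleton_eq_range prod.reindex axis_eq_axis inj_on_def)
    then show ?thesis by (simp add: UNIV_2 inner_axis)
  qed
  finally show "emeasure (distr (lborel \<Otimes>\<^sub>M lborel) borel (\<lambda>z. vec2 (fst z) (snd z))) (box l u) = ennreal (\<Prod>b\<in>Basis. (u - l) \<bullet> b)" .
qed simp

lemma integral_vec2:
  fixes f :: "real^2 \<Rightarrow> 'a::{banach, second_countable_topology}"
  assumes f: "integrable lborel f"
  shows "(LINT x|lborel. f x) = (LINT x|lborel. LINT y|lborel. f (vec2 x y))"
proof -
  have fm[measurable]: "f \<in> borel_measurable borel" using f by (simp add: borel_measurable_integrable)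
  have 1: "(LINT x|lborel. f x) = integral\<^sup>L (lborel \<Otimes>\<^sub>M lborel) (\<lambda>z. f (vec2 (fst z) (snd z)))"
    by (subst lborel_vec2[symmetric], subst integral_distr) auto
  have "integrable (distr (lborel \<Otimes>\<^sub>M lborel) borel (\<lambda>z. vec2 (fst z) (snd z))) f" using f lborel_vec2 by simp
  then have "integrable (lborel \<Otimes>\<^sub>M lborel) (\<lambda>z. f (vec2 (fst z) (snd z)))"
    by (subst (asm) integrable_distr_eq) auto
  from lborel_pair.integral_fst'[OF this] show ?thesis unfolding 1 by simp
qed

lemma lborel_reflect: "distr lborel borel (\<lambda>x. t - x) = (lborel :: 'a::euclidean_space measure)"
proof -
  have "lborel = density (distr lborel borel (\<lambda>x. t + (-1) *\<^sub>R x)) (\<lambda>_. ennreal (\<bar>-1\<bar>^DIM('a)))"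
    by (rule lborel_affine) simp
  then show ?thesis by (simp add: density_1)
qed

lemma lborel_integral_reflect:
  fixes f :: "'a::euclidean_space \<Rightarrow> 'b::{banach, second_countable_topology}"
  assumes [measurable]: "f \<in> borel_measurable borel"
  shows "(LINT x|lborel. f (t - x)) = (LINT x|lborel. f x)"
  by (subst (2) lborel_reflect[of t, symmetric]) (subst integral_distr, auto)

lemma lborel_integrable_reflect:
  fixes f :: "'a::euclidean_space \<Rightarrow> 'b::{banach, second_countable_topology}"
  assumes "integrable lborel f"
  shows "integrable lborel (\<lambda>x. f (t - x))"
proof -
  have [measurable]: "f \<in> borel_measurable borel" using assms by (simp add: borel_measurable_integrable)
  have "integrable (distr lborel borel (\<lambda>x. t - x)) f" using assms by (simp add: lborel_reflect)
  then show ?thesis by (subst (asm) integrable_distr_eq) auto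
qed

lemma AE_lborel_reflect:
  assumes "AE x in (lborel :: 'a::euclidean_space measure). P x"
  shows "AE x in (lborel :: 'a measure). P (t - x)"
proof -
  have "AE x in distr lborel borel (\<lambda>x. t - x). P x" by (subst lborel_reflect) (rule assms)
  then show ?thesis by (rule AE_distrD[rotated]) simp
qed

lemma lborel_integral_shift:
  fixes f :: "'a::euclidean_space \<Rightarrow> 'b::{banach, second_countable_topology}"
  assumes [measurable]: "f \<in> borel_measurable borel"
  shows "(LINT x|lborel. f (x - t)) = (LINT x|lborel. f x)"
proof -
  have "(LINT x|lborel. f (x - t)) = (LINT x|lborel. f ((- t) - (- x)))" by simp
  also have "\<dots> = (LINT x|lborel. f (- t - x))"
    using lborel_integral_reflect[of "\<lambda>x. f (- t - x)" 0] by simp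
  also have "\<dots> = (LINT x|lborel. f x)" by (rule lborel_integral_reflect) fact
  finally show ?thesis .
qed

text \<open>Half-open, so that the integer translates tile the plane exactly. The corner 0 serves
  for the translations of the lattice, the corner -1/2 for the Fejer kernels, which have to be
  centred at the origin.\<close>

definition Ubox :: "real \<Rightarrow> (real^2) set" where
  "Ubox a = {x. \<forall>i. a \<le> x $ i \<and> x $ i < a + 1}"

lemma Ubox_2: "Ubox a = {x. a \<le> x $ 1 \<and> x $ 1 < a + 1 \<and> a \<le> x $ 2 \<and> x $ 2 < a + 1}"
  by (auto simp: Ubox_def forall_2)

lemma Ubox_measurable [measurable]: "Ubox a \<in> sets borel"
  unfolding Ubox_2 by measurable

lemma indicator_Ubox: "indicator (Ubox a) (vec2 x y) = (indicator {a..<a+1} x * indicator {a..<a+1} y :: real)"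
  by (auto simp: Ubox_2 split: split_indicator)

lemma Ubox_unique_lattice:
  assumes "finite W" "W \<subseteq> int_lattice" "\<And>w. w \<in> int_lattice \<Longrightarrow> w - y \<in> Ubox a \<Longrightarrow> w \<in> W"
  shows "(\<Sum>w\<in>W. indicator (Ubox a) (w - y)) = (1::real)"
proof -
  \<comment> \<open>Coordinatewise the only integer in the half-open interval from a + y_i to a +
    y_i + 1.\<close>
  define w0 :: "real^2" where "w0 = (\<chi> i. of_int \<lceil>a + y $ i\<rceil>)"
  have iff: "w - y \<in> Ubox a \<longleftrightarrow> w = w0" if "w \<in> int_lattice" for w
  proof -
    have "a \<le> w $ i - y $ i \<and> w $ i - y $ i < a + 1 \<longleftrightarrow> w $ i = of_int \<lceil>a + y $ i\<rceil>" for i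
    proof -
      have "w $ i \<in> \<int>" using that by (simp add: int_lattice_def)
      then obtain k where k: "w $ i = of_int k" by (rule Ints_cases) blast
      have "a \<le> w $ i - y $ i \<and> w $ i - y $ i < a + 1 \<longleftrightarrow> \<lceil>a + y $ i\<rceil> = k"
        unfolding k ceiling_eq_iff by linarith
      then show ?thesis by (auto simp: k)
    qed
    then show ?thesis by (simp add: Ubox_def vec_eq_iff w0_def)
  qed
  have w0: "w0 \<in> int_lattice" by (simp add: w0_def int_lattice_def)
  then have "w0 \<in> W" using assms(3)[OF w0] iff[OF w0] by simp
  moreover have "indicator (Ubox a) (w - y) = (if w = w0 then 1 else 0 :: real)" if "w \<in> W" for w
    using iff[of w] that assms(2) by (auto split: split_indicator)
  ultimately show ?thesis using assms(1) by (simp cong: sum.cong)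
qed

text \<open>The usual unfolding, with reflected translates of the cell as the tiling. The sum is
  over a finite set, which therefore has to contain every lattice point that links the support of g
  to the cell.\<close>

lemma unfold_lattice_integral:
  fixes g :: "real^2 \<Rightarrow> complex"
  assumes g: "integrable lborel g" and W: "finite W" "W \<subseteq> int_lattice"
    and cover: "\<And>y w. g y \<noteq> 0 \<Longrightarrow> w \<in> int_lattice \<Longrightarrow> w - y \<in> Ubox a \<Longrightarrow> w \<in> W"
  shows "(LINT x|lborel. indicator (Ubox a) x *\<^sub>R (\<Sum>w\<in>W. g (w - x))) = (LINT y|lborel. g y)"
proof -
  have gm[measurable]: "g \<in> borel_measurable borel" using g by (simp add: borel_measurable_integrable)
  have i1: "integrable lborel (\<lambda>x. indicator (Ubox a) x *\<^sub>R g (w - x))" for w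
    by (intro integrable_mult_indicator lborel_integrable_reflect g) auto
  have i2: "integrable lborel (\<lambda>y. indicator (Ubox a) (w - y) *\<^sub>R g y)" for w
    using lborel_integrable_reflect[OF i1[of w], of w] by simp
  have "g y = (\<Sum>w\<in>W. indicator (Ubox a) (w - y) *\<^sub>R g y)" for y
  proof (cases "g y = 0")
    case False
    then have "(\<Sum>w\<in>W. indicator (Ubox a) (w - y)) = (1::real)"
      using cover by (intro Ubox_unique_lattice W) auto
    then show ?thesis by (simp flip: scaleR_sum_left)
  qed simp
  then have "(LINT y|lborel. g y) = (LINT y|lborel. (\<Sum>w\<in>W. indicator (Ubox a) (w - y) *\<^sub>R g y))"
    by (rule Bochner_Integration.integral_cong[OF refl])
  also have "\<dots> = (\<Sum>w\<in>W. LINT y|lborel. indicator (Ubox a) (w - y) *\<^sub>R g y)"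
    by (rule Bochner_Integration.integral_sum) (rule i2)
  also have "\<dots> = (\<Sum>w\<in>W. LINT x|lborel. indicator (Ubox a) x *\<^sub>R g (w - x))"
    using lborel_integral_reflect[of "\<lambda>x. indicator (Ubox a) x *\<^sub>R g (w - x)" w for w] by (intro sum.cong) auto
  also have "\<dots> = (LINT x|lborel. (\<Sum>w\<in>W. indicator (Ubox a) x *\<^sub>R g (w - x)))"
    by (rule Bochner_Integration.integral_sum[symmetric]) (rule i1)
  also have "\<dots> = (LINT x|lborel. indicator (Ubox a) x *\<^sub>R (\<Sum>w\<in>W. g (w - x)))"
    by (simp add: scaleR_sum_right)
  finally show ?thesis ..
qed

section \<open>Characters and Fejer kernels\<close>

definition chi :: "int \<Rightarrow> int \<Rightarrow> real^2 \<Rightarrow> complex" where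
  "chi a b x = cis (2 * pi * (of_int a * x $ 1 + of_int b * x $ 2))"

lemma chi_add: "chi a b (x + y) = chi a b x * chi a b y"
  by (simp add: chi_def cis_mult algebra_simps)

lemma chi_neg: "chi (-a) (-b) x = cnj (chi a b x)" "chi a b (- x) = cnj (chi a b x)"
  by (simp_all add: chi_def cis_cnj algebra_simps)

lemma norm_chi [simp]: "norm (chi a b x) = 1"
  by (simp add: chi_def)

lemma chi_lattice: "w \<in> int_lattice \<Longrightarrow> chi a b w = 1"
proof -
  assume "w \<in> int_lattice"
  then have w: "w $ 1 \<in> \<int>" "w $ 2 \<in> \<int>" by (simp_all add: int_lattice_def)
  obtain k where "w $ 1 = of_int k" by (rule Ints_cases[OF w(1)]) blast
  moreover obtain l where "w $ 2 = of_int l" by (rule Ints_cases[OF w(2)]) blast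
  ultimately have "chi a b w = cis (2 * pi * of_int (a * k + b * l))" by (simp add: chi_def)
  then show ?thesis by (simp add: cis_multiple_2pi)
qed

lemma chi_measurable [measurable]: "chi a b \<in> borel_measurable borel"
  unfolding chi_def[abs_def] by (intro borel_measurable_continuous_onI continuous_intros)

lemma integral_cis_half:
  "(LINT t|lborel. indicator {-1/2..<1/2} t *\<^sub>R cis (2 * pi * (of_int a * t))) = (if a = 0 then 1 else 0)"
proof -
  have "(LINT t|lborel. indicator {-1/2..<1/2::real} t *\<^sub>R cis (2 * pi * (of_int a * t)))
    = (LINT t|lborel. indicator {-1/2..1/2} t *\<^sub>R cis (2 * pi * (of_int a * t)))"
  proof (rule integral_cong_AE)
    show "AE t in lborel. indicator {-1/2..<1/2::real} t *\<^sub>R cis (2 * pi * (of_int a * t)) = indicator {-1/2..1/2} t *\<^sub>R cis (2 * pi * (of_int a * t))"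
      using AE_lborel_singleton[of "1/2::real"] by eventually_elim (auto split: split_indicator)
  qed (intro borel_measurable_scaleR borel_measurable_indicator borel_measurable_continuous_onI[OF continuous_on_cis] continuous_intros; simp)+
  also have "\<dots> = (if a = 0 then 1 else 0)"
  proof (cases "a = 0")
    case True
    then show ?thesis by (simp add: Bochner_Integration.integral_scaleR_left)
  next
    case False
    define F where "F t = cis (2 * pi * (of_int a * t)) / (2 * pi * of_int a * \<i>)" for t
    have "(LINT t|lborel. indicator {-1/2..1/2} t *\<^sub>R cis (2 * pi * (of_int a * t))) = F (1/2) - F (-1/2)"
    proof (rule integral_FTC_Icc)
      show "(-1/2::real) \<le> 1/2" by simp
      show "continuous_on {-1/2..1/2} (\<lambda>t. cis (2 * pi * (of_int a * t)))" by (intro continuous_intros)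
      fix t :: real
      have "((\<lambda>t. cis (2 * pi * (of_int a * t))) has_vector_derivative (2 * pi * of_int a) *\<^sub>R (\<i> * cis (2 * pi * (of_int a * t)))) (at t within {-1/2..1/2})"
        unfolding has_vector_derivative_def
        by (rule has_derivative_eq_rhs, rule has_derivative_cis) (auto intro!: derivative_eq_intros simp: mult_ac)
      from has_vector_derivative_divide[OF this, of "2 * pi * of_int a * \<i>"]
      show "(F has_vector_derivative cis (2 * pi * (of_int a * t))) (at t within {-1/2..1/2})"
        unfolding F_def using False by (simp add: scaleR_conv_of_real)
    qed
    also have "F (1/2) - F (-1/2) = 0"
    proof -
      have "cis (2 * pi * (of_int a * (1/2))) = cis (2 * pi * (of_int a * (-1/2))) * cis (2 * pi * of_int a)"
        by (simp add: cis_mult algebra_simps)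
      then show ?thesis by (simp add: F_def cis_multiple_2pi)
    qed
    finally show ?thesis using False by simp
  qed
  finally show ?thesis .
qed

lemma integrable_bounded_on:
  fixes f :: "'a::euclidean_space \<Rightarrow> 'b::{banach, second_countable_topology}"
  assumes "f \<in> borel_measurable borel" "A \<in> sets borel" "emeasure lborel A < \<infinity>"
    "\<And>x. x \<in> A \<Longrightarrow> norm (f x) \<le> B" "\<And>x. x \<notin> A \<Longrightarrow> f x = 0"
  shows "integrable lborel f"
  by (rule integrableI_bounded_set[where A = A and B = B]) (use assms in auto)

lemma emeasure_Ubox: "emeasure lborel (Ubox a) = 1"
proof -
  have "emeasure lborel (Ubox a) = emeasure (distr (lborel \<Otimes>\<^sub>M lborel) borel (\<lambda>z. vec2 (fst z) (snd z))) (Ubox a)"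
    by (simp add: lborel_vec2)
  also have "\<dots> = emeasure (lborel \<Otimes>\<^sub>M lborel) ((\<lambda>z. vec2 (fst z) (snd z)) -` Ubox a \<inter> space (lborel \<Otimes>\<^sub>M lborel))"
    by (intro emeasure_distr) auto
  also have "(\<lambda>z. vec2 (fst z) (snd z)) -` Ubox a \<inter> space (lborel \<Otimes>\<^sub>M lborel) = {a..<a+1} \<times> {a..<a+1}"
    by (auto simp: Ubox_2 space_pair_measure)
  also have "emeasure (lborel \<Otimes>\<^sub>M lborel) \<dots> = emeasure lborel {a..<a+1} * emeasure lborel {a..<a+1}"
    by (intro lborel.emeasure_pair_measure_Times) auto
  finally show ?thesis by simp
qed

lemma integrable_Ubox:
  fixes f :: "real^2 \<Rightarrow> 'b::{banach, second_countable_topology}"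
  assumes [measurable]: "f \<in> borel_measurable borel" and "\<And>x. x \<in> Ubox a \<Longrightarrow> norm (f x) \<le> B"
  shows "integrable lborel (\<lambda>x. indicator (Ubox a) x *\<^sub>R f x)"
  by (rule integrable_bounded_on[where A = "Ubox a" and B = B]) (use assms(2) in \<open>auto simp: emeasure_Ubox\<close>)

lemma chi_ortho:
  "(LINT x|lborel. indicator (Ubox (-1/2)) x *\<^sub>R chi a b x) = (if a = 0 \<and> b = 0 then 1 else 0)"
proof -
  let ?I = "indicator {-1/2..<1/2} :: real \<Rightarrow> real"
  let ?c = "\<lambda>(a::int) t. cis (2 * pi * (of_int a * t))"
  have "(LINT x|lborel. indicator (Ubox (-1/2)) x *\<^sub>R chi a b x)
    = (LINT x|lborel. LINT y|lborel. indicator (Ubox (-1/2)) (vec2 x y) *\<^sub>R chi a b (vec2 x y))"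
    by (intro integral_vec2 integrable_Ubox[where B = 1]) auto
  also have "\<dots> = (LINT x|lborel. LINT y|lborel. (?I x *\<^sub>R ?c a x) * (?I y *\<^sub>R ?c b y))"
    by (intro Bochner_Integration.integral_cong refl)
      (simp add: indicator_Ubox chi_def cis_mult[symmetric] distrib_left scaleR_conv_of_real flip: cis_mult)
  also have "\<dots> = (LINT x|lborel. ?I x *\<^sub>R ?c a x) * (LINT y|lborel. ?I y *\<^sub>R ?c b y)"
    by (simp only: integral_mult_right_zero integral_mult_left_zero)
  finally show ?thesis unfolding integral_cis_half by simp
qed

text \<open>The geometric sum whose squared modulus, divided by n, is the one-dimensional Fejer
  kernel.\<close>

definition Dn :: "nat \<Rightarrow> real \<Rightarrow> complex" where
  "Dn n t = (\<Sum>j<n. cis (2 * pi * (real j * t)))"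

text \<open>With z = \<open>cis (2 * pi * t)\<close> the product (1 - z) \<open>Dn n t\<close> is 1
  - z^n, of modulus at most 2, and |1 - z| = 2 |sin (pi t)|. Away from 0 the sum thus stays bounded
  as n grows.\<close>

lemma Dn_bound:
  assumes d: "0 < d" "d \<le> 1/2" and t: "d \<le> \<bar>t\<bar>" "\<bar>t\<bar> \<le> 1/2"
  shows "(norm (Dn n t))\<^sup>2 \<le> 1 / (sin (pi * d))\<^sup>2"
proof -
  let ?z = "cis (2 * pi * t)"
  have Dz: "Dn n t = (\<Sum>j<n. ?z ^ j)" unfolding Dn_def by (intro sum.cong refl) (simp add: Complex.DeMoivre mult_ac)
  have s0: "sin (pi * d) > 0" using d by (intro sin_gt_zero) auto
  have "sin (pi * d) \<le> sin (pi * \<bar>t\<bar>)"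
  proof (rule sin_monotone_2pi_le)
    have "pi * \<bar>t\<bar> \<le> pi * (1/2)" using t by (intro mult_left_mono) auto
    then show "pi * \<bar>t\<bar> \<le> pi/2" by simp
    have "0 \<le> pi * d" using d by simp
    then show "- (pi/2) \<le> pi * d" using pi_gt_zero by linarith
    show "pi * d \<le> pi * \<bar>t\<bar>" using t by (intro mult_left_mono) auto
  qed
  then have "(sin (pi * d))\<^sup>2 \<le> (sin (pi * \<bar>t\<bar>))\<^sup>2" using s0 by (intro power_mono) auto
  also have "(sin (pi * \<bar>t\<bar>))\<^sup>2 = (sin (pi * t))\<^sup>2" by (cases "t \<ge> 0") auto
  finally have s: "(sin (pi * d))\<^sup>2 \<le> (sin (pi * t))\<^sup>2" .
  have "(norm (1 - ?z))\<^sup>2 = (1 - cos (2 * (pi * t)))\<^sup>2 + (sin (2 * (pi * t)))\<^sup>2"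
    by (simp add: cmod_power2 mult.assoc)
  also have "\<dots> = 4 * (sin (pi * t))\<^sup>2 * ((sin (pi * t))\<^sup>2 + (cos (pi * t))\<^sup>2)"
    unfolding cos_double_sin sin_double by algebra
  finally have nz: "(norm (1 - ?z))\<^sup>2 = 4 * (sin (pi * t))\<^sup>2" by simp
  have "(1 - ?z) * Dn n t = 1 - ?z ^ n"
    unfolding Dz by (metis one_diff_power_eq)
  then have "norm (1 - ?z) * norm (Dn n t) \<le> 2"
    by (metis norm_mult norm_triangle_ineq4 norm_one norm_power norm_cis power_one one_add_one)
  then have "(norm (1 - ?z) * norm (Dn n t))\<^sup>2 \<le> 2\<^sup>2" by (intro power_mono) auto
  then have "4 * (sin (pi * t))\<^sup>2 * (norm (Dn n t))\<^sup>2 \<le> 4" unfolding power_mult_distrib nz by simp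
  then have "(sin (pi * d))\<^sup>2 * (norm (Dn n t))\<^sup>2 \<le> 1"
    using mult_right_mono[OF s, of "(norm (Dn n t))\<^sup>2"] by simp
  then show ?thesis using s0 by (simp add: pos_le_divide_eq mult.commute)
qed

text \<open>The Fejer coefficients n - |m| are never written down: they appear as the number of
  pairs in \<open>sq n\<close> with difference m.\<close>

definition df :: "nat \<times> nat \<Rightarrow> int" where
  "df z = int (fst z) - int (snd z)"

definition sq :: "nat \<Rightarrow> (nat \<times> nat) set" where
  "sq n = {..<n} \<times> {..<n}"

lemma finite_sq [simp]: "finite (sq n)" by (simp add: sq_def)

lemma sum_df: "(\<Sum>z\<in>sq n. if df z = 0 then 1 else 0) = (of_nat n :: complex)"
proof -
  have "(\<Sum>z\<in>sq n. if df z = 0 then 1 else 0) = (\<Sum>j<n. \<Sum>k<n. if j = k then 1 else (0::complex))"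
    unfolding sq_def df_def sum.cartesian_product by (intro sum.cong refl) auto
  then show ?thesis by simp
qed

lemma Dn_square: "of_real ((norm (Dn n t))\<^sup>2) = (\<Sum>z\<in>sq n. cis (2 * pi * (of_int (df z) * t)))"
proof -
  have "of_real ((norm (Dn n t))\<^sup>2) = Dn n t * cnj (Dn n t)" by (rule complex_norm_square)
  also have "\<dots> = (\<Sum>j<n. \<Sum>k<n. cis (2 * pi * (real j * t)) * cis (- (2 * pi * (real k * t))))"
    unfolding Dn_def by (simp add: cis_cnj sum_product)
  also have "\<dots> = (\<Sum>z\<in>sq n. cis (2 * pi * (of_int (df z) * t)))"
    unfolding sq_def df_def sum.cartesian_product
    by (intro sum.cong refl) (auto simp: cis_mult algebra_simps)
  finally show ?thesis .
qed

definition fejer :: "nat \<Rightarrow> real^2 \<Rightarrow> real" where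
  "fejer n x = (norm (Dn n (x $ 1)))\<^sup>2 * (norm (Dn n (x $ 2)))\<^sup>2 / (real n)\<^sup>2"

lemma Dn_measurable [measurable]: "Dn n \<in> borel_measurable borel"
  unfolding Dn_def[abs_def] by (intro borel_measurable_continuous_onI continuous_intros)

lemma norm_Dn_le: "norm (Dn n t) \<le> real n"
  unfolding Dn_def by (rule order_trans[OF norm_sum]) simp

lemma fejer_measurable [measurable]: "fejer n \<in> borel_measurable borel"
  unfolding fejer_def[abs_def] by measurable

lemma fejer_nonneg: "fejer n x \<ge> 0" by (simp add: fejer_def)

lemma fejer_le: "fejer n x \<le> (real n)\<^sup>2"
proof (cases "n = 0")
  case False
  have "(norm (Dn n (x $ i)))\<^sup>2 \<le> (real n)\<^sup>2" for i by (intro power_mono norm_Dn_le) auto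
  then have "(norm (Dn n (x $ 1)))\<^sup>2 * (norm (Dn n (x $ 2)))\<^sup>2 \<le> (real n)\<^sup>2 * (real n)\<^sup>2" by (intro mult_mono) auto
  then show ?thesis using False by (simp add: fejer_def divide_simps)
qed (simp add: fejer_def)

lemma fejer_expand:
  "of_real (fejer n x) = (\<Sum>z\<in>sq n \<times> sq n. chi (df (fst z)) (df (snd z)) x) / of_nat (n\<^sup>2)"
proof -
  have "of_real (fejer n x) = (of_real ((norm (Dn n (x $ 1)))\<^sup>2) :: complex) * of_real ((norm (Dn n (x $ 2)))\<^sup>2) / of_nat (n\<^sup>2)"
    by (simp add: fejer_def)
  also have "of_real ((norm (Dn n (x $ 1)))\<^sup>2) * of_real ((norm (Dn n (x $ 2)))\<^sup>2)
     = (\<Sum>z\<in>sq n \<times> sq n. chi (df (fst z)) (df (snd z)) x)"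
    unfolding Dn_square sum_product sum.cartesian_product chi_def
    by (intro sum.cong refl) (auto simp: cis_mult distrib_left)
  finally show ?thesis .
qed

lemma integrable_Ubox_chi: "integrable lborel (\<lambda>x. indicator (Ubox c) x *\<^sub>R chi a b x)"
  by (intro integrable_Ubox[where B = 1]) auto

lemma integral_Dn_square:
  "(LINT x|lborel. indicator (Ubox (-1/2)) x *\<^sub>R (norm (Dn n (x $ i)))\<^sup>2) = real n"
proof -
  define ch where "ch z x = (if i = 1 then chi (df z) 0 x else chi 0 (df z) x)" for z x
  have c: "cis (2 * pi * (of_int (df z) * x $ i)) = ch z x" for z and x :: "real^2"
    using exhaust_2[of i] by (auto simp: chi_def ch_def)
  have ii: "integrable lborel (\<lambda>x. indicator (Ubox (-1/2)) x *\<^sub>R ch z x)" for z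
    unfolding ch_def by (cases "i = 1") (simp_all add: integrable_Ubox_chi)
  have "of_real (LINT x|lborel. indicator (Ubox (-1/2)) x *\<^sub>R (norm (Dn n (x $ i)))\<^sup>2)
     = (LINT x|lborel. of_real (indicator (Ubox (-1/2)) x *\<^sub>R (norm (Dn n (x $ i)))\<^sup>2) :: complex)"
    by (rule integral_complex_of_real[symmetric])
  also have "\<dots> = (LINT x|lborel. (\<Sum>z\<in>sq n. indicator (Ubox (-1/2)) x *\<^sub>R ch z x))"
  proof -
    have "complex_of_real ((norm (Dn n (x $ i)))\<^sup>2) = (\<Sum>z\<in>sq n. ch z x)" for x
      by (simp only: Dn_square c)
    then show ?thesis by (simp only: real_scaleR_def of_real_mult scaleR_conv_of_real sum_distrib_left)
  qed
  also have "\<dots> = (\<Sum>z\<in>sq n. LINT x|lborel. indicator (Ubox (-1/2)) x *\<^sub>R ch z x)"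
    by (rule Bochner_Integration.integral_sum) (rule ii)
  also have "\<dots> = (\<Sum>z\<in>sq n. if df z = 0 then 1 else 0)"
    by (intro sum.cong refl) (cases "i = 1"; simp only: ch_def if_True if_False chi_ortho simp_thms)
  also have "\<dots> = of_real (real n)" by (simp add: sum_df)
  finally show ?thesis by (simp only: of_real_eq_iff)
qed

lemma integral_fejer_mult:
  fixes f :: "real^2 \<Rightarrow> complex"
  assumes [measurable]: "f \<in> borel_measurable borel" and "\<And>x. norm (f x) \<le> B"
  shows "(LINT x|lborel. indicator (Ubox a) x *\<^sub>R (of_real (fejer n x) * f x))
    = (\<Sum>z\<in>sq n \<times> sq n. LINT x|lborel. indicator (Ubox a) x *\<^sub>R (chi (df (fst z)) (df (snd z)) x * f x)) / of_nat (n\<^sup>2)"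
proof -
  have ii: "integrable lborel (\<lambda>x. indicator (Ubox a) x *\<^sub>R (chi k l x * f x))" for k l
    by (intro integrable_Ubox[where B = B]) (auto simp: norm_mult assms(2))
  have "(LINT x|lborel. indicator (Ubox a) x *\<^sub>R (of_real (fejer n x) * f x))
     = (LINT x|lborel. (\<Sum>z\<in>sq n \<times> sq n. indicator (Ubox a) x *\<^sub>R (chi (df (fst z)) (df (snd z)) x * f x)) / of_nat (n\<^sup>2))"
    unfolding fejer_expand
    by (intro Bochner_Integration.integral_cong refl) (simp only: scaleR_conv_of_real sum_distrib_left sum_distrib_right times_divide_eq_left times_divide_eq_right)
  also have "\<dots> = (LINT x|lborel. (\<Sum>z\<in>sq n \<times> sq n. indicator (Ubox a) x *\<^sub>R (chi (df (fst z)) (df (snd z)) x * f x))) / of_nat (n\<^sup>2)"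
    by (rule integral_divide_zero)
  also have "(LINT x|lborel. (\<Sum>z\<in>sq n \<times> sq n. indicator (Ubox a) x *\<^sub>R (chi (df (fst z)) (df (snd z)) x * f x)))
     = (\<Sum>z\<in>sq n \<times> sq n. LINT x|lborel. indicator (Ubox a) x *\<^sub>R (chi (df (fst z)) (df (snd z)) x * f x))"
    by (rule Bochner_Integration.integral_sum) (rule ii)
  finally show ?thesis .
qed

lemma integral_fejer:
  assumes "n > 0"
  shows "(LINT x|lborel. indicator (Ubox (-1/2)) x *\<^sub>R fejer n x) = 1"
proof -
  have "of_real (LINT x|lborel. indicator (Ubox (-1/2)) x *\<^sub>R fejer n x)
     = (LINT x|lborel. of_real (indicator (Ubox (-1/2)) x *\<^sub>R fejer n x) :: complex)"
    by (rule integral_complex_of_real[symmetric])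
  also have "\<dots> = (LINT x|lborel. indicator (Ubox (-1/2)) x *\<^sub>R (of_real (fejer n x) * 1))"
    by (simp add: scaleR_conv_of_real)
  also have "\<dots> = (\<Sum>z\<in>sq n \<times> sq n. LINT x|lborel. indicator (Ubox (-1/2)) x *\<^sub>R (chi (df (fst z)) (df (snd z)) x * 1)) / of_nat (n\<^sup>2)"
    by (rule integral_fejer_mult[where B = 1]) auto
  also have "\<dots> = (\<Sum>z\<in>sq n \<times> sq n. (if df (fst z) = 0 then 1 else 0) * (if df (snd z) = 0 then 1 else 0)) / of_nat (n\<^sup>2)"
    by (intro arg_cong2[where f = "(/)"] sum.cong refl) (simp only: mult_1_right chi_ortho, simp)
  also have "(\<Sum>z\<in>sq n \<times> sq n. (if df (fst z) = 0 then 1 else 0) * (if df (snd z) = 0 then 1 else 0 :: complex))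
     = (\<Sum>z\<in>sq n. if df z = 0 then 1 else 0) * (\<Sum>z\<in>sq n. if df z = 0 then 1 else 0)"
    unfolding sum_product sum.cartesian_product by (intro sum.cong refl) auto
  also have "\<dots> / of_nat (n\<^sup>2) = of_real 1" unfolding sum_df using assms by (simp add: power2_eq_square)
  finally show ?thesis by (simp only: of_real_eq_iff)
qed

section \<open>Variance of a periodized function\<close>

lemma borel_measurable_cnj [measurable]:
  assumes "f \<in> borel_measurable M"
  shows "(\<lambda>x. cnj (f x)) \<in> borel_measurable M"
  using measurable_compose[OF assms, of cnj borel] borel_measurable_continuous_onI[of cnj]
  by (simp add: continuous_on_cnj)

text \<open>Continuity almost everywhere is what a profile with jumps provides. It is enough for
  continuity of the autocorrelation at 0, the only regularity that the Fejer argument uses.\<close>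

locale periodized =
  fixes q :: "real^2 \<Rightarrow> real" and K L :: real
  assumes q_measurable [measurable]: "q \<in> borel_measurable borel"
    and q_bound: "\<bar>q x\<bar> \<le> K"
    and q_support: "q x \<noteq> 0 \<Longrightarrow> \<bar>x $ i\<bar> \<le> L"
    and q_cont: "AE x in lborel. isCont q x"
    and L0: "L \<ge> 0"
begin

text \<open>The margin 3 makes the finite window exact for all translations with components of
  modulus at most 3. This covers the unit square and its shifts by
  \<open>Ubox (-1/2)\<close>.\<close>

definition W :: "(real^2) set" where "W = {w \<in> int_lattice. \<forall>i. \<bar>w $ i\<bar> \<le> L + 3}"

lemma finite_W: "finite W"
proof -
  have "W \<subseteq> (\<lambda>(a, b). vec2 (of_int a) (of_int b)) ` ({-\<lceil>L + 3\<rceil>..\<lceil>L + 3\<rceil>} \<times> {-\<lceil>L + 3\<rceil>..\<lceil>L + 3\<rceil>})"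
  proof
    fix w assume w: "w \<in> W"
    then have i: "w $ i \<in> \<int>" "\<bar>w $ i\<bar> \<le> L + 3" for i by (auto simp: W_def int_lattice_def)
    obtain a where a: "w $ 1 = of_int a" by (rule Ints_cases[OF i(1)[of 1]]) blast
    obtain b where b: "w $ 2 = of_int b" by (rule Ints_cases[OF i(1)[of 2]]) blast
    have "-\<lceil>L + 3\<rceil> \<le> k \<and> k \<le> \<lceil>L + 3\<rceil>" if "\<bar>of_int k :: real\<bar> \<le> L + 3" for k
      using that by linarith
    then have "(a, b) \<in> {-\<lceil>L + 3\<rceil>..\<lceil>L + 3\<rceil>} \<times> {-\<lceil>L + 3\<rceil>..\<lceil>L + 3\<rceil>}"
      using i(2)[of 1] i(2)[of 2] unfolding a b by auto
    moreover have "w = vec2 (of_int a) (of_int b)" using a b vec2_eta[of w] by simp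
    ultimately show "w \<in> (\<lambda>(a, b). vec2 (of_int a) (of_int b)) ` ({-\<lceil>L + 3\<rceil>..\<lceil>L + 3\<rceil>} \<times> {-\<lceil>L + 3\<rceil>..\<lceil>L + 3\<rceil>})"
      by (auto intro!: image_eqI[where x = "(a, b)"])
  qed
  then show ?thesis by (rule finite_subset) auto
qed

lemma W_lattice: "W \<subseteq> int_lattice" by (auto simp: W_def)

lemma K0: "K \<ge> 0" using q_bound[of 0] by linarith

text \<open>Agrees with the periodic lattice sum for moderate \<xi> only, see
  \<open>F_eq_infsum\<close>. As a finite sum it is measurable and bounded on the whole plane, and
  it inherits continuity almost everywhere.\<close>

definition F :: "real^2 \<Rightarrow> real" where "F \<xi> = (\<Sum>w\<in>W. q (w - \<xi>))"

definition M :: real where "M = card W * K"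

lemma F_measurable [measurable]: "F \<in> borel_measurable borel"
  unfolding F_def[abs_def] by measurable

lemma F_bound: "\<bar>F \<xi>\<bar> \<le> M"
  unfolding F_def M_def by (rule order_trans[OF sum_abs]) (use sum_bounded_above[of W "\<lambda>w. \<bar>q (w - \<xi>)\<bar>" K] q_bound in auto)

lemma M0: "M \<ge> 0" using K0 by (simp add: M_def)

lemma F_eq_infsum:
  assumes "\<And>i. \<bar>\<xi> $ i\<bar> \<le> 3"
  shows "(\<Sum>\<^sub>\<infinity>w\<in>int_lattice. q (w - \<xi>)) = F \<xi>"
proof -
  have "(\<Sum>\<^sub>\<infinity>w\<in>int_lattice. q (w - \<xi>)) = (\<Sum>\<^sub>\<infinity>w\<in>W. q (w - \<xi>))"
  proof (rule infsum_cong_neutral)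
    fix w assume "w \<in> int_lattice - W"
    then obtain i where "\<bar>w $ i\<bar> > L + 3" by (auto simp: W_def not_le)
    then have "\<bar>(w - \<xi>) $ i\<bar> > L" using assms[of i] by simp
    then show "q (w - \<xi>) = 0" using q_support[of "w - \<xi>" i] by fastforce
  qed (use W_lattice in auto)
  then show ?thesis by (simp add: F_def finite_W)
qed

lemma integrable_q:
  assumes [measurable]: "c \<in> borel_measurable borel" and "\<And>x. norm (c x :: complex) \<le> 1"
  shows "integrable lborel (\<lambda>x. of_real (q x) * c x)"
proof (rule integrable_bounded_on)
  show "cbox (vec2 (-L) (-L)) (vec2 L L) \<in> sets borel" by simp
  show "emeasure lborel (cbox (vec2 (-L) (-L)) (vec2 L L)) < \<infinity>" by (rule emeasure_lborel_cbox_finite)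
  show "norm (of_real (q x) * c x) \<le> K" for x
  proof -
    have "\<bar>q x\<bar> * norm (c x) \<le> K * 1" using q_bound K0 assms(2) by (intro mult_mono) auto
    then show ?thesis by (simp add: norm_mult)
  qed
  show "of_real (q x) * c x = 0" if "x \<notin> cbox (vec2 (-L) (-L)) (vec2 L L)" for x
  proof -
    have "q x = 0"
    proof (rule ccontr)
      assume "q x \<noteq> 0"
      then have "\<bar>x $ 1\<bar> \<le> L" "\<bar>x $ 2\<bar> \<le> L" using q_support by blast+
      then show False using that by (auto simp: mem_box_cart forall_2)
    qed
    then show ?thesis by simp
  qed
qed measurable

definition qh :: "int \<Rightarrow> int \<Rightarrow> complex" where
  "qh a b = (LINT y|lborel. of_real (q y) * cnj (chi a b y))"

text \<open>The slack of the window in each coordinate: |w_i| <= |w_i - y_i| + |y_i - \<xi>_i| +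
  |\<xi>_i| <= 1 + L + 1.\<close>

lemma cover:
  assumes "q (y - \<xi>) \<noteq> 0" "w \<in> int_lattice" "w - y \<in> Ubox a" "\<And>i. \<bar>\<xi> $ i\<bar> \<le> 1" "- 1 \<le> a" "a \<le> 0"
  shows "w \<in> W"
proof -
  have "\<bar>w $ i\<bar> \<le> L + 3" for i
  proof -
    have "\<bar>(y - \<xi>) $ i\<bar> \<le> L" by (rule q_support) fact
    then have "y $ i - \<xi> $ i \<le> L" "- L \<le> y $ i - \<xi> $ i" by (auto simp: abs_le_iff)
    moreover have "a \<le> w $ i - y $ i" "w $ i - y $ i < a + 1" using assms(3) by (auto simp: Ubox_def)
    moreover have "\<xi> $ i \<le> 1" "- 1 \<le> \<xi> $ i" using assms(4)[of i] by (auto simp: abs_le_iff)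
    ultimately show ?thesis using assms(5,6) by (intro abs_leI) linarith+
  qed
  then show ?thesis using assms(2) by (simp add: W_def)
qed

text \<open>Unfolding extends the cell integral to the plane. Since characters are 1 on the lattice,
  the translation \<xi> comes out as a factor; the minus sign in w - \<xi> is the reason why
  \<open>chi\<close> and not its conjugate stands under the integral.\<close>

lemma inner_transform:
  assumes \<xi>: "\<xi> \<in> Ubox 0"
  shows "(LINT \<tau>|lborel. indicator (Ubox (-1/2)) \<tau> *\<^sub>R (chi a b \<tau> * of_real (F (\<xi> + \<tau>)))) = cnj (chi a b \<xi>) * qh a b"
proof -
  define g where "g y = of_real (q (y - \<xi>)) * cnj (chi a b (y - \<xi>))" for y
  have qi: "integrable lborel (\<lambda>y. of_real (q y) * cnj (chi a b y))" by (intro integrable_q) auto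
  then have "integrable lborel (\<lambda>y. of_real (q (- \<xi> - y)) * cnj (chi a b (- \<xi> - y)))" by (rule lborel_integrable_reflect)
  then have "integrable lborel (\<lambda>y. of_real (q (- \<xi> - (0 - y))) * cnj (chi a b (- \<xi> - (0 - y))))" by (rule lborel_integrable_reflect)
  then have gi: "integrable lborel g" by (simp add: g_def[abs_def])
  have x1: "\<bar>\<xi> $ i\<bar> \<le> 1" for i using \<xi> by (auto simp: Ubox_def intro: less_imp_le)
  have "(LINT \<tau>|lborel. indicator (Ubox (-1/2)) \<tau> *\<^sub>R (\<Sum>w\<in>W. g (w - \<tau>))) = (LINT y|lborel. g y)"
    by (rule unfold_lattice_integral[OF gi finite_W W_lattice]) (rule cover[of _ \<xi>], auto simp: g_def x1)
  also have "(LINT y|lborel. g y) = qh a b"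
    unfolding g_def qh_def by (rule lborel_integral_shift[of "\<lambda>y. of_real (q y) * cnj (chi a b y)"])
      (use borel_measurable_integrable[OF qi] in simp)
  finally have A: "(LINT \<tau>|lborel. indicator (Ubox (-1/2)) \<tau> *\<^sub>R (\<Sum>w\<in>W. g (w - \<tau>))) = qh a b" .
  have S: "(\<Sum>w\<in>W. g (w - \<tau>)) = chi a b \<xi> * (chi a b \<tau> * of_real (F (\<xi> + \<tau>)))" for \<tau>
  proof -
    have "g (w - \<tau>) = chi a b \<xi> * (chi a b \<tau> * of_real (q (w - (\<xi> + \<tau>))))" if "w \<in> W" for w
    proof -
      have "chi a b (w + - v) = cnj (chi a b v)" for v
        unfolding chi_add[of a b w] chi_neg(2) using chi_lattice[of w a b] that W_lattice by auto
      from this[of "\<xi> + \<tau>"] have c0: "chi a b (w - (\<xi> + \<tau>)) = cnj (chi a b \<xi> * chi a b \<tau>)"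
        unfolding add_uminus_conv_diff chi_add .
      have eq: "w - \<tau> - \<xi> = w - (\<xi> + \<tau>)" by simp
      show ?thesis unfolding g_def eq c0 complex_cnj_cnj by (simp only: mult_ac)
    qed
    then show ?thesis by (simp add: F_def sum_distrib_left cong: sum.cong)
  qed
  have eq: "r *\<^sub>R (z * v) = z * (r *\<^sub>R v)" for r :: real and z v :: complex by simp
  have "chi a b \<xi> * (LINT \<tau>|lborel. indicator (Ubox (-1/2)) \<tau> *\<^sub>R (chi a b \<tau> * of_real (F (\<xi> + \<tau>)))) = qh a b"
    using A unfolding S eq[of _ "chi a b \<xi>"] integral_mult_right_zero .
  then have "cnj (chi a b \<xi>) * qh a b = (cnj (chi a b \<xi>) * chi a b \<xi>) * (LINT \<tau>|lborel. indicator (Ubox (-1/2)) \<tau> *\<^sub>R (chi a b \<tau> * of_real (F (\<xi> + \<tau>))))"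
    by simp
  also have "cnj (chi a b \<xi>) * chi a b \<xi> = 1" using complex_norm_square[of "chi a b \<xi>"] by (simp add: mult.commute)
  finally show ?thesis by simp
qed

lemma outer_transform:
  "(LINT \<xi>|lborel. indicator (Ubox 0) \<xi> *\<^sub>R (of_real (F \<xi>) * cnj (chi a b \<xi>))) = cnj (qh a b)"
proof -
  define g where "g y = of_real (q y) * chi a b y" for y
  have gi: "integrable lborel g" unfolding g_def by (intro integrable_q) auto
  have "(LINT \<xi>|lborel. indicator (Ubox 0) \<xi> *\<^sub>R (\<Sum>w\<in>W. g (w - \<xi>))) = (LINT y|lborel. g y)"
    by (rule unfold_lattice_integral[OF gi finite_W W_lattice]) (rule cover[of _ 0], auto simp: g_def)
  also have "(LINT y|lborel. g y) = cnj (qh a b)"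
    unfolding g_def qh_def Bochner_Integration.integral_cnj[symmetric] by simp
  finally have A: "(LINT \<xi>|lborel. indicator (Ubox 0) \<xi> *\<^sub>R (\<Sum>w\<in>W. g (w - \<xi>))) = cnj (qh a b)" .
  have S: "(\<Sum>w\<in>W. g (w - \<xi>)) = of_real (F \<xi>) * cnj (chi a b \<xi>)" for \<xi>
  proof -
    have "g (w - \<xi>) = of_real (q (w - \<xi>)) * cnj (chi a b \<xi>)" if "w \<in> W" for w
    proof -
      have "chi a b (w + - \<xi>) = cnj (chi a b \<xi>)"
        unfolding chi_add[of a b w] chi_neg(2) using chi_lattice[of w a b] that W_lattice by auto
      then show ?thesis by (simp add: g_def)
    qed
    then show ?thesis by (simp add: F_def sum_distrib_right cong: sum.cong)
  qed
  show ?thesis using A unfolding S .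
qed

text \<open>The Fejer means of the autocorrelation \<open>G\<close> at \<open>0\<close> are weighted sums of the squared Fourier
  coefficients, so continuity of \<open>G\<close> at \<open>0\<close> replaces the Parseval identity.\<close>

definition G :: "real^2 \<Rightarrow> real" where
  "G \<tau> = (LINT \<xi>|lborel. indicator (Ubox 0) \<xi> *\<^sub>R (F (\<xi> + \<tau>) * F \<xi>))"

lemma G_measurable [measurable]: "G \<in> borel_measurable borel"
proof -
  have "(\<lambda>\<tau>. LINT \<xi>|lborel. indicator (Ubox 0) \<xi> *\<^sub>R (F (\<xi> + \<tau>) * F \<xi>)) \<in> borel_measurable borel"
    by measurable
  then show ?thesis by (simp add: G_def[abs_def])
qed

lemma FF_bound: "\<bar>F x * F y\<bar> \<le> M\<^sup>2"
  unfolding abs_mult power2_eq_square using M0 by (intro mult_mono F_bound) auto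

lemma integrable_FF: "integrable lborel (\<lambda>\<xi>. indicator (Ubox 0) \<xi> *\<^sub>R (F (\<xi> + \<tau>) * F \<xi>))"
  by (rule integrable_Ubox[where B = "M\<^sup>2"]) (use FF_bound in auto)

lemma integral_Ubox_const: "(LINT x|lborel. indicator (Ubox a) x *\<^sub>R c) = (c :: real)"
proof -
  have "(LINT x|lborel. indicator (Ubox a) x *\<^sub>R c) = measure lborel (Ubox a) *\<^sub>R c"
    by (simp add: emeasure_Ubox measure_def)
  then show ?thesis by (simp add: emeasure_Ubox measure_def)
qed

lemma G_bound: "\<bar>G \<tau>\<bar> \<le> M\<^sup>2"
proof -
  have "norm (G \<tau>) \<le> (LINT \<xi>|lborel. indicator (Ubox 0) \<xi> *\<^sub>R M\<^sup>2)"
    unfolding G_def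
    by (rule Bochner_Integration.integral_norm_bound_integral[OF integrable_FF integrable_Ubox[where B = "M\<^sup>2"]])
      (use FF_bound in \<open>auto split: split_indicator\<close>)
  then show ?thesis unfolding integral_Ubox_const by simp
qed

text \<open>By Fubini the unfoldings in \<tau> and in \<xi> can be done one after the other; they
  contribute the coefficient and its conjugate.\<close>

lemma G_transform:
  "(LINT \<tau>|lborel. indicator (Ubox (-1/2)) \<tau> *\<^sub>R (chi a b \<tau> * of_real (G \<tau>))) = of_real ((norm (qh a b))\<^sup>2)"
proof -
  define f where "f \<tau> \<xi> = indicator (Ubox (-1/2)) \<tau> *\<^sub>R (indicator (Ubox 0) \<xi> *\<^sub>R (chi a b \<tau> * of_real (F (\<xi> + \<tau>) * F \<xi>)))" for \<tau> \<xi>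
  have fi: "integrable (lborel \<Otimes>\<^sub>M lborel) (\<lambda>(\<tau>, \<xi>). f \<tau> \<xi>)"
  proof (rule integrableI_bounded_set[where A = "Ubox (-1/2) \<times> Ubox 0" and B = "M\<^sup>2"])
    show "emeasure (lborel \<Otimes>\<^sub>M lborel) (Ubox (-1/2) \<times> Ubox 0) < \<infinity>"
      by (subst lborel.emeasure_pair_measure_Times) (auto simp: emeasure_Ubox)
    show "(\<lambda>(\<tau>, \<xi>). f \<tau> \<xi>) \<in> borel_measurable (lborel \<Otimes>\<^sub>M lborel)" unfolding f_def by measurable
    show "AE x in lborel \<Otimes>\<^sub>M lborel. x \<in> Ubox (-1/2) \<times> Ubox 0 \<longrightarrow> norm (case x of (\<tau>, \<xi>) \<Rightarrow> f \<tau> \<xi>) \<le> M\<^sup>2"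
      using FF_bound by (intro AE_I2) (auto simp: f_def norm_mult abs_mult)
    show "AE x in lborel \<Otimes>\<^sub>M lborel. x \<notin> Ubox (-1/2) \<times> Ubox 0 \<longrightarrow> (case x of (\<tau>, \<xi>) \<Rightarrow> f \<tau> \<xi>) = 0"
      by (intro AE_I2) (auto simp: f_def indicator_def)
  qed auto
  have "(LINT \<tau>|lborel. indicator (Ubox (-1/2)) \<tau> *\<^sub>R (chi a b \<tau> * of_real (G \<tau>))) = (LINT \<tau>|lborel. LINT \<xi>|lborel. f \<tau> \<xi>)"
  proof (intro Bochner_Integration.integral_cong refl)
    fix \<tau> :: "real^2"
    have "of_real (G \<tau>) = (LINT \<xi>|lborel. of_real (indicator (Ubox 0) \<xi> *\<^sub>R (F (\<xi> + \<tau>) * F \<xi>)) :: complex)"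
      unfolding G_def by (rule integral_complex_of_real[symmetric])
    then have "chi a b \<tau> * of_real (G \<tau>) = (LINT \<xi>|lborel. chi a b \<tau> * of_real (indicator (Ubox 0) \<xi> *\<^sub>R (F (\<xi> + \<tau>) * F \<xi>)))"
      by simp
    then have "indicator (Ubox (-1/2)) \<tau> *\<^sub>R (chi a b \<tau> * of_real (G \<tau>)) = (LINT \<xi>|lborel. indicator (Ubox (-1/2)) \<tau> *\<^sub>R (chi a b \<tau> * of_real (indicator (Ubox 0) \<xi> *\<^sub>R (F (\<xi> + \<tau>) * F \<xi>))))"
      by simp
    also have "\<dots> = (LINT \<xi>|lborel. f \<tau> \<xi>)"
      unfolding f_def by (intro Bochner_Integration.integral_cong refl) (simp add: scaleR_conv_of_real mult_ac)
    finally show "indicator (Ubox (-1/2)) \<tau> *\<^sub>R (chi a b \<tau> * of_real (G \<tau>)) = (LINT \<xi>|lborel. f \<tau> \<xi>)" .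
  qed
  also have "\<dots> = (LINT \<xi>|lborel. LINT \<tau>|lborel. f \<tau> \<xi>)"
    by (rule lborel_pair.Fubini_integral[OF fi, symmetric])
  also have "\<dots> = (LINT \<xi>|lborel. indicator (Ubox 0) \<xi> *\<^sub>R (of_real (F \<xi>) * cnj (chi a b \<xi>)) * qh a b)"
  proof (intro Bochner_Integration.integral_cong refl)
    fix \<xi> :: "real^2"
    show "(LINT \<tau>|lborel. f \<tau> \<xi>) = indicator (Ubox 0) \<xi> *\<^sub>R (of_real (F \<xi>) * cnj (chi a b \<xi>)) * qh a b"
    proof (cases "\<xi> \<in> Ubox 0")
      case True
      have "(LINT \<tau>|lborel. f \<tau> \<xi>) = (LINT \<tau>|lborel. of_real (F \<xi>) * (indicator (Ubox (-1/2)) \<tau> *\<^sub>R (chi a b \<tau> * of_real (F (\<xi> + \<tau>)))))"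
        unfolding f_def using True by (intro Bochner_Integration.integral_cong refl) (simp add: scaleR_conv_of_real mult_ac)
      also have "\<dots> = of_real (F \<xi>) * (cnj (chi a b \<xi>) * qh a b)"
        unfolding integral_mult_right_zero inner_transform[OF True] ..
      finally show ?thesis using True by (simp add: mult_ac)
    qed (simp add: f_def)
  qed
  also have "\<dots> = cnj (qh a b) * qh a b" unfolding integral_mult_left_zero outer_transform ..
  also have "\<dots> = of_real ((norm (qh a b))\<^sup>2)" unfolding complex_norm_square by (rule mult.commute)
  finally show ?thesis .
qed

text \<open>Dominated convergence: at almost every \<xi> all the finitely many summands of F are
  continuous, hence F (\<xi> + \<tau>) tends to F \<xi> as \<tau> tends to 0.\<close>

lemma isCont_G0: "isCont G 0"
proof -
  have AEq: "AE \<xi> in lborel. isCont F \<xi>"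
  proof -
    have "AE \<xi> in lborel. \<forall>w\<in>W. isCont q (w - \<xi>)"
      using finite_W AE_lborel_reflect[OF q_cont] by (intro AE_finite_allI) auto
    then show ?thesis
    proof eventually_elim
      case (elim \<xi>)
      show ?case unfolding F_def[abs_def]
      proof (rule continuous_sum)
        fix w assume "w \<in> W"
        then have "isCont q (w - \<xi>)" using elim by simp
        moreover have "isCont (\<lambda>\<xi>. w - \<xi>) \<xi>" by (intro continuous_intros)
        ultimately show "isCont (\<lambda>\<xi>. q (w - \<xi>)) \<xi>" using isCont_o2[of \<xi> "\<lambda>\<xi>. w - \<xi>" q] by auto
      qed
    qed
  qed
  have "(\<lambda>k. G (X k)) \<longlonglongrightarrow> G 0" if X: "X \<longlonglongrightarrow> 0" for X :: "nat \<Rightarrow> real^2"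
    unfolding G_def
  proof (rule integral_dominated_convergence[where w = "\<lambda>\<xi>. indicator (Ubox 0) \<xi> *\<^sub>R M\<^sup>2"])
    show "integrable lborel (\<lambda>\<xi>. indicator (Ubox 0) \<xi> *\<^sub>R M\<^sup>2 :: real)" by (rule integrable_Ubox[where B = "M\<^sup>2"]) auto
    show "AE \<xi> in lborel. (\<lambda>k. indicator (Ubox 0) \<xi> *\<^sub>R (F (\<xi> + X k) * F \<xi>)) \<longlonglongrightarrow> indicator (Ubox 0) \<xi> *\<^sub>R (F (\<xi> + 0) * F \<xi>)"
      using AEq
    proof eventually_elim
      case (elim \<xi>)
      have "(\<lambda>k. \<xi> + X k) \<longlonglongrightarrow> \<xi> + 0" by (intro tendsto_intros X)
      then have "(\<lambda>k. F (\<xi> + X k)) \<longlonglongrightarrow> F (\<xi> + 0)"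
        by (rule isCont_tendsto_compose[rotated]) (use elim in simp)
      then show ?case by (intro tendsto_intros)
    qed
    show "AE \<xi> in lborel. norm (indicator (Ubox 0) \<xi> *\<^sub>R (F (\<xi> + X k) * F \<xi>)) \<le> indicator (Ubox 0) \<xi> *\<^sub>R M\<^sup>2" for k
      using FF_bound by (intro AE_I2) (auto split: split_indicator)
  qed measurable
  then show ?thesis unfolding continuous_at_sequentially by (auto simp: o_def)
qed

end

section \<open>Convergence of the Fejer means\<close>

context periodized
begin

text \<open>The approximate identity argument at the single point 0: near it the continuity of G is
  used, elsewhere only the bound M^2.\<close>

lemma fejer_limit: "(\<lambda>n. LINT \<tau>|lborel. indicator (Ubox (-1/2)) \<tau> *\<^sub>R (fejer n \<tau> * G \<tau>)) \<longlonglongrightarrow> G 0"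
proof (rule LIMSEQ_I)
  fix r :: real assume r: "r > 0"
  obtain d0 where d0: "d0 > 0" "\<And>\<tau>. norm \<tau> < d0 \<Longrightarrow> \<bar>G \<tau> - G 0\<bar> < r/2"
    using isCont_G0 r unfolding continuous_at_eps_delta dist_norm real_norm_def diff_zero by (meson half_gt_zero)
  \<comment> \<open>A quarter of \<open>d0\<close>, so that the sum of both coordinates stays below
    \<open>d0\<close> when each is below d; at most 1/2 because the cell ends there.\<close>
  define d where "d = min (d0/4) (1/2)"
  have d: "0 < d" "d \<le> 1/2" using d0 by (auto simp: d_def)
  define s where "s = 1 / (sin (pi * d))\<^sup>2"
  have s0: "s \<ge> 0" by (simp add: s_def)
  obtain N :: nat where N: "N > 0" "8 * M\<^sup>2 * s / r < real N"
  proof -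
    obtain N0 :: nat where "8 * M\<^sup>2 * s / r < real N0" using reals_Archimedean2 by blast
    then show thesis by (intro that[of "Suc N0"]) auto
  qed
  show "\<exists>no. \<forall>n\<ge>no. norm ((LINT \<tau>|lborel. indicator (Ubox (-1/2)) \<tau> *\<^sub>R (fejer n \<tau> * G \<tau>)) - G 0) < r"
  proof (intro exI[of _ N] allI impI)
    fix n assume n: "n \<ge> N"
    then have n0: "real n > 0" "n > 0" using N(1) by simp_all
    \<comment> \<open>Away from the origin one coordinate has modulus at least d, where the squared
      Dirichlet sum is at most s. The other factor is kept and integrates to n, so each of the two
      coordinates contributes n c, of order 1/n.\<close>
    define c where "c = 2 * M\<^sup>2 * s / (real n)\<^sup>2"
    let ?U = "indicator (Ubox (-1/2)) :: real^2 \<Rightarrow> real"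
    have i1: "integrable lborel (\<lambda>\<tau>. ?U \<tau> *\<^sub>R (fejer n \<tau> * G \<tau>))"
    proof (rule integrable_Ubox[where B = "(real n)\<^sup>2 * M\<^sup>2"])
      fix x show "norm (fejer n x * G x) \<le> (real n)\<^sup>2 * M\<^sup>2"
        unfolding norm_mult using G_bound fejer_le[of n x] fejer_nonneg[of n x] by (intro mult_mono) auto
    qed measurable
    have i2: "integrable lborel (\<lambda>\<tau>. ?U \<tau> *\<^sub>R fejer n \<tau>)"
      by (rule integrable_Ubox[where B = "(real n)\<^sup>2"]) (use fejer_le fejer_nonneg in auto)
    have i3: "integrable lborel (\<lambda>\<tau>. ?U \<tau> *\<^sub>R (norm (Dn n (\<tau> $ i)))\<^sup>2)" for i
      by (rule integrable_Ubox[where B = "(real n)\<^sup>2"]) (auto intro!: power_mono norm_Dn_le)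
    have "(LINT \<tau>|lborel. ?U \<tau> *\<^sub>R (fejer n \<tau> * G \<tau>)) - G 0
      = (LINT \<tau>|lborel. ?U \<tau> *\<^sub>R (fejer n \<tau> * G \<tau>)) - (LINT \<tau>|lborel. (?U \<tau> *\<^sub>R fejer n \<tau>) * G 0)"
      unfolding integral_mult_left_zero integral_fejer[OF n0(2)] by simp
    also have "\<dots> = (LINT \<tau>|lborel. ?U \<tau> *\<^sub>R (fejer n \<tau> * G \<tau>) - (?U \<tau> *\<^sub>R fejer n \<tau>) * G 0)"
      by (rule Bochner_Integration.integral_diff[symmetric, OF i1], rule integrable_mult_left, rule i2)
    finally have E: "(LINT \<tau>|lborel. ?U \<tau> *\<^sub>R (fejer n \<tau> * G \<tau>)) - G 0 = (LINT \<tau>|lborel. ?U \<tau> *\<^sub>R (fejer n \<tau> * G \<tau>) - (?U \<tau> *\<^sub>R fejer n \<tau>) * G 0)" .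
    have "norm (LINT \<tau>|lborel. ?U \<tau> *\<^sub>R (fejer n \<tau> * G \<tau>) - (?U \<tau> *\<^sub>R fejer n \<tau>) * G 0) \<le> (LINT \<tau>|lborel. (?U \<tau> *\<^sub>R fejer n \<tau>) * (r/2) + ((?U \<tau> *\<^sub>R (norm (Dn n (\<tau> $ 1)))\<^sup>2) * c + (?U \<tau> *\<^sub>R (norm (Dn n (\<tau> $ 2)))\<^sup>2) * c))"
    proof (rule Bochner_Integration.integral_norm_bound_integral)
      show "integrable lborel (\<lambda>\<tau>. ?U \<tau> *\<^sub>R (fejer n \<tau> * G \<tau>) - (?U \<tau> *\<^sub>R fejer n \<tau>) * G 0)"
        by (intro Bochner_Integration.integrable_diff[OF i1], rule integrable_mult_left, rule i2)
      show "integrable lborel (\<lambda>\<tau>. (?U \<tau> *\<^sub>R fejer n \<tau>) * (r/2) + ((?U \<tau> *\<^sub>R (norm (Dn n (\<tau> $ 1)))\<^sup>2) * c + (?U \<tau> *\<^sub>R (norm (Dn n (\<tau> $ 2)))\<^sup>2) * c))"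
        by (rule Bochner_Integration.integrable_add, rule integrable_mult_left, rule i2,
            rule Bochner_Integration.integrable_add; rule integrable_mult_left; rule i3)
      fix \<tau> :: "real^2"
      show "norm (?U \<tau> *\<^sub>R (fejer n \<tau> * G \<tau>) - (?U \<tau> *\<^sub>R fejer n \<tau>) * G 0) \<le>
        (?U \<tau> *\<^sub>R fejer n \<tau>) * (r/2) + ((?U \<tau> *\<^sub>R (norm (Dn n (\<tau> $ 1)))\<^sup>2) * c + (?U \<tau> *\<^sub>R (norm (Dn n (\<tau> $ 2)))\<^sup>2) * c)"
      proof (cases "\<tau> \<in> Ubox (-1/2)")
        case True
        have half: "\<bar>\<tau> $ i\<bar> \<le> 1/2" for i
        proof -
          have "-1/2 \<le> \<tau> $ i" "\<tau> $ i < -1/2 + 1" using True by (auto simp: Ubox_def)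
          then show ?thesis by (intro abs_leI) linarith+
        qed
        have "?U \<tau> = 1" using True by simp
        moreover have "fejer n \<tau> * G \<tau> - fejer n \<tau> * G 0 = fejer n \<tau> * (G \<tau> - G 0)" by (simp add: right_diff_distrib)
        ultimately have eq: "norm (?U \<tau> *\<^sub>R (fejer n \<tau> * G \<tau>) - (?U \<tau> *\<^sub>R fejer n \<tau>) * G 0) = fejer n \<tau> * \<bar>G \<tau> - G 0\<bar>"
          using fejer_nonneg[of n \<tau>] by (simp only: scaleR_one real_norm_def abs_mult abs_of_nonneg)
        have GG: "\<bar>G \<tau> - G 0\<bar> \<le> 2 * M\<^sup>2" using G_bound[of \<tau>] G_bound[of 0] by linarith
        have c0: "c \<ge> 0" using s0 by (simp add: c_def)
        have far: "fejer n \<tau> * \<bar>G \<tau> - G 0\<bar> \<le> (norm (Dn n (\<tau> $ j)))\<^sup>2 * c"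
          if "d \<le> \<bar>\<tau> $ i\<bar>" "{i, j} = {1, 2}" for i j
        proof -
          have "(norm (Dn n (\<tau> $ i)))\<^sup>2 \<le> s" unfolding s_def by (rule Dn_bound[OF d that(1) half])
          then have "(norm (Dn n (\<tau> $ j)))\<^sup>2 * (norm (Dn n (\<tau> $ i)))\<^sup>2 / (real n)\<^sup>2 \<le> (norm (Dn n (\<tau> $ j)))\<^sup>2 * s / (real n)\<^sup>2"
            by (intro divide_right_mono mult_left_mono) auto
          moreover have "fejer n \<tau> = (norm (Dn n (\<tau> $ j)))\<^sup>2 * (norm (Dn n (\<tau> $ i)))\<^sup>2 / (real n)\<^sup>2"
            using that(2) by (auto simp: fejer_def doubleton_eq_iff mult.commute)
          ultimately have "fejer n \<tau> \<le> (norm (Dn n (\<tau> $ j)))\<^sup>2 * s / (real n)\<^sup>2" by simp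
          then have "fejer n \<tau> * \<bar>G \<tau> - G 0\<bar> \<le> ((norm (Dn n (\<tau> $ j)))\<^sup>2 * s / (real n)\<^sup>2) * (2 * M\<^sup>2)"
            using GG s0 by (intro mult_mono) auto
          then show ?thesis by (simp add: c_def mult_ac)
        qed
        consider "d \<le> \<bar>\<tau> $ 1\<bar>" | "d \<le> \<bar>\<tau> $ 2\<bar>" | "\<bar>\<tau> $ 1\<bar> < d" "\<bar>\<tau> $ 2\<bar> < d" by linarith
        then have "fejer n \<tau> * \<bar>G \<tau> - G 0\<bar> \<le> fejer n \<tau> * (r/2) + ((norm (Dn n (\<tau> $ 1)))\<^sup>2 * c + (norm (Dn n (\<tau> $ 2)))\<^sup>2 * c)"
        proof cases
          case 1
          have "0 \<le> fejer n \<tau> * (r/2)" "0 \<le> (norm (Dn n (\<tau> $ 1)))\<^sup>2 * c" using r c0 fejer_nonneg by auto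
          with far[OF 1, of 2] show ?thesis by simp
        next
          case 2
          have "0 \<le> fejer n \<tau> * (r/2)" "0 \<le> (norm (Dn n (\<tau> $ 2)))\<^sup>2 * c" using r c0 fejer_nonneg by auto
          with far[OF 2, of 1] show ?thesis by (simp add: insert_commute)
        next
          case 3
          have "norm \<tau> \<le> \<bar>\<tau> $ 1\<bar> + \<bar>\<tau> $ 2\<bar>" using norm_le_l1_cart[of \<tau>] by (simp add: sum_2)
          also have "\<dots> < d0" using 3 d0(1) by (simp add: d_def)
          finally have "\<bar>G \<tau> - G 0\<bar> < r/2" by (rule d0(2))
          then have "fejer n \<tau> * \<bar>G \<tau> - G 0\<bar> \<le> fejer n \<tau> * (r/2)" using fejer_nonneg by (intro mult_left_mono) auto
          moreover have "0 \<le> (norm (Dn n (\<tau> $ 1)))\<^sup>2 * c" "0 \<le> (norm (Dn n (\<tau> $ 2)))\<^sup>2 * c" using c0 by auto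
          ultimately show ?thesis by linarith
        qed
        then show ?thesis unfolding eq using True by simp
      qed simp
    qed
    also have "\<dots> = r/2 + (real n * c + real n * c)"
    proof -
      have j1: "integrable lborel (\<lambda>\<tau>. (?U \<tau> *\<^sub>R fejer n \<tau>) * (r/2))" by (rule integrable_mult_left, rule i2)
      have j2: "integrable lborel (\<lambda>\<tau>. (?U \<tau> *\<^sub>R (norm (Dn n (\<tau> $ i)))\<^sup>2) * c)" for i
        by (rule integrable_mult_left, rule i3)
      show ?thesis
        unfolding Bochner_Integration.integral_add[OF j1 Bochner_Integration.integrable_add[OF j2[of 1] j2[of 2]]]
          Bochner_Integration.integral_add[OF j2[of 1] j2[of 2]] integral_mult_left_zero
          integral_fejer[OF n0(2)] integral_Dn_square by simp
    qed
    finally have B: "norm (LINT \<tau>|lborel. ?U \<tau> *\<^sub>R (fejer n \<tau> * G \<tau>) - (?U \<tau> *\<^sub>R fejer n \<tau>) * G 0) \<le> r/2 + (real n * c + real n * c)" .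
    have "real n * c + real n * c = 4 * M\<^sup>2 * s / real n" using n0 by (simp add: c_def power2_eq_square)
    also have "4 * M\<^sup>2 * s / real n < r / 2"
    proof -
      have "8 * M\<^sup>2 * s / r < real n" using N(2) n by linarith
      then have "8 * M\<^sup>2 * s < real n * r" using r by (simp add: pos_divide_less_eq)
      then show ?thesis using n0 r by (simp add: pos_divide_less_eq mult.commute)
    qed
    finally show "norm ((LINT \<tau>|lborel. ?U \<tau> *\<^sub>R (fejer n \<tau> * G \<tau>)) - G 0) < r" using B unfolding E by simp
  qed
qed

lemma fejer_sum:
  "(LINT \<tau>|lborel. indicator (Ubox (-1/2)) \<tau> *\<^sub>R (fejer n \<tau> * G \<tau>))
    = (\<Sum>z\<in>sq n \<times> sq n. (norm (qh (df (fst z)) (df (snd z))))\<^sup>2) / (real n)\<^sup>2"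
proof -
  have "of_real (LINT \<tau>|lborel. indicator (Ubox (-1/2)) \<tau> *\<^sub>R (fejer n \<tau> * G \<tau>))
    = (LINT \<tau>|lborel. of_real (indicator (Ubox (-1/2)) \<tau> *\<^sub>R (fejer n \<tau> * G \<tau>)) :: complex)"
    by (rule integral_complex_of_real[symmetric])
  also have "\<dots> = (LINT \<tau>|lborel. indicator (Ubox (-1/2)) \<tau> *\<^sub>R (of_real (fejer n \<tau>) * of_real (G \<tau>)))"
    by (simp add: scaleR_conv_of_real)
  also have "\<dots> = (\<Sum>z\<in>sq n \<times> sq n. LINT \<tau>|lborel. indicator (Ubox (-1/2)) \<tau> *\<^sub>R (chi (df (fst z)) (df (snd z)) \<tau> * of_real (G \<tau>))) / of_nat (n\<^sup>2)"
    by (rule integral_fejer_mult[where B = "M\<^sup>2"]) (use G_bound in auto)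
  also have "\<dots> = of_real ((\<Sum>z\<in>sq n \<times> sq n. (norm (qh (df (fst z)) (df (snd z))))\<^sup>2) / (real n)\<^sup>2)"
    unfolding G_transform by simp
  finally show ?thesis by (simp only: of_real_eq_iff)
qed

text \<open>Exactly n^2 pairs have both differences 0, and each carries I^2, so dropping them
  subtracts I^2 from the Fejer mean of G. On the other side F has mean I over the cell, whence G 0 -
  I^2 is its variance.\<close>

lemma variance_limit:
  assumes I: "qh 0 0 = of_real I"
  shows "(\<lambda>n. (\<Sum>z\<in>{z \<in> sq n \<times> sq n. (df (fst z), df (snd z)) \<noteq> (0, 0)}. (norm (qh (df (fst z)) (df (snd z))))\<^sup>2) / (real n)\<^sup>2)
    \<longlonglongrightarrow> (LINT \<xi>|lborel. indicator (Ubox 0) \<xi> *\<^sub>R (F \<xi> - I)\<^sup>2)"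
proof -
  have iF: "integrable lborel (\<lambda>\<xi>. indicator (Ubox 0) \<xi> *\<^sub>R F \<xi>)" "integrable lborel (\<lambda>\<xi>. indicator (Ubox 0) \<xi> *\<^sub>R (F \<xi>)\<^sup>2)"
    "integrable lborel (\<lambda>\<xi>. indicator (Ubox 0) \<xi> *\<^sub>R I\<^sup>2)"
    subgoal by (rule integrable_Ubox[where B = M]) (use F_bound in auto)
    subgoal using integrable_FF[of 0] by (simp add: power2_eq_square)
    subgoal by (rule integrable_Ubox[where B = "I\<^sup>2"]) auto
    done
  have "of_real (LINT \<xi>|lborel. indicator (Ubox 0) \<xi> *\<^sub>R F \<xi>) = (LINT \<xi>|lborel. of_real (indicator (Ubox 0) \<xi> *\<^sub>R F \<xi>) :: complex)"
    by (rule integral_complex_of_real[symmetric])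
  also have "\<dots> = cnj (qh 0 0)" unfolding outer_transform[of 0 0, symmetric] by (simp add: chi_def scaleR_conv_of_real)
  finally have m: "(LINT \<xi>|lborel. indicator (Ubox 0) \<xi> *\<^sub>R F \<xi>) = I"
    unfolding I by (simp only: complex_cnj_complex_of_real of_real_eq_iff)
  have "(LINT \<xi>|lborel. indicator (Ubox 0) \<xi> *\<^sub>R (F \<xi> - I)\<^sup>2)
     = (LINT \<xi>|lborel. (indicator (Ubox 0) \<xi> *\<^sub>R (F \<xi>)\<^sup>2 + indicator (Ubox 0) \<xi> *\<^sub>R I\<^sup>2) - (indicator (Ubox 0) \<xi> *\<^sub>R F \<xi>) * (2 * I))"
    by (intro Bochner_Integration.integral_cong refl) (simp add: power2_eq_square algebra_simps)
  also have "\<dots> = ((LINT \<xi>|lborel. indicator (Ubox 0) \<xi> *\<^sub>R (F \<xi>)\<^sup>2) + (LINT \<xi>|lborel. indicator (Ubox 0) \<xi> *\<^sub>R I\<^sup>2)) - (LINT \<xi>|lborel. indicator (Ubox 0) \<xi> *\<^sub>R F \<xi>) * (2 * I)"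
  proof -
    have k: "integrable lborel (\<lambda>\<xi>. (indicator (Ubox 0) \<xi> *\<^sub>R F \<xi>) * (2 * I))" by (rule integrable_mult_left, rule iF)
    show ?thesis
      unfolding Bochner_Integration.integral_diff[OF Bochner_Integration.integrable_add[OF iF(2,3)] k]
        Bochner_Integration.integral_add[OF iF(2,3)] integral_mult_left_zero ..
  qed
  also have "\<dots> = G 0 - I\<^sup>2" unfolding m integral_Ubox_const G_def by (simp add: power2_eq_square)
  finally have V: "(LINT \<xi>|lborel. indicator (Ubox 0) \<xi> *\<^sub>R (F \<xi> - I)\<^sup>2) = G 0 - I\<^sup>2" .
  have lim: "(\<lambda>n. (\<Sum>z\<in>sq n \<times> sq n. (norm (qh (df (fst z)) (df (snd z))))\<^sup>2) / (real n)\<^sup>2 - I\<^sup>2) \<longlonglongrightarrow> G 0 - I\<^sup>2"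
    using fejer_limit unfolding fejer_sum by (intro tendsto_intros)
  have "\<forall>\<^sub>F n in sequentially. (\<Sum>z\<in>sq n \<times> sq n. (norm (qh (df (fst z)) (df (snd z))))\<^sup>2) / (real n)\<^sup>2 - I\<^sup>2
     = (\<Sum>z\<in>{z \<in> sq n \<times> sq n. (df (fst z), df (snd z)) \<noteq> (0, 0)}. (norm (qh (df (fst z)) (df (snd z))))\<^sup>2) / (real n)\<^sup>2"
    using eventually_gt_at_top[of 0]
  proof eventually_elim
    case (elim n)
    let ?A = "{z \<in> sq n \<times> sq n. (df (fst z), df (snd z)) \<noteq> (0, 0)}" and ?B = "{z \<in> sq n. df z = 0} \<times> {z \<in> sq n. df z = 0}"
    let ?s = "\<lambda>z. (norm (qh (df (fst z)) (df (snd z))))\<^sup>2"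
    have U: "sq n \<times> sq n = ?A \<union> ?B" by auto
    have "sum ?s (sq n \<times> sq n) = sum ?s (?A \<union> ?B)" by (rule arg_cong[OF U])
    also have "\<dots> = sum ?s ?A + sum ?s ?B" by (rule sum.union_disjoint) auto
    finally have "(\<Sum>z\<in>sq n \<times> sq n. (norm (qh (df (fst z)) (df (snd z))))\<^sup>2) = (\<Sum>z\<in>?A. (norm (qh (df (fst z)) (df (snd z))))\<^sup>2) + (\<Sum>z\<in>?B. (norm (qh (df (fst z)) (df (snd z))))\<^sup>2)"
      .
    also have "(\<Sum>z\<in>?B. (norm (qh (df (fst z)) (df (snd z))))\<^sup>2) = (\<Sum>z\<in>?B. I\<^sup>2)" by (intro sum.cong refl) (auto simp: I)
    also have "\<dots> = (real n)\<^sup>2 * I\<^sup>2"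
    proof -
      have "{z \<in> sq n. df z = 0} = (\<lambda>i. (i, i)) ` {..<n}" by (auto simp: sq_def df_def)
      then have "card {z \<in> sq n. df z = 0} = n" by (simp add: card_image inj_on_def)
      then show ?thesis by (simp add: card_cartesian_product power2_eq_square)
    qed
    finally show ?case using elim by (simp add: add_divide_distrib)
  qed
  from Lim_transform_eventually[OF lim this] show ?thesis unfolding V .
qed

end

section \<open>Convex curves\<close>

lemma periodic_of_int:
  fixes f :: "real \<Rightarrow> 'a"
  assumes "\<And>t. f (t + 1) = f t"
  shows "f (t + of_int k) = f t"
proof -
  have nat: "f (t + real n) = f t" for n t
  proof (induction n)
    case (Suc n)
    have "f (t + real (Suc n)) = f ((t + real n) + 1)" by (simp add: algebra_simps)
    then show ?case using assms Suc by metis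
  qed simp
  show ?thesis
  proof (cases "k \<ge> 0")
    case True
    then show ?thesis using nat[of t "nat k"] by simp
  next
    case False
    then show ?thesis using nat[of "t + of_int k" "nat (- k)"] by simp
  qed
qed

lemma periodic_reduce:
  fixes t :: real
  obtains k :: int where "t - of_int k \<in> {0..<1}"
proof (rule that[of "\<lfloor>t\<rfloor>"])
  show "t - of_int \<lfloor>t\<rfloor> \<in> {0..<1}" using floor_correct[of t] unfolding atLeastLessThan_iff by linarith
qed

text \<open>The quotient of the two Caratheodory slopes is the difference quotient of u, so
  continuity of u at the point is promoted to differentiability. This is applied to the parameter of
  a curve that moves inside a level set.\<close>

lemma DERIV_implicit:
  fixes u \<rho> :: "real \<Rightarrow> real"
  assumes r: "(\<rho> has_real_derivative D) (at (u a))" and D: "D \<noteq> 0" and u: "isCont u a"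
    and c: "((\<lambda>\<tau>. \<rho> (u \<tau>)) has_real_derivative E) (at a)"
  shows "(u has_real_derivative E / D) (at a)"
proof -
  from r obtain g where g: "\<And>z. \<rho> z - \<rho> (u a) = g z * (z - u a)" "isCont g (u a)" "g (u a) = D"
    unfolding CARAT_DERIV by blast
  from c obtain h where h: "\<And>z. \<rho> (u z) - \<rho> (u a) = h z * (z - a)" "isCont h a" "h a = E"
    unfolding CARAT_DERIV by blast
  have gc: "isCont (\<lambda>\<tau>. g (u \<tau>)) a" using isCont_o2[OF u g(2)] .
  have "\<forall>\<^sub>F \<tau> in at a. g (u \<tau>) \<noteq> 0"
    using gc D unfolding continuous_at g(3)[symmetric] by (rule tendsto_imp_eventually_ne)
  then have ev: "\<forall>\<^sub>F \<tau> in at a. (u \<tau> - u a) / (\<tau> - a) = h \<tau> / g (u \<tau>)"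
    using eventually_neq_at_within[of a a UNIV]
  proof eventually_elim
    case (elim \<tau>)
    have "g (u \<tau>) * (u \<tau> - u a) = h \<tau> * (\<tau> - a)" using g(1)[of "u \<tau>"] h(1)[of \<tau>] by simp
    then show ?case using elim by (simp add: divide_simps mult.commute)
  qed
  have "((\<lambda>\<tau>. h \<tau> / g (u \<tau>)) \<longlongrightarrow> E / D) (at a)"
    using h(2) gc D unfolding continuous_at h(3) g(3) by (intro tendsto_divide) auto
  then have "((\<lambda>\<tau>. (u \<tau> - u a) / (\<tau> - a)) \<longlongrightarrow> E / D) (at a)"
    by (rule Lim_transform_eventually) (use ev in \<open>simp add: eq_commute\<close>)
  then show ?thesis by (simp add: has_field_derivative_iff)
qed

lemma nice_smooth:
  assumes "\<And>j t. (f j has_real_derivative f (Suc j) t) (at t)" "\<And>j t. f j (t + 1) = f j t"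
  shows "nice e k (\<lambda>t s. f j t)"
proof (induction k arbitrary: j)
  have c: "continuous_on (UNIV \<times> {-e..e}) (\<lambda>(t, s). f j t)" for j
  proof -
    have "continuous_on UNIV (f j)" using assms(1) by (meson DERIV_continuous_on has_field_derivative_at_within)
    then have "continuous_on (UNIV \<times> {-e..e}) (\<lambda>z. f j (fst z))"
      by (rule continuous_on_compose2) (auto intro!: continuous_intros)
    then show ?thesis by (simp add: split_beta)
  qed
  {
    case 0 show ?case using c assms(2) by simp
  next
    case (Suc k)
    show ?case by (rule nice_SucI[OF _ Suc]) (use c assms in auto)
  }
qed

lemma smooth_on_UNIV_derivs:
  fixes f :: "real \<Rightarrow> 'a::real_normed_vector"
  assumes "smooth_on UNIV f"
  shows "(nth_vderiv j UNIV f has_vector_derivative nth_vderiv (Suc j) UNIV f t) (at t)"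
  using assms unfolding smooth_on_def Ck_on_def nth_vderiv_simps(2)
  by (metis UNIV_I lessI vector_derivative_works)

lemma has_vector_derivative_shift_arg:
  assumes "(f has_vector_derivative f') (at (t + c))"
  shows "((\<lambda>t. f (t + c)) has_vector_derivative f') (at (t::real))"
proof -
  have "((\<lambda>t. t + c) has_vector_derivative 1) (at t)" by (auto intro!: derivative_eq_intros)
  from vector_diff_chain_at[OF this assms] show ?thesis by (simp add: o_def)
qed

lemma periodic_vderiv:
  fixes f :: "real \<Rightarrow> 'a::real_normed_vector"
  assumes "\<And>t. (f has_vector_derivative f' t) (at t)" "\<And>t. f (t + 1) = f t"
  shows "f' (t + 1) = f' t"
proof -
  have "((\<lambda>t. f (t + 1)) has_vector_derivative f' (t + 1)) (at t)"
    by (rule has_vector_derivative_shift_arg) (rule assms(1))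
  then have "(f has_vector_derivative f' (t + 1)) (at t)" by (simp add: assms(2))
  then show ?thesis using assms(1)[of t] by (rule vector_derivative_unique_at)
qed

lemma periodic_nth_vderiv:
  fixes f :: "real \<Rightarrow> 'a::real_normed_vector"
  assumes "smooth_on UNIV f" "\<And>t. f (t + 1) = f t"
  shows "nth_vderiv j UNIV f (t + 1) = nth_vderiv j UNIV f t"
proof (induction j arbitrary: t)
  case 0 then show ?case using assms(2) by (simp add: nth_vderiv_simps)
next
  case (Suc j)
  show ?case by (rule periodic_vderiv[OF smooth_on_UNIV_derivs[OF assms(1)] Suc])
qed

section \<open>The frame of a convex curve and its outward normal\<close>

lemma vec_nth_derivative:
  assumes "(f has_vector_derivative f') F"
  shows "((\<lambda>t. f t $ i) has_vector_derivative f' $ i) F"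
  using bounded_linear.has_vector_derivative[OF bounded_linear_vec_nth assms] .

lemma vec2_has_derivative:
  assumes "(f has_real_derivative f') (at t within S)" "(g has_real_derivative g') (at t within S)"
  shows "((\<lambda>t. vec2 (f t) (g t)) has_vector_derivative vec2 f' g') (at t within S)"
proof -
  have eq: "vec2 a b = a *\<^sub>R axis 1 1 + b *\<^sub>R axis 2 1" for a b
    by (simp add: vec_eq_iff forall_2 axis_def)
  show ?thesis unfolding eq
    using assms by (auto intro!: derivative_eq_intros has_vector_derivative_scaleR simp: has_real_derivative_iff_has_vector_derivative)
qed

lemma inner_2: "(x::real^2) \<bullet> y = x $ 1 * y $ 1 + x $ 2 * y $ 2"
  by (simp add: inner_vec_def sum_2)

lemma norm_2: "(norm (x::real^2))\<^sup>2 = (x $ 1)\<^sup>2 + (x $ 2)\<^sup>2"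
  using power2_norm_eq_inner[of x] by (simp add: inner_2 power2_eq_square)

locale convex_curve =
  fixes \<Omega> :: "(real^2) set" and \<gamma> :: "real \<Rightarrow> real^2"
  assumes open_\<Omega>: "open \<Omega>" and ne: "\<Omega> \<noteq> {}" and bdd: "bounded \<Omega>" and cvx: "convex \<Omega>"
    and param: "smooth_closed_param (frontier \<Omega>) \<gamma>"
begin

abbreviation "\<Gamma> \<equiv> frontier \<Omega>"

definition gd :: "nat \<Rightarrow> real \<Rightarrow> real^2" where "gd j = nth_vderiv j UNIV \<gamma>"

lemma gd0: "gd 0 = \<gamma>" by (simp add: gd_def nth_vderiv_simps)

lemma smooth_\<gamma>: "smooth_on UNIV \<gamma>" using param by (simp add: smooth_closed_param_def)

lemma gd_deriv: "(gd j has_vector_derivative gd (Suc j) t) (at t)"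
  unfolding gd_def by (rule smooth_on_UNIV_derivs[OF smooth_\<gamma>])

lemma \<gamma>_deriv: "(\<gamma> has_vector_derivative gd 1 t) (at t)"
  using gd_deriv[of 0 t] by (simp add: gd0)

lemma \<gamma>_periodic: "\<gamma> (t + 1) = \<gamma> t" using param by (simp add: smooth_closed_param_def)

lemma gd_periodic: "gd j (t + 1) = gd j t"
  unfolding gd_def by (rule periodic_nth_vderiv[OF smooth_\<gamma> \<gamma>_periodic])

lemma gd1_nonzero: "gd 1 t \<noteq> 0"
  using param by (simp add: smooth_closed_param_def gd_def nth_vderiv_def)

lemma range_\<gamma>: "range \<gamma> = \<Gamma>"
proof -
  have "\<gamma> t \<in> \<gamma> ` {0..1}" for t
  proof -
    obtain k where k: "t - of_int k \<in> {0..<1}" using periodic_reduce[of t] by blast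
    have "\<gamma> (t - of_int k) = \<gamma> t" using periodic_of_int[of \<gamma> t "- k"] \<gamma>_periodic by simp
    then show ?thesis using k by (intro image_eqI[where x = "t - of_int k"]) auto
  qed
  moreover have "\<gamma> ` {0..1} = \<Gamma>" using param by (simp add: smooth_closed_param_def)
  ultimately show ?thesis by blast
qed

lemma \<gamma>_in: "\<gamma> t \<in> \<Gamma>" using range_\<gamma> by auto

lemma \<gamma>_eq_iff: "\<gamma> t = \<gamma> u \<longleftrightarrow> (\<exists>k. u = t + of_int k)"
proof
  assume eq: "\<gamma> t = \<gamma> u"
  obtain k where k: "t - of_int k \<in> {0..<1}" using periodic_reduce[of t] by blast
  obtain l where l: "u - of_int l \<in> {0..<1}" using periodic_reduce[of u] by blast
  have "\<gamma> (t - of_int k) = \<gamma> t" "\<gamma> (u - of_int l) = \<gamma> u"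
    using periodic_of_int[of \<gamma> t "- k"] periodic_of_int[of \<gamma> u "- l"] \<gamma>_periodic by simp_all
  then have "t - of_int k = u - of_int l"
    using param k l eq unfolding smooth_closed_param_def inj_on_def by metis
  then have "u = t + of_int (l - k)" by simp
  then show "\<exists>k. u = t + of_int k" by blast
next
  assume "\<exists>k. u = t + of_int k"
  then show "\<gamma> t = \<gamma> u" using periodic_of_int[of \<gamma>] \<gamma>_periodic by auto
qed

definition spd :: "real \<Rightarrow> real" where "spd t = sqrt ((gd 1 t $ 1)\<^sup>2 + (gd 1 t $ 2)\<^sup>2)"

lemma spd_norm: "spd t = norm (gd 1 t)"
  unfolding spd_def norm_2[symmetric] by simp

lemma spd_pos: "spd t > 0" using gd1_nonzero by (simp add: spd_norm)

lemma spd_ne: "spd t \<noteq> 0" using spd_pos[of t] by simp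

lemma spd_square: "(spd t)\<^sup>2 = (gd 1 t $ 1)\<^sup>2 + (gd 1 t $ 2)\<^sup>2"
  unfolding spd_norm norm_2 ..

definition T1 :: "real \<Rightarrow> real" where "T1 t = gd 1 t $ 1 * (1 / spd t)"
definition T2 :: "real \<Rightarrow> real" where "T2 t = gd 1 t $ 2 * (1 / spd t)"
text \<open>Speed times curvature with respect to the given parametrization, that is, the derivative
  in t of the angle of the tangent.\<close>

definition turn :: "real \<Rightarrow> real" where "turn t = (gd 1 t $ 1 * gd 2 t $ 2 - gd 1 t $ 2 * gd 2 t $ 1) * (1 / spd t) * (1 / spd t)"

lemma T_unit: "(T1 t)\<^sup>2 + (T2 t)\<^sup>2 = 1"
proof -
  have "(T1 t)\<^sup>2 + (T2 t)\<^sup>2 = (spd t)\<^sup>2 * (1 / spd t)\<^sup>2"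
    unfolding spd_square T1_def T2_def by algebra
  then show ?thesis using spd_pos[of t] by (simp add: power_divide)
qed

lemma gd1_T: "gd 1 t $ 1 = spd t * T1 t" "gd 1 t $ 2 = spd t * T2 t"
  using spd_pos[of t] by (simp_all add: T1_def T2_def)

lemma comp_deriv: "((\<lambda>t. gd j t $ i) has_real_derivative gd (Suc j) t $ i) (at t)"
  using vec_nth_derivative[OF gd_deriv] by (simp add: has_real_derivative_iff_has_vector_derivative)

lemma spd_deriv: "(spd has_real_derivative (gd 1 t $ 1 * gd 2 t $ 1 + gd 1 t $ 2 * gd 2 t $ 2) / spd t) (at t)"
proof -
  have d: "((\<lambda>t. (gd 1 t $ 1)\<^sup>2 + (gd 1 t $ 2)\<^sup>2) has_real_derivative 2 * (gd 1 t $ 1 * gd 2 t $ 1 + gd 1 t $ 2 * gd 2 t $ 2)) (at t)"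
    by (rule DERIV_cong[OF DERIV_add[OF DERIV_power[OF comp_deriv[of 1 1 t], of 2] DERIV_power[OF comp_deriv[of 1 2 t], of 2]]])
      (simp add: numeral_2_eq_2 algebra_simps)
  have p: "(gd 1 t $ 1)\<^sup>2 + (gd 1 t $ 2)\<^sup>2 > 0" using spd_pos[of t] unfolding spd_square[symmetric] by simp
  have half: "inverse c / 2 * (2 * n) = n / c" for c n :: real by (cases "c = 0") (simp_all add: field_simps)
  have "((\<lambda>t. sqrt ((gd 1 t $ 1)\<^sup>2 + (gd 1 t $ 2)\<^sup>2)) has_real_derivative
     (inverse (sqrt ((gd 1 t $ 1)\<^sup>2 + (gd 1 t $ 2)\<^sup>2)) / 2) * (2 * (gd 1 t $ 1 * gd 2 t $ 1 + gd 1 t $ 2 * gd 2 t $ 2))) (at t)"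
    by (rule DERIV_chain2[OF DERIV_real_sqrt[OF p] d])
  then show ?thesis unfolding spd_def[abs_def] half .
qed

lemma T_deriv:
  "(T1 has_real_derivative - (turn t * T2 t)) (at t)" "(T2 has_real_derivative turn t * T1 t) (at t)"
proof -
  let ?a = "gd 1 t $ 1" and ?b = "gd 1 t $ 2" and ?a' = "gd 2 t $ 1" and ?b' = "gd 2 t $ 2"
  have s: "spd t \<noteq> 0" using spd_pos[of t] by simp
  have d1: "(T1 has_real_derivative (?a' * spd t - ?a * ((?a * ?a' + ?b * ?b') / spd t)) / (spd t * spd t)) (at t)"
    and d2: "(T2 has_real_derivative (?b' * spd t - ?b * ((?a * ?a' + ?b * ?b') / spd t)) / (spd t * spd t)) (at t)"
    using DERIV_divide[OF comp_deriv[of 1 1 t] spd_deriv s] DERIV_divide[OF comp_deriv[of 1 2 t] spd_deriv s]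
    unfolding T1_def[abs_def] T2_def[abs_def] by (simp_all add: numeral_2_eq_2)
  have s2: "spd t * spd t = ?a * ?a + ?b * ?b" using spd_square[of t] by (simp add: power2_eq_square)
  have e1: "(?a' * spd t - ?a * ((?a * ?a' + ?b * ?b') / spd t)) / (spd t * spd t) = (?a' * (spd t * spd t) - ?a * (?a * ?a' + ?b * ?b')) / (spd t * spd t * spd t)"
    and e2: "(?b' * spd t - ?b * ((?a * ?a' + ?b * ?b') / spd t)) / (spd t * spd t) = (?b' * (spd t * spd t) - ?b * (?a * ?a' + ?b * ?b')) / (spd t * spd t * spd t)"
    using s by (simp_all add: divide_simps)
  have f1: "- (turn t * T2 t) = (?a' * (spd t * spd t) - ?a * (?a * ?a' + ?b * ?b')) / (spd t * spd t * spd t)"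
    unfolding turn_def T2_def using s by (simp add: divide_simps) (simp add: s2 algebra_simps)
  have f2: "turn t * T1 t = (?b' * (spd t * spd t) - ?b * (?a * ?a' + ?b * ?b')) / (spd t * spd t * spd t)"
    unfolding turn_def T1_def using s by (simp add: divide_simps) (simp add: s2 algebra_simps)
  show "(T1 has_real_derivative - (turn t * T2 t)) (at t)" unfolding f1 using d1 unfolding e1 .
  show "(T2 has_real_derivative turn t * T1 t) (at t)" unfolding f2 using d2 unfolding e2 .
qed

lemma nice_gd: "nice e k (\<lambda>t s. gd j t $ i)"
  by (rule nice_smooth[of "\<lambda>j t. gd j t $ i"]) (auto intro: comp_deriv simp: gd_periodic)

lemma nice_spd: "nice e k (\<lambda>t s. spd t)"
  unfolding spd_def
proof (rule nice_sqrt)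
  show "nice e k (\<lambda>t s. (gd 1 t $ 1)\<^sup>2 + (gd 1 t $ 2)\<^sup>2)" by (intro nice_add nice_power nice_gd)
  show "(gd 1 t $ 1)\<^sup>2 + (gd 1 t $ 2)\<^sup>2 > 0" for t using spd_pos[of t] unfolding spd_square[symmetric] by simp
qed

lemma nice_T: "nice e k (\<lambda>t s. T1 t)" "nice e k (\<lambda>t s. T2 t)" "nice e k (\<lambda>t s. turn t)"
  unfolding T1_def T2_def turn_def
  subgoal by (intro nice_mult nice_gd nice_inverse nice_spd spd_ne)
  subgoal by (intro nice_mult nice_gd nice_inverse nice_spd spd_ne)
  subgoal by (intro nice_mult nice_diff nice_gd nice_inverse nice_spd spd_ne)
  done

text \<open>The strict inequality on \<Omega> comes from the supporting hyperplane at a relative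
  boundary point. It later shows that an interior point never lies on a tangent, so that the side of
  the domain is well defined.\<close>

lemma supporting_normal:
  obtains \<nu> where "norm \<nu> = 1" "\<And>y. y \<in> closure \<Omega> \<Longrightarrow> \<nu> \<bullet> (y - \<gamma> t) \<le> 0" "\<And>y. y \<in> \<Omega> \<Longrightarrow> \<nu> \<bullet> (y - \<gamma> t) < 0"
proof -
  have ri: "rel_interior (closure \<Omega>) = \<Omega>"
    by (simp add: convex_rel_interior_closure cvx rel_interior_open open_\<Omega>)
  have "\<gamma> t \<in> closure \<Omega>" "\<gamma> t \<notin> rel_interior (closure \<Omega>)"
    using \<gamma>_in[of t] open_\<Omega> unfolding ri by (auto simp: frontier_def interior_open)
  then obtain a where a: "a \<noteq> 0" "\<And>y. y \<in> closure \<Omega> \<Longrightarrow> a \<bullet> \<gamma> t \<le> a \<bullet> y" "\<And>y. y \<in> \<Omega> \<Longrightarrow> a \<bullet> \<gamma> t < a \<bullet> y"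
    using supporting_hyperplane_rel_boundary[of "closure \<Omega>" "\<gamma> t"] cvx unfolding ri by (metis convex_closure)
  show ?thesis
  proof (rule that[of "(- 1 / norm a) *\<^sub>R a"])
    show "norm ((- 1 / norm a) *\<^sub>R a) = 1" using a(1) by simp
    show "((- 1 / norm a) *\<^sub>R a) \<bullet> (y - \<gamma> t) \<le> 0" if "y \<in> closure \<Omega>" for y
      using a(1) a(2)[OF that] by (simp add: inner_diff_right divide_simps)
    show "((- 1 / norm a) *\<^sub>R a) \<bullet> (y - \<gamma> t) < 0" if "y \<in> \<Omega>" for y
      using a(1) a(3)[OF that] by (simp add: inner_diff_right divide_simps)
  qed
qed

text \<open>Fermat's rule for a curve that stays in a half plane and touches its edge.\<close>

lemma max_on_curve_orthogonal:
  assumes "(\<beta> has_vector_derivative v) (at s)" "\<And>\<tau>. a \<bullet> (\<beta> \<tau> - z) \<le> 0" "\<beta> s = z"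
  shows "a \<bullet> v = 0"
proof -
  have "((\<lambda>\<tau>. a \<bullet> (\<beta> \<tau> - z)) has_real_derivative a \<bullet> v) (at s)"
    using assms(1) unfolding has_real_derivative_iff_has_vector_derivative
    by (auto intro!: bounded_linear.has_vector_derivative[OF bounded_linear_inner_right] derivative_eq_intros)
  then show ?thesis
    by (rule DERIV_local_max[where d = 1]) (use assms(2,3) in auto)
qed

lemma orthogonal_T:
  assumes "a \<bullet> gd 1 t = 0"
  shows "a = (a $ 1 * T2 t - a $ 2 * T1 t) *\<^sub>R vec2 (T2 t) (- T1 t)"
proof -
  have "spd t * (a $ 1 * T1 t + a $ 2 * T2 t) = 0" using assms unfolding inner_2 gd1_T by (simp add: algebra_simps)
  then have o: "a $ 1 * T1 t + a $ 2 * T2 t = 0" using spd_pos[of t] by simp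
  have "a $ 1 = (a $ 1 * T2 t - a $ 2 * T1 t) * T2 t" "a $ 2 = (a $ 1 * T2 t - a $ 2 * T1 t) * (- T1 t)"
    using o T_unit[of t] by algebra+
  then show ?thesis by (simp add: vec_eq_iff forall_2)
qed

definition in_pt :: "real^2" where "in_pt = (SOME y. y \<in> \<Omega>)"

lemma in_pt: "in_pt \<in> \<Omega>" unfolding in_pt_def using ne by (simp add: some_in_eq)

text \<open>Tells on which side of the tangent the domain lies: it is negative when the right-hand
  normal of the parametrization points outward.\<close>

definition side :: "real \<Rightarrow> real" where "side t = vec2 (T2 t) (- T1 t) \<bullet> (in_pt - \<gamma> t)"

text \<open>The parametrization may run in either direction.\<close>

definition sig :: real where "sig = - sgn (side 0)"

lemma continuous_side: "continuous_on S side"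
proof -
  have c: "continuous_on S T1" "continuous_on S T2" for S
    by (meson DERIV_continuous_on T_deriv has_field_derivative_at_within)+
  have c\<gamma>: "continuous_on S \<gamma>" by (meson \<gamma>_deriv continuous_at_imp_continuous_on has_vector_derivative_continuous)
  show ?thesis unfolding side_def[abs_def] by (intro continuous_intros c c\<gamma>)
qed

lemma normal_exists:
  "\<exists>k. \<bar>k\<bar> = 1 \<and> k * side t < 0 \<and> (\<forall>y\<in>closure \<Omega>. (k *\<^sub>R vec2 (T2 t) (- T1 t)) \<bullet> (y - \<gamma> t) \<le> 0)"
proof -
  obtain \<nu> where \<nu>: "norm \<nu> = 1" "\<And>y. y \<in> closure \<Omega> \<Longrightarrow> \<nu> \<bullet> (y - \<gamma> t) \<le> 0" "\<And>y. y \<in> \<Omega> \<Longrightarrow> \<nu> \<bullet> (y - \<gamma> t) < 0"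
    by (rule supporting_normal) blast
  have "\<nu> \<bullet> gd 1 t = 0"
    by (rule max_on_curve_orthogonal[OF \<gamma>_deriv]) (use \<nu>(2) \<gamma>_in in \<open>auto simp: frontier_def\<close>)
  note eq = orthogonal_T[OF this]
  define k where "k = \<nu> $ 1 * T2 t - \<nu> $ 2 * T1 t"
  have e: "\<nu> = k *\<^sub>R vec2 (T2 t) (- T1 t)" using eq by (simp add: k_def)
  have "(norm (vec2 (T2 t) (- T1 t)))\<^sup>2 = 1" unfolding norm_2 using T_unit[of t] by simp
  then have "norm (vec2 (T2 t) (- T1 t)) = 1" by (simp add: power2_eq_1_iff) (metis norm_ge_zero neg_0_le_iff_le not_one_le_zero)
  then have "\<bar>k\<bar> = 1" using \<nu>(1) unfolding e by simp
  moreover have "k * side t < 0" using \<nu>(3)[OF in_pt] unfolding e side_def by simp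
  ultimately show ?thesis using \<nu>(2) unfolding e by auto
qed

lemma side_nonzero: "side t \<noteq> 0" using normal_exists[of t] by auto

text \<open>A continuous function without zeros on the line keeps its sign, so one orientation sign
  serves for the whole curve.\<close>

lemma side_sgn: "sgn (side t) = sgn (side 0)"
proof (rule ccontr)
  assume ne: "sgn (side t) \<noteq> sgn (side 0)"
  have "connected (side ` UNIV)" by (intro connected_continuous_image continuous_side) simp
  then have iv: "is_interval (side ` UNIV)" by (simp add: is_interval_connected_1)
  have "(side t < 0 \<and> 0 < side 0) \<or> (side 0 < 0 \<and> 0 < side t)"
    using ne side_nonzero[of t] side_nonzero[of 0] by (auto simp: sgn_real_def split: if_splits)
  then have "0 \<in> side ` UNIV"
    using iv unfolding is_interval_1 by (meson less_imp_le rangeI)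
  then show False using side_nonzero by auto
qed

lemma sig_cases: "sig = 1 \<or> sig = -1" using side_nonzero[of 0] by (auto simp: sig_def sgn_real_def)

lemma sig_square: "sig * sig = 1" using sig_cases by auto

definition n1 :: "real \<Rightarrow> real" where "n1 t = sig * T2 t"
definition n2 :: "real \<Rightarrow> real" where "n2 t = - (sig * T1 t)"
definition nrm :: "real \<Rightarrow> real^2" where "nrm t = vec2 (n1 t) (n2 t)"
definition crv :: "real \<Rightarrow> real" where "crv t = sig * turn t"

lemma nrm_eq: "nrm t = sig *\<^sub>R vec2 (T2 t) (- T1 t)"
  by (simp add: nrm_def n1_def n2_def vec_eq_iff forall_2)

lemma nrm_supporting: "y \<in> closure \<Omega> \<Longrightarrow> nrm t \<bullet> (y - \<gamma> t) \<le> 0"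
proof -
  obtain k where k: "\<bar>k\<bar> = 1" "k * side t < 0" "\<forall>y\<in>closure \<Omega>. (k *\<^sub>R vec2 (T2 t) (- T1 t)) \<bullet> (y - \<gamma> t) \<le> 0"
    using normal_exists by blast
  have "k = sig"
    using k(1,2) side_sgn[of t] side_nonzero[of t] unfolding sig_def
    by (auto simp: sgn_real_def abs_if mult_less_0_iff split: if_splits)
  then show "y \<in> closure \<Omega> \<Longrightarrow> nrm t \<bullet> (y - \<gamma> t) \<le> 0" using k(3) by (simp add: nrm_eq)
qed

lemma nrm_unit: "(n1 t)\<^sup>2 + (n2 t)\<^sup>2 = 1" "norm (nrm t) = 1"
proof -
  show 1: "(n1 t)\<^sup>2 + (n2 t)\<^sup>2 = 1"
    using T_unit[of t] sig_square unfolding n1_def n2_def by algebra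
  have "(norm (nrm t))\<^sup>2 = 1" unfolding norm_2 nrm_def using 1 by simp
  then have "norm (nrm t) = 1 \<or> norm (nrm t) = -1" by (simp add: power2_eq_1_iff)
  then show "norm (nrm t) = 1" using norm_ge_zero[of "nrm t"] by linarith
qed

lemma nrm_ortho: "nrm t \<bullet> gd 1 t = 0" "T1 t * n1 t + T2 t * n2 t = 0"
  unfolding inner_2 nrm_def n1_def n2_def gd1_T by simp_all

lemma frame_deriv:
  "(T1 has_real_derivative - (crv t * n1 t)) (at t)" "(T2 has_real_derivative - (crv t * n2 t)) (at t)"
  "(n1 has_real_derivative crv t * T1 t) (at t)" "(n2 has_real_derivative crv t * T2 t) (at t)"
proof -
  have e: "crv t * n1 t = turn t * T2 t" "- (crv t * n2 t) = turn t * T1 t"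
    using sig_square unfolding crv_def n1_def n2_def by algebra+
  show "(T1 has_real_derivative - (crv t * n1 t)) (at t)" "(T2 has_real_derivative - (crv t * n2 t)) (at t)"
    unfolding e using T_deriv[of t] by simp_all
  show "(n1 has_real_derivative crv t * T1 t) (at t)" "(n2 has_real_derivative crv t * T2 t) (at t)"
    unfolding n1_def[abs_def] n2_def[abs_def] crv_def by (auto intro!: derivative_eq_intros T_deriv)
qed

lemma nice_n: "nice e k (\<lambda>t s. n1 t)" "nice e k (\<lambda>t s. n2 t)" "nice e k (\<lambda>t s. crv t)"
  unfolding n1_def n2_def crv_def by (intro nice_uminus nice_mult nice_const nice_T)+

text \<open>The normal is a definite description, so uniqueness has to be shown. Orthogonality to
  curves in the boundary leaves \<open>nrm t\<close> and its negative. If the negative qualified,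
  convexity would make the whole inner ray miss the closure; a line separating the two would have to
  be the tangent, with the domain on its wrong side.\<close>

lemma outward_normal: "outward_unit_normal \<Omega> (\<gamma> t) = nrm t"
  unfolding outward_unit_normal_def
proof (rule the_equality, intro conjI allI impI)
  show "norm (nrm t) = 1" by (rule nrm_unit)
next
  fix \<beta> v assume *: "(\<beta> has_vector_derivative v) (at 0) \<and> \<beta> (0::real) = \<gamma> t \<and> range \<beta> \<subseteq> \<Gamma>"
  show "nrm t \<bullet> v = 0"
  proof (rule max_on_curve_orthogonal[of \<beta> v 0 _ "\<gamma> t"])
    show "nrm t \<bullet> (\<beta> \<tau> - \<gamma> t) \<le> 0" for \<tau>
      by (rule nrm_supporting) (use * in \<open>auto simp: frontier_def\<close>)
  qed (use * in auto)
next
  show "\<forall>\<^sub>F s in at_right 0. \<gamma> t + s *\<^sub>R nrm t \<notin> closure \<Omega>"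
    using eventually_at_right_less[of "0::real"]
  proof eventually_elim
    case (elim s)
    have "nrm t \<bullet> ((\<gamma> t + s *\<^sub>R nrm t) - \<gamma> t) = s" using nrm_unit(2)[of t] by (simp add: dot_square_norm)
    then show ?case using nrm_supporting[of "\<gamma> t + s *\<^sub>R nrm t" t] elim by auto
  qed
next
  fix \<nu> assume *: "norm \<nu> = 1 \<and>
        (\<forall>\<beta> v. (\<beta> has_vector_derivative v) (at (0::real)) \<and> \<beta> 0 = \<gamma> t \<and> range \<beta> \<subseteq> \<Gamma> \<longrightarrow> \<nu> \<bullet> v = 0) \<and>
        (\<forall>\<^sub>F s in at_right 0. \<gamma> t + s *\<^sub>R \<nu> \<notin> closure \<Omega>)"
  have "((\<lambda>\<tau>. \<gamma> (\<tau> + t)) has_vector_derivative gd 1 t) (at 0)"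
    by (rule has_vector_derivative_shift_arg) (use \<gamma>_deriv[of t] in simp)
  then have "\<nu> \<bullet> gd 1 t = 0" using * \<gamma>_in by fastforce
  note e = orthogonal_T[OF this]
  define k where "k = \<nu> $ 1 * T2 t - \<nu> $ 2 * T1 t"
  have e: "\<nu> = (k * sig) *\<^sub>R nrm t" using e sig_square unfolding k_def[symmetric] nrm_eq by (simp add: mult.assoc)
  then have "\<bar>k * sig\<bar> = 1" using * nrm_unit(2)[of t] by (metis mult_cancel_left1 norm_scaleR mult.right_neutral)
  then consider "k * sig = 1" | "k * sig = -1" by linarith
  then show "\<nu> = nrm t"
  proof cases
    case 1 then show ?thesis using e by simp
  next
    case 2
    then have \<nu>: "\<nu> = - nrm t" using e by simp
    \<comment> \<open>The open inner normal ray. By convexity, a point of the closure on it would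
      bring the whole segment down to \<open>\<gamma> t\<close> into the closure, against the
      condition on \<nu>.\<close>
    define R where "R = {\<gamma> t - s *\<^sub>R nrm t | s. s > 0}"
    have disj: "closure \<Omega> \<inter> R = {}"
    proof (rule ccontr)
      assume "closure \<Omega> \<inter> R \<noteq> {}"
      then obtain s0 where s0: "s0 > 0" "\<gamma> t - s0 *\<^sub>R nrm t \<in> closure \<Omega>" by (auto simp: R_def)
      have "\<forall>\<^sub>F s in at_right 0. s < s0" using s0(1) by (simp add: eventually_at_right_real eventually_at_right_field) (metis s0(1))
      moreover have "\<forall>\<^sub>F s in at_right (0::real). s > 0" by (rule eventually_at_right_less)
      moreover have "\<forall>\<^sub>F s in at_right 0. \<gamma> t + s *\<^sub>R \<nu> \<notin> closure \<Omega>" using * by blast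
      ultimately have "\<forall>\<^sub>F s in at_right (0::real). False"
      proof eventually_elim
        case (elim s)
        have "(1 - s / s0) *\<^sub>R \<gamma> t + (s / s0) *\<^sub>R (\<gamma> t - s0 *\<^sub>R nrm t) \<in> closure \<Omega>"
          using elim s0 \<gamma>_in[of t] convex_closure[OF cvx]
          by (intro convexD) (auto simp: frontier_def)
        moreover have "(1 - s / s0) *\<^sub>R \<gamma> t + (s / s0) *\<^sub>R (\<gamma> t - s0 *\<^sub>R nrm t) = \<gamma> t + s *\<^sub>R \<nu>"
          using s0(1) by (simp add: \<nu> algebra_simps)
        ultimately show False using elim by simp
      qed
      then show False by (simp add: trivial_limit_at_right_real)
    qed
    have cR: "convex R"
    proof -
      have "R = (\<lambda>s. \<gamma> t + s *\<^sub>R (- nrm t)) ` {0<..}" by (auto simp: R_def)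
      also have "\<dots> = (+) (\<gamma> t) ` ((\<lambda>s. s *\<^sub>R (- nrm t)) ` {0<..})" by (simp add: image_image)
      finally show ?thesis
        by (simp only:) (intro convex_translation convex_linear_image bounded_linear.linear[OF bounded_linear_scaleR_left] convex_real_interval)
    qed
    have "\<gamma> t \<in> closure \<Omega>" using \<gamma>_in[of t] by (simp add: frontier_def)
    moreover have "\<gamma> t - 1 *\<^sub>R nrm t \<in> R" unfolding R_def by (intro CollectI exI[of _ 1]) simp
    ultimately have nonempty: "closure \<Omega> \<noteq> {}" "R \<noteq> {}" by auto
    obtain a b where ab: "a \<noteq> 0" "\<forall>x\<in>closure \<Omega>. a \<bullet> x \<le> b" "\<forall>x\<in>R. a \<bullet> x \<ge> b"
      using separating_hyperplane_sets[OF convex_closure[OF cvx] cR nonempty disj] by blast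
    have bz: "a \<bullet> \<gamma> t \<le> b" using ab(2) \<open>\<gamma> t \<in> closure \<Omega>\<close> by blast
    have bs: "b \<le> a \<bullet> \<gamma> t - s * (a \<bullet> nrm t)" if "s > 0" for s
      using ab(3) that by (auto simp: R_def inner_diff_right)
    have "a \<bullet> nrm t \<le> 0" using bz bs[of 1] by simp
    \<comment> \<open>The separating line passes through \<open>\<gamma> t\<close>, which is seen by
      letting s tend to 0 in \<open>bs\<close>.\<close>
    have ble: "b \<le> a \<bullet> \<gamma> t"
    proof (rule field_le_epsilon)
      fix d :: real assume d: "d > 0"
      define s where "s = d / (1 + \<bar>a \<bullet> nrm t\<bar>)"
      have "s > 0" using d by (simp add: s_def add_pos_nonneg)
      have "s * (- (a \<bullet> nrm t)) \<le> s * (1 + \<bar>a \<bullet> nrm t\<bar>)" using \<open>s > 0\<close> by (intro mult_left_mono) auto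
      also have "\<dots> = d" by (simp add: s_def)
      finally have "s * (- (a \<bullet> nrm t)) \<le> d" .
      then show "b \<le> a \<bullet> \<gamma> t + d" using bs[OF \<open>s > 0\<close>] by simp
    qed
    have sup: "a \<bullet> (y - \<gamma> t) \<le> 0" if "y \<in> closure \<Omega>" for y
      using ab(2) that ble by (auto simp: inner_diff_right intro: order_trans)
    have "a \<bullet> gd 1 t = 0"
      by (rule max_on_curve_orthogonal[OF \<gamma>_deriv]) (use sup \<gamma>_in in \<open>auto simp: frontier_def\<close>)
    note ea = orthogonal_T[OF this]
    define l where "l = a $ 1 * T2 t - a $ 2 * T1 t"
    have ea: "a = (l * sig) *\<^sub>R nrm t" using ea sig_square unfolding l_def[symmetric] nrm_eq by (simp add: mult.assoc)
    have "nrm t \<bullet> nrm t = 1" using nrm_unit(2)[of t] by (simp add: dot_square_norm)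
    then have "a \<bullet> nrm t = l * sig" by (subst ea) simp
    then have l: "l * sig < 0" using \<open>a \<bullet> nrm t \<le> 0\<close> ab(1) ea by (metis less_eq_real_def scale_zero_left)
    \<comment> \<open>Both half planes bounded by the tangent would contain the closure of \<Omega>,
      so the domain would lie in a line; the ball inside it contradicts this.\<close>
    have z: "nrm t \<bullet> (y - \<gamma> t) = 0" if "y \<in> closure \<Omega>" for y
    proof -
      have "l * sig * (nrm t \<bullet> (y - \<gamma> t)) \<le> 0" using sup[OF that] by (subst (asm) ea) simp
      then have "nrm t \<bullet> (y - \<gamma> t) \<ge> 0" using l by (simp add: mult_le_0_iff)
      then show ?thesis using nrm_supporting[OF that, of t] by simp
    qed
    obtain d where d: "d > 0" "ball in_pt d \<subseteq> \<Omega>" using open_\<Omega> in_pt unfolding open_contains_ball by blast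
    have "in_pt + (d/2) *\<^sub>R nrm t \<in> \<Omega>"
      using d nrm_unit(2)[of t] by (intro subsetD[OF d(2)]) (simp add: dist_norm)
    then have "nrm t \<bullet> (in_pt + (d/2) *\<^sub>R nrm t - \<gamma> t) = 0" "nrm t \<bullet> (in_pt - \<gamma> t) = 0"
      using z in_pt closure_subset by blast+
    then have "d / 2 * (nrm t \<bullet> nrm t) = 0" by (simp add: inner_diff_right inner_add_right)
    then show ?thesis using d(1) \<open>nrm t \<bullet> nrm t = 1\<close> by simp
  qed
qed

end

section \<open>Tubular coordinates\<close>

lemma nice_bounded_all:
  assumes "nice e k g"
  obtains B where "B \<ge> 0" "\<And>t s. s \<in> {-e..e} \<Longrightarrow> \<bar>g t s\<bar> \<le> B"
proof -
  obtain B where B: "B \<ge> 0" "\<And>t s. t \<in> {0..1} \<Longrightarrow> s \<in> {-e..e} \<Longrightarrow> \<bar>g t s\<bar> \<le> B"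
    using nice_bounded[OF assms] by blast
  have "\<bar>g t s\<bar> \<le> B" if s: "s \<in> {-e..e}" for t s
  proof -
    obtain k where k: "t - of_int k \<in> {0..<1}" using periodic_reduce[of t] by blast
    have "g (t - of_int k) s = g t s"
      using periodic_of_int[of "\<lambda>t. g t s" t "- k"] nice_0[OF assms] by simp
    then show ?thesis using B(2)[of "t - of_int k" s] k s by simp
  qed
  then show ?thesis using that B(1) by blast
qed

lemma nice_bounded_t:
  assumes "nice 1 k (\<lambda>t s. g t)"
  obtains B where "B \<ge> 0" "\<And>t. \<bar>g t\<bar> \<le> B"
proof -
  obtain B where B: "B \<ge> 0" "\<And>t s. s \<in> {-1..1::real} \<Longrightarrow> \<bar>g t\<bar> \<le> B"
    using nice_bounded_all[OF assms] by blast
  show ?thesis using that[OF B(1)] B(2)[of 0] by simp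
qed

lemma lipschitz_of_deriv:
  fixes f :: "real \<Rightarrow> 'a::real_normed_vector"
  assumes "\<And>t. (f has_vector_derivative f' t) (at t)" "convex S" "\<And>t. t \<in> S \<Longrightarrow> norm (f' t) \<le> B" "t \<in> S" "u \<in> S"
  shows "norm (f u - f t) \<le> B * \<bar>u - t\<bar>"
proof -
  have "norm (f u - f t) \<le> B * norm (u - t)"
  proof (rule differentiable_bound[OF assms(2)])
    show "(f has_derivative (\<lambda>h. h *\<^sub>R f' x)) (at x within S)" for x
      using assms(1) unfolding has_vector_derivative_def by (rule has_derivative_at_withinI)
    show "onorm (\<lambda>h. h *\<^sub>R f' x) \<le> B" if "x \<in> S" for x
    proof (rule onorm_le)
      fix h :: real
      have "\<bar>h\<bar> * norm (f' x) \<le> \<bar>h\<bar> * B" using assms(3)[OF that] by (intro mult_left_mono) auto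
      then show "norm (h *\<^sub>R f' x) \<le> B * norm h" by (simp add: mult.commute)
    qed
  qed (use assms in auto)
  then show ?thesis by simp
qed

section \<open>Chord and reach estimates\<close>

context convex_curve
begin

lemma gd_bounded:
  obtains B where "B \<ge> 0" "\<And>t. norm (gd j t) \<le> B"
proof -
  obtain B1 where B1: "B1 \<ge> 0" "\<And>t. \<bar>gd j t $ 1\<bar> \<le> B1"
    using nice_bounded_t[OF nice_gd[of 1 0 j 1]] by blast
  obtain B2 where B2: "B2 \<ge> 0" "\<And>t. \<bar>gd j t $ 2\<bar> \<le> B2"
    using nice_bounded_t[OF nice_gd[of 1 0 j 2]] by blast
  have "norm (gd j t) \<le> B1 + B2" for t
    using norm_le_l1_cart[of "gd j t"] B1(2)[of t] B2(2)[of t] by (simp add: sum_2)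
  then show ?thesis using that[of "B1 + B2"] B1(1) B2(1) by simp
qed

lemma gd_lipschitz:
  obtains B where "B \<ge> 0" "\<And>t u. norm (gd j u - gd j t) \<le> B * \<bar>u - t\<bar>"
proof -
  obtain B where B: "B \<ge> 0" "\<And>t. norm (gd (Suc j) t) \<le> B" by (rule gd_bounded) blast
  have "norm (gd j u - gd j t) \<le> B * \<bar>u - t\<bar>" for t u
    by (rule lipschitz_of_deriv[OF gd_deriv convex_UNIV]) (use B in auto)
  then show ?thesis using that B(1) by blast
qed

lemma spd_lower:
  obtains c where "c > 0" "\<And>t. spd t \<ge> c"
proof -
  have "nice 1 0 (\<lambda>t s. 1 / spd t)" by (intro nice_inverse nice_spd spd_ne)
  from nice_bounded_t[OF this] obtain B where B: "B \<ge> 0" "\<And>t. \<bar>1 / spd t\<bar> \<le> B" by blast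
  have "spd t \<ge> 1 / (B + 1)" for t
  proof -
    have "1 / spd t \<le> B + 1" using B(2)[of t] spd_pos[of t] by simp
    then have "1 \<le> (B + 1) * spd t" using spd_pos[of t] by (simp add: pos_divide_le_eq)
    then show ?thesis using B(1) by (simp add: pos_divide_le_eq mult.commute)
  qed
  then show ?thesis using that[of "1 / (B + 1)"] B(1) by simp
qed

lemma continuous_\<gamma>: "continuous_on S \<gamma>"
  by (meson \<gamma>_deriv continuous_at_imp_continuous_on has_vector_derivative_continuous)

lemma \<gamma>_shift: "\<gamma> (t - of_int k) = \<gamma> t"
  using periodic_of_int[of \<gamma> t "- k"] \<gamma>_periodic by simp

text \<open>Up to parameter distance d the curve minus its linear part moves at speed at most c/2,
  so a chord keeps at least half of the minimal speed c.\<close>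

lemma chord_near:
  assumes c: "c > 0" "\<And>t. spd t \<ge> c" and B: "B \<ge> 0" "\<And>t u. norm (gd 1 u - gd 1 t) \<le> B * \<bar>u - t\<bar>"
    and d: "d \<ge> 0" "B * d \<le> c / 2" and u: "\<bar>u - t\<bar> \<le> d"
  shows "c / 2 * \<bar>u - t\<bar> \<le> norm (\<gamma> u - \<gamma> t)"
proof -
  define g where "g \<tau> = \<gamma> \<tau> - \<tau> *\<^sub>R gd 1 t" for \<tau>
  have "norm (g u - g t) \<le> (c / 2) * \<bar>u - t\<bar>"
  proof (rule lipschitz_of_deriv[of g "\<lambda>\<tau>. gd 1 \<tau> - gd 1 t" "cball t d"])
    show "(g has_vector_derivative gd 1 \<tau> - gd 1 t) (at \<tau>)" for \<tau>
    proof -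
      have "((\<lambda>\<tau>. \<tau> *\<^sub>R gd 1 t) has_vector_derivative gd 1 t) (at \<tau>)"
        by (auto intro!: derivative_eq_intros)
      from has_vector_derivative_diff[OF \<gamma>_deriv this] show ?thesis by (simp add: g_def[abs_def])
    qed
    show "norm (gd 1 \<tau> - gd 1 t) \<le> c / 2" if "\<tau> \<in> cball t d" for \<tau>
    proof -
      have "norm (gd 1 \<tau> - gd 1 t) \<le> B * \<bar>\<tau> - t\<bar>" by (rule B)
      also have "\<dots> \<le> B * d" using that B(1) by (intro mult_left_mono) (auto simp: dist_real_def)
      finally show ?thesis using d(2) by linarith
    qed
  qed (use u d in \<open>auto simp: dist_real_def\<close>)
  moreover have "(u - t) *\<^sub>R gd 1 t = (\<gamma> u - \<gamma> t) - (g u - g t)"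
    by (simp add: g_def scaleR_diff_left)
  then have "norm ((u - t) *\<^sub>R gd 1 t) \<le> norm (\<gamma> u - \<gamma> t) + norm (g u - g t)"
    by (simp only: norm_triangle_ineq4)
  moreover have "c * \<bar>u - t\<bar> \<le> norm ((u - t) *\<^sub>R gd 1 t)"
    using mult_right_mono[OF c(2)[of t], of "\<bar>u - t\<bar>"] by (simp add: spd_norm mult.commute)
  ultimately show ?thesis by (simp add: algebra_simps)
qed

text \<open>Compactness together with injectivity up to the period; the restriction to parameter
  differences of at most 1/2 keeps away from a full period.\<close>

lemma chord_far:
  assumes d: "d > 0"
  obtains m where "m > 0" "\<And>t u. d \<le> \<bar>u - t\<bar> \<Longrightarrow> \<bar>u - t\<bar> \<le> 1/2 \<Longrightarrow> m \<le> norm (\<gamma> u - \<gamma> t)"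
proof -
  define K where "K = {0..1::real} \<times> ({-1/2..-d} \<union> {d..1/2})"
  define h where "h z = norm (\<gamma> (fst z + snd z) - \<gamma> (fst z))" for z
  have cK: "compact K" unfolding K_def by (intro compact_Times compact_Un compact_Icc)
  have pos: "h z > 0" if "z \<in> K" for z
  proof -
    have z: "snd z \<noteq> 0" "\<bar>snd z\<bar> \<le> 1/2" using that d by (auto simp: K_def)
    have "\<gamma> (fst z) \<noteq> \<gamma> (fst z + snd z)"
    proof
      assume "\<gamma> (fst z) = \<gamma> (fst z + snd z)"
      then obtain k where "fst z + snd z = fst z + of_int k" unfolding \<gamma>_eq_iff by blast
      then have "snd z = of_int k" by simp
      then show False using z by simp
    qed
    then show ?thesis by (simp add: h_def)
  qed
  have ch: "continuous_on K h" unfolding h_def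
    by (intro continuous_intros continuous_on_compose2[OF continuous_\<gamma>[of UNIV]]) auto
  obtain m where m: "m > 0" "\<And>z. z \<in> K \<Longrightarrow> m \<le> h z"
  proof (cases "K = {}")
    case True then show ?thesis using that[of 1] by simp
  next
    case False
    then obtain z where "z \<in> K" "\<forall>y\<in>K. h z \<le> h y" using continuous_attains_inf[OF cK _ ch] by blast
    then show ?thesis using that[of "h z"] pos by blast
  qed
  have "m \<le> norm (\<gamma> u - \<gamma> t)" if "d \<le> \<bar>u - t\<bar>" "\<bar>u - t\<bar> \<le> 1/2" for t u
  proof -
    obtain k where k: "t - of_int k \<in> {0..<1}" using periodic_reduce[of t] by blast
    have "(t - of_int k, u - t) \<in> K" using k that by (auto simp: K_def abs_if split: if_splits)
    from m(2)[OF this] have "m \<le> norm (\<gamma> (t - of_int k + (u - t)) - \<gamma> (t - of_int k))" by (simp add: h_def)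
    also have "t - of_int k + (u - t) = u - of_int k" by simp
    finally show ?thesis unfolding \<gamma>_shift .
  qed
  then show ?thesis using that m(1) by blast
qed

lemma chord_lower:
  obtains b where "b > 0" "\<And>t u. \<bar>u - t\<bar> \<le> 1/2 \<Longrightarrow> b * \<bar>u - t\<bar> \<le> norm (\<gamma> u - \<gamma> t)"
proof -
  obtain c where c: "c > 0" "\<And>t. spd t \<ge> c" using spd_lower by blast
  obtain B where B: "B \<ge> 0" "\<And>t u. norm (gd 1 u - gd 1 t) \<le> B * \<bar>u - t\<bar>" using gd_lipschitz[of 1] by blast
  define d where "d = c / (2 * (B + 1))"
  have d0: "d > 0" using c(1) B(1) by (simp add: d_def)
  have "(B + 1) * d = c / 2" unfolding d_def using B(1) by (subst mult.commute) (simp add: divide_simps)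
  then have Bd: "B * d \<le> c / 2" using d0 by (simp add: algebra_simps)
  obtain m where m: "m > 0" "\<And>t u. d \<le> \<bar>u - t\<bar> \<Longrightarrow> \<bar>u - t\<bar> \<le> 1/2 \<Longrightarrow> m \<le> norm (\<gamma> u - \<gamma> t)"
    using chord_far[OF d0] by blast
  have "min (c/2) m * \<bar>u - t\<bar> \<le> norm (\<gamma> u - \<gamma> t)" if u: "\<bar>u - t\<bar> \<le> 1/2" for t u
  proof (cases "\<bar>u - t\<bar> \<le> d")
    case True
    have "min (c/2) m * \<bar>u - t\<bar> \<le> c/2 * \<bar>u - t\<bar>" by (intro mult_right_mono) auto
    also have "\<dots> \<le> norm (\<gamma> u - \<gamma> t)" by (rule chord_near[OF c B _ Bd True]) (use d0 in simp)
    finally show ?thesis .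
  next
    case False
    have "min (c/2) m * \<bar>u - t\<bar> \<le> m * 1" using u m(1) c(1) by (intro mult_mono) auto
    also have "\<dots> \<le> norm (\<gamma> u - \<gamma> t)" using m(2)[of u t] False u by simp
    finally show ?thesis .
  qed
  then show ?thesis using that[of "min (c/2) m"] c(1) m(1) by simp
qed

lemma round_shift:
  obtains k :: int where "\<bar>(u - of_int k) - t\<bar> \<le> (1/2 :: real)"
proof (rule that[of "round (u - t)"])
  show "\<bar>u - of_int (round (u - t)) - t\<bar> \<le> 1/2"
    using of_int_round_abs_le[of "u - t"] by (simp add: abs_minus_commute algebra_simps)
qed

text \<open>The normal component of a chord is quadratic in the parameter difference, since the
  velocity is Lipschitz and orthogonal to the normal at t. After a shift of u by an integer the
  chord bound converts this into the square of the chord.\<close>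

lemma reach:
  obtains r where "r > 0" "\<And>t u. \<bar>nrm t \<bullet> (\<gamma> u - \<gamma> t)\<bar> \<le> (norm (\<gamma> u - \<gamma> t))\<^sup>2 / (2 * r)"
proof -
  obtain b where b: "b > 0" "\<And>t u. \<bar>u - t\<bar> \<le> 1/2 \<Longrightarrow> b * \<bar>u - t\<bar> \<le> norm (\<gamma> u - \<gamma> t)" using chord_lower by blast
  obtain B where B: "B \<ge> 0" "\<And>t u. norm (gd 1 u - gd 1 t) \<le> B * \<bar>u - t\<bar>" using gd_lipschitz[of 1] by blast
  have quad: "\<bar>nrm t \<bullet> (\<gamma> u - \<gamma> t)\<bar> \<le> B * \<bar>u - t\<bar> * \<bar>u - t\<bar>" for t u
  proof -
    have "norm (nrm t \<bullet> \<gamma> u - nrm t \<bullet> \<gamma> t) \<le> (B * \<bar>u - t\<bar>) * \<bar>u - t\<bar>"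
    proof (rule lipschitz_of_deriv[of "\<lambda>\<tau>. nrm t \<bullet> \<gamma> \<tau>" "\<lambda>\<tau>. nrm t \<bullet> gd 1 \<tau>" "cball t \<bar>u - t\<bar>"])
      show "((\<lambda>\<tau>. nrm t \<bullet> \<gamma> \<tau>) has_vector_derivative nrm t \<bullet> gd 1 \<tau>) (at \<tau>)" for \<tau>
        by (rule bounded_linear.has_vector_derivative[OF bounded_linear_inner_right \<gamma>_deriv])
      fix \<tau> assume \<tau>: "\<tau> \<in> cball t \<bar>u - t\<bar>"
      have "nrm t \<bullet> gd 1 \<tau> = nrm t \<bullet> (gd 1 \<tau> - gd 1 t)" unfolding inner_diff_right using nrm_ortho(1)[of t] by simp
      also have "norm \<dots> \<le> norm (nrm t) * norm (gd 1 \<tau> - gd 1 t)" using Cauchy_Schwarz_ineq2[of "nrm t" "gd 1 \<tau> - gd 1 t"] by simp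
      also have "\<dots> \<le> 1 * (B * \<bar>\<tau> - t\<bar>)" unfolding nrm_unit(2) using B(2) by simp
      also have "\<dots> \<le> B * \<bar>u - t\<bar>" using \<tau> B(1) by (auto simp: dist_real_def intro!: mult_left_mono)
      finally show "norm (nrm t \<bullet> gd 1 \<tau>) \<le> B * \<bar>u - t\<bar>" .
    qed (auto simp: dist_real_def)
    then show ?thesis by (simp add: inner_diff_right)
  qed
  \<comment> \<open>B + 1 instead of B keeps the denominator positive.\<close>
  define r where "r = b\<^sup>2 / (2 * (B + 1))"
  have "\<bar>nrm t \<bullet> (\<gamma> u - \<gamma> t)\<bar> \<le> (norm (\<gamma> u - \<gamma> t))\<^sup>2 / (2 * r)" for t u
  proof -
    obtain k where k: "\<bar>(u - of_int k) - t\<bar> \<le> 1/2" using round_shift by blast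
    let ?w = "u - of_int k"
    have "(b * \<bar>?w - t\<bar>)\<^sup>2 \<le> (norm (\<gamma> ?w - \<gamma> t))\<^sup>2" using b(1) by (intro power_mono b(2) k) auto
    then have sq: "b\<^sup>2 * (\<bar>?w - t\<bar> * \<bar>?w - t\<bar>) \<le> (norm (\<gamma> u - \<gamma> t))\<^sup>2"
      unfolding \<gamma>_shift power_mult_distrib by (simp only: power2_eq_square)
    have "\<bar>nrm t \<bullet> (\<gamma> u - \<gamma> t)\<bar> \<le> B * \<bar>?w - t\<bar> * \<bar>?w - t\<bar>" using quad[of t ?w] unfolding \<gamma>_shift .
    also have "\<dots> \<le> (B + 1) * (\<bar>?w - t\<bar> * \<bar>?w - t\<bar>)" unfolding mult.assoc by (intro mult_right_mono) auto
    also have "\<dots> \<le> (B + 1) * ((norm (\<gamma> u - \<gamma> t))\<^sup>2 / b\<^sup>2)"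
      using sq b(1) B(1) by (intro mult_left_mono) (simp_all add: pos_le_divide_eq mult.commute)
    also have "\<dots> = (norm (\<gamma> u - \<gamma> t))\<^sup>2 / (2 * r)" using B(1) b(1) unfolding r_def by (simp add: divide_simps)
    finally show ?thesis .
  qed
  moreover have "r > 0" using b(1) B(1) by (simp add: r_def)
  ultimately show ?thesis using that by blast
qed

end

text \<open>\<open>r\<close> is a lower bound for the reach of the curve: the two discs of radius \<open>r\<close> touching it at a
  point contain no other point of it.\<close>

locale tube_chart = convex_curve +
  fixes b r e c0 :: real
  assumes b0: "b > 0" and chord: "\<bar>u - t\<bar> \<le> 1/2 \<Longrightarrow> b * \<bar>u - t\<bar> \<le> norm (\<gamma> u - \<gamma> t)"
    and r_reach: "\<bar>nrm t \<bullet> (\<gamma> u - \<gamma> t)\<bar> \<le> (norm (\<gamma> u - \<gamma> t))\<^sup>2 / (2 * r)"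
    and e0: "e > 0" and er: "2 * e \<le> r" and c0: "c0 > 0"
    and speed: "\<bar>s\<bar> \<le> e \<Longrightarrow> c0 \<le> spd t + s * crv t"

lemma (in convex_curve) exists_tube_chart: "\<exists>b r e c0. tube_chart \<Omega> \<gamma> b r e c0"
proof -
  obtain b where b: "b > 0" "\<And>t u. \<bar>u - t\<bar> \<le> 1/2 \<Longrightarrow> b * \<bar>u - t\<bar> \<le> norm (\<gamma> u - \<gamma> t)" using chord_lower by blast
  obtain r where r: "r > 0" "\<And>t u. \<bar>nrm t \<bullet> (\<gamma> u - \<gamma> t)\<bar> \<le> (norm (\<gamma> u - \<gamma> t))\<^sup>2 / (2 * r)" using reach by blast
  obtain c where c: "c > 0" "\<And>t. spd t \<ge> c" using spd_lower by blast
  obtain B where B: "B \<ge> 0" "\<And>t. \<bar>crv t\<bar> \<le> B"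
    using nice_bounded_t[OF nice_n(3)[of 1 0]] by blast
  \<comment> \<open>The first term stays a factor 2 below the reach, the second keeps the speed of
    all parallel curves above c / 2.\<close>
  define e where "e = min (r / 2) (c / (2 * (B + 1)))"
  have e: "e > 0" "2 * e \<le> r" using r(1) c(1) B(1) by (auto simp: e_def)
  have "c / 2 \<le> spd t + s * crv t" if s: "\<bar>s\<bar> \<le> e" for s t
  proof -
    have "\<bar>s * crv t\<bar> \<le> (c / (2 * (B + 1))) * (B + 1)"
      unfolding abs_mult using s B(1) B(2)[of t] c(1) by (intro mult_mono) (auto simp: e_def)
    also have "\<dots> = c / 2" using B(1) by (simp add: divide_simps)
    finally show ?thesis using c(2)[of t] by linarith
  qed
  then have "tube_chart \<Omega> \<gamma> b r e (c / 2)"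
    by unfold_locales (use b r(2) e c(1) in auto)
  then show ?thesis by blast
qed

section \<open>Nearest points and the inverse of tubular coordinates\<close>

context tube_chart
begin

definition \<Phi> :: "real \<Rightarrow> real \<Rightarrow> real^2" where "\<Phi> t s = \<gamma> t + s *\<^sub>R nrm t"

lemma nrm_self: "nrm t \<bullet> nrm t = 1" using nrm_unit(2)[of t] by (simp add: dot_square_norm)

lemma \<Phi>_square: "(norm (\<Phi> t s - \<gamma> u))\<^sup>2 = s\<^sup>2 - 2 * s * (nrm t \<bullet> (\<gamma> u - \<gamma> t)) + (norm (\<gamma> u - \<gamma> t))\<^sup>2"
proof -
  have eq: "\<Phi> t s - \<gamma> u = s *\<^sub>R nrm t - (\<gamma> u - \<gamma> t)" by (simp add: \<Phi>_def)
  show ?thesis unfolding eq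
    unfolding power2_norm_eq_inner by (simp add: inner_diff_left inner_diff_right nrm_self inner_commute power2_eq_square algebra_simps)
qed

text \<open>The factor 2 between e and r makes the mixed term in the squared distance at most half
  of the squared chord. What remains makes the foot point the only nearest point, and quantitatively
  so.\<close>

lemma reach_half:
  assumes "\<bar>s\<bar> \<le> e"
  shows "2 * \<bar>s * (nrm t \<bullet> (\<gamma> u - \<gamma> t))\<bar> \<le> (norm (\<gamma> u - \<gamma> t))\<^sup>2 / 2"
proof -
  have "\<bar>s * (nrm t \<bullet> (\<gamma> u - \<gamma> t))\<bar> \<le> (r / 2) * ((norm (\<gamma> u - \<gamma> t))\<^sup>2 / (2 * r))"
    unfolding abs_mult using assms er e0 by (intro mult_mono r_reach) auto
  also have "\<dots> = (norm (\<gamma> u - \<gamma> t))\<^sup>2 / 4" using e0 er by simp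
  finally show ?thesis by simp
qed

lemma \<Phi>_far: "\<bar>s\<bar> \<le> e \<Longrightarrow> s\<^sup>2 + (norm (\<gamma> u - \<gamma> t))\<^sup>2 / 2 \<le> (norm (\<Phi> t s - \<gamma> u))\<^sup>2"
  using reach_half[of s t u] unfolding \<Phi>_square by (simp add: mult.assoc)

lemma dist_\<Phi>: "dist (\<Phi> t s) (\<gamma> t) = \<bar>s\<bar>"
  by (simp add: \<Phi>_def dist_norm nrm_unit)

lemma \<Phi>_closest:
  assumes "\<bar>s\<bar> \<le> e" shows "\<bar>s\<bar> \<le> dist (\<Phi> t s) (\<gamma> u)" "dist (\<Phi> t s) (\<gamma> u) \<le> \<bar>s\<bar> \<Longrightarrow> \<gamma> u = \<gamma> t"
proof -
  have "\<bar>s\<bar>\<^sup>2 \<le> (norm (\<Phi> t s - \<gamma> u))\<^sup>2" using \<Phi>_far[OF assms, of u t] zero_le_power2[of "norm (\<gamma> u - \<gamma> t)"] unfolding power2_abs by linarith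
  then show "\<bar>s\<bar> \<le> dist (\<Phi> t s) (\<gamma> u)" unfolding dist_norm by (rule power2_le_imp_le) simp
  assume "dist (\<Phi> t s) (\<gamma> u) \<le> \<bar>s\<bar>"
  then have "(norm (\<Phi> t s - \<gamma> u))\<^sup>2 \<le> \<bar>s\<bar>\<^sup>2" unfolding dist_norm by (intro power_mono) auto
  then have "(norm (\<gamma> u - \<gamma> t))\<^sup>2 \<le> 0" using \<Phi>_far[OF assms, of u t] unfolding power2_abs by linarith
  then show "\<gamma> u = \<gamma> t" by simp
qed

lemma \<Gamma>_ne: "\<Gamma> \<noteq> {}" using \<gamma>_in[of 0] by auto

lemma infdist_\<Phi>: "\<bar>s\<bar> \<le> e \<Longrightarrow> infdist (\<Phi> t s) \<Gamma> = \<bar>s\<bar>"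
proof (rule antisym)
  show "infdist (\<Phi> t s) \<Gamma> \<le> \<bar>s\<bar>" using infdist_le[OF \<gamma>_in[of t], of "\<Phi> t s"] dist_\<Phi> by simp
  assume s: "\<bar>s\<bar> \<le> e"
  show "\<bar>s\<bar> \<le> infdist (\<Phi> t s) \<Gamma>"
    unfolding infdist_notempty[OF \<Gamma>_ne] using \<Gamma>_ne
    by (rule cINF_greatest) (use \<Phi>_closest(1)[OF s] range_\<gamma> in \<open>metis rangeE\<close>)
qed

lemma closest_\<Phi>: "\<bar>s\<bar> \<le> e \<Longrightarrow> closest_point \<Gamma> (\<Phi> t s) = \<gamma> t"
  unfolding closest_point_def
proof (rule some_equality)
  assume s: "\<bar>s\<bar> \<le> e"
  show "\<gamma> t \<in> \<Gamma> \<and> (\<forall>y\<in>\<Gamma>. dist (\<Phi> t s) (\<gamma> t) \<le> dist (\<Phi> t s) y)"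
    using \<Phi>_closest(1)[OF s] \<gamma>_in unfolding range_\<gamma>[symmetric] dist_\<Phi> by auto
  fix p assume p: "p \<in> \<Gamma> \<and> (\<forall>y\<in>\<Gamma>. dist (\<Phi> t s) p \<le> dist (\<Phi> t s) y)"
  then obtain u where u: "p = \<gamma> u" using range_\<gamma> by blast
  show "p = \<gamma> t" using p \<gamma>_in[of t] \<Phi>_closest(2)[OF s, of t u] unfolding u dist_\<Phi>[of t s, symmetric] by blast
qed

lemma signed_distance_\<Phi>: "\<bar>s\<bar> \<le> e \<Longrightarrow> signed_distance \<Omega> (\<Phi> t s) = s"
  by (simp add: signed_distance_def closest_\<Phi> outward_normal) (simp add: \<Phi>_def nrm_self)

text \<open>At a nearest point of the curve the squared distance is stationary, so the connecting
  vector is normal there.\<close>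

lemma tube_surj:
  assumes "infdist x \<Gamma> \<le> e"
  obtains t s where "\<bar>s\<bar> \<le> e" "x = \<Phi> t s"
proof -
  obtain p where p: "p \<in> \<Gamma>" "infdist x \<Gamma> = dist x p" using infdist_attains_inf[OF frontier_closed \<Gamma>_ne] by blast
  then obtain t where t: "p = \<gamma> t" using range_\<gamma> by blast
  have min: "dist x (\<gamma> t) \<le> dist x (\<gamma> \<tau>)" for \<tau> using infdist_le[OF \<gamma>_in[of \<tau>], of x] p(2) t by simp
  have "((\<lambda>\<tau>. (x - \<gamma> \<tau>) \<bullet> (x - \<gamma> \<tau>)) has_real_derivative - (2 * ((x - \<gamma> t) \<bullet> gd 1 t))) (at t)"
    using \<gamma>_deriv[of t] unfolding has_real_derivative_iff_has_vector_derivative has_vector_derivative_def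
    by (auto intro!: derivative_eq_intros simp: inner_commute algebra_simps)
  then have "- (2 * ((x - \<gamma> t) \<bullet> gd 1 t)) = 0"
  proof (rule DERIV_local_min[where d = 1])
    have "(dist x (\<gamma> t))\<^sup>2 \<le> (dist x (\<gamma> \<tau>))\<^sup>2" for \<tau> using min by (intro power_mono) auto
    then show "\<forall>\<tau>. \<bar>t - \<tau>\<bar> < 1 \<longrightarrow> (x - \<gamma> t) \<bullet> (x - \<gamma> t) \<le> (x - \<gamma> \<tau>) \<bullet> (x - \<gamma> \<tau>)"
      by (simp add: dist_norm power2_norm_eq_inner)
  qed simp
  then have "(x - \<gamma> t) \<bullet> gd 1 t = 0" by simp
  note o = orthogonal_T[OF this]
  define k where "k = (x - \<gamma> t) $ 1 * T2 t - (x - \<gamma> t) $ 2 * T1 t"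
  have x: "x = \<Phi> t (k * sig)"
    using o sig_square unfolding k_def[symmetric] \<Phi>_def nrm_eq by (simp add: mult.assoc algebra_simps)
  moreover have "\<bar>k * sig\<bar> \<le> e" using assms p(2) dist_\<Phi>[of t "k * sig"] unfolding t x by simp
  ultimately show ?thesis using that by blast
qed

lemma tube_eq: "\<epsilon> \<le> e \<Longrightarrow> x \<in> tube \<Gamma> \<epsilon> \<longleftrightarrow> (\<exists>t s. \<bar>s\<bar> \<le> \<epsilon> \<and> x = \<Phi> t s)"
proof
  assume le: "\<epsilon> \<le> e" and "x \<in> tube \<Gamma> \<epsilon>"
  then have x: "infdist x \<Gamma> \<le> \<epsilon>" by (simp add: tube_def)
  then obtain t s where ts: "\<bar>s\<bar> \<le> e" "x = \<Phi> t s" using tube_surj[of x] le order_trans by metis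
  then show "\<exists>t s. \<bar>s\<bar> \<le> \<epsilon> \<and> x = \<Phi> t s" using x infdist_\<Phi>[OF ts(1), of t] by auto
next
  assume "\<epsilon> \<le> e" "\<exists>t s. \<bar>s\<bar> \<le> \<epsilon> \<and> x = \<Phi> t s"
  then show "x \<in> tube \<Gamma> \<epsilon>" using infdist_\<Phi> by (auto simp: tube_def)
qed

lemma \<Phi>_inj:
  assumes "\<bar>s\<bar> \<le> e" "\<bar>s'\<bar> \<le> e" "\<Phi> t s = \<Phi> u s'"
  shows "s = s'" "\<gamma> t = \<gamma> u"
  using signed_distance_\<Phi>[OF assms(1), of t] signed_distance_\<Phi>[OF assms(2), of u]
    closest_\<Phi>[OF assms(1), of t] closest_\<Phi>[OF assms(2), of u] assms(3) by simp_all

text \<open>Let D be the difference of the foot points. In the scalar product of D with the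
  difference of the two points, |D|^2 is disturbed by two normal terms, each at most |D|^2 / 4 by
  \<open>reach_half\<close>; Cauchy-Schwarz on the other side gives the factor 2.\<close>

lemma projection_lipschitz:
  assumes s: "\<bar>s\<bar> \<le> e" "\<bar>s'\<bar> \<le> e"
  shows "norm (\<gamma> u - \<gamma> t) \<le> 2 * norm (\<Phi> u s' - \<Phi> t s)"
proof (cases "\<gamma> u = \<gamma> t")
  case False
  let ?D = "\<gamma> u - \<gamma> t"
  have "?D \<bullet> (\<Phi> u s' - \<Phi> t s) = ?D \<bullet> ?D + s' * (nrm u \<bullet> ?D) - s * (nrm t \<bullet> ?D)"
    by (simp add: \<Phi>_def inner_simps inner_commute algebra_simps)
  moreover have "nrm u \<bullet> ?D = - (nrm u \<bullet> (\<gamma> t - \<gamma> u))" by (simp add: inner_diff_right)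
  ultimately have "?D \<bullet> (\<Phi> u s' - \<Phi> t s) = (norm ?D)\<^sup>2 - s' * (nrm u \<bullet> (\<gamma> t - \<gamma> u)) - s * (nrm t \<bullet> ?D)"
    by (simp add: power2_norm_eq_inner)
  moreover have "2 * \<bar>s' * (nrm u \<bullet> (\<gamma> t - \<gamma> u))\<bar> \<le> (norm ?D)\<^sup>2 / 2"
    using reach_half[OF s(2), of u t] by (simp only: norm_minus_commute[of "\<gamma> t"])
  moreover have "2 * \<bar>s * (nrm t \<bullet> ?D)\<bar> \<le> (norm ?D)\<^sup>2 / 2" by (rule reach_half[OF s(1)])
  moreover have "?D \<bullet> (\<Phi> u s' - \<Phi> t s) \<le> norm ?D * norm (\<Phi> u s' - \<Phi> t s)" by (rule norm_cauchy_schwarz)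
  ultimately have "norm ?D * norm ?D \<le> norm ?D * (2 * norm (\<Phi> u s' - \<Phi> t s))"
    by (simp add: power2_eq_square abs_if split: if_splits)
  then show ?thesis using False by simp
qed simp

lemma nrm_lipschitz:
  obtains N where "N \<ge> 0" "\<And>t u. norm (nrm u - nrm t) \<le> N * \<bar>u - t\<bar>"
proof -
  have d: "(nrm has_vector_derivative vec2 (crv t * T1 t) (crv t * T2 t)) (at t)" for t
    unfolding nrm_def[abs_def] by (rule vec2_has_derivative[OF frame_deriv(3,4)])
  obtain B where B: "B \<ge> 0" "\<And>t. \<bar>crv t\<bar> \<le> B"
    using nice_bounded_t[OF nice_n(3)[of 1 0]] by blast
  have "norm (vec2 (crv t * T1 t) (crv t * T2 t)) \<le> B" for t
  proof -
    have "(norm (vec2 (crv t * T1 t) (crv t * T2 t)))\<^sup>2 = (crv t)\<^sup>2 * ((T1 t)\<^sup>2 + (T2 t)\<^sup>2)"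
      unfolding norm_2 by (simp add: power_mult_distrib algebra_simps)
    also have "\<dots> = \<bar>crv t\<bar>\<^sup>2" by (simp add: T_unit)
    also have "\<dots> \<le> B\<^sup>2" using B(2)[of t] by (intro power_mono) auto
    finally show ?thesis using B(1) by (rule power2_le_imp_le)
  qed
  then have "norm (nrm u - nrm t) \<le> B * \<bar>u - t\<bar>" for t u
    by (intro lipschitz_of_deriv[OF d convex_UNIV]) auto
  then show ?thesis using that B(1) by blast
qed

lemma \<Phi>_shift: "\<Phi> (t - of_int k) s = \<Phi> t s"
proof -
  have "n1 (t - of_int k) = n1 t" "n2 (t - of_int k) = n2 t"
    using periodic_of_int[of n1 t "- k"] periodic_of_int[of n2 t "- k"] nice_n(1)[of 1 0] nice_n(2)[of 1 0] by simp_all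
  then show ?thesis by (simp add: \<Phi>_def nrm_def \<gamma>_shift)
qed

text \<open>A Lipschitz inverse of the coordinates near any given (t, s), in place of the inverse
  function theorem. The parameter of a point is determined only up to integers and is chosen within
  1/2 of t, where the chord bound applies.\<close>

lemma tube_lift:
  obtains L where "L > 0" "\<And>x t s. infdist x \<Gamma> \<le> e \<Longrightarrow> \<bar>s\<bar> \<le> e \<Longrightarrow>
    \<exists>u. x = \<Phi> u (signed_distance \<Omega> x) \<and> \<bar>signed_distance \<Omega> x\<bar> \<le> e \<and>
      \<bar>u - t\<bar> \<le> L * norm (x - \<Phi> t s) \<and> \<bar>signed_distance \<Omega> x - s\<bar> \<le> L * norm (x - \<Phi> t s)"
proof -
  obtain N where N: "N \<ge> 0" "\<And>t u. norm (nrm u - nrm t) \<le> N * \<bar>u - t\<bar>" using nrm_lipschitz by blast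
  define L where "L = 2 / b + (3 + e * N * (2 / b))"
  have L0: "2 / b > 0" "e * N * (2 / b) \<ge> 0" using b0 e0 N(1) by auto
  have "\<exists>u. x = \<Phi> u (signed_distance \<Omega> x) \<and> \<bar>signed_distance \<Omega> x\<bar> \<le> e \<and>
      \<bar>u - t\<bar> \<le> L * norm (x - \<Phi> t s) \<and> \<bar>signed_distance \<Omega> x - s\<bar> \<le> L * norm (x - \<Phi> t s)"
    if x: "infdist x \<Gamma> \<le> e" and s: "\<bar>s\<bar> \<le> e" for x t s
  proof -
    obtain w s' where ws: "\<bar>s'\<bar> \<le> e" "x = \<Phi> w s'" using tube_surj[OF x] by blast
    obtain k where k: "\<bar>(w - of_int k) - t\<bar> \<le> 1/2" using round_shift by blast
    define u where "u = w - of_int k"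
    have xu: "x = \<Phi> u s'" unfolding u_def \<Phi>_shift by (rule ws(2))
    have sd: "signed_distance \<Omega> x = s'" unfolding xu by (rule signed_distance_\<Phi>[OF ws(1)])
    let ?X = "norm (x - \<Phi> t s)"
    have p: "norm (\<gamma> u - \<gamma> t) \<le> 2 * ?X" unfolding xu by (rule projection_lipschitz[OF s ws(1)])
    have "b * \<bar>u - t\<bar> \<le> norm (\<gamma> u - \<gamma> t)" using chord k unfolding u_def by blast
    then have ut: "\<bar>u - t\<bar> \<le> 2 / b * ?X" using p b0 by (simp add: pos_le_divide_eq mult.commute)
    \<comment> \<open>The variation of the normal is split off: the first term sees only the
      displacement of the point and of its foot, the second is controlled by the Lipschitz bound for
      \<open>nrm\<close> and |s| <= e.\<close>
    have "s' - s = nrm u \<bullet> ((x - \<gamma> u) - (\<Phi> t s - \<gamma> t)) + (nrm u - nrm t) \<bullet> (s *\<^sub>R nrm t)"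
      unfolding xu \<Phi>_def by (simp add: inner_simps nrm_self algebra_simps)
    also have "\<bar>\<dots>\<bar> \<le> \<bar>nrm u \<bullet> ((x - \<gamma> u) - (\<Phi> t s - \<gamma> t))\<bar> + \<bar>(nrm u - nrm t) \<bullet> (s *\<^sub>R nrm t)\<bar>" by (rule abs_triangle_ineq)
    also have "\<dots> \<le> 3 * ?X + e * N * (2 / b) * ?X"
    proof (rule add_mono)
      have "(x - \<gamma> u) - (\<Phi> t s - \<gamma> t) = (x - \<Phi> t s) - (\<gamma> u - \<gamma> t)" by simp
      then have "\<bar>nrm u \<bullet> ((x - \<gamma> u) - (\<Phi> t s - \<gamma> t))\<bar> \<le> norm (nrm u) * norm ((x - \<Phi> t s) - (\<gamma> u - \<gamma> t))"
        by (metis Cauchy_Schwarz_ineq2)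
      also have "norm (nrm u) * norm ((x - \<Phi> t s) - (\<gamma> u - \<gamma> t)) \<le> 1 * (?X + 2 * ?X)"
        unfolding nrm_unit(2) using norm_triangle_ineq4[of "x - \<Phi> t s" "\<gamma> u - \<gamma> t"] p by simp
      finally show "\<bar>nrm u \<bullet> ((x - \<gamma> u) - (\<Phi> t s - \<gamma> t))\<bar> \<le> 3 * ?X" by (simp del: diff_diff_eq2 diff_diff_eq add_diff_eq diff_add_eq)
      have "\<bar>(nrm u - nrm t) \<bullet> (s *\<^sub>R nrm t)\<bar> \<le> norm (nrm u - nrm t) * norm (s *\<^sub>R nrm t)" by (rule Cauchy_Schwarz_ineq2)
      also have "\<dots> \<le> (N * (2 / b * ?X)) * e"
      proof (rule mult_mono)
        show "norm (nrm u - nrm t) \<le> N * (2 / b * ?X)"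
          by (rule order_trans[OF N(2) mult_left_mono[OF ut N(1)]])
      qed (use s N(1) b0 in \<open>auto simp: nrm_unit\<close>)
      also have "\<dots> = e * N * (2 / b) * ?X" by (simp only: mult_ac)
      finally show "\<bar>(nrm u - nrm t) \<bullet> (s *\<^sub>R nrm t)\<bar> \<le> e * N * (2 / b) * ?X" .
    qed
    also have "\<dots> = (3 + e * N * (2 / b)) * ?X" by (simp only: distrib_right)
    also have "\<dots> \<le> L * ?X" using L0 by (intro mult_right_mono) (auto simp: L_def)
    finally have "\<bar>s' - s\<bar> \<le> L * ?X" .
    moreover have "\<bar>u - t\<bar> \<le> L * ?X"
      using L0 by (intro order_trans[OF ut] mult_right_mono) (auto simp: L_def)
    ultimately show ?thesis using xu ws(1) unfolding sd by blast
  qed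
  moreover have "L > 0" using L0 unfolding L_def by linarith
  ultimately show ?thesis using that by blast
qed

text \<open>Continuity can be tested in coordinates: for x near x0 the lift provided by
  \<open>tube_lift\<close> is close to the coordinates of x0.\<close>

lemma tube_continuous:
  fixes g :: "real \<Rightarrow> real \<Rightarrow> real"
  assumes g: "continuous_on (UNIV \<times> {-e..e}) (\<lambda>(t, s). g t s)" and q: "\<And>t s. \<bar>s\<bar> \<le> e \<Longrightarrow> q (\<Phi> t s) = g t s"
  shows "continuous_on {x. infdist x \<Gamma> \<le> e} q"
  unfolding continuous_on_iff
proof (intro ballI allI impI)
  fix x0 \<rho> assume x0: "x0 \<in> {x. infdist x \<Gamma> \<le> e}" and \<rho>: "(\<rho>::real) > 0"
  obtain L where L: "L > 0" "\<And>x t s. infdist x \<Gamma> \<le> e \<Longrightarrow> \<bar>s\<bar> \<le> e \<Longrightarrow>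
    \<exists>u. x = \<Phi> u (signed_distance \<Omega> x) \<and> \<bar>signed_distance \<Omega> x\<bar> \<le> e \<and>
      \<bar>u - t\<bar> \<le> L * norm (x - \<Phi> t s) \<and> \<bar>signed_distance \<Omega> x - s\<bar> \<le> L * norm (x - \<Phi> t s)"
    using tube_lift by blast
  obtain t0 s0 where ts: "\<bar>s0\<bar> \<le> e" "x0 = \<Phi> t0 s0" using tube_surj x0 by blast
  have "(t0, s0) \<in> UNIV \<times> {-e..e}" using ts(1) by auto
  then obtain d where d: "d > 0" "\<And>z. z \<in> UNIV \<times> {-e..e} \<Longrightarrow> dist z (t0, s0) < d \<Longrightarrow> dist (case z of (t, s) \<Rightarrow> g t s) (g t0 s0) < \<rho>"
    using g \<rho> unfolding continuous_on_iff by fastforce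
  show "\<exists>d>0. \<forall>x\<in>{x. infdist x \<Gamma> \<le> e}. dist x x0 < d \<longrightarrow> dist (q x) (q x0) < \<rho>"
  proof (intro exI[of _ "d / (2 * L)"] conjI ballI impI)
    show "d / (2 * L) > 0" using d(1) L(1) by simp
    fix x assume x: "x \<in> {x. infdist x \<Gamma> \<le> e}" "dist x x0 < d / (2 * L)"
    obtain u s where u: "x = \<Phi> u s" "\<bar>s\<bar> \<le> e" "\<bar>u - t0\<bar> \<le> L * norm (x - x0)" "\<bar>s - s0\<bar> \<le> L * norm (x - x0)"
      using L(2)[of x s0 t0] x(1) ts by blast
    have "dist (u, s) (t0, s0) \<le> \<bar>u - t0\<bar> + \<bar>s - s0\<bar>"
      unfolding dist_prod_def fst_conv snd_conv using sqrt_sum_squares_le_sum_abs[of "dist u t0" "dist s s0"] by (simp add: dist_real_def)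
    also have "\<dots> \<le> 2 * L * norm (x - x0)" using u(3,4) by simp
    also have "\<dots> < d" using x(2) L(1) by (simp add: dist_norm pos_less_divide_eq mult.commute)
    finally show "dist (q x) (q x0) < \<rho>"
      using d(2)[of "(u, s)"] u(2) unfolding u(1) ts(2) q[OF u(2)] q[OF ts(1)] by (auto simp: abs_le_iff)
  qed
qed

end

section \<open>Curvature of parallel curves\<close>

lemma Ck_on_2D:
  fixes \<beta> :: "real \<Rightarrow> 'a::real_normed_vector"
  assumes "Ck_on 2 S \<beta>" "open S" "\<tau> \<in> S"
  shows "(\<beta> has_vector_derivative nth_vderiv 1 S \<beta> \<tau>) (at \<tau>)"
    "(nth_vderiv 1 S \<beta> has_vector_derivative nth_vderiv 2 S \<beta> \<tau>) (at \<tau>)"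
proof -
  have at: "at \<tau> within S = at \<tau>" using assms(2,3) by (rule at_within_open[rotated])
  have d: "nth_vderiv j S \<beta> differentiable (at \<tau>)" if "j < 2" for j
    using assms(1,3) that unfolding Ck_on_def at[symmetric] by blast
  show "(\<beta> has_vector_derivative nth_vderiv 1 S \<beta> \<tau>) (at \<tau>)"
    using d[of 0] unfolding vector_derivative_works One_nat_def nth_vderiv_simps at by simp
  show "(nth_vderiv 1 S \<beta> has_vector_derivative nth_vderiv 2 S \<beta> \<tau>) (at \<tau>)"
    using d[of 1] unfolding vector_derivative_works numeral_2_eq_2 nth_vderiv_simps(2)[of "Suc 0"] at by simp
qed

lemma Ck_on_2I:
  fixes \<beta> :: "real \<Rightarrow> 'a::real_normed_vector"
  assumes S: "open S" and 1: "\<And>\<tau>. (\<beta> has_vector_derivative \<beta>1 \<tau>) (at \<tau>)"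
    and 2: "\<And>\<tau>. (\<beta>1 has_vector_derivative \<beta>2 \<tau>) (at \<tau>)" and c: "continuous_on S \<beta>2"
  shows "Ck_on 2 S \<beta>" "\<tau> \<in> S \<Longrightarrow> nth_vderiv 1 S \<beta> \<tau> = \<beta>1 \<tau>"
proof -
  have e1: "nth_vderiv (Suc 0) S \<beta> \<tau> = \<beta>1 \<tau>" if "\<tau> \<in> S" for \<tau>
    unfolding nth_vderiv_simps at_within_open[OF that S] by (rule vector_derivative_at[OF 1])
  have d1: "(nth_vderiv (Suc 0) S \<beta> has_vector_derivative \<beta>2 \<tau>) (at \<tau>)" if "\<tau> \<in> S" for \<tau>
    by (rule has_vector_derivative_transform_within_open[OF 2 S that]) (simp add: e1)
  have e2: "nth_vderiv 2 S \<beta> \<tau> = \<beta>2 \<tau>" if "\<tau> \<in> S" for \<tau>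
    unfolding numeral_2_eq_2 nth_vderiv_simps(2)[of "Suc 0"] at_within_open[OF that S] by (rule vector_derivative_at[OF d1[OF that]])
  have "nth_vderiv j S \<beta> differentiable (at \<tau> within S)" if "j < 2" "\<tau> \<in> S" for j \<tau>
  proof -
    have "j = 0 \<or> j = Suc 0" using that(1) by auto
    then show ?thesis
      using 1[of \<tau>] d1[OF that(2)] unfolding at_within_open[OF that(2) S]
      by (auto simp: nth_vderiv_simps intro: differentiableI_vector)
  qed
  moreover have "continuous_on S (nth_vderiv 2 S \<beta>)" using c e2 by (simp cong: continuous_on_cong)
  ultimately show "Ck_on 2 S \<beta>" unfolding Ck_on_def by blast
  show "\<tau> \<in> S \<Longrightarrow> nth_vderiv 1 S \<beta> \<tau> = \<beta>1 \<tau>" using e1 by simp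
qed

lemma has_vector_derivative_affine_arg:
  assumes "(f has_vector_derivative f') (at (t + \<sigma> * \<tau>))"
  shows "((\<lambda>\<tau>. f (t + \<sigma> * \<tau>)) has_vector_derivative \<sigma> *\<^sub>R f') (at (\<tau>::real))"
proof -
  have "((\<lambda>\<tau>. t + \<sigma> * \<tau>) has_vector_derivative \<sigma>) (at \<tau>)" by (auto intro!: derivative_eq_intros)
  from vector_diff_chain_at[OF this assms] show ?thesis by (simp add: o_def)
qed

context tube_chart
begin

definition Tv :: "real \<Rightarrow> real^2" where "Tv t = vec2 (T1 t) (T2 t)"
definition D :: "real \<Rightarrow> real \<Rightarrow> real" where "D t s = spd t + s * crv t"

lemma D_pos: "\<bar>s\<bar> \<le> e \<Longrightarrow> D t s > 0" using speed[of s t] c0 by (simp add: D_def)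

lemma gd1_Tv: "gd 1 t = spd t *\<^sub>R Tv t"
  using gd1_T[of t] by (simp add: vec_eq_iff forall_2 Tv_def)

lemma nrm_deriv: "(nrm has_vector_derivative crv t *\<^sub>R Tv t) (at t)"
proof -
  have "crv t *\<^sub>R Tv t = vec2 (crv t * T1 t) (crv t * T2 t)" by (simp add: vec_eq_iff forall_2 Tv_def)
  then show ?thesis using vec2_has_derivative[OF frame_deriv(3,4)] by (simp add: nrm_def[abs_def])
qed

lemma Tv_deriv: "(Tv has_vector_derivative - (crv t *\<^sub>R nrm t)) (at t)"
proof -
  have "- (crv t *\<^sub>R nrm t) = vec2 (- (crv t * n1 t)) (- (crv t * n2 t))" by (simp add: vec_eq_iff forall_2 nrm_def)
  then show ?thesis using vec2_has_derivative[OF frame_deriv(1,2)] by (simp add: Tv_def[abs_def])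
qed

lemma Tv_self: "Tv t \<bullet> Tv t = 1" using T_unit[of t] by (simp add: Tv_def inner_2 power2_eq_square)

lemma \<Phi>_deriv: "((\<lambda>t. \<Phi> t s) has_vector_derivative D t s *\<^sub>R Tv t) (at t)"
proof -
  have "((\<lambda>t. s *\<^sub>R nrm t) has_vector_derivative s *\<^sub>R (crv t *\<^sub>R Tv t)) (at t)"
    by (rule bounded_linear.has_vector_derivative[OF bounded_linear_scaleR_right nrm_deriv])
  from has_vector_derivative_add[OF \<gamma>_deriv this] show ?thesis
    unfolding gd1_Tv by (simp add: \<Phi>_def[abs_def] D_def scaleR_add_left)
qed

lemma tube_\<Phi>:
  assumes "infdist x \<Gamma> \<le> e" "signed_distance \<Omega> x = s"
  obtains w where "x = \<Phi> w s" "\<bar>s\<bar> \<le> e"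
proof -
  obtain w s' where w: "\<bar>s'\<bar> \<le> e" "x = \<Phi> w s'" using tube_surj[OF assms(1)] by blast
  then have "s' = s" using assms(2) signed_distance_\<Phi> by simp
  then show ?thesis using that w by blast
qed

text \<open>For \<open>s \<ge> 0\<close> the parallel curve stays on one side of its tangent, for \<open>s < 0\<close> it stays outside
  the circle of radius \<open>-s\<close> around the foot point.\<close>

lemma level_curve_orthogonal:
  assumes \<beta>: "(\<beta> has_vector_derivative v) (at \<tau>0)" and d: "d > 0"
    and sd: "\<And>\<tau>. \<bar>\<tau>0 - \<tau>\<bar> < d \<Longrightarrow> signed_distance \<Omega> (\<beta> \<tau>) = s \<and> infdist (\<beta> \<tau>) \<Gamma> \<le> e"
    and u: "\<beta> \<tau>0 = \<Phi> u s"
  shows "nrm u \<bullet> v = 0"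
proof -
  have near: "\<exists>w. \<beta> \<tau> = \<Phi> w s \<and> \<bar>s\<bar> \<le> e" if "\<bar>\<tau>0 - \<tau>\<bar> < d" for \<tau>
    using tube_\<Phi> sd[OF that] by metis
  show ?thesis
  proof (cases "s \<ge> 0")
    case True
    have "((\<lambda>\<tau>. nrm u \<bullet> (\<beta> \<tau> - \<Phi> u s)) has_real_derivative nrm u \<bullet> v) (at \<tau>0)"
    proof -
      have "((\<lambda>\<tau>. \<beta> \<tau> - \<Phi> u s) has_vector_derivative v) (at \<tau>0)"
        using has_vector_derivative_diff[OF \<beta> has_vector_derivative_const[of "\<Phi> u s"]] by simp
      from bounded_linear.has_vector_derivative[OF bounded_linear_inner_right this]
      show ?thesis unfolding has_real_derivative_iff_has_vector_derivative .
    qed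
    then show ?thesis
    proof (rule DERIV_local_max[OF _ d], intro allI impI)
      fix \<tau> assume "\<bar>\<tau>0 - \<tau>\<bar> < d"
      then obtain w where w: "\<beta> \<tau> = \<Phi> w s" using near by blast
      have "nrm u \<bullet> (\<beta> \<tau> - \<Phi> u s) = nrm u \<bullet> (\<gamma> w - \<gamma> u) + s * (nrm u \<bullet> nrm w - 1)"
        unfolding w \<Phi>_def by (simp add: inner_simps nrm_self algebra_simps)
      moreover have "nrm u \<bullet> (\<gamma> w - \<gamma> u) \<le> 0"
        by (rule nrm_supporting) (use \<gamma>_in[of w] in \<open>simp add: frontier_def\<close>)
      moreover have "nrm u \<bullet> nrm w \<le> 1" using norm_cauchy_schwarz[of "nrm u" "nrm w"] nrm_unit(2) by simp
      then have "s * (nrm u \<bullet> nrm w - 1) \<le> 0" using True by (simp add: mult_nonneg_nonpos)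
      ultimately show "nrm u \<bullet> (\<beta> \<tau> - \<Phi> u s) \<le> nrm u \<bullet> (\<beta> \<tau>0 - \<Phi> u s)" unfolding u by simp
    qed
  next
    case False
    have "((\<lambda>\<tau>. (\<beta> \<tau> - \<gamma> u) \<bullet> (\<beta> \<tau> - \<gamma> u)) has_real_derivative (\<beta> \<tau>0 - \<gamma> u) \<bullet> v + v \<bullet> (\<beta> \<tau>0 - \<gamma> u)) (at \<tau>0)"
    proof -
      have "((\<lambda>\<tau>. \<beta> \<tau> - \<gamma> u) has_vector_derivative v) (at \<tau>0)"
        using has_vector_derivative_diff[OF \<beta> has_vector_derivative_const[of "\<gamma> u"]] by simp
      from bounded_bilinear.has_vector_derivative[OF bounded_bilinear_inner this this]
      show ?thesis unfolding has_real_derivative_iff_has_vector_derivative .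
    qed
    then have "(\<beta> \<tau>0 - \<gamma> u) \<bullet> v + v \<bullet> (\<beta> \<tau>0 - \<gamma> u) = 0"
    proof (rule DERIV_local_min[OF _ d], intro allI impI)
      fix \<tau> assume "\<bar>\<tau>0 - \<tau>\<bar> < d"
      then obtain w where w: "\<beta> \<tau> = \<Phi> w s" "\<bar>s\<bar> \<le> e" using near by blast
      have "\<bar>s\<bar>\<^sup>2 \<le> (dist (\<Phi> w s) (\<gamma> u))\<^sup>2" by (intro power_mono \<Phi>_closest(1) w(2)) auto
      then have "(dist (\<Phi> u s) (\<gamma> u))\<^sup>2 \<le> (dist (\<Phi> w s) (\<gamma> u))\<^sup>2" unfolding dist_\<Phi> .
      then show "(\<beta> \<tau>0 - \<gamma> u) \<bullet> (\<beta> \<tau>0 - \<gamma> u) \<le> (\<beta> \<tau> - \<gamma> u) \<bullet> (\<beta> \<tau> - \<gamma> u)"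
        unfolding u w(1) dist_norm power2_norm_eq_inner .
    qed
    then have "s * (nrm u \<bullet> v) = 0" unfolding u \<Phi>_def by (simp add: inner_commute)
    then show ?thesis using False by simp
  qed
qed

text \<open>A curve in a level set of the signed distance might leave the tube, where this function
  says nothing about tubular coordinates. By continuity it stays inside for small \<tau>, and there
  a parameter can be chosen; at this stage it is only known to be continuous at 0.\<close>

lemma level_curve_lift:
  assumes s: "\<bar>s\<bar> < e" and \<beta>: "isCont \<beta> 0" "\<beta> 0 = \<Phi> t s" and \<delta>: "\<delta> > 0"
    and sd: "\<And>\<tau>. \<bar>\<tau>\<bar> < \<delta> \<Longrightarrow> signed_distance \<Omega> (\<beta> \<tau>) = s"
  obtains d u where "0 < d" "d \<le> \<delta>" "\<And>\<tau>. \<bar>\<tau>\<bar> < d \<Longrightarrow> infdist (\<beta> \<tau>) \<Gamma> \<le> e" "\<And>\<tau>. \<bar>\<tau>\<bar> < d \<Longrightarrow> \<beta> \<tau> = \<Phi> (u \<tau>) s"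
    "u 0 = t" "isCont u (0::real)"
proof -
  obtain d0 where d0: "d0 > 0" "\<And>\<tau>. dist \<tau> 0 < d0 \<Longrightarrow> dist (\<beta> \<tau>) (\<beta> 0) < e - \<bar>s\<bar>"
    using \<beta>(1) s unfolding continuous_at_eps_delta by (metis diff_gt_0_iff_gt)
  define d where "d = min d0 \<delta>"
  have d: "0 < d" "d \<le> \<delta>" using d0 \<delta> by (auto simp: d_def)
  have tb: "infdist (\<beta> \<tau>) \<Gamma> \<le> e" if "\<bar>\<tau>\<bar> < d" for \<tau>
  proof -
    have "infdist (\<beta> \<tau>) \<Gamma> \<le> infdist (\<beta> 0) \<Gamma> + dist (\<beta> \<tau>) (\<beta> 0)" by (rule infdist_triangle)
    also have "\<dots> \<le> \<bar>s\<bar> + (e - \<bar>s\<bar>)"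
      using d0(2)[of \<tau>] that s infdist_\<Phi>[of s t] unfolding \<beta>(2) by (auto simp: d_def dist_real_def)
    finally show ?thesis by simp
  qed
  obtain L where L: "L > 0" "\<And>x t s. infdist x \<Gamma> \<le> e \<Longrightarrow> \<bar>s\<bar> \<le> e \<Longrightarrow>
    \<exists>u. x = \<Phi> u (signed_distance \<Omega> x) \<and> \<bar>signed_distance \<Omega> x\<bar> \<le> e \<and>
      \<bar>u - t\<bar> \<le> L * norm (x - \<Phi> t s) \<and> \<bar>signed_distance \<Omega> x - s\<bar> \<le> L * norm (x - \<Phi> t s)"
    using tube_lift by blast
  have "\<forall>\<tau>\<in>{\<tau>. \<bar>\<tau>\<bar> < d}. \<exists>u. \<beta> \<tau> = \<Phi> u s \<and> \<bar>u - t\<bar> \<le> L * norm (\<beta> \<tau> - \<beta> 0)"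
  proof
    fix \<tau> assume "\<tau> \<in> {\<tau>. \<bar>\<tau>\<bar> < d}"
    then have \<tau>: "\<bar>\<tau>\<bar> < d" by simp
    then have sds: "signed_distance \<Omega> (\<beta> \<tau>) = s" using sd d(2) by simp
    show "\<exists>u. \<beta> \<tau> = \<Phi> u s \<and> \<bar>u - t\<bar> \<le> L * norm (\<beta> \<tau> - \<beta> 0)"
      using L(2)[OF tb[OF \<tau>], of s t] s unfolding sds \<beta>(2) by auto
  qed
  then obtain u where u': "\<forall>\<tau>\<in>{\<tau>. \<bar>\<tau>\<bar> < d}. \<beta> \<tau> = \<Phi> (u \<tau>) s \<and> \<bar>u \<tau> - t\<bar> \<le> L * norm (\<beta> \<tau> - \<beta> 0)" by (rule bchoice[THEN exE]) blast
  have u: "\<And>\<tau>. \<bar>\<tau>\<bar> < d \<Longrightarrow> \<beta> \<tau> = \<Phi> (u \<tau>) s" "\<And>\<tau>. \<bar>\<tau>\<bar> < d \<Longrightarrow> \<bar>u \<tau> - t\<bar> \<le> L * norm (\<beta> \<tau> - \<beta> 0)"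
    using u' by blast+
  have u0: "u 0 = t" using u(2)[of 0] d(1) by simp
  have "((\<lambda>\<tau>. u \<tau> - t) \<longlongrightarrow> 0) (at 0)"
  proof (rule Lim_null_comparison)
    have "eventually (\<lambda>\<tau>. \<tau> \<in> {-d<..<d}) (at (0::real))" using d(1) by (intro eventually_at_in_open') auto
    then show "\<forall>\<^sub>F \<tau> in at 0. norm (u \<tau> - t) \<le> L * norm (\<beta> \<tau> - \<beta> 0)"
      by eventually_elim (use u(2) in auto)
    have "((\<lambda>\<tau>. L * norm (\<beta> \<tau> - \<beta> 0)) \<longlongrightarrow> L * norm (\<beta> 0 - \<beta> 0)) (at 0)"
      using \<beta>(1) unfolding continuous_at by (intro tendsto_intros)
    then show "((\<lambda>\<tau>. L * norm (\<beta> \<tau> - \<beta> 0)) \<longlongrightarrow> 0) (at 0)" by simp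
  qed
  then have "isCont u 0" unfolding continuous_at u0 by (rule LIM_zero_cancel)
  then show ?thesis using that[OF d tb u(1) u0] by blast
qed

text \<open>The definition ranges over all C2 curves in the level set, so no parametrization may be
  preferred. The velocity is orthogonal to \<open>nrm (u \<tau>)\<close> for all small \<tau>;
  differentiating this relation once, at 0, gives the normal component of the acceleration from the
  first derivative of u alone.\<close>

lemma level_curvature_unique:
  assumes s: "\<bar>s\<bar> < e" and \<delta>: "\<delta> > 0" and C: "Ck_on 2 {-\<delta><..<\<delta>} \<beta>"
    and sd: "\<And>\<tau>. \<tau> \<in> {-\<delta><..<\<delta>} \<Longrightarrow> signed_distance \<Omega> (\<beta> \<tau>) = s" and \<beta>0: "\<beta> 0 = \<Phi> t s"
    and v: "v = nth_vderiv 1 {-\<delta><..<\<delta>} \<beta> 0" and w: "w = nth_vderiv 2 {-\<delta><..<\<delta>} \<beta> 0"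
    and pos: "cross2 (nrm t) v > 0"
  shows "cross2 v w / norm v ^ 3 = crv t / D t s"
proof -
  let ?\<beta>1 = "nth_vderiv 1 {-\<delta><..<\<delta>} \<beta>"
  note ders = Ck_on_2D[OF C open_greaterThanLessThan]
  have 0: "(0::real) \<in> {-\<delta><..<\<delta>}" using \<delta> by simp
  have dv: "(\<beta> has_vector_derivative v) (at 0)" and dw: "(?\<beta>1 has_vector_derivative w) (at 0)"
    using ders[OF 0] v w by simp_all
  obtain d u where d: "0 < d" "d \<le> \<delta>" "\<And>\<tau>. \<bar>\<tau>\<bar> < d \<Longrightarrow> infdist (\<beta> \<tau>) \<Gamma> \<le> e" and u: "\<And>\<tau>. \<bar>\<tau>\<bar> < d \<Longrightarrow> \<beta> \<tau> = \<Phi> (u \<tau>) s"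
    "u 0 = t" "isCont u 0"
  proof (rule level_curve_lift[OF s has_vector_derivative_continuous[OF dv] \<beta>0 \<delta>])
    show "signed_distance \<Omega> (\<beta> \<tau>) = s" if "\<bar>\<tau>\<bar> < \<delta>" for \<tau> by (rule sd) (use that in auto)
  qed blast
  have 0: "(0::real) \<in> {-d<..<d}" using d(1) by simp
  have Dp: "D t s > 0" using s by (intro D_pos) simp
  define a where "a = Tv t \<bullet> v"
  \<comment> \<open>The tangential component of \<beta> is computed in two ways, once directly and
    once through the parameter u.\<close>
  have du: "(u has_real_derivative a / D t s) (at 0)"
  proof (rule DERIV_implicit[of "\<lambda>z. Tv t \<bullet> \<Phi> z s"])
    have "((\<lambda>z. Tv t \<bullet> \<Phi> z s) has_vector_derivative Tv t \<bullet> (D t s *\<^sub>R Tv t)) (at t)"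
      by (rule bounded_linear.has_vector_derivative[OF bounded_linear_inner_right \<Phi>_deriv])
    then show "((\<lambda>z. Tv t \<bullet> \<Phi> z s) has_real_derivative D t s) (at (u 0))"
      unfolding has_real_derivative_iff_has_vector_derivative u(2) by (simp add: Tv_self)
    have "((\<lambda>\<tau>. Tv t \<bullet> \<beta> \<tau>) has_vector_derivative a) (at 0)"
      unfolding a_def by (rule bounded_linear.has_vector_derivative[OF bounded_linear_inner_right dv])
    then show "((\<lambda>\<tau>. Tv t \<bullet> \<Phi> (u \<tau>) s) has_real_derivative a) (at 0)"
      unfolding has_real_derivative_iff_has_vector_derivative
      by (rule has_vector_derivative_transform_within_open[OF _ open_greaterThanLessThan 0]) (simp add: u(1) abs_less_iff)
  qed (use Dp u in auto)
  have orth: "nrm (u \<tau>) \<bullet> ?\<beta>1 \<tau> = 0" if \<tau>: "\<tau> \<in> {-d<..<d}" for \<tau>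
  proof (rule level_curve_orthogonal[where \<beta> = \<beta> and d = "d - \<bar>\<tau>\<bar>" and s = s and ?\<tau>0.0 = \<tau>])
    show "(\<beta> has_vector_derivative ?\<beta>1 \<tau>) (at \<tau>)" by (rule ders(1)) (use \<tau> d(2) in auto)
    show "d - \<bar>\<tau>\<bar> > 0" using \<tau> by auto
    show "signed_distance \<Omega> (\<beta> \<tau>') = s \<and> infdist (\<beta> \<tau>') \<Gamma> \<le> e" if "\<bar>\<tau> - \<tau>'\<bar> < d - \<bar>\<tau>\<bar>" for \<tau>'
    proof -
      have "\<bar>\<tau>'\<bar> < d" using that by linarith
      then show ?thesis using d by (intro conjI sd d(3)) auto
    qed
    show "\<beta> \<tau> = \<Phi> (u \<tau>) s" by (rule u(1)) (use \<tau> in auto)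
  qed
  have "((\<lambda>\<tau>. nrm (u \<tau>)) has_vector_derivative (a / D t s) *\<^sub>R (crv t *\<^sub>R Tv t)) (at 0)"
    using vector_diff_chain_at[of u "a / D t s" 0 nrm "crv t *\<^sub>R Tv t"] du nrm_deriv[of t] u(2)
    by (simp add: has_real_derivative_iff_has_vector_derivative o_def)
  from bounded_bilinear.has_vector_derivative[OF bounded_bilinear_inner this dw]
  have "((\<lambda>\<tau>. nrm (u \<tau>) \<bullet> ?\<beta>1 \<tau>) has_vector_derivative nrm t \<bullet> w + ((a / D t s) *\<^sub>R (crv t *\<^sub>R Tv t)) \<bullet> v) (at 0)"
    unfolding u(2) v .
  moreover have "((\<lambda>\<tau>. nrm (u \<tau>) \<bullet> ?\<beta>1 \<tau>) has_vector_derivative 0) (at 0)"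
    by (rule has_vector_derivative_transform_within_open[OF has_vector_derivative_const[of 0] open_greaterThanLessThan 0]) (rule orth[symmetric])
  ultimately have "nrm t \<bullet> w + ((a / D t s) *\<^sub>R (crv t *\<^sub>R Tv t)) \<bullet> v = 0"
    by (rule vector_derivative_unique_at)
  then have E: "nrm t \<bullet> w = - (crv t * a * a / D t s)" by (simp add: a_def mult_ac)
  have o: "nrm t \<bullet> v = 0" using orth[OF 0] u(2) v by simp
  have "v $ 1 = a * T1 t" "v $ 2 = a * T2 t"
    using o T_unit[of t] sig_square unfolding a_def inner_2 Tv_def nrm_def n1_def n2_def vector_2 by algebra+
  then have va: "v = a *\<^sub>R Tv t" by (simp add: vec_eq_iff forall_2 Tv_def)
  have "norm (Tv t) = 1" using Tv_self[of t] by (simp add: norm_eq_1)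
  then have nv: "norm v = \<bar>a\<bar>" unfolding va by simp
  have "cross2 (nrm t) v = sig * a * ((T1 t)\<^sup>2 + (T2 t)\<^sup>2)"
    unfolding va cross2_def nrm_def n1_def n2_def Tv_def by (simp add: power2_eq_square algebra_simps)
  then have sa: "sig * a > 0" using pos by (simp add: T_unit)
  then have abs: "\<bar>a\<bar> = sig * a" using sig_cases by auto
  have "cross2 v w = - (sig * a * (nrm t \<bullet> w))"
    using sig_square unfolding va cross2_def nrm_def n1_def n2_def Tv_def inner_2 vector_2 vector_scaleR_component real_scaleR_def by algebra
  \<comment> \<open>A factor \<open>sig * sig\<close> = 1 is inserted to obtain three copies of
    \<open>sig * a\<close>, which equals the norm of v and cancels the cube in the
    curvature.\<close>
  also have "\<dots> = (sig * sig) * (sig * a * a * a) * (crv t / D t s)" unfolding E sig_square by simp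
  also have "\<dots> = (sig * a) * (sig * a) * (sig * a) * (crv t / D t s)" by (simp only: mult_ac)
  finally have c: "cross2 v w = (sig * a) * (sig * a) * (sig * a) * (crv t / D t s)" .
  have "x * x * x * k / x ^ 3 = k" if "x > 0" for x k :: real using that by (simp add: power3_eq_cube)
  from this[OF sa] show ?thesis unfolding nv abs c .
qed

text \<open>The parallel curve at distance s is a witness, and \<open>level_curvature_unique\<close>
  shows that any other admissible curve gives the same value.\<close>

lemma level_curvature_\<Phi>:
  assumes s: "\<bar>s\<bar> < e"
  shows "level_curvature \<Omega> (\<Phi> t s) = crv t / D t s"
proof -
  have le: "\<bar>s\<bar> \<le> e" and s': "s \<in> {-e..e}" using s by auto
  have "nice e (Suc 0) D" unfolding D_def[abs_def] by (intro nice_add nice_mult nice_s nice_n nice_spd)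
  then obtain D' where D': "\<And>t s. s \<in> {-e..e} \<Longrightarrow> ((\<lambda>t. D t s) has_real_derivative D' t s) (at t)" "nice e 0 D'"
    by (rule nice_derivE) blast
  define X where "X t = D t s *\<^sub>R Tv t" for t
  define X' where "X' t = D t s *\<^sub>R - (crv t *\<^sub>R nrm t) + D' t s *\<^sub>R Tv t" for t
  have dX: "(X has_vector_derivative X' t) (at t)" for t
    unfolding X_def[abs_def] X'_def by (rule has_vector_derivative_scaleR[OF D'(1)[OF s'] Tv_deriv])
  have cv: "continuous_on UNIV Tv" "continuous_on UNIV nrm"
    by (meson Tv_deriv nrm_deriv continuous_at_imp_continuous_on has_vector_derivative_continuous)+
  have cX': "continuous_on UNIV X'"
    unfolding X'_def[abs_def]
    by (intro continuous_intros cv nice_continuous[OF \<open>nice e (Suc 0) D\<close> s'] nice_continuous[OF D'(2) s'] nice_continuous[OF nice_n(3)[of e 0] s'])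
  \<comment> \<open>The factor \<open>sig\<close> chooses the direction of travel for which the
    outward normal points to the right.\<close>
  define \<beta> where "\<beta> \<tau> = \<Phi> (t + sig * \<tau>) s" for \<tau>
  define \<beta>1 where "\<beta>1 \<tau> = sig *\<^sub>R X (t + sig * \<tau>)" for \<tau>
  define \<beta>2 where "\<beta>2 \<tau> = sig *\<^sub>R (sig *\<^sub>R X' (t + sig * \<tau>))" for \<tau>
  have b1: "(\<beta> has_vector_derivative \<beta>1 \<tau>) (at \<tau>)" for \<tau>
    unfolding \<beta>_def[abs_def] \<beta>1_def X_def by (rule has_vector_derivative_affine_arg[OF \<Phi>_deriv])
  have b2: "(\<beta>1 has_vector_derivative \<beta>2 \<tau>) (at \<tau>)" for \<tau>
    unfolding \<beta>1_def[abs_def] \<beta>2_def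
    by (rule bounded_linear.has_vector_derivative[OF bounded_linear_scaleR_right has_vector_derivative_affine_arg[OF dX]])
  have c2: "continuous_on {-1<..<1} \<beta>2"
    unfolding \<beta>2_def[abs_def] by (intro continuous_intros continuous_on_compose2[OF cX']) auto
  note Ck = Ck_on_2I[OF open_greaterThanLessThan b1 b2 c2]
  let ?S = "{-1<..<1::real}"
  have v: "nth_vderiv 1 ?S \<beta> 0 = (sig * D t s) *\<^sub>R Tv t"
    using Ck(2)[of 0] by (simp add: \<beta>1_def X_def)
  have pos: "cross2 (nrm t) (nth_vderiv 1 ?S \<beta> 0) > 0"
  proof -
    have "cross2 (nrm t) (nth_vderiv 1 ?S \<beta> 0) = (sig * sig) * D t s * ((T1 t)\<^sup>2 + (T2 t)\<^sup>2)"
      unfolding v cross2_def nrm_def n1_def n2_def Tv_def by (simp add: power2_eq_square algebra_simps)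
    then show ?thesis using D_pos[OF le] by (simp add: sig_square T_unit)
  qed
  have sub: "\<beta> ` ?S \<subseteq> {y. signed_distance \<Omega> y = s}" by (auto simp: \<beta>_def signed_distance_\<Phi>[OF le])
  have \<beta>0: "\<beta> 0 = \<Phi> t s" by (simp add: \<beta>_def)
  show ?thesis
    unfolding level_curvature_def signed_curvature_def closest_\<Phi>[OF le] outward_normal signed_distance_\<Phi>[OF le] Let_def
  proof (rule the_equality)
    have val: "cross2 (nth_vderiv 1 ?S \<beta> 0) (nth_vderiv 2 ?S \<beta> 0) / norm (nth_vderiv 1 ?S \<beta> 0) ^ 3 = crv t / D t s"
      by (rule level_curvature_unique[OF s zero_less_one Ck(1) _ \<beta>0 refl refl pos]) (use sub in blast)
    show "\<exists>\<beta> \<delta>. \<delta> > 0 \<and> Ck_on 2 {-\<delta><..<\<delta>} \<beta> \<and> \<beta> ` {-\<delta><..<\<delta>} \<subseteq> {y. signed_distance \<Omega> y = s} \<and> \<beta> 0 = \<Phi> t s \<and>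
      0 < cross2 (nrm t) (nth_vderiv 1 {-\<delta><..<\<delta>} \<beta> 0) \<and>
      crv t / D t s = cross2 (nth_vderiv 1 {-\<delta><..<\<delta>} \<beta> 0) (nth_vderiv 2 {-\<delta><..<\<delta>} \<beta> 0) / norm (nth_vderiv 1 {-\<delta><..<\<delta>} \<beta> 0) ^ 3"
      by (intro exI[of _ \<beta>] exI[of _ 1]) (use Ck(1) sub \<beta>0 pos val in auto)
  next
    fix k assume "\<exists>\<beta> \<delta>. \<delta> > 0 \<and> Ck_on 2 {-\<delta><..<\<delta>} \<beta> \<and> \<beta> ` {-\<delta><..<\<delta>} \<subseteq> {y. signed_distance \<Omega> y = s} \<and> \<beta> 0 = \<Phi> t s \<and>
      0 < cross2 (nrm t) (nth_vderiv 1 {-\<delta><..<\<delta>} \<beta> 0) \<and>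
      k = cross2 (nth_vderiv 1 {-\<delta><..<\<delta>} \<beta> 0) (nth_vderiv 2 {-\<delta><..<\<delta>} \<beta> 0) / norm (nth_vderiv 1 {-\<delta><..<\<delta>} \<beta> 0) ^ 3"
    then obtain \<beta>' \<delta> where *: "\<delta> > 0" "Ck_on 2 {-\<delta><..<\<delta>} \<beta>'" "\<beta>' ` {-\<delta><..<\<delta>} \<subseteq> {y. signed_distance \<Omega> y = s}" "\<beta>' 0 = \<Phi> t s"
      "0 < cross2 (nrm t) (nth_vderiv 1 {-\<delta><..<\<delta>} \<beta>' 0)"
      "k = cross2 (nth_vderiv 1 {-\<delta><..<\<delta>} \<beta>' 0) (nth_vderiv 2 {-\<delta><..<\<delta>} \<beta>' 0) / norm (nth_vderiv 1 {-\<delta><..<\<delta>} \<beta>' 0) ^ 3"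
      by blast
    show "k = crv t / D t s"
      unfolding *(6) by (rule level_curvature_unique[OF s *(1,2) _ *(4) refl refl *(5)]) (use *(3) in blast)
  qed
qed

text \<open>The factor J is the ratio of the length element of the curve to that of the parallel
  curve, precisely the inverse of what a change to tubular coordinates produces per unit of arc
  length.\<close>

lemma proj_jacobian_\<Phi>:
  assumes "\<bar>s\<bar> < e"
  shows "proj_jacobian \<Omega> (\<Phi> t s) s = spd t / D t s"
proof -
  have "D t s > 0" using assms by (intro D_pos) simp
  then have "1 - s * (crv t / D t s) = (D t s - s * crv t) / D t s" by (simp add: diff_divide_distrib)
  then show ?thesis unfolding proj_jacobian_def level_curvature_\<Phi>[OF assms] by (simp add: D_def)
qed

end

section \<open>Regularity of the integrand\<close>

lemma Ck_on_continuous: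
  assumes "Ck_on k S f" shows "continuous_on S f"
proof (cases k)
  case 0 then show ?thesis using assms by (simp add: Ck_on_def nth_vderiv_simps)
next
  case (Suc j)
  then have "f differentiable (at t within S)" if "t \<in> S" for t
    using assms that unfolding Ck_on_def by (metis nth_vderiv_simps(1) zero_less_Suc)
  then show ?thesis by (simp add: continuous_on_eq_continuous_within differentiable_imp_continuous_within)
qed

lemma weight_profile_cases:
  assumes "weight_profile q \<theta>"
  obtains "continuous_on UNIV \<theta>" | "\<theta> \<in> borel_measurable borel" "piecewise_C1 \<theta>"
proof (cases "q = 0")
  case True
  then show ?thesis using assms that(2) by (simp add: weight_profile_def)
next
  case False
  then have "Ck_on (q - 1) UNIV \<theta>" using assms by (simp add: weight_profile_def)
  then show ?thesis by (rule that(1)[OF Ck_on_continuous])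
qed

lemma profile_measurable: "weight_profile q \<theta> \<Longrightarrow> \<theta> \<in> borel_measurable borel"
  by (rule weight_profile_cases) (auto intro: borel_measurable_continuous_onI)

lemma finite_avoid:
  assumes "finite (B :: real set)"
  obtains d where "d > 0" "{x - d<..<x} \<inter> B = {}" "{x<..<x + d} \<inter> B = {}"
proof -
  obtain d where d: "d > 0" "\<forall>y\<in>B. y \<noteq> x \<longrightarrow> d \<le> dist x y" using finite_set_avoid[OF assms, of x] by blast
  have "d \<le> dist x y" if "y \<in> B" "y < x \<or> x < y" for y using d(2) that by auto
  then show ?thesis using d(1) by (intro that[of d]) (fastforce simp: dist_real_def)+
qed

lemma piecewise_C1E:
  assumes "piecewise_C1 g"
  obtains B where "finite B" "\<And>a b. a < b \<Longrightarrow> {a<..<b} \<inter> B = {} \<Longrightarrow> \<exists>G. continuous_on {a..b} G \<and> (\<forall>x\<in>{a<..<b}. G x = g x)"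
  using assms Ck_on_continuous[of 1] unfolding piecewise_C1_def by meson

lemma profile_continuous:
  assumes "weight_profile q \<theta>"
  obtains B where "finite B" "\<And>s. s \<notin> B \<Longrightarrow> isCont \<theta> s"
  using assms
proof (cases rule: weight_profile_cases)
  case 1
  then show ?thesis using that[of "{}"] by (auto simp: continuous_on_eq_continuous_at)
next
  case 2
  obtain B where B: "finite B" "\<And>a b. a < b \<Longrightarrow> {a<..<b} \<inter> B = {} \<Longrightarrow> \<exists>G. continuous_on {a..b} G \<and> (\<forall>x\<in>{a<..<b}. G x = \<theta> x)"
    using piecewise_C1E[OF 2(2)] by blast
  have "isCont \<theta> s" if s: "s \<notin> B" for s
  proof -
    obtain d where d: "d > 0" "{s - d<..<s} \<inter> B = {}" "{s<..<s + d} \<inter> B = {}" using finite_avoid[OF B(1)] by blast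
    have "{s - d<..<s + d} \<inter> B = {}" using d s by (auto simp: disjoint_iff) (metis linorder_less_linear)
    then obtain G where G: "continuous_on {s-d..s+d} G" "\<forall>x\<in>{s-d<..<s+d}. G x = \<theta> x"
      using B(2)[of "s - d" "s + d"] d(1) by auto
    have "continuous_on {s-d<..<s+d} G" using G(1) by (rule continuous_on_subset) auto
    then have "continuous_on {s-d<..<s+d} \<theta>" by (rule continuous_on_eq) (use G(2) in auto)
    then show ?thesis using d(1) by (simp add: continuous_on_eq_continuous_at)
  qed
  then show ?thesis using that B(1) by blast
qed

text \<open>Boundedness on [-1, 1] is local by Bolzano's principle. Around a point there are at most
  that point itself, with its single and possibly arbitrary value, and two open pieces, each with a
  continuous extension to a compact interval.\<close>

lemma profile_bounded:
  assumes w: "weight_profile q \<theta>"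
  obtains M where "M \<ge> 0" "\<And>s. \<bar>\<theta> s\<bar> \<le> M"
proof -
  have "bounded (\<theta> ` {-1..1})"
    using w
  proof (cases rule: weight_profile_cases)
    case 1
    then show ?thesis by (meson compact_Icc compact_continuous_image compact_imp_bounded continuous_on_subset subset_UNIV)
  next
    case 2
    obtain B where B: "finite B" "\<And>a b. a < b \<Longrightarrow> {a<..<b} \<inter> B = {} \<Longrightarrow> \<exists>G. continuous_on {a..b} G \<and> (\<forall>x\<in>{a<..<b}. G x = \<theta> x)"
      using piecewise_C1E[OF 2(2)] by blast
    have bd: "bounded (\<theta> ` {a<..<b})" if ab: "a < b" "{a<..<b} \<inter> B = {}" for a b
    proof -
      obtain G where G: "continuous_on {a..b} G" "\<forall>x\<in>{a<..<b}. G x = \<theta> x" using B(2)[OF ab] by blast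
      have "bounded (G ` {a..b})" by (intro compact_imp_bounded compact_continuous_image G(1) compact_Icc)
      moreover have "\<theta> ` {a<..<b} \<subseteq> G ` {a..b}" using G(2) by (metis greaterThanLessThan_subseteq_atLeastAtMost_iff image_cong image_mono order_refl)
      ultimately show ?thesis by (rule bounded_subset)
    qed
    have "(-1::real) \<le> 1" by simp
    then show ?thesis
    proof (induction rule: Bolzano)
      case (trans a b c)
      then have "\<theta> ` {a..c} = \<theta> ` {a..b} \<union> \<theta> ` {b..c}" by (simp add: ivl_disj_un_two_touch(4) flip: image_Un)
      then show ?case using trans by simp
    next
      case (local x)
      obtain d where d: "d > 0" "{x - d<..<x} \<inter> B = {}" "{x<..<x + d} \<inter> B = {}" using finite_avoid[OF B(1)] by blast
      have bU: "bounded (insert (\<theta> x) (\<theta> ` {x-d<..<x} \<union> \<theta> ` {x<..<x+d}))"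
        using bd[of "x - d" x] bd[of x "x + d"] d by simp
      have "bounded (\<theta> ` {a..b})" if "a \<le> x \<and> x \<le> b \<and> b - a < d" for a b
      proof (rule bounded_subset[OF bU])
        show "\<theta> ` {a..b} \<subseteq> insert (\<theta> x) (\<theta> ` {x-d<..<x} \<union> \<theta> ` {x<..<x+d})"
        proof
          fix y assume "y \<in> \<theta> ` {a..b}"
          then obtain s where s: "y = \<theta> s" "a \<le> s" "s \<le> b" by auto
          have "s = x \<or> s \<in> {x-d<..<x} \<or> s \<in> {x<..<x+d}" using s that by auto
          then show "y \<in> insert (\<theta> x) (\<theta> ` {x-d<..<x} \<union> \<theta> ` {x<..<x+d})" using s(1) by blast
        qed
      qed
      then show ?case using d(1) by blast
    qed
  qed
  then obtain M where M: "\<forall>y\<in>\<theta> ` {-1..1}. norm y \<le> M" unfolding bounded_iff by blast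
  have "\<bar>\<theta> s\<bar> \<le> \<bar>M\<bar>" for s
  proof (cases "s \<in> {-1..1}")
    case True
    then have "\<bar>\<theta> s\<bar> \<le> M" using M by auto
    then show ?thesis by linarith
  qed (use profile_vanishes[OF w, of s] in simp)
  then show ?thesis using that[of "\<bar>M\<bar>"] by simp
qed

lemma rot_component: "(rot t *v y) $ 1 = cos t * y $ 1 - sin t * y $ 2" "(rot t *v y) $ 2 = sin t * y $ 1 + cos t * y $ 2"
  by (simp_all add: matrix_vector_mult_def sum_2)

lemma rot_inverse: "rot t *v (rot (- t) *v y) = y" "rot (- t) *v (rot t *v y) = y"
proof -
  have "rot 0 = mat 1" by (simp add: vec_eq_iff forall_2 mat_def)
  then show "rot t *v (rot (- t) *v y) = y" "rot (- t) *v (rot t *v y) = y"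
    by (simp_all add: matrix_vector_mul_assoc rot_mult)
qed

lemma norm_rot: "norm (rot t *v y) = norm y"
proof -
  have "(norm (rot t *v y))\<^sup>2 = (norm y)\<^sup>2"
    unfolding norm_2 rot_component using sin_cos_squared_add[of t] by algebra
  then show ?thesis by (simp add: power2_eq_iff_nonneg)
qed

lemma continuous_rot: "continuous_on S (\<lambda>y. rot t *v y)"
  by (intro linear_continuous_on matrix_vector_mul_bounded_linear)

context tube_chart
begin

text \<open>The choice is unique up to an integer, so only periodic functions of it are meaningful.\<close>

definition foot_param :: "real^2 \<Rightarrow> real" where "foot_param x = (SOME t. \<gamma> t = closest_point \<Gamma> x)"

lemma periodic_at_foot_param:
  assumes s: "\<bar>s\<bar> \<le> e" and g: "\<And>t. g (t + 1) = g t"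
  shows "g (foot_param (\<Phi> t s)) = g t"
proof -
  have "\<gamma> (foot_param (\<Phi> t s)) = \<gamma> t" unfolding foot_param_def closest_\<Phi>[OF s] by (rule someI) (rule refl)
  then obtain k where "t = foot_param (\<Phi> t s) + of_int k" unfolding \<gamma>_eq_iff by blast
  then show ?thesis using periodic_of_int[of g, OF g] by metis
qed

text \<open>Periodicity in t makes the arbitrary choice inside \<open>foot_param\<close>
  invisible.\<close>

lemma tube_continuous_nice:
  assumes g: "nice e 0 g"
  shows "continuous_on {x. infdist x \<Gamma> \<le> e} (\<lambda>x. g (foot_param x) (signed_distance \<Omega> x))"
proof (rule tube_continuous[of g])
  show "continuous_on (UNIV \<times> {-e..e}) (\<lambda>(t, s). g t s)" using g by simp
  show "g (foot_param (\<Phi> t s)) (signed_distance \<Omega> (\<Phi> t s)) = g t s" if "\<bar>s\<bar> \<le> e" for t s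
    unfolding signed_distance_\<Phi>[OF that] by (rule periodic_at_foot_param[OF that]) (use g in simp)
qed

lemma open_tube: "open {x. infdist x \<Gamma> < e}" "closed {x. infdist x \<Gamma> \<le> \<epsilon>}" "open {x. infdist x \<Gamma> > \<epsilon>}"
  by (intro open_Collect_less closed_Collect_le continuous_intros)+

lemma nice_D: "nice e k D"
  unfolding D_def[abs_def] by (intro nice_add nice_mult nice_s nice_n nice_spd)

end

locale tube_integrand = tube_chart +
  fixes f :: "real^2 \<Rightarrow> real" and \<theta> :: "real \<Rightarrow> real" and q :: nat
  assumes f_smooth: "smooth_on UNIV (f \<circ> \<gamma>)" and profile: "weight_profile q \<theta>"
begin

lemma nice_f: "nice e k (\<lambda>t s. f (\<gamma> t))"
proof -
  have "nice e k (\<lambda>t s. nth_vderiv 0 UNIV (f \<circ> \<gamma>) t)"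
  proof (rule nice_smooth[of "\<lambda>j. nth_vderiv j UNIV (f \<circ> \<gamma>)"])
    show "(nth_vderiv j UNIV (f \<circ> \<gamma>) has_real_derivative nth_vderiv (Suc j) UNIV (f \<circ> \<gamma>) t) (at t)" for j t
      unfolding has_real_derivative_iff_has_vector_derivative by (rule smooth_on_UNIV_derivs[OF f_smooth])
    show "nth_vderiv j UNIV (f \<circ> \<gamma>) (t + 1) = nth_vderiv j UNIV (f \<circ> \<gamma>) t" for j t
      by (rule periodic_nth_vderiv[OF f_smooth]) (simp add: \<gamma>_periodic)
  qed
  then show ?thesis by (simp add: nth_vderiv_simps)
qed

definition dens :: "real \<Rightarrow> real \<Rightarrow> real" where "dens t s = f (\<gamma> t) * spd t * (1 / D t s)"

lemma nice_dens: "nice e k dens"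
proof -
  have nz: "D t s \<noteq> 0" if "s \<in> {-e..e}" for t s using D_pos[of s t] that by (auto simp: abs_le_iff)
  show ?thesis unfolding dens_def[abs_def] by (intro nice_mult nice_f nice_spd nice_inverse nice_D nz)
qed

lemma integrand_\<Phi>:
  assumes \<epsilon>: "0 < \<epsilon>" "\<epsilon> < e" and s: "\<bar>s\<bar> < e"
  shows "ibi_integrand \<Omega> f \<theta> \<epsilon> (\<Phi> t s) = dens t s * (\<theta> (s / \<epsilon>) / \<epsilon>)"
proof -
  have s': "\<bar>s\<bar> \<le> e" using s by simp
  show ?thesis
  proof (cases "\<bar>s\<bar> \<le> \<epsilon>")
    case True
    then have "\<Phi> t s \<in> tube \<Gamma> \<epsilon>" by (simp add: tube_def infdist_\<Phi>[OF s'])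
    then show ?thesis
      unfolding ibi_integrand_def closest_\<Phi>[OF s'] signed_distance_\<Phi>[OF s'] proj_jacobian_\<Phi>[OF s] scaled_profile_def dens_def
      by (simp add: mult_ac)
  next
    case False
    then have "\<Phi> t s \<notin> tube \<Gamma> \<epsilon>" by (simp add: tube_def infdist_\<Phi>[OF s'])
    moreover have "\<theta> (s / \<epsilon>) = 0"
      by (rule profile_vanishes[OF profile]) (use False \<epsilon>(1) in \<open>auto simp: field_simps abs_le_iff\<close>)
    ultimately show ?thesis unfolding ibi_integrand_def by simp
  qed
qed

lemma integrand_eq:
  assumes \<epsilon>: "0 < \<epsilon>" "\<epsilon> < e" and x: "infdist x \<Gamma> < e"
  shows "ibi_integrand \<Omega> f \<theta> \<epsilon> x = dens (foot_param x) (signed_distance \<Omega> x) * (\<theta> (signed_distance \<Omega> x / \<epsilon>) / \<epsilon>)"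
proof -
  obtain t s where ts: "\<bar>s\<bar> \<le> e" "x = \<Phi> t s" using tube_surj[OF less_imp_le[OF x]] by blast
  have s: "\<bar>s\<bar> < e" using x infdist_\<Phi>[OF ts(1), of t] unfolding ts(2) by simp
  have "dens (foot_param x) s = dens t s"
    unfolding ts(2) by (rule periodic_at_foot_param[OF ts(1)]) (use nice_dens[of 0] in simp)
  then show ?thesis unfolding ts(2) signed_distance_\<Phi>[OF ts(1)] integrand_\<Phi>[OF \<epsilon> s] by simp
qed

text \<open>The signed distance and the amplitude are controlled only on the closed tube, so both
  are cut off by its indicator before \<theta> is applied. Outside the tube the first factor
  vanishes, whatever \<theta> does at 0.\<close>

lemma integrand_measurable:
  assumes \<epsilon>: "0 < \<epsilon>" "\<epsilon> < e"
  shows "ibi_integrand \<Omega> f \<theta> \<epsilon> \<in> borel_measurable borel"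
proof -
  let ?U = "{x. infdist x \<Gamma> \<le> \<epsilon>}"
  have [measurable]: "\<theta> \<in> borel_measurable borel" by (rule profile_measurable[OF profile])
  have sub: "?U \<subseteq> {x. infdist x \<Gamma> \<le> e}" using \<epsilon> by auto
  have U: "?U \<in> sets borel" by (intro borel_closed open_tube(2))
  have m[measurable]: "(\<lambda>x. indicator ?U x *\<^sub>R dens (foot_param x) (signed_distance \<Omega> x)) \<in> borel_measurable borel"
      "(\<lambda>x. indicator ?U x *\<^sub>R signed_distance \<Omega> x) \<in> borel_measurable borel"
    by (rule borel_measurable_continuous_on_indicator[OF U continuous_on_subset[OF tube_continuous_nice[OF nice_dens] sub]],
        rule borel_measurable_continuous_on_indicator[OF U continuous_on_subset[OF tube_continuous_nice[OF nice_s] sub]])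
  have "ibi_integrand \<Omega> f \<theta> \<epsilon> = (\<lambda>x. (indicator ?U x *\<^sub>R dens (foot_param x) (signed_distance \<Omega> x)) * (\<theta> ((indicator ?U x *\<^sub>R signed_distance \<Omega> x) / \<epsilon>) / \<epsilon>))"
  proof
    fix x
    show "ibi_integrand \<Omega> f \<theta> \<epsilon> x = (indicator ?U x *\<^sub>R dens (foot_param x) (signed_distance \<Omega> x)) * (\<theta> ((indicator ?U x *\<^sub>R signed_distance \<Omega> x) / \<epsilon>) / \<epsilon>)"
    proof (cases "x \<in> ?U")
      case True
      then show ?thesis using integrand_eq[OF \<epsilon>, of x] \<epsilon>(2) by simp
    next
      case False
      then show ?thesis by (simp add: ibi_integrand_def tube_def)
    qed
  qed
  also have "\<dots> \<in> borel_measurable borel" by measurable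
  finally show ?thesis .
qed

lemma integrand_bounded:
  obtains K where "K \<ge> 0" "\<And>\<epsilon> x. 0 < \<epsilon> \<Longrightarrow> \<epsilon> < e \<Longrightarrow> \<bar>ibi_integrand \<Omega> f \<theta> \<epsilon> x\<bar> \<le> K / \<epsilon>"
proof -
  obtain M where M: "M \<ge> 0" "\<And>s. \<bar>\<theta> s\<bar> \<le> M" using profile_bounded[OF profile] by blast
  obtain B where B: "B \<ge> 0" "\<And>t s. s \<in> {-e..e} \<Longrightarrow> \<bar>dens t s\<bar> \<le> B" using nice_bounded_all[OF nice_dens[of 0]] by blast
  have "\<bar>ibi_integrand \<Omega> f \<theta> \<epsilon> x\<bar> \<le> B * M / \<epsilon>" if \<epsilon>: "0 < \<epsilon>" "\<epsilon> < e" for \<epsilon> x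
  proof (cases "infdist x \<Gamma> < e")
    case True
    obtain t s where ts: "\<bar>s\<bar> \<le> e" "x = \<Phi> t s" using tube_surj[OF less_imp_le[OF True]] by blast
    have s: "\<bar>s\<bar> < e" using True infdist_\<Phi>[OF ts(1), of t] unfolding ts(2) by simp
    have "\<bar>dens t s\<bar> \<le> B" using ts(1) by (intro B(2)) (auto simp: abs_le_iff)
    then have "\<bar>dens t s\<bar> * (\<bar>\<theta> (s / \<epsilon>)\<bar> / \<epsilon>) \<le> B * (M / \<epsilon>)"
      using M B(1) \<epsilon> by (intro mult_mono divide_right_mono) auto
    then show ?thesis unfolding ts(2) integrand_\<Phi>[OF \<epsilon> s] using \<epsilon>(1) by (simp add: abs_mult)
  next
    case False
    then have "ibi_integrand \<Omega> f \<theta> \<epsilon> x = 0" using \<epsilon>(2) by (simp add: ibi_integrand_def tube_def)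
    then show ?thesis using B(1) M(1) \<epsilon>(1) by simp
  qed
  then show ?thesis using that[of "B * M"] B(1) M(1) by simp
qed

lemma integrand_support:
  obtains R where "R \<ge> 0" "\<And>\<epsilon> x. 0 < \<epsilon> \<Longrightarrow> \<epsilon> < e \<Longrightarrow> ibi_integrand \<Omega> f \<theta> \<epsilon> x \<noteq> 0 \<Longrightarrow> norm x \<le> R"
proof -
  obtain B where B: "B \<ge> 0" "\<And>t. norm (\<gamma> t) \<le> B" using gd_bounded[of 0] unfolding gd0 by blast
  have "norm x \<le> B + e" if \<epsilon>: "0 < \<epsilon>" "\<epsilon> < e" and x: "ibi_integrand \<Omega> f \<theta> \<epsilon> x \<noteq> 0" for \<epsilon> x
  proof -
    have "x \<in> tube \<Gamma> \<epsilon>" using x unfolding ibi_integrand_def by (auto split: if_splits)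
    then obtain t s where ts: "\<bar>s\<bar> \<le> \<epsilon>" "x = \<Phi> t s" using tube_eq[of \<epsilon> x] \<epsilon>(2) by auto
    have "norm x \<le> norm (\<gamma> t) + norm (s *\<^sub>R nrm t)" unfolding ts(2) \<Phi>_def by (rule norm_triangle_ineq)
    then show ?thesis using B(2)[of t] ts(1) \<epsilon>(2) nrm_unit(2)[of t] by simp
  qed
  then show ?thesis using that[of "B + e"] B(1) e0 by simp
qed

lemma negligible_parallel_curve: "negligible (range (\<lambda>t. \<Phi> t s))"
proof (rule negligible_differentiable_image_lowdim)
  show "(\<lambda>t. \<Phi> t s) differentiable_on UNIV"
    using \<Phi>_deriv by (auto simp: differentiable_on_def intro: differentiableI_vector)
qed simp

text \<open>Discontinuities can lie only on the parallel curves at distance \<epsilon> b with b a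
  discontinuity of \<theta>. If \<theta> jumps at an end of its support, the corresponding edge of
  the tube is one of these curves; otherwise \<theta> continues the formula by 0 across the
  edge.\<close>

lemma integrand_continuous_off_curves:
  obtains E where "\<And>\<epsilon>. negligible (E \<epsilon>)" "\<And>\<epsilon> x. 0 < \<epsilon> \<Longrightarrow> \<epsilon> < e \<Longrightarrow> x \<notin> E \<epsilon> \<Longrightarrow> isCont (ibi_integrand \<Omega> f \<theta> \<epsilon>) x"
proof -
  obtain B where B: "finite B" "\<And>s. s \<notin> B \<Longrightarrow> isCont \<theta> s" using profile_continuous[OF profile] by blast
  define E where "E \<epsilon> = (\<Union>b\<in>B. range (\<lambda>t. \<Phi> t (\<epsilon> * b)))" for \<epsilon>
  have "negligible (E \<epsilon>)" for \<epsilon> unfolding E_def using B(1) negligible_parallel_curve by (intro negligible_Union) auto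
  moreover have "isCont (ibi_integrand \<Omega> f \<theta> \<epsilon>) x" if \<epsilon>: "0 < \<epsilon>" "\<epsilon> < e" and x: "x \<notin> E \<epsilon>" for \<epsilon> x
  proof (cases "infdist x \<Gamma> \<le> \<epsilon>")
    case True
    let ?V = "{x. infdist x \<Gamma> < e}"
    have xV: "x \<in> ?V" using True \<epsilon>(2) by simp
    have sub: "?V \<subseteq> {x. infdist x \<Gamma> \<le> e}" by auto
    have c: "isCont (\<lambda>x. dens (foot_param x) (signed_distance \<Omega> x)) x" "isCont (signed_distance \<Omega>) x"
      using continuous_on_subset[OF tube_continuous_nice[OF nice_dens] sub] continuous_on_subset[OF tube_continuous_nice[OF nice_s] sub] xV
      unfolding continuous_on_eq_continuous_at[OF open_tube(1)] by auto
    obtain t s where ts: "\<bar>s\<bar> \<le> \<epsilon>" "x = \<Phi> t s" using tube_eq[of \<epsilon> x] True \<epsilon>(2) by (auto simp: tube_def)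
    have "s / \<epsilon> \<notin> B"
    proof
      assume "s / \<epsilon> \<in> B"
      then have "\<Phi> t (\<epsilon> * (s / \<epsilon>)) \<in> E \<epsilon>" unfolding E_def by blast
      then show False using x ts(2) \<epsilon>(1) by simp
    qed
    then have "isCont \<theta> (signed_distance \<Omega> x / \<epsilon>)" using B(2) ts \<epsilon>(2) signed_distance_\<Phi>[of s t] by simp
    moreover have "isCont (\<lambda>x. signed_distance \<Omega> x / \<epsilon>) x" using c(2) \<epsilon>(1) by (intro continuous_intros) auto
    ultimately have "isCont (\<lambda>x. \<theta> (signed_distance \<Omega> x / \<epsilon>)) x" using isCont_o2[of x "\<lambda>x. signed_distance \<Omega> x / \<epsilon>" \<theta>] by blast
    then have "isCont (\<lambda>x. dens (foot_param x) (signed_distance \<Omega> x) * (\<theta> (signed_distance \<Omega> x / \<epsilon>) / \<epsilon>)) x"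
      using c(1) \<epsilon>(1) by (intro continuous_intros) auto
    then have c3: "isCont (\<lambda>x. dens (foot_param x) (signed_distance \<Omega> x) * (\<theta> (signed_distance \<Omega> x / \<epsilon>) / \<epsilon>)) x" .
    have "\<forall>\<^sub>F y in nhds x. ibi_integrand \<Omega> f \<theta> \<epsilon> y = dens (foot_param y) (signed_distance \<Omega> y) * (\<theta> (signed_distance \<Omega> y / \<epsilon>) / \<epsilon>)"
      unfolding eventually_nhds using open_tube(1) xV integrand_eq[OF \<epsilon>] by (intro exI[of _ ?V]) auto
    from isCont_cong[OF this] c3 show ?thesis by simp
  next
    case False
    have "\<forall>\<^sub>F y in nhds x. ibi_integrand \<Omega> f \<theta> \<epsilon> y = 0"
      unfolding eventually_nhds using open_tube(3)[of \<epsilon>] False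
      by (intro exI[of _ "{x. infdist x \<Gamma> > \<epsilon>}"]) (auto simp: ibi_integrand_def tube_def)
    then have "isCont (ibi_integrand \<Omega> f \<theta> \<epsilon>) x = isCont (\<lambda>x. 0 :: real) x" by (rule isCont_cong)
    then show ?thesis by simp
  qed
  ultimately show ?thesis using that by blast
qed

text \<open>The term of the lattice sum as a function of w - \<xi>, for the rotation by \<phi>; the
  rotation by - \<phi> is the inverse that pulls the lattice back to the original curve.\<close>

definition rq :: "real \<Rightarrow> real \<Rightarrow> real \<Rightarrow> real^2 \<Rightarrow> real" where
  "rq h \<epsilon> \<phi> y = h\<^sup>2 * ibi_integrand \<Omega> f \<theta> \<epsilon> (h *\<^sub>R (rot (- \<phi>) *v y))"

lemma rq_periodized:
  obtains K R where "K \<ge> 0" "R \<ge> 0"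
    "\<And>h \<epsilon> \<phi>. h > 0 \<Longrightarrow> 0 < \<epsilon> \<Longrightarrow> \<epsilon> < e \<Longrightarrow> periodized (rq h \<epsilon> \<phi>) (h\<^sup>2 * (K / \<epsilon>)) (R / h)"
proof -
  obtain K where K: "K \<ge> 0" "\<And>\<epsilon> x. 0 < \<epsilon> \<Longrightarrow> \<epsilon> < e \<Longrightarrow> \<bar>ibi_integrand \<Omega> f \<theta> \<epsilon> x\<bar> \<le> K / \<epsilon>" using integrand_bounded by blast
  obtain R where R: "R \<ge> 0" "\<And>\<epsilon> x. 0 < \<epsilon> \<Longrightarrow> \<epsilon> < e \<Longrightarrow> ibi_integrand \<Omega> f \<theta> \<epsilon> x \<noteq> 0 \<Longrightarrow> norm x \<le> R" using integrand_support by blast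
  obtain E where E: "\<And>\<epsilon>. negligible (E \<epsilon>)" "\<And>\<epsilon> x. 0 < \<epsilon> \<Longrightarrow> \<epsilon> < e \<Longrightarrow> x \<notin> E \<epsilon> \<Longrightarrow> isCont (ibi_integrand \<Omega> f \<theta> \<epsilon>) x"
    using integrand_continuous_off_curves by blast
  have "periodized (rq h \<epsilon> \<phi>) (h\<^sup>2 * (K / \<epsilon>)) (R / h)" if h: "h > 0" and \<epsilon>: "0 < \<epsilon>" "\<epsilon> < e" for h \<epsilon> \<phi>
  proof
    let ?A = "\<lambda>y. h *\<^sub>R (rot (- \<phi>) *v y)"
    have cA: "continuous_on UNIV ?A" by (intro continuous_intros continuous_rot)
    have [measurable]: "?A \<in> borel_measurable borel" using cA by (rule borel_measurable_continuous_onI)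
    note [measurable] = integrand_measurable[OF \<epsilon>]
    show "rq h \<epsilon> \<phi> \<in> borel_measurable borel" unfolding rq_def[abs_def] by measurable
    show "\<bar>rq h \<epsilon> \<phi> x\<bar> \<le> h\<^sup>2 * (K / \<epsilon>)" for x
      unfolding rq_def abs_mult using K(2)[OF \<epsilon>] by (intro mult_mono) auto
    show "\<bar>x $ i\<bar> \<le> R / h" if "rq h \<epsilon> \<phi> x \<noteq> 0" for x i
    proof -
      have "norm (?A x) \<le> R" by (rule R(2)[OF \<epsilon>]) (use that in \<open>auto simp: rq_def\<close>)
      then have "norm x \<le> R / h" using h by (simp add: norm_rot pos_le_divide_eq mult.commute)
      then show ?thesis using component_le_norm_cart[of x i] by linarith
    qed
    show "R / h \<ge> 0" using R(1) h by simp
    let ?A' = "\<lambda>x. (1 / h) *\<^sub>R (rot \<phi> *v x)"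
    have inv: "?A' (?A y) = y" for y using h rot_inverse(1)[of \<phi> y] by (simp add: matrix_vector_mult_scaleR)
    have "linear ?A'" by (intro linear_compose_scale_right matrix_vector_mul_linear)
    then have "negligible (?A' ` E \<epsilon>)"
      by (intro negligible_differentiable_image_negligible E(1) linear_imp_differentiable_on) auto
    then have "AE y in lebesgue. y \<notin> ?A' ` E \<epsilon>" unfolding negligible_iff_null_sets by (rule AE_not_in)
    then have "AE y in lborel. y \<notin> ?A' ` E \<epsilon>" by (simp add: AE_completion_iff)
    then show "AE y in lborel. isCont (rq h \<epsilon> \<phi>) y"
    proof eventually_elim
      case (elim y)
      have "?A y \<notin> E \<epsilon>" using elim inv[of y] by (metis imageI)
      then have c1: "isCont (ibi_integrand \<Omega> f \<theta> \<epsilon>) (?A y)" by (rule E(2)[OF \<epsilon>])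
      have c2: "isCont ?A y" using cA by (simp add: continuous_on_eq_continuous_at)
      have "isCont (\<lambda>y. ibi_integrand \<Omega> f \<theta> \<epsilon> (?A y)) y" by (rule isCont_o2[OF c2 c1])
      then show ?case unfolding rq_def[abs_def] by (intro continuous_intros)
    qed
  qed
  then show ?thesis using that K(1) R(1) by blast
qed

end

section \<open>Fourier transform of the integrand\<close>

definition cv :: "complex \<Rightarrow> real^2" where "cv z = vec2 (Re z) (Im z)"

lemma bounded_linear_cv: "bounded_linear cv"
  unfolding linear_conv_bounded_linear[symmetric]
  by (rule linearI) (simp_all add: cv_def vec_eq_iff forall_2)

lemma cv_eq_iff: "cv z = cv w \<longleftrightarrow> z = w"
  by (auto simp: cv_def vec_eq_iff forall_2 complex_eq_iff)

lemma cv_0: "cv 0 = 0" by (simp add: cv_def vec_eq_iff forall_2)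

lemma integrable_lborel_absolutely:
  fixes G :: "real^2 \<Rightarrow> complex"
  assumes "integrable lborel G"
  shows "(\<lambda>x. cv (G x)) absolutely_integrable_on UNIV" "integral UNIV (\<lambda>x. cv (G x)) = cv (LINT x|lborel. G x)"
proof -
  have i: "integrable lborel (\<lambda>x. cv (G x))" by (rule integrable_bounded_linear[OF bounded_linear_cv assms])
  then have "integrable lebesgue (\<lambda>x. cv (G x))"
    by (subst integrable_completion) (auto simp: borel_measurable_integrable)
  then show "(\<lambda>x. cv (G x)) absolutely_integrable_on UNIV" by (simp add: set_integrable_def)
  have "(LINT x|lborel. cv (G x)) = cv (LINT x|lborel. G x)" by (rule integral_bounded_linear[OF bounded_linear_cv assms])
  then show "integral UNIV (\<lambda>x. cv (G x)) = cv (LINT x|lborel. G x)" using integral_lborel[OF i] by simp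
qed

text \<open>The change of variables formula of the library is stated for functions with values in a vector
  type, which is why the complex integrals pass through \<open>cv\<close>.\<close>

lemma complex_change_of_variables:
  fixes G H :: "real^2 \<Rightarrow> complex" and g :: "real^2 \<Rightarrow> real^2"
  assumes S: "S \<in> sets lebesgue" and g: "\<And>x. x \<in> S \<Longrightarrow> (g has_derivative g' x) (at x within S)" and inj: "inj_on g S"
    and G: "integrable lborel G" "\<And>y. y \<notin> g ` S \<Longrightarrow> G y = 0"
    and H: "integrable lborel H" "\<And>x. x \<notin> S \<Longrightarrow> H x = 0"
    and eq: "\<And>x. x \<in> S \<Longrightarrow> H x = \<bar>det (matrix (g' x))\<bar> *\<^sub>R G (g x)"
  shows "(LINT y|lborel. G y) = (LINT x|lborel. H x)"
proof -
  have r: "(\<lambda>y. if y \<in> g ` S then cv (G y) else 0) = (\<lambda>y. cv (G y))" using G(2) by (auto simp: cv_0)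
  have r': "(\<lambda>x. if x \<in> S then cv (H x) else 0) = (\<lambda>x. cv (H x))" using H(2) by (auto simp: cv_0)
  have "(\<lambda>y. cv (G y)) absolutely_integrable_on (g ` S)"
    using integrable_lborel_absolutely(1)[OF G(1)] absolutely_integrable_restrict_UNIV[of "g ` S" "\<lambda>y. cv (G y)"] unfolding r by simp
  then have "integral (g ` S) (\<lambda>y. cv (G y)) = integral S (\<lambda>x. \<bar>det (matrix (g' x))\<bar> *\<^sub>R cv (G (g x)))"
    by (intro integral_change_of_variables[OF S g inj]) auto
  also have "\<dots> = integral S (\<lambda>x. cv (H x))"
    using eq by (intro Henstock_Kurzweil_Integration.integral_cong) (simp add: bounded_linear.linear[OF bounded_linear_cv] linear_cmul)
  also have "\<dots> = cv (LINT x|lborel. H x)"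
    using integral_restrict_UNIV[of S "\<lambda>x. cv (H x)"] integrable_lborel_absolutely(2)[OF H(1)] unfolding r' by simp
  finally have "cv (LINT y|lborel. G y) = cv (LINT x|lborel. H x)"
    using integral_restrict_UNIV[of "g ` S" "\<lambda>y. cv (G y)"] integrable_lborel_absolutely(2)[OF G(1)] unfolding r by simp
  then show ?thesis unfolding cv_eq_iff .
qed

lemma matrix_2: "matrix g' $ i $ j = g' (axis j 1) $ i"
  by (simp add: matrix_def)

lemma lborel_integral_interval:
  fixes g :: "real \<Rightarrow> complex"
  assumes "set_integrable lborel A g" "A \<in> sets borel" "negligible ({a..b} - A)" "A \<subseteq> {a..b}"
  shows "(LINT x|lborel. indicator A x *\<^sub>R g x) = integral {a..b} g"
proof -
  have "(LINT x|lborel. indicator A x *\<^sub>R g x) = integral A g"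
    using set_borel_integral_eq_integral(2)[OF assms(1)] by (simp add: set_lebesgue_integral_def)
  also have "\<dots> = integral {a..b} g"
    by (rule integral_subset_negligible[OF assms(4,3)])
  finally show ?thesis .
qed

section \<open>The transform in tubular coordinates\<close>

sublocale tube_chart \<subseteq> fr: curve_frame "\<lambda>t. \<gamma> t $ 1" "\<lambda>t. \<gamma> t $ 2" spd crv T1 T2 n1 n2 e c0
proof
  show "e > 0" "c0 > 0" by (rule e0 c0)+
  show "((\<lambda>t. \<gamma> t $ 1) has_real_derivative spd t * T1 t) (at t)" "((\<lambda>t. \<gamma> t $ 2) has_real_derivative spd t * T2 t) (at t)" for t
    using comp_deriv[of 0 1 t] comp_deriv[of 0 2 t] gd1_T[of t] by (simp_all add: gd0)
  show "nice e k (\<lambda>t s. \<gamma> t $ 1)" "nice e k (\<lambda>t s. \<gamma> t $ 2)" for k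
    using nice_gd[of e k 0 1] nice_gd[of e k 0 2] by (simp_all add: gd0)
  show "T1 t * n1 t + T2 t * n2 t = 0" for t by (rule nrm_ortho(2))
  show "c0 \<le> spd t + s * crv t" if "s \<in> {-e..e}" for s t by (rule speed) (use that in auto)
qed (rule frame_deriv T_unit nrm_unit nice_spd nice_n nice_T)+

context tube_integrand
begin

text \<open>Coordinates on the rotated tube, scaled by 1/h. Both parameters are normalized, so that
  their domain \<open>strip\<close> depends neither on h nor on \<epsilon>.\<close>

definition chart :: "real \<Rightarrow> real \<Rightarrow> real \<Rightarrow> real^2 \<Rightarrow> real^2" where
  "chart h \<epsilon> \<phi> y = (1 / h) *\<^sub>R (rot \<phi> *v \<Phi> (y $ 1) (\<epsilon> * y $ 2))"

definition chart' :: "real \<Rightarrow> real \<Rightarrow> real \<Rightarrow> real^2 \<Rightarrow> real^2 \<Rightarrow> real^2" where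
  "chart' h \<epsilon> \<phi> y k = (1 / h) *\<^sub>R (rot \<phi> *v (k $ 1 *\<^sub>R (D (y $ 1) (\<epsilon> * y $ 2) *\<^sub>R Tv (y $ 1)) + k $ 2 *\<^sub>R (\<epsilon> *\<^sub>R nrm (y $ 1))))"

lemma has_derivative_nth2: "((\<lambda>y::real^2. y $ i) has_derivative (\<lambda>k. k $ i)) F"
  by (rule bounded_linear_imp_has_derivative[OF bounded_linear_vec_nth])

lemma chart_derivative: "(chart h \<epsilon> \<phi> has_derivative chart' h \<epsilon> \<phi> y) (at y within S)"
proof -
  have g: "((\<lambda>y. \<gamma> (y $ 1)) has_derivative (\<lambda>k. k $ 1 *\<^sub>R gd 1 (y $ 1))) (at y within S)"
    by (rule has_derivative_compose[OF has_derivative_nth2 \<gamma>_deriv[unfolded has_vector_derivative_def]])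
  have n: "((\<lambda>y. nrm (y $ 1)) has_derivative (\<lambda>k. k $ 1 *\<^sub>R (crv (y $ 1) *\<^sub>R Tv (y $ 1)))) (at y within S)"
    by (rule has_derivative_compose[OF has_derivative_nth2 nrm_deriv[unfolded has_vector_derivative_def]])
  have s: "((\<lambda>y. \<epsilon> * y $ 2) has_derivative (\<lambda>k. \<epsilon> * k $ 2)) (at y within S)"
    by (intro has_derivative_mult_right has_derivative_nth2)
  have "((\<lambda>y. \<Phi> (y $ 1) (\<epsilon> * y $ 2)) has_derivative
     (\<lambda>k. k $ 1 *\<^sub>R gd 1 (y $ 1) + ((\<epsilon> * y $ 2) *\<^sub>R (k $ 1 *\<^sub>R (crv (y $ 1) *\<^sub>R Tv (y $ 1))) + (\<epsilon> * k $ 2) *\<^sub>R nrm (y $ 1)))) (at y within S)"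
    unfolding \<Phi>_def by (intro has_derivative_add g has_derivative_scaleR s n)
  then have P: "((\<lambda>y. \<Phi> (y $ 1) (\<epsilon> * y $ 2)) has_derivative
     (\<lambda>k. k $ 1 *\<^sub>R (D (y $ 1) (\<epsilon> * y $ 2) *\<^sub>R Tv (y $ 1)) + k $ 2 *\<^sub>R (\<epsilon> *\<^sub>R nrm (y $ 1)))) (at y within S)"
    by (rule has_derivative_eq_rhs) (unfold gd1_Tv D_def, simp add: fun_eq_iff algebra_simps)
  have "bounded_linear (\<lambda>z. (1 / h) *\<^sub>R (rot \<phi> *v z))"
    by (intro bounded_linear_const_scaleR matrix_vector_mul_bounded_linear)
  from bounded_linear.has_derivative[OF this P] show ?thesis unfolding chart_def[abs_def] chart'_def[abs_def] .
qed

text \<open>The rotation has determinant 1 and the pair of tangent and normal has determinant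
  \<open>- sig\<close>. There remain D for the tangential direction, \<epsilon> for the normal one
  and the scaling 1/h^2.\<close>

lemma chart_det:
  assumes h: "h > 0" and \<epsilon>: "\<epsilon> > 0" and y: "\<bar>\<epsilon> * y $ 2\<bar> \<le> e"
  shows "\<bar>det (matrix (chart' h \<epsilon> \<phi> y))\<bar> = \<epsilon> * D (y $ 1) (\<epsilon> * y $ 2) / h\<^sup>2"
proof -
  let ?t = "y $ 1" and ?D = "D (y $ 1) (\<epsilon> * y $ 2)"
  have m: "matrix (chart' h \<epsilon> \<phi> y) $ 1 $ 1 = (1 / h) * (?D * (cos \<phi> * T1 ?t - sin \<phi> * T2 ?t))"
    "matrix (chart' h \<epsilon> \<phi> y) $ 2 $ 1 = (1 / h) * (?D * (sin \<phi> * T1 ?t + cos \<phi> * T2 ?t))"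
    "matrix (chart' h \<epsilon> \<phi> y) $ 1 $ 2 = (1 / h) * (\<epsilon> * (cos \<phi> * n1 ?t - sin \<phi> * n2 ?t))"
    "matrix (chart' h \<epsilon> \<phi> y) $ 2 $ 2 = (1 / h) * (\<epsilon> * (sin \<phi> * n1 ?t + cos \<phi> * n2 ?t))"
    unfolding matrix_2 chart'_def vector_scaleR_component rot_component
    by (simp_all add: axis_def Tv_def nrm_def algebra_simps)
  have "det (matrix (chart' h \<epsilon> \<phi> y)) = (1 / h) * (1 / h) * (?D * \<epsilon>) * (((sin \<phi>)\<^sup>2 + (cos \<phi>)\<^sup>2) * (T1 ?t * n2 ?t - T2 ?t * n1 ?t))"
    unfolding det_2 m by algebra
  also have "\<dots> = (1 / h) * (1 / h) * (?D * \<epsilon>) * (- sig * ((T1 ?t)\<^sup>2 + (T2 ?t)\<^sup>2))"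
    unfolding sin_cos_squared_add n1_def n2_def by (simp add: power2_eq_square algebra_simps)
  finally have d: "det (matrix (chart' h \<epsilon> \<phi> y)) = (1 / h) * (1 / h) * (?D * \<epsilon>) * (- sig)" by (simp add: T_unit)
  have "\<bar>- sig\<bar> = 1" using sig_cases by auto
  then show ?thesis unfolding d abs_mult using h \<epsilon> D_pos[OF y, of ?t] by (simp add: power2_eq_square field_simps)
qed

text \<open>Half-open in the first coordinate, so that each point of the curve is met once per
  period.\<close>

definition strip :: "(real^2) set" where
  "strip = {y. 0 \<le> y $ 1 \<and> y $ 1 < 1 \<and> -1 \<le> y $ 2 \<and> y $ 2 \<le> 1}"

lemma strip_measurable [measurable]: "strip \<in> sets borel" unfolding strip_def by measurable

lemma strip_bound: "0 < \<epsilon> \<Longrightarrow> y \<in> strip \<Longrightarrow> \<bar>\<epsilon> * y $ 2\<bar> \<le> \<epsilon>"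
  unfolding strip_def abs_mult by (auto simp: abs_le_iff mult_left_le)

lemma chart_inverse: "h > 0 \<Longrightarrow> h *\<^sub>R (rot (- \<phi>) *v chart h \<epsilon> \<phi> y) = \<Phi> (y $ 1) (\<epsilon> * y $ 2)"
  unfolding chart_def by (simp add: matrix_vector_mult_scaleR rot_inverse)

lemma chart_inj:
  assumes h: "h > 0" and \<epsilon>: "0 < \<epsilon>" "\<epsilon> < e"
  shows "inj_on (chart h \<epsilon> \<phi>) strip"
proof (rule inj_onI)
  fix x y assume x: "x \<in> strip" and y: "y \<in> strip" and eq: "chart h \<epsilon> \<phi> x = chart h \<epsilon> \<phi> y"
  have "\<Phi> (x $ 1) (\<epsilon> * x $ 2) = \<Phi> (y $ 1) (\<epsilon> * y $ 2)"
    using eq chart_inverse[OF h, of \<phi> \<epsilon> x] chart_inverse[OF h, of \<phi> \<epsilon> y] by simp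
  moreover have "\<bar>\<epsilon> * x $ 2\<bar> \<le> e" "\<bar>\<epsilon> * y $ 2\<bar> \<le> e"
    using strip_bound[OF \<epsilon>(1) x] strip_bound[OF \<epsilon>(1) y] \<epsilon>(2) by linarith+
  ultimately have "\<epsilon> * x $ 2 = \<epsilon> * y $ 2" "\<gamma> (x $ 1) = \<gamma> (y $ 1)" using \<Phi>_inj by blast+
  then have "x $ 2 = y $ 2" using \<epsilon>(1) by simp
  moreover have "x $ 1 = y $ 1"
  proof -
    obtain k where k: "y $ 1 = x $ 1 + of_int k" using \<open>\<gamma> (x $ 1) = \<gamma> (y $ 1)\<close> unfolding \<gamma>_eq_iff by blast
    have "\<bar>of_int k :: real\<bar> < 1" using k x y by (auto simp: strip_def abs_less_iff)
    then have "k = 0" by linarith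
    then show ?thesis using k by simp
  qed
  ultimately show "x = y" by (simp add: vec_eq_iff forall_2)
qed

lemma chart_covers:
  assumes h: "h > 0" and \<epsilon>: "0 < \<epsilon>" "\<epsilon> < e" and y: "rq h \<epsilon> \<phi> y \<noteq> 0"
  shows "y \<in> chart h \<epsilon> \<phi> ` strip"
proof -
  let ?x = "h *\<^sub>R (rot (- \<phi>) *v y)"
  have "?x \<in> tube \<Gamma> \<epsilon>" using y unfolding rq_def ibi_integrand_def by (auto split: if_splits)
  then obtain t s where ts: "\<bar>s\<bar> \<le> \<epsilon>" "?x = \<Phi> t s" using tube_eq[of \<epsilon> ?x] \<epsilon>(2) by auto
  obtain k where k: "t - of_int k \<in> {0..<1}" using periodic_reduce[of t] by blast
  let ?z = "vec2 (t - of_int k) (s / \<epsilon>)"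
  have z: "?z \<in> strip" using k ts(1) \<epsilon>(1) by (auto simp: strip_def field_simps abs_le_iff)
  have "chart h \<epsilon> \<phi> ?z = (1 / h) *\<^sub>R (rot \<phi> *v ?x)"
    unfolding chart_def ts(2) using \<epsilon>(1) by (simp add: \<Phi>_shift)
  also have "\<dots> = y" using h by (simp add: matrix_vector_mult_scaleR rot_inverse)
  finally show ?thesis using z by blast
qed

definition curve_dens :: "real \<Rightarrow> real" where "curve_dens t = f (\<gamma> t) * spd t"

lemma nice_curve_dens: "nice e k (\<lambda>t s. curve_dens t)"
  unfolding curve_dens_def by (intro nice_mult nice_f nice_spd)

text \<open>The transform's integrand after the change of variables: the quotient of
  \<open>spd\<close> by D in the amplitude and the D of the determinant have cancelled to
  \<open>spd\<close>, which sits in \<open>curve_dens\<close>.\<close>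

definition pulled :: "real \<Rightarrow> real \<Rightarrow> real \<Rightarrow> real^2 \<Rightarrow> complex" where
  "pulled R \<epsilon> p y = indicator strip y *\<^sub>R (of_real (curve_dens (y $ 1) * \<theta> (y $ 2)) * cis (- (R * fr.ph (\<epsilon> * y $ 2) p (y $ 1))))"

lemma continuous_ph: "continuous_on UNIV (\<lambda>y::real^2. R * fr.ph (\<epsilon> * y $ 2) p (y $ 1))"
proof -
  have c: "continuous_on UNIV n1" "continuous_on UNIV n2" "continuous_on UNIV (\<lambda>t. \<gamma> t $ 1)" "continuous_on UNIV (\<lambda>t. \<gamma> t $ 2)"
    using nice_continuous[OF nice_n(1)[of e 0], of 0] nice_continuous[OF nice_n(2)[of e 0], of 0] e0
    by (auto intro!: continuous_intros continuous_\<gamma>)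
  show ?thesis unfolding fr.ph_def fr.nu_def
    by (intro continuous_intros continuous_on_compose2[OF c(1)] continuous_on_compose2[OF c(2)]
        continuous_on_compose2[OF c(3)] continuous_on_compose2[OF c(4)]) auto
qed

lemma continuous_curve_dens: "continuous_on S curve_dens"
  using nice_continuous[OF nice_curve_dens[of 0], of 0] e0 by simp

lemma curve_dens_bounded: obtains B where "B \<ge> 0" "\<And>t. \<bar>curve_dens t\<bar> \<le> B"
  using nice_bounded_all[OF nice_curve_dens[of 0]] e0 by (metis atLeastAtMost_iff less_imp_le neg_le_0_iff_le)

lemma integrable_pulled: "integrable lborel (pulled R \<epsilon> p)"
proof -
  obtain B where B: "B \<ge> 0" "\<And>t. \<bar>curve_dens t\<bar> \<le> B" using curve_dens_bounded by blast
  obtain M where M: "M \<ge> 0" "\<And>s. \<bar>\<theta> s\<bar> \<le> M" using profile_bounded[OF profile] by blast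
  have [measurable]: "curve_dens \<in> borel_measurable borel" "\<theta> \<in> borel_measurable borel"
    by (rule borel_measurable_continuous_onI[OF continuous_curve_dens], rule profile_measurable[OF profile])
  have [measurable]: "(\<lambda>y. cis (- (R * fr.ph (\<epsilon> * y $ 2) p (y $ 1)))) \<in> borel_measurable (borel :: (real^2) measure)"
    by (intro borel_measurable_continuous_onI continuous_intros continuous_ph)
  show ?thesis
  proof (rule integrable_bounded_on[where A = strip and B = "B * M"])
    show "pulled R \<epsilon> p \<in> borel_measurable borel" unfolding pulled_def[abs_def] by measurable
    show "strip \<in> sets borel" by simp
    have "strip \<subseteq> cbox (vec2 0 (-1)) (vec2 1 1)" by (auto simp: strip_def mem_box_cart forall_2)
    then have "emeasure lborel strip \<le> emeasure lborel (cbox (vec2 0 (-1)) (vec2 1 1))" by (intro emeasure_mono) auto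
    also have "\<dots> < \<infinity>" by (rule emeasure_lborel_cbox_finite)
    finally show "emeasure lborel strip < \<infinity>" .
    show "norm (pulled R \<epsilon> p y) \<le> B * M" if "y \<in> strip" for y
      unfolding pulled_def using that B M by (auto simp: norm_mult abs_mult intro!: mult_mono)
    show "pulled R \<epsilon> p y = 0" if "y \<notin> strip" for y using that by (simp add: pulled_def)
  qed
qed

text \<open>Because the phase is affine in the normal variable, the inner integral is the transform
  of \<theta> at \<epsilon> R \<open>nu\<close>, and the outer one is \<open>osw\<close>.\<close>

lemma pulled_iterated: "(LINT y|lborel. pulled R \<epsilon> p y) = fr.osw (ft \<theta> (-1) 1) curve_dens 0 0 R \<epsilon> p"
proof -
  let ?w = "ft \<theta> (-1) 1"
  have "(LINT y|lborel. pulled R \<epsilon> p y) = (LINT t|lborel. LINT s|lborel. pulled R \<epsilon> p (vec2 t s))"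
    by (rule integral_vec2[OF integrable_pulled])
  also have "\<dots> = (LINT t|lborel. indicator {0..<1} t *\<^sub>R (of_real (curve_dens t) * ?w (\<epsilon> * R * fr.nu p t) * cis (- (R * fr.ph 0 p t))))"
  proof (intro Bochner_Integration.integral_cong refl)
    fix t :: real
    have P: "pulled R \<epsilon> p (vec2 t s) = (indicator {0..<1} t *\<^sub>R (of_real (curve_dens t) * cis (- (R * fr.ph 0 p t)))) *
       (indicator {-1..1} s *\<^sub>R (of_real (\<theta> s) * cis (- ((\<epsilon> * R * fr.nu p t) * s))))" for s
    proof -
      have e: "cis (- (R * fr.ph (\<epsilon> * s) p t)) = cis (- (R * fr.ph 0 p t)) * cis (- ((\<epsilon> * R * fr.nu p t) * s))"
        unfolding cis_mult fr.ph_def by (simp add: algebra_simps)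
      show ?thesis unfolding pulled_def vector_2 e by (auto simp: strip_def mult_ac split: split_indicator)
    qed
    have "(LINT s|lborel. pulled R \<epsilon> p (vec2 t s)) = (indicator {0..<1} t *\<^sub>R (of_real (curve_dens t) * cis (- (R * fr.ph 0 p t)))) *
       (LINT s|lborel. indicator {-1..1} s *\<^sub>R (of_real (\<theta> s) * cis (- ((\<epsilon> * R * fr.nu p t) * s))))"
      unfolding P by (rule integral_mult_right_zero)
    also have "(LINT s|lborel. indicator {-1..1} s *\<^sub>R (of_real (\<theta> s) * cis (- ((\<epsilon> * R * fr.nu p t) * s)))) = ?w (\<epsilon> * R * fr.nu p t)"
    proof -
      obtain M where M: "M \<ge> 0" "\<And>s. \<bar>\<theta> s\<bar> \<le> M" using profile_bounded[OF profile] by blast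
      have [measurable]: "\<theta> \<in> borel_measurable borel" by (rule profile_measurable[OF profile])
      have [measurable]: "(\<lambda>s. cis (- ((\<epsilon> * R * fr.nu p t) * s))) \<in> borel_measurable borel"
        by (intro borel_measurable_continuous_onI continuous_intros)
      have "set_integrable lborel {-1..1} (\<lambda>s. of_real (\<theta> s) * cis (- ((\<epsilon> * R * fr.nu p t) * s)))"
        unfolding set_integrable_def
      proof (rule integrable_bounded_on[where A = "{-1..1}" and B = M])
        show "(\<lambda>s. indicator {-1..1} s *\<^sub>R (of_real (\<theta> s) * cis (- ((\<epsilon> * R * fr.nu p t) * s)))) \<in> borel_measurable borel" by measurable
      qed (use M in \<open>auto simp: norm_mult\<close>)
      then show ?thesis unfolding ft_def by (intro lborel_integral_interval) auto
    qed
    finally show "(LINT s|lborel. pulled R \<epsilon> p (vec2 t s)) = indicator {0..<1} t *\<^sub>R (of_real (curve_dens t) * ?w (\<epsilon> * R * fr.nu p t) * cis (- (R * fr.ph 0 p t)))"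
      by (simp add: mult_ac)
  qed
  also have "\<dots> = integral {0..1} (\<lambda>t. of_real (curve_dens t) * ?w (\<epsilon> * R * fr.nu p t) * cis (- (R * fr.ph 0 p t)))"
  proof (rule lborel_integral_interval)
    have "continuous_on {0..1} (\<lambda>t. of_real (curve_dens t * fr.tau p t ^ 0 * fr.nu p t ^ 0) * ?w (\<epsilon> * R * fr.nu p t) * cis (- (R * fr.ph 0 p t)))"
      by (rule fr.osw_integrand_continuous[OF nice_curve_dens continuous_on_FM[OF profile_FM(2)[OF profile]]]) (intro continuous_intros)+
    then have "continuous_on {0..1} (\<lambda>t. of_real (curve_dens t) * ?w (\<epsilon> * R * fr.nu p t) * cis (- (R * fr.ph 0 p t)))" by simp
    then have "set_integrable lborel {0..1} (\<lambda>t. of_real (curve_dens t) * ?w (\<epsilon> * R * fr.nu p t) * cis (- (R * fr.ph 0 p t)))"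
      by (rule borel_integrable_atLeastAtMost')
    then show "set_integrable lborel {0..<1} (\<lambda>t. of_real (curve_dens t) * ?w (\<epsilon> * R * fr.nu p t) * cis (- (R * fr.ph 0 p t)))"
      by (rule set_integrable_subset) auto
    have "{0..1} - {0..<1} = {1::real}" by auto
    then show "negligible ({0..1} - {0..<1::real})" by simp
  qed auto
  finally show ?thesis unfolding fr.osw_def by simp
qed

text \<open>Rotating the curve by \<phi> amounts to rotating the frequency by - \<phi>, so that an
  average over rotations becomes an average over directions.\<close>

lemma pulled_phase:
  assumes ab: "of_int m1 = \<rho> * cos \<psi>" "of_int m2 = \<rho> * sin \<psi>" and h: "h > 0"
  shows "cnj (chi m1 m2 (chart h \<epsilon> \<phi> y)) = cis (- ((2 * pi * \<rho> / h) * fr.ph (\<epsilon> * y $ 2) (\<psi> - \<phi>) (y $ 1)))"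
proof -
  let ?X = "\<Phi> (y $ 1) (\<epsilon> * y $ 2)"
  have "of_int m1 * chart h \<epsilon> \<phi> y $ 1 + of_int m2 * chart h \<epsilon> \<phi> y $ 2
     = (1 / h) * (\<rho> * (cos (\<psi> - \<phi>) * ?X $ 1 + sin (\<psi> - \<phi>) * ?X $ 2))"
    unfolding ab chart_def vector_scaleR_component rot_component real_scaleR_def cos_diff sin_diff by algebra
  also have "cos (\<psi> - \<phi>) * ?X $ 1 + sin (\<psi> - \<phi>) * ?X $ 2 = fr.ph (\<epsilon> * y $ 2) (\<psi> - \<phi>) (y $ 1)"
    unfolding fr.ph_def fr.nu_def \<Phi>_def nrm_def by (simp add: algebra_simps)
  finally show ?thesis unfolding chi_def cis_cnj by (simp add: mult_ac)
qed

text \<open>The h^2 in front of the lattice sum cancels the scaling of the chart, and the \<epsilon>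
  of the chart cancels the normalization of the profile. Hence h survives only in the frequency 2 pi
  \<rho> / h.\<close>

lemma transform_osw:
  assumes h: "h > 0" and \<epsilon>: "0 < \<epsilon>" "\<epsilon> < e" and ab: "of_int m1 = \<rho> * cos \<psi>" "of_int m2 = \<rho> * sin \<psi>"
  shows "periodized.qh (rq h \<epsilon> \<phi>) m1 m2 = fr.osw (ft \<theta> (-1) 1) curve_dens 0 0 (2 * pi * \<rho> / h) \<epsilon> (\<psi> - \<phi>)"
proof -
  obtain K L where "periodized (rq h \<epsilon> \<phi>) (h\<^sup>2 * (K / \<epsilon>)) (L / h)" using rq_periodized h \<epsilon> by metis
  then interpret P: periodized "rq h \<epsilon> \<phi>" "h\<^sup>2 * (K / \<epsilon>)" "L / h" .
  have "P.qh m1 m2 = (LINT y|lborel. of_real (rq h \<epsilon> \<phi> y) * cnj (chi m1 m2 y))" by (rule P.qh_def)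
  also have "\<dots> = (LINT y|lborel. pulled (2 * pi * \<rho> / h) \<epsilon> (\<psi> - \<phi>) y)"
  proof (rule complex_change_of_variables[of strip])
    show "strip \<in> sets lebesgue" by simp
    show "(chart h \<epsilon> \<phi> has_derivative chart' h \<epsilon> \<phi> x) (at x within strip)" for x by (rule chart_derivative)
    show "inj_on (chart h \<epsilon> \<phi>) strip" by (rule chart_inj[OF h \<epsilon>])
    show "integrable lborel (\<lambda>y. of_real (rq h \<epsilon> \<phi> y) * cnj (chi m1 m2 y))" by (rule P.integrable_q) auto
    show "of_real (rq h \<epsilon> \<phi> y) * cnj (chi m1 m2 y) = 0" if "y \<notin> chart h \<epsilon> \<phi> ` strip" for y
      using chart_covers[OF h \<epsilon>, of \<phi> y] that by auto
    show "integrable lborel (pulled (2 * pi * \<rho> / h) \<epsilon> (\<psi> - \<phi>))" by (rule integrable_pulled)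
    show "pulled (2 * pi * \<rho> / h) \<epsilon> (\<psi> - \<phi>) y = 0" if "y \<notin> strip" for y using that by (simp add: pulled_def)
    fix y assume y: "y \<in> strip"
    have le: "\<bar>\<epsilon> * y $ 2\<bar> < e" using strip_bound[OF \<epsilon>(1) y] \<epsilon>(2) by linarith
    have Dp: "D (y $ 1) (\<epsilon> * y $ 2) > 0" using le by (intro D_pos) simp
    have "\<bar>det (matrix (chart' h \<epsilon> \<phi> y))\<bar> * rq h \<epsilon> \<phi> (chart h \<epsilon> \<phi> y) = curve_dens (y $ 1) * \<theta> (y $ 2)"
      unfolding rq_def chart_inverse[OF h] integrand_\<Phi>[OF \<epsilon> le] chart_det[OF h \<epsilon>(1) less_imp_le[OF le]] dens_def curve_dens_def
      using h \<epsilon>(1) Dp by simp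
    then have "curve_dens (y $ 1) * \<theta> (y $ 2) = \<bar>det (matrix (chart' h \<epsilon> \<phi> y))\<bar> * rq h \<epsilon> \<phi> (chart h \<epsilon> \<phi> y)" by simp
    then show "pulled (2 * pi * \<rho> / h) \<epsilon> (\<psi> - \<phi>) y = \<bar>det (matrix (chart' h \<epsilon> \<phi> y))\<bar> *\<^sub>R (of_real (rq h \<epsilon> \<phi> (chart h \<epsilon> \<phi> y)) * cnj (chi m1 m2 (chart h \<epsilon> \<phi> y)))"
      unfolding pulled_def pulled_phase[OF ab h] using y by (simp add: scaleR_conv_of_real)
  qed
  also have "\<dots> = fr.osw (ft \<theta> (-1) 1) curve_dens 0 0 (2 * pi * \<rho> / h) \<epsilon> (\<psi> - \<phi>)" by (rule pulled_iterated)
  finally show ?thesis .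
qed

text \<open>At frequency 0 only the total mass 1 of the profile is left, so the mean over the
  translations is exact for every rotation and every h.\<close>

lemma transform_zero:
  assumes h: "h > 0" and \<epsilon>: "0 < \<epsilon>" "\<epsilon> < e"
  shows "periodized.qh (rq h \<epsilon> \<phi>) 0 0 = of_real (integral {0..1} curve_dens)"
proof -
  have "ft \<theta> (-1) 1 0 = integral {-1..1} (\<lambda>s. of_real (\<theta> s))" by (simp add: ft_def)
  also have "\<dots> = of_real (integral {-1..1} \<theta>)"
  proof -
    have "(\<theta> has_integral 1) {-1..1}" using profile by (simp add: weight_profile_def)
    then have "((\<lambda>s. of_real (\<theta> s) :: complex) has_integral of_real 1) {-1..1}" by (rule has_integral_of_real)
    then show ?thesis using \<open>(\<theta> has_integral 1) {-1..1}\<close> by (simp add: integral_unique)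
  qed
  also have "integral {-1..1} \<theta> = 1" using profile by (simp add: weight_profile_def integral_unique)
  finally have w: "ft \<theta> (-1) 1 0 = 1" by simp
  have "(curve_dens has_integral integral {0..1} curve_dens) {0..1}"
    by (intro integrable_integral integrable_continuous_interval continuous_curve_dens)
  then have "((\<lambda>s. of_real (curve_dens s) :: complex) has_integral of_real (integral {0..1} curve_dens)) {0..1}" by (rule has_integral_of_real)
  then have i: "integral {0..1} (\<lambda>s. of_real (curve_dens s) :: complex) = of_real (integral {0..1} curve_dens)" by (rule integral_unique)
  show ?thesis
    using transform_osw[OF h \<epsilon>, of 0 0 0 0 \<phi>] by (simp add: fr.osw_def w i)
qed

end

section \<open>The mean square error\<close>

text \<open>Dominating \<open>1/|m|^3\<close> by a product of weights turns the Fejer sums over the plane lattice into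
  squares of one-dimensional sums.\<close>

definition int_weight :: "int \<Rightarrow> real" where "int_weight m = (max 1 \<bar>of_int m\<bar>) powr (-3/2)"

lemma int_weight_nonneg: "int_weight m \<ge> 0" by (simp add: int_weight_def)

text \<open>For fixed j the differences j - k are distinct integers, so a row is at most the
  one-sided series taken twice, once for each sign. The series converges because 3/2 > 1, and there
  are n rows.\<close>

lemma sum_int_weight:
  obtains S where "S \<ge> 0" "\<And>n. (\<Sum>z\<in>sq n. int_weight (df z)) \<le> real n * S"
proof -
  define g where "g i = int_weight (int i)" for i :: nat
  have "summable (\<lambda>i. real i powr (-3/2))" by (simp add: summable_real_powr_iff)
  moreover have "\<forall>\<^sub>F i in sequentially. g i = real i powr (-3/2)"
    using eventually_ge_at_top[of 1] by eventually_elim (simp add: g_def int_weight_def max_def)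
  ultimately have g: "summable g" using summable_cong[of g "\<lambda>i. real i powr (-3/2)"] by simp
  have g0: "g i \<ge> 0" for i by (simp add: g_def int_weight_nonneg)
  have row: "(\<Sum>k<n. int_weight (int j - int k)) \<le> 2 * suminf g" if "j < n" for j n
  proof -
    have U: "{..<n} = {..j} \<union> {j<..<n}" using that by auto
    have "(\<Sum>k<n. int_weight (int j - int k)) = (\<Sum>k\<in>{..j}. int_weight (int j - int k)) + (\<Sum>k\<in>{j<..<n}. int_weight (int j - int k))"
      unfolding U by (rule sum.union_disjoint) auto
    also have "(\<Sum>k\<in>{..j}. int_weight (int j - int k)) = (\<Sum>i\<in>(\<lambda>k. j - k) ` {..j}. g i)"
      by (subst sum.reindex) (auto simp: inj_on_def g_def of_nat_diff)
    also have "\<dots> \<le> suminf g" by (rule sum_le_suminf[OF g]) (auto simp: g0)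
    also have "(\<Sum>k\<in>{j<..<n}. int_weight (int j - int k)) = (\<Sum>i\<in>(\<lambda>k. k - j) ` {j<..<n}. g i)"
    proof (subst sum.reindex)
      show "inj_on (\<lambda>k. k - j) {j<..<n}" by (auto simp: inj_on_def)
      show "(\<Sum>k\<in>{j<..<n}. int_weight (int j - int k)) = sum (g \<circ> (\<lambda>k. k - j)) {j<..<n}"
        by (intro sum.cong refl) (auto simp: g_def of_nat_diff int_weight_def abs_minus_commute)
    qed
    also have "\<dots> \<le> suminf g" by (rule sum_le_suminf[OF g]) (auto simp: g0)
    finally show ?thesis by simp
  qed
  have "(\<Sum>z\<in>sq n. int_weight (df z)) \<le> real n * (2 * suminf g)" for n
  proof -
    have "(\<Sum>z\<in>sq n. int_weight (df z)) = (\<Sum>j<n. \<Sum>k<n. int_weight (int j - int k))"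
      unfolding sq_def df_def sum.cartesian_product by (simp add: split_beta)
    also have "\<dots> \<le> (\<Sum>j<n. 2 * suminf g)" by (intro sum_mono row) simp
    finally show ?thesis by simp
  qed
  moreover have "2 * suminf g \<ge> 0" using suminf_nonneg[OF g] g0 by simp
  ultimately show ?thesis using that by blast
qed

text \<open>Off the origin max(1, |m1|) max(1, |m2|) <= m1^2 + m2^2 = \<rho>^2. Raised to the power
  -3/2 this bounds \<rho>^-3 by a product of one-dimensional weights.\<close>

lemma polar_int:
  fixes m1 m2 :: int
  assumes "(m1, m2) \<noteq> (0, 0)"
  obtains \<rho> \<psi> where "\<rho> \<ge> 1" "0 \<le> \<psi>" "\<psi> \<le> 2 * pi" "of_int m1 = \<rho> * cos \<psi>" "of_int m2 = \<rho> * sin \<psi>" "1 / \<rho> ^ 3 \<le> int_weight m1 * int_weight m2"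
proof -
  define \<rho> where "\<rho> = sqrt ((of_int m1)\<^sup>2 + (of_int m2)\<^sup>2)"
  let ?k1 = "max 1 \<bar>of_int m1\<bar> :: real" and ?k2 = "max 1 \<bar>of_int m2\<bar> :: real"
  have k: "?k1 * ?k2 \<le> (of_int m1)\<^sup>2 + (of_int m2)\<^sup>2"
  proof -
    have sq: "\<bar>x\<bar> \<le> x\<^sup>2" if "\<bar>x\<bar> \<ge> 1" for x :: real
      using mult_left_mono[OF that, of "\<bar>x\<bar>"] by (simp add: power2_eq_square flip: abs_mult)
    have one: "m = 0 \<or> \<bar>of_int m :: real\<bar> \<ge> 1" for m :: int by (auto simp flip: of_int_abs)
    consider "m1 = 0" "\<bar>of_int m2 :: real\<bar> \<ge> 1" | "m2 = 0" "\<bar>of_int m1 :: real\<bar> \<ge> 1" | "\<bar>of_int m1 :: real\<bar> \<ge> 1" "\<bar>of_int m2 :: real\<bar> \<ge> 1"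
      using one[of m1] one[of m2] assms by auto
    then show ?thesis
    proof cases
      case 1 then show ?thesis using sq[of "of_int m2"] by (simp add: max_def)
    next
      case 2 then show ?thesis using sq[of "of_int m1"] by (simp add: max_def)
    next
      case 3
      have "0 \<le> (\<bar>of_int m1\<bar> - \<bar>of_int m2\<bar> :: real)\<^sup>2" by simp
      then have "2 * (\<bar>of_int m1\<bar> * \<bar>of_int m2\<bar>) \<le> (of_int m1)\<^sup>2 + (of_int m2 :: real)\<^sup>2" by (simp add: power2_diff)
      moreover have "0 \<le> \<bar>of_int m1\<bar> * \<bar>of_int m2 :: real\<bar>" by simp
      ultimately have "\<bar>of_int m1\<bar> * \<bar>of_int m2\<bar> \<le> (of_int m1)\<^sup>2 + (of_int m2 :: real)\<^sup>2" by linarith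
      then show ?thesis using 3 by (simp add: max_def)
    qed
  qed
  have k1: "1 \<le> ?k1 * ?k2" using mult_mono[of 1 ?k1 1 ?k2] by simp
  have r2: "\<rho>\<^sup>2 = (of_int m1)\<^sup>2 + (of_int m2)\<^sup>2" by (simp add: \<rho>_def)
  have r0: "\<rho> \<ge> 0" by (simp add: \<rho>_def)
  have "1\<^sup>2 \<le> \<rho>\<^sup>2" using k k1 unfolding r2 by simp
  then have r1: "\<rho> \<ge> 1" using r0 by (rule power2_le_imp_le)
  have "(of_int m1 / \<rho>)\<^sup>2 + (of_int m2 / \<rho>)\<^sup>2 = 1"
    using r1 by (simp add: power_divide flip: add_divide_distrib r2)
  then obtain \<psi> where \<psi>: "0 \<le> \<psi>" "\<psi> < 2 * pi" "of_int m1 / \<rho> = cos \<psi>" "of_int m2 / \<rho> = sin \<psi>"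
    using sincos_total_2pi by blast
  have "(\<rho>\<^sup>2) powr (-3/2) \<le> (?k1 * ?k2) powr (-3/2)"
    using k k1 unfolding r2 by (intro powr_mono2') auto
  also have "\<dots> = int_weight m1 * int_weight m2" unfolding int_weight_def by (rule powr_mult)
  also have "(\<rho>\<^sup>2) powr (-3/2) = 1 / \<rho> ^ 3"
  proof -
    have "(\<rho>\<^sup>2) powr (-3/2) = (\<rho> powr 2) powr (-3/2)" using r1 by simp
    also have "\<dots> = \<rho> powr (- 3)" unfolding powr_powr by simp
    also have "\<dots> = 1 / \<rho> powr 3" by (rule powr_minus_divide)
    finally show ?thesis using r1 by simp
  qed
  finally have w: "1 / \<rho> ^ 3 \<le> int_weight m1 * int_weight m2" .
  show ?thesis
    by (rule that[OF r1 \<psi>(1) _ _ _ w]) (use \<psi> r1 in \<open>auto simp: field_simps\<close>)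
qed

lemma integral_periodic_reflect:
  fixes f :: "real \<Rightarrow> real"
  assumes c: "continuous_on UNIV f" and per: "\<And>x. f (x + P) = f x" and b: "0 \<le> \<beta>" "\<beta> \<le> P"
  shows "integral {0..P} (\<lambda>x. f (\<beta> - x)) = integral {0..P} f"
proof -
  have cr: "continuous_on UNIV (\<lambda>x. f (- x))" by (rule continuous_on_compose2[OF c]) (auto intro: continuous_intros)
  have "f (- (x + P)) = f (- x)" for x using per[of "- x - P"] by simp
  from integral_periodic_shift[OF cr this b] have "integral {0..P} (\<lambda>x. f (\<beta> - x)) = integral {0..P} (\<lambda>x. f (- x))" by simp
  also have "\<dots> = integral {-P..0} f" using Henstock_Kurzweil_Integration.integral_reflect_real[of 0 "-P" f] by simp
  also have "\<dots> = integral {-P..0} (f \<circ> (\<lambda>x. x + P))" by (simp add: o_def per)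
  also have "\<dots> = integral {-P + P..0 + P} f" by (rule integral_shift) (rule continuous_on_subset[OF c], simp)
  finally show ?thesis by simp
qed

context tube_integrand
begin

lemma osw_periodic: "fr.osw w g i j R \<epsilon> (p + 2 * pi) = fr.osw w g i j R \<epsilon> p"
  by (simp add: fr.osw_def fr.tau_def fr.nu_def fr.ph_def)

definition rate :: "real \<Rightarrow> real \<Rightarrow> real" where "rate h \<epsilon> = h * (h / \<epsilon>) ^ (2 * (q + 1))"

lemma angle_average:
  obtains C where "C \<ge> 0"
    "\<And>h \<epsilon> m1 m2. 0 < h \<Longrightarrow> h \<le> 1 \<Longrightarrow> 0 < \<epsilon> \<Longrightarrow> \<epsilon> < e \<Longrightarrow> (m1, m2) \<noteq> (0, 0) \<Longrightarrow>
      continuous_on {0..2*pi} (\<lambda>\<phi>. (norm (periodized.qh (rq h \<epsilon> \<phi>) m1 m2))\<^sup>2) \<and>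
      integral {0..2*pi} (\<lambda>\<phi>. (norm (periodized.qh (rq h \<epsilon> \<phi>) m1 m2))\<^sup>2) \<le> C * rate h \<epsilon> * (int_weight m1 * int_weight m2)"
proof -
  let ?T = "fr.osw (ft \<theta> (-1) 1) curve_dens 0 0"
  let ?N = "2 * (q + 1)"
  obtain C where C: "C \<ge> 0" "\<And>R \<epsilon>. R \<ge> 1 \<Longrightarrow> \<epsilon> \<in> {0<..e} \<Longrightarrow> integral {0..2*pi} (\<lambda>p. (norm (?T R \<epsilon> p))\<^sup>2) \<le> C * (1 / (R * (\<epsilon> * R) ^ ?N))"
    using fr.tube_transform_L2[OF nice_curve_dens profile] unfolding L2O_def by blast
  have "continuous_on {0..2*pi} (\<lambda>\<phi>. (norm (periodized.qh (rq h \<epsilon> \<phi>) m1 m2))\<^sup>2) \<and>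
      integral {0..2*pi} (\<lambda>\<phi>. (norm (periodized.qh (rq h \<epsilon> \<phi>) m1 m2))\<^sup>2) \<le> C * rate h \<epsilon> * (int_weight m1 * int_weight m2)"
    if h: "0 < h" "h \<le> 1" and \<epsilon>: "0 < \<epsilon>" "\<epsilon> < e" and m: "(m1, m2) \<noteq> (0, 0)" for h \<epsilon> m1 m2
  proof -
    obtain \<rho> \<psi> where \<rho>: "\<rho> \<ge> 1" "1 / \<rho> ^ 3 \<le> int_weight m1 * int_weight m2" and \<psi>: "0 \<le> \<psi>" "\<psi> \<le> 2 * pi"
      and mm: "of_int m1 = \<rho> * cos \<psi>" "of_int m2 = \<rho> * sin \<psi>"
      using polar_int[OF m] by metis
    define R where "R = 2 * pi * \<rho> / h"
    have rh: "\<rho> / h \<ge> 1" using \<rho>(1) h by simp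
    have Rr: "\<rho> / h \<le> R"
    proof -
      have "1 * (\<rho> / h) \<le> (2 * pi) * (\<rho> / h)" using rh pi_ge_two by (intro mult_right_mono) auto
      then show ?thesis by (simp add: R_def)
    qed
    have R0: "R > 0" using rh Rr by linarith
    define g where "g p = (norm (?T R \<epsilon> p))\<^sup>2" for p
    have cg: "continuous_on UNIV g" unfolding g_def
      by (intro continuous_intros fr.osw_continuous[OF nice_curve_dens continuous_on_FM[OF profile_FM(2)[OF profile]]])
    have eq: "(\<lambda>\<phi>. (norm (periodized.qh (rq h \<epsilon> \<phi>) m1 m2))\<^sup>2) = (\<lambda>\<phi>. g (\<psi> - \<phi>))"
      unfolding transform_osw[OF h(1) \<epsilon> mm] g_def R_def ..
    have "integral {0..2*pi} (\<lambda>\<phi>. g (\<psi> - \<phi>)) = integral {0..2*pi} g"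
      by (rule integral_periodic_reflect[OF cg _ \<psi>]) (simp add: g_def osw_periodic)
    also have "\<dots> \<le> C * (1 / (R * (\<epsilon> * R) ^ ?N))"
      unfolding g_def by (rule C(2)) (use rh Rr \<epsilon> in auto)
    also have "\<dots> \<le> C * (rate h \<epsilon> * (1 / \<rho> ^ 3))"
    proof (rule mult_left_mono[OF _ C(1)])
      \<comment> \<open>Of the 2 (q + 1) powers of \<rho> in the last factor only two are kept. With
        the one from R they make \<rho>^3, which is enough for summability and works for every
        q.\<close>
      have "(\<rho> / h) * ((\<epsilon> * (1 / h)) ^ ?N * \<rho>\<^sup>2) \<le> R * (\<epsilon> * R) ^ ?N"
      proof (rule mult_mono[OF Rr])
        have "(\<epsilon> * (1 / h)) ^ ?N * \<rho>\<^sup>2 \<le> (\<epsilon> * (1 / h)) ^ ?N * \<rho> ^ ?N"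
          using \<rho>(1) \<epsilon>(1) h(1) by (intro mult_left_mono power_increasing) auto
        also have "\<dots> = (\<epsilon> * (\<rho> / h)) ^ ?N" by (simp flip: power_mult_distrib)
        also have "\<dots> \<le> (\<epsilon> * R) ^ ?N" using \<epsilon>(1) \<rho>(1) h(1) Rr by (intro power_mono mult_left_mono) auto
        finally show "(\<epsilon> * (1 / h)) ^ ?N * \<rho>\<^sup>2 \<le> (\<epsilon> * R) ^ ?N" .
      qed (use R0 \<epsilon>(1) h(1) in auto)
      then have "1 / (R * (\<epsilon> * R) ^ ?N) \<le> 1 / ((\<rho> / h) * ((\<epsilon> * (1 / h)) ^ ?N * \<rho>\<^sup>2))"
        using R0 \<epsilon>(1) h(1) \<rho>(1) by (intro divide_left_mono mult_pos_pos zero_less_power) auto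
      also have "\<dots> = rate h \<epsilon> * (1 / \<rho> ^ 3)"
        using h(1) \<epsilon>(1) \<rho>(1) unfolding rate_def power_divide power_mult_distrib
        by (simp add: power_divide power2_eq_square power3_eq_cube)
      finally show "1 / (R * (\<epsilon> * R) ^ ?N) \<le> rate h \<epsilon> * (1 / \<rho> ^ 3)" .
    qed
    also have "\<dots> \<le> C * (rate h \<epsilon> * (int_weight m1 * int_weight m2))"
      using \<rho>(2) C(1) h(1) \<epsilon>(1) by (intro mult_left_mono) (auto simp: rate_def)
    finally have "integral {0..2*pi} (\<lambda>\<phi>. g (\<psi> - \<phi>)) \<le> C * rate h \<epsilon> * (int_weight m1 * int_weight m2)" by (simp only: mult.assoc)
    moreover have "continuous_on {0..2*pi} (\<lambda>\<phi>. g (\<psi> - \<phi>))"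
      by (rule continuous_on_compose2[OF cg]) (auto intro!: continuous_intros)
    ultimately show ?thesis unfolding eq by blast
  qed
  then show ?thesis using that C(1) by blast
qed

text \<open>The Fejer approximation to the variance over translations. Being nonnegative for every
  \<phi>, it is suited to Fatou's lemma.\<close>

definition fejer_var :: "real \<Rightarrow> real \<Rightarrow> nat \<Rightarrow> real \<Rightarrow> real" where
  "fejer_var h \<epsilon> n \<phi> = (\<Sum>z\<in>{z \<in> sq n \<times> sq n. (df (fst z), df (snd z)) \<noteq> (0, 0)}.
     (norm (periodized.qh (rq h \<epsilon> \<phi>) (df (fst z)) (df (snd z))))\<^sup>2) / (real n)\<^sup>2"

text \<open>The sum over pairs of pairs factorizes into two sums of at most n S each, and the
  normalization n^2 cancels, so the bound is uniform in n.\<close>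

lemma fejer_var_average:
  obtains C where "C \<ge> 0"
    "\<And>h \<epsilon> n. 0 < h \<Longrightarrow> h \<le> 1 \<Longrightarrow> 0 < \<epsilon> \<Longrightarrow> \<epsilon> < e \<Longrightarrow>
      continuous_on {0..2*pi} (fejer_var h \<epsilon> n) \<and> integral {0..2*pi} (fejer_var h \<epsilon> n) \<le> C * rate h \<epsilon>"
proof -
  obtain C where C: "C \<ge> 0" "\<And>h \<epsilon> m1 m2. 0 < h \<Longrightarrow> h \<le> 1 \<Longrightarrow> 0 < \<epsilon> \<Longrightarrow> \<epsilon> < e \<Longrightarrow> (m1, m2) \<noteq> (0, 0) \<Longrightarrow>
      continuous_on {0..2*pi} (\<lambda>\<phi>. (norm (periodized.qh (rq h \<epsilon> \<phi>) m1 m2))\<^sup>2) \<and>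
      integral {0..2*pi} (\<lambda>\<phi>. (norm (periodized.qh (rq h \<epsilon> \<phi>) m1 m2))\<^sup>2) \<le> C * rate h \<epsilon> * (int_weight m1 * int_weight m2)"
    using angle_average by blast
  obtain S where S: "S \<ge> 0" "\<And>n. (\<Sum>z\<in>sq n. int_weight (df z)) \<le> real n * S" using sum_int_weight by blast
  have "continuous_on {0..2*pi} (fejer_var h \<epsilon> n) \<and> integral {0..2*pi} (fejer_var h \<epsilon> n) \<le> C * S\<^sup>2 * rate h \<epsilon>"
    if h: "0 < h" "h \<le> 1" and \<epsilon>: "0 < \<epsilon>" "\<epsilon> < e" for h \<epsilon> n
  proof
    let ?A = "{z \<in> sq n \<times> sq n. (df (fst z), df (snd z)) \<noteq> (0, 0)}"
    let ?s = "\<lambda>z \<phi>. (norm (periodized.qh (rq h \<epsilon> \<phi>) (df (fst z)) (df (snd z))))\<^sup>2"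
    have cs: "continuous_on {0..2*pi} (?s z)" and ib: "integral {0..2*pi} (?s z) \<le> C * rate h \<epsilon> * (int_weight (df (fst z)) * int_weight (df (snd z)))"
      if "z \<in> ?A" for z
      using C(2)[OF h \<epsilon>, of "df (fst z)" "df (snd z)"] that by auto
    show "continuous_on {0..2*pi} (fejer_var h \<epsilon> n)"
    proof (cases "n = 0")
      case False
      then show ?thesis unfolding fejer_var_def by (intro continuous_on_divide continuous_on_sum cs continuous_on_const) auto
    qed (simp add: fejer_var_def[abs_def])
    have V0: "rate h \<epsilon> \<ge> 0" using h(1) \<epsilon>(1) by (simp add: rate_def)
    have "integral {0..2*pi} (fejer_var h \<epsilon> n) = integral {0..2*pi} (\<lambda>\<phi>. \<Sum>z\<in>?A. ?s z \<phi>) / (real n)\<^sup>2"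
      unfolding fejer_var_def by simp
    also have "integral {0..2*pi} (\<lambda>\<phi>. \<Sum>z\<in>?A. ?s z \<phi>) = (\<Sum>z\<in>?A. integral {0..2*pi} (?s z))"
      by (intro Henstock_Kurzweil_Integration.integral_sum integrable_continuous_interval cs) auto
    also have "\<dots> / (real n)\<^sup>2 \<le> (\<Sum>z\<in>?A. C * rate h \<epsilon> * (int_weight (df (fst z)) * int_weight (df (snd z)))) / (real n)\<^sup>2"
      by (intro divide_right_mono sum_mono ib) auto
    also have "\<dots> \<le> (\<Sum>z\<in>sq n \<times> sq n. C * rate h \<epsilon> * (int_weight (df (fst z)) * int_weight (df (snd z)))) / (real n)\<^sup>2"
      using C(1) V0 int_weight_nonneg by (intro divide_right_mono sum_mono2) auto
    also have "(\<Sum>z\<in>sq n \<times> sq n. C * rate h \<epsilon> * (int_weight (df (fst z)) * int_weight (df (snd z)))) = C * rate h \<epsilon> * ((\<Sum>z\<in>sq n. int_weight (df z)) * (\<Sum>z\<in>sq n. int_weight (df z)))"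
      unfolding sum_product sum.cartesian_product by (simp add: sum_distrib_left split_beta)
    also have "\<dots> / (real n)\<^sup>2 \<le> (C * rate h \<epsilon> * ((real n * S) * (real n * S))) / (real n)\<^sup>2"
      using C(1) V0 S int_weight_nonneg by (intro divide_right_mono mult_left_mono mult_mono sum_nonneg) auto
    also have "\<dots> \<le> C * S\<^sup>2 * rate h \<epsilon>"
      using C(1) V0 by (cases "n = 0") (simp_all add: power2_eq_square)
    finally show "integral {0..2*pi} (fejer_var h \<epsilon> n) \<le> C * S\<^sup>2 * rate h \<epsilon>" .
  qed
  then show ?thesis using that[of "C * S\<^sup>2"] C(1) by simp
qed

end

section \<open>Integration over rotations and translations\<close>

lemma matrix_inv_rot: "matrix_inv (rot t) = rot (- t)"
  unfolding matrix_inv_def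
proof (rule some_equality)
  have r0: "rot 0 = mat 1" by (simp add: vec_eq_iff forall_2 mat_def)
  then show "rot t ** rot (- t) = mat 1 \<and> rot (- t) ** rot t = mat 1" by (simp add: rot_mult)
  fix B assume B: "rot t ** B = mat 1 \<and> B ** rot t = mat 1"
  have "B = (rot (- t) ** rot t) ** B" by (simp add: rot_mult r0)
  also have "\<dots> = rot (- t)" using B by (simp flip: matrix_mul_assoc)
  finally show "B = rot (- t)" .
qed

lemma transpose_rot: "transpose (rot t) = rot (- t)"
  by (simp add: vec_eq_iff forall_2 transpose_def)

lemma unit_square_measurable: "unit_square \<in> sets borel"
proof -
  have "unit_square = {x. 0 \<le> x $ 1 \<and> x $ 1 \<le> 1 \<and> 0 \<le> x $ 2 \<and> x $ 2 \<le> 1}" by (auto simp: unit_square_def forall_2)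
  also have "\<dots> \<in> sets borel" by measurable
  finally show ?thesis .
qed

lemma unit_square_cbox: "unit_square = cbox (vec2 0 0) (vec2 1 1)"
  by (auto simp: unit_square_def mem_box_cart forall_2)

text \<open>Bridges the closed square of translations and the half-open cell; they differ only on
  the two edges where a coordinate is 1.\<close>

lemma AE_unit_square: "AE x in lborel. indicator unit_square x = (indicator (Ubox 0) x :: real)"
proof -
  have n: "AE x in lborel. (x::real^2) $ i \<noteq> 1" for i
  proof -
    have "negligible {x::real^2. x $ i = 1}"
      using negligible_standard_hyperplane[of "axis i 1 :: real^2" 1] by (simp add: inner_axis)
    then have "AE x in lebesgue. x \<notin> {x::real^2. x $ i = 1}" unfolding negligible_iff_null_sets by (rule AE_not_in)
    then show ?thesis by (simp add: AE_completion_iff)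
  qed
  show ?thesis using n[of 1] n[of 2]
  proof eventually_elim
    case (elim x)
    have "x \<in> unit_square \<longleftrightarrow> x \<in> Ubox 0" unfolding unit_square_def Ubox_def using elim by (simp add: forall_2 less_le)
    then show ?case by (simp add: indicator_def)
  qed
qed

lemma finite_measure_unit_square: "finite_measure (restrict_space lborel unit_square)"
proof (rule finite_measureI)
  have "emeasure lborel unit_square < \<infinity>" unfolding unit_square_cbox by (rule emeasure_lborel_cbox_finite)
  then show "emeasure (restrict_space lborel unit_square) (space (restrict_space lborel unit_square)) \<noteq> \<infinity>"
    using unit_square_measurable by (simp add: emeasure_restrict_space space_restrict_space)
qed

lemma finite_measure_SO2_haar: "finite_measure SO2_haar"
  by (rule finite_measureI) (simp add: emeasure_space_SO2_haar[simplified])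

lemma measurable_SO2_haar: "g \<in> borel_measurable borel \<Longrightarrow> g \<in> borel_measurable SO2_haar"
  using measurable_cong_sets[OF sets_SO2_haar refl] measurable_restrict_space1 by blast

lemma nn_integral_SO2_haar:
  fixes H :: "real^2^2 \<Rightarrow> ennreal"
  assumes "H \<in> borel_measurable SO2_haar"
  shows "(\<integral>\<^sup>+\<eta>. H \<eta> \<partial>SO2_haar) = (\<integral>\<^sup>+\<phi>. H (rot \<phi>) * indicator {0..<2*pi} \<phi> \<partial>lborel) / ennreal (2 * pi)"
proof -
  have H: "H \<in> borel_measurable (restrict_space borel SO2)"
    using assms measurable_cong_sets[OF sets_SO2_haar refl] by blast
  have r: "rot \<in> uniform_measure lborel {0..<2*pi} \<rightarrow>\<^sub>M restrict_space borel SO2"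
    using rot_measurable by (simp add: measurable_def)
  have Hr: "(\<lambda>\<phi>. H (rot \<phi>)) \<in> borel_measurable borel" using measurable_compose[OF rot_measurable H] .
  have "(\<integral>\<^sup>+\<eta>. H \<eta> \<partial>SO2_haar) = (\<integral>\<^sup>+\<phi>. H (rot \<phi>) \<partial>uniform_measure lborel {0..<2*pi})"
    unfolding SO2_haar_def by (rule nn_integral_distr[OF r]) (use H in simp)
  also have "\<dots> = (\<integral>\<^sup>+\<phi>. H (rot \<phi>) * indicator {0..<2*pi} \<phi> \<partial>lborel) / emeasure lborel {0..<2*pi}"
    by (rule nn_integral_uniform_measure) (use Hr in auto)
  finally show ?thesis by simp
qed

context tube_integrand
begin

definition \<I> :: real where "\<I> = integral {0..1} curve_dens"

definition lat :: "real \<Rightarrow> real \<Rightarrow> real \<Rightarrow> real \<Rightarrow> real^2 \<Rightarrow> real" where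
  "lat L h \<epsilon> \<phi> = periodized.F (rq h \<epsilon> \<phi>) (L / h)"

text \<open>The Fejer sums converge for each rotation without any uniformity, but their averages
  over the rotations are bounded uniformly in n, and Fatou's lemma carries the bound to the limit.
  The other conclusions record that on the unit square the integrals of the statement are a bounded
  finite lattice sum.\<close>

lemma variance_average:
  obtains C L where "C \<ge> 0"
    "\<And>h \<epsilon>. 0 < h \<Longrightarrow> h \<le> 1 \<Longrightarrow> 0 < \<epsilon> \<Longrightarrow> \<epsilon> < e \<Longrightarrow>
      (\<integral>\<^sup>+\<phi>. ennreal (LINT \<xi>|lborel. indicator (Ubox 0) \<xi> *\<^sub>R (lat L h \<epsilon> \<phi> \<xi> - \<I>)\<^sup>2) * indicator {0..2*pi} \<phi> \<partial>lborel) \<le> ennreal (C * rate h \<epsilon>)"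
    "\<And>h \<epsilon> \<phi> \<xi>. 0 < h \<Longrightarrow> 0 < \<epsilon> \<Longrightarrow> \<epsilon> < e \<Longrightarrow> \<xi> \<in> unit_square \<Longrightarrow> ibi \<Omega> f \<theta> \<epsilon> h (rot \<phi>) \<xi> = lat L h \<epsilon> \<phi> \<xi>"
    "\<And>h \<epsilon>. 0 < h \<Longrightarrow> 0 < \<epsilon> \<Longrightarrow> \<epsilon> < e \<Longrightarrow> \<exists>B W. finite W \<and> (\<forall>\<phi> \<xi>. \<bar>lat L h \<epsilon> \<phi> \<xi>\<bar> \<le> B \<and> lat L h \<epsilon> \<phi> \<xi> = (\<Sum>w\<in>W. rq h \<epsilon> \<phi> (w - \<xi>)))"
proof -
  obtain C where C: "C \<ge> 0" "\<And>h \<epsilon> n. 0 < h \<Longrightarrow> h \<le> 1 \<Longrightarrow> 0 < \<epsilon> \<Longrightarrow> \<epsilon> < e \<Longrightarrow>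
      continuous_on {0..2*pi} (fejer_var h \<epsilon> n) \<and> integral {0..2*pi} (fejer_var h \<epsilon> n) \<le> C * rate h \<epsilon>"
    using fejer_var_average by blast
  obtain K L where K: "K \<ge> 0" and L: "L \<ge> 0" and per: "\<And>h \<epsilon> \<phi>. h > 0 \<Longrightarrow> 0 < \<epsilon> \<Longrightarrow> \<epsilon> < e \<Longrightarrow> periodized (rq h \<epsilon> \<phi>) (h\<^sup>2 * (K / \<epsilon>)) (L / h)"
    using rq_periodized by blast
  have 1: "(\<integral>\<^sup>+\<phi>. ennreal (LINT \<xi>|lborel. indicator (Ubox 0) \<xi> *\<^sub>R (lat L h \<epsilon> \<phi> \<xi> - \<I>)\<^sup>2) * indicator {0..2*pi} \<phi> \<partial>lborel) \<le> ennreal (C * rate h \<epsilon>)"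
    if h: "0 < h" "h \<le> 1" and \<epsilon>: "0 < \<epsilon>" "\<epsilon> < e" for h \<epsilon>
  proof -
    let ?V = "\<lambda>\<phi>. LINT \<xi>|lborel. indicator (Ubox 0) \<xi> *\<^sub>R (lat L h \<epsilon> \<phi> \<xi> - \<I>)\<^sup>2"
    let ?u = "\<lambda>n \<phi>. ennreal (indicator {0..2*pi} \<phi> *\<^sub>R fejer_var h \<epsilon> n \<phi>)"
    have lim: "(\<lambda>n. fejer_var h \<epsilon> n \<phi>) \<longlonglongrightarrow> ?V \<phi>" for \<phi>
      using periodized.variance_limit[OF per[OF h(1) \<epsilon>] transform_zero[OF h(1) \<epsilon>]]
      unfolding fejer_var_def lat_def \<I>_def .
    have n0: "fejer_var h \<epsilon> n \<phi> \<ge> 0" for n \<phi> unfolding fejer_var_def by (intro divide_nonneg_nonneg sum_nonneg) auto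
    have "ennreal (?V \<phi>) * indicator {0..2*pi} \<phi> = liminf (\<lambda>n. ?u n \<phi>)" for \<phi>
    proof -
      have "(\<lambda>n. ?u n \<phi>) \<longlonglongrightarrow> ennreal (indicator {0..2*pi} \<phi> *\<^sub>R ?V \<phi>)"
        by (intro tendsto_ennrealI tendsto_intros lim)
      then have "liminf (\<lambda>n. ?u n \<phi>) = ennreal (indicator {0..2*pi} \<phi> *\<^sub>R ?V \<phi>)" by (intro lim_imp_Liminf) auto
      then show ?thesis by (auto split: split_indicator)
    qed
    then have "(\<integral>\<^sup>+\<phi>. ennreal (?V \<phi>) * indicator {0..2*pi} \<phi> \<partial>lborel) = (\<integral>\<^sup>+\<phi>. liminf (\<lambda>n. ?u n \<phi>) \<partial>lborel)" by simp
    also have "\<dots> \<le> liminf (\<lambda>n. \<integral>\<^sup>+\<phi>. ?u n \<phi> \<partial>lborel)"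
    proof (rule nn_integral_liminf)
      show "?u n \<in> borel_measurable lborel" for n
      proof -
        have m: "(\<lambda>\<phi>. indicator {0..2*pi} \<phi> *\<^sub>R fejer_var h \<epsilon> n \<phi>) \<in> borel_measurable borel"
          by (rule borel_measurable_continuous_on_indicator) (use C(2)[OF h \<epsilon>] in auto)
        show ?thesis using measurable_compose[OF m measurable_ennreal] by simp
      qed
    qed
    also have "\<dots> \<le> ennreal (C * rate h \<epsilon>)"
    proof -
      have "(\<integral>\<^sup>+\<phi>. ?u n \<phi> \<partial>lborel) \<le> ennreal (C * rate h \<epsilon>)" for n
      proof -
        have "(\<integral>\<^sup>+\<phi>. ?u n \<phi> \<partial>lborel) = (\<integral>\<^sup>+\<phi>. ennreal (fejer_var h \<epsilon> n \<phi>) * indicator {0..2*pi} \<phi> \<partial>lborel)"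
          by (intro nn_integral_cong) (auto split: split_indicator)
        also have "\<dots> = ennreal (integral {0..2*pi} (fejer_var h \<epsilon> n))"
          using C(2)[OF h \<epsilon>, of n] n0
          by (intro nn_integral_has_integral_lebesgue' integrable_integral integrable_continuous_interval) auto
        also have "\<dots> \<le> ennreal (C * rate h \<epsilon>)" using C(2)[OF h \<epsilon>, of n] by (intro ennreal_leI) simp
        finally show ?thesis .
      qed
      then have "liminf (\<lambda>n. \<integral>\<^sup>+\<phi>. ?u n \<phi> \<partial>lborel) \<le> liminf (\<lambda>n::nat. ennreal (C * rate h \<epsilon>))" by (intro Liminf_mono) simp
      then show ?thesis by (simp add: Liminf_const)
    qed
    finally show ?thesis .
  qed
  have 2: "ibi \<Omega> f \<theta> \<epsilon> h (rot \<phi>) \<xi> = lat L h \<epsilon> \<phi> \<xi>"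
    if h: "0 < h" and \<epsilon>: "0 < \<epsilon>" "\<epsilon> < e" and \<xi>: "\<xi> \<in> unit_square" for h \<epsilon> \<phi> \<xi>
  proof -
    have x3: "\<bar>\<xi> $ i\<bar> \<le> 3" for i using \<xi> by (auto simp: unit_square_def intro: order_trans)
    have "ibi \<Omega> f \<theta> \<epsilon> h (rot \<phi>) \<xi> = (\<Sum>\<^sub>\<infinity>w\<in>int_lattice. rq h \<epsilon> \<phi> (w - \<xi>))"
      unfolding ibi_def rq_def matrix_inv_rot by (rule infsum_cmult_right'[symmetric])
    also have "\<dots> = lat L h \<epsilon> \<phi> \<xi>"
      unfolding lat_def by (rule periodized.F_eq_infsum[OF per[OF h \<epsilon>]]) (rule x3)
    finally show ?thesis .
  qed
  have 3: "\<exists>B W. finite W \<and> (\<forall>\<phi> \<xi>. \<bar>lat L h \<epsilon> \<phi> \<xi>\<bar> \<le> B \<and> lat L h \<epsilon> \<phi> \<xi> = (\<Sum>w\<in>W. rq h \<epsilon> \<phi> (w - \<xi>)))"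
    if h: "0 < h" and \<epsilon>: "0 < \<epsilon>" "\<epsilon> < e" for h \<epsilon>
    using periodized.finite_W[OF per[OF h \<epsilon>]] periodized.F_bound[OF per[OF h \<epsilon>]] periodized.F_def[OF per[OF h \<epsilon>]]
    unfolding lat_def by metis
  show ?thesis using that[OF C(1) 1 2 3] by blast
qed

text \<open>Joint measurability in rotation and translation. On rotations the inverse matrix is the
  transpose, which depends continuously on the entries, and the lattice sum is over a window common
  to all of them.\<close>

lemma ibi_measurable:
  assumes h: "h > 0" and \<epsilon>: "0 < \<epsilon>" "\<epsilon> < e" and W: "finite W"
    and eq: "\<And>\<phi> \<xi>. \<xi> \<in> unit_square \<Longrightarrow> ibi \<Omega> f \<theta> \<epsilon> h (rot \<phi>) \<xi> = (\<Sum>w\<in>W. rq h \<epsilon> \<phi> (w - \<xi>))"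
  shows "(\<lambda>z. ibi \<Omega> f \<theta> \<epsilon> h (snd z) (fst z)) \<in> borel_measurable (restrict_space lborel unit_square \<Otimes>\<^sub>M SO2_haar)"
proof -
  let ?M = "restrict_space lborel unit_square \<Otimes>\<^sub>M SO2_haar"
  define J where "J z = (\<Sum>w\<in>W. h\<^sup>2 * ibi_integrand \<Omega> f \<theta> \<epsilon> (h *\<^sub>R (transpose (snd z) *v (w - fst z))))" for z :: "(real^2) \<times> (real^2^2)"
  note [measurable] = integrand_measurable[OF \<epsilon>]
  have A[measurable]: "(\<lambda>z. h *\<^sub>R (transpose (snd z) *v (w - fst z))) \<in> borel_measurable (borel \<Otimes>\<^sub>M borel)" for w :: "real^2"
    unfolding borel_prod transpose_def matrix_vector_mult_def
    by (intro borel_measurable_continuous_onI continuous_intros continuous_on_vec_lambda)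
  have J: "J \<in> borel_measurable (borel \<Otimes>\<^sub>M borel)" unfolding J_def[abs_def] by measurable
  have i1: "(\<lambda>x. x) \<in> restrict_space lborel unit_square \<rightarrow>\<^sub>M borel" by (rule measurable_restrict_space1) simp
  have i2: "(\<lambda>x. x) \<in> SO2_haar \<rightarrow>\<^sub>M borel" by (rule measurable_SO2_haar) simp
  have "(\<lambda>z. (fst z, snd z)) \<in> ?M \<rightarrow>\<^sub>M borel \<Otimes>\<^sub>M borel"
    by (intro measurable_Pair measurable_compose[OF measurable_fst i1] measurable_compose[OF measurable_snd i2])
  from measurable_compose[OF this J] have "(\<lambda>z. J (fst z, snd z)) \<in> borel_measurable ?M" .
  moreover have "J (fst z, snd z) = ibi \<Omega> f \<theta> \<epsilon> h (snd z) (fst z)" if "z \<in> space ?M" for z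
  proof -
    have z: "fst z \<in> unit_square" "snd z \<in> SO2" using that by (auto simp: space_pair_measure space_restrict_space)
    then obtain \<phi> where "snd z = rot \<phi>" using SO2_eq_range_rot by auto
    then show ?thesis using eq[OF z(1), of \<phi>] by (simp add: J_def rq_def transpose_rot)
  qed
  ultimately show ?thesis using measurable_cong by (metis (no_types, lifting))
qed

text \<open>Boundedness on a finite measure space permits Fubini, so the translations can be
  integrated first for a fixed rotation; the inner integral is then the variance bounded in
  \<open>variance_average\<close>. The Haar average is the integral over angles divided by 2 pi, a
  factor that is simply dropped.\<close>

lemma mean_square_bound:
  obtains C where "C \<ge> 0"
    "\<And>h \<epsilon>. 0 < h \<Longrightarrow> h \<le> 1 \<Longrightarrow> 0 < \<epsilon> \<Longrightarrow> \<epsilon> < e \<Longrightarrow>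
      integrable (restrict_space lborel unit_square \<Otimes>\<^sub>M SO2_haar) (\<lambda>(\<xi>, \<eta>). \<bar>ibi \<Omega> f \<theta> \<epsilon> h \<eta> \<xi> - \<I>\<bar>\<^sup>2) \<and>
      (LINT \<xi>|restrict_space lborel unit_square. LINT \<eta>|SO2_haar. \<bar>ibi \<Omega> f \<theta> \<epsilon> h \<eta> \<xi> - \<I>\<bar>\<^sup>2) \<le> C * rate h \<epsilon>"
proof (rule variance_average)
  fix C L
  assume C: "C \<ge> 0"
    "\<And>h \<epsilon>. 0 < h \<Longrightarrow> h \<le> 1 \<Longrightarrow> 0 < \<epsilon> \<Longrightarrow> \<epsilon> < e \<Longrightarrow>
      (\<integral>\<^sup>+\<phi>. ennreal (LINT \<xi>|lborel. indicator (Ubox 0) \<xi> *\<^sub>R (lat L h \<epsilon> \<phi> \<xi> - \<I>)\<^sup>2) * indicator {0..2*pi} \<phi> \<partial>lborel) \<le> ennreal (C * rate h \<epsilon>)"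
    and eq: "\<And>h \<epsilon> \<phi> \<xi>. 0 < h \<Longrightarrow> 0 < \<epsilon> \<Longrightarrow> \<epsilon> < e \<Longrightarrow> \<xi> \<in> unit_square \<Longrightarrow> ibi \<Omega> f \<theta> \<epsilon> h (rot \<phi>) \<xi> = lat L h \<epsilon> \<phi> \<xi>"
    and fin: "\<And>h \<epsilon>. 0 < h \<Longrightarrow> 0 < \<epsilon> \<Longrightarrow> \<epsilon> < e \<Longrightarrow> \<exists>B W. finite W \<and> (\<forall>\<phi> \<xi>. \<bar>lat L h \<epsilon> \<phi> \<xi>\<bar> \<le> B \<and> lat L h \<epsilon> \<phi> \<xi> = (\<Sum>w\<in>W. rq h \<epsilon> \<phi> (w - \<xi>)))"
  let ?U = "restrict_space lborel unit_square" and ?M = "restrict_space lborel unit_square \<Otimes>\<^sub>M SO2_haar"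
  have main: "integrable ?M (\<lambda>(\<xi>, \<eta>). \<bar>ibi \<Omega> f \<theta> \<epsilon> h \<eta> \<xi> - \<I>\<bar>\<^sup>2) \<and>
      (LINT \<xi>|?U. LINT \<eta>|SO2_haar. \<bar>ibi \<Omega> f \<theta> \<epsilon> h \<eta> \<xi> - \<I>\<bar>\<^sup>2) \<le> C * rate h \<epsilon>"
    if h: "0 < h" "h \<le> 1" and \<epsilon>: "0 < \<epsilon>" "\<epsilon> < e" for h \<epsilon>
  proof
    let ?g = "\<lambda>\<xi> \<eta>. \<bar>ibi \<Omega> f \<theta> \<epsilon> h \<eta> \<xi> - \<I>\<bar>\<^sup>2"
    obtain B W where W: "finite W" "\<And>\<phi> \<xi>. \<bar>lat L h \<epsilon> \<phi> \<xi>\<bar> \<le> B" "\<And>\<phi> \<xi>. lat L h \<epsilon> \<phi> \<xi> = (\<Sum>w\<in>W. rq h \<epsilon> \<phi> (w - \<xi>))"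
      using fin[OF h(1) \<epsilon>] by blast
    have ibi: "ibi \<Omega> f \<theta> \<epsilon> h (rot \<phi>) \<xi> = lat L h \<epsilon> \<phi> \<xi>" if "\<xi> \<in> unit_square" for \<phi> \<xi>
      by (rule eq[OF h(1) \<epsilon> that])
    have [measurable]: "(\<lambda>z. ibi \<Omega> f \<theta> \<epsilon> h (snd z) (fst z)) \<in> borel_measurable ?M"
      by (rule ibi_measurable[OF h(1) \<epsilon> W(1)]) (simp add: ibi W(3))
    interpret U: finite_measure ?U by (rule finite_measure_unit_square)
    interpret S: finite_measure SO2_haar by (rule finite_measure_SO2_haar)
    interpret US: pair_sigma_finite ?U SO2_haar ..
    interpret P: finite_measure ?M by (rule finite_measure_pair_measure[OF finite_measure_SO2_haar finite_measure_unit_square])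
    have int: "integrable ?M (\<lambda>z. ?g (fst z) (snd z))"
    proof (rule P.integrable_const_bound)
      show "AE z in ?M. norm (?g (fst z) (snd z)) \<le> (B + \<bar>\<I>\<bar>)\<^sup>2"
      proof (rule AE_I2)
        fix z assume "z \<in> space ?M"
        then have z: "fst z \<in> unit_square" "snd z \<in> SO2" by (auto simp: space_pair_measure space_restrict_space)
        then obtain \<phi> where \<phi>: "snd z = rot \<phi>" using SO2_eq_range_rot by auto
        have "\<bar>lat L h \<epsilon> \<phi> (fst z) - \<I>\<bar> \<le> B + \<bar>\<I>\<bar>" using W(2)[of \<phi> "fst z"] by linarith
        then have "\<bar>lat L h \<epsilon> \<phi> (fst z) - \<I>\<bar>\<^sup>2 \<le> (B + \<bar>\<I>\<bar>)\<^sup>2" by (rule power_mono) simp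
        then show "norm (?g (fst z) (snd z)) \<le> (B + \<bar>\<I>\<bar>)\<^sup>2" unfolding \<phi> ibi[OF z(1)] by simp
      qed
    qed measurable
    then show int': "integrable ?M (\<lambda>(\<xi>, \<eta>). ?g \<xi> \<eta>)" unfolding case_prod_beta' .
    define H where "H \<eta> = (LINT \<xi>|?U. ?g \<xi> \<eta>)" for \<eta>
    have sw: "(LINT \<xi>|?U. LINT \<eta>|SO2_haar. ?g \<xi> \<eta>) = (LINT \<eta>|SO2_haar. H \<eta>)"
      unfolding H_def by (rule US.Fubini_integral[symmetric]) (use int' in simp)
    have iH: "integrable SO2_haar H" unfolding H_def by (rule US.integrable_snd) (use int' in simp)
    have H0: "H \<eta> \<ge> 0" for \<eta> unfolding H_def by (rule Bochner_Integration.integral_nonneg) simp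
    have Hrot: "H (rot \<phi>) = (LINT \<xi>|lborel. indicator (Ubox 0) \<xi> *\<^sub>R (lat L h \<epsilon> \<phi> \<xi> - \<I>)\<^sup>2)" for \<phi>
    proof -
      have "H (rot \<phi>) = (LINT \<xi>|lborel. indicator unit_square \<xi> *\<^sub>R ?g \<xi> (rot \<phi>))"
        unfolding H_def by (rule integral_restrict_space) (use unit_square_measurable in simp)
      also have "\<dots> = (LINT \<xi>|lborel. indicator unit_square \<xi> *\<^sub>R (lat L h \<epsilon> \<phi> \<xi> - \<I>)\<^sup>2)"
        by (intro Bochner_Integration.integral_cong refl) (auto simp: ibi split: split_indicator)
      also have "\<dots> = (LINT \<xi>|lborel. indicator (Ubox 0) \<xi> *\<^sub>R (lat L h \<epsilon> \<phi> \<xi> - \<I>)\<^sup>2)"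
      proof (rule integral_cong_AE)
        note [measurable] = integrand_measurable[OF \<epsilon>] unit_square_measurable
        have [measurable]: "(\<lambda>\<xi>. h *\<^sub>R (rot (- \<phi>) *v (w - \<xi>))) \<in> borel_measurable borel" for w
          by (intro borel_measurable_continuous_onI continuous_intros continuous_on_compose2[OF continuous_rot[of UNIV]]) auto
        have [measurable]: "lat L h \<epsilon> \<phi> \<in> borel_measurable borel" unfolding W(3)[abs_def] rq_def by measurable
        show "(\<lambda>\<xi>. indicator unit_square \<xi> *\<^sub>R (lat L h \<epsilon> \<phi> \<xi> - \<I>)\<^sup>2) \<in> borel_measurable lborel"
          "(\<lambda>\<xi>. indicator (Ubox 0) \<xi> *\<^sub>R (lat L h \<epsilon> \<phi> \<xi> - \<I>)\<^sup>2) \<in> borel_measurable lborel" by measurable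
        show "AE \<xi> in lborel. indicator unit_square \<xi> *\<^sub>R (lat L h \<epsilon> \<phi> \<xi> - \<I>)\<^sup>2 = indicator (Ubox 0) \<xi> *\<^sub>R (lat L h \<epsilon> \<phi> \<xi> - \<I>)\<^sup>2"
          using AE_unit_square by eventually_elim simp
      qed
      finally show ?thesis .
    qed
    have "ennreal (LINT \<eta>|SO2_haar. H \<eta>) = (\<integral>\<^sup>+\<eta>. ennreal (H \<eta>) \<partial>SO2_haar)"
      by (rule nn_integral_eq_integral[OF iH, symmetric]) (simp add: H0)
    also have "\<dots> = (\<integral>\<^sup>+\<phi>. ennreal (H (rot \<phi>)) * indicator {0..<2*pi} \<phi> \<partial>lborel) / ennreal (2 * pi)"
      by (rule nn_integral_SO2_haar) (use iH in measurable)
    also have "\<dots> \<le> (\<integral>\<^sup>+\<phi>. ennreal (H (rot \<phi>)) * indicator {0..2*pi} \<phi> \<partial>lborel) / ennreal (2 * pi)"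
      by (intro divide_right_mono_ennreal nn_integral_mono) (auto split: split_indicator)
    also have "\<dots> \<le> ennreal (C * rate h \<epsilon>) / ennreal (2 * pi)"
      unfolding Hrot by (intro divide_right_mono_ennreal C(2) h \<epsilon>)
    also have "\<dots> = ennreal (C * rate h \<epsilon> / (2 * pi))"
      using C(1) h(1) \<epsilon>(1) by (intro divide_ennreal) (auto simp: rate_def)
    also have "\<dots> \<le> ennreal (C * rate h \<epsilon>)"
    proof (rule ennreal_leI)
      have v: "C * rate h \<epsilon> \<ge> 0" using C(1) h(1) \<epsilon>(1) by (auto simp: rate_def)
      have "C * rate h \<epsilon> / (2 * pi) \<le> C * rate h \<epsilon> / 1" using v pi_ge_two by (intro divide_left_mono) auto
      then show "C * rate h \<epsilon> / (2 * pi) \<le> C * rate h \<epsilon>" by simp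
    qed
    finally have "ennreal (LINT \<eta>|SO2_haar. H \<eta>) \<le> ennreal (C * rate h \<epsilon>)" .
    moreover have "C * rate h \<epsilon> \<ge> 0" using C(1) h(1) \<epsilon>(1) by (auto simp: rate_def)
    ultimately show "(LINT \<xi>|?U. LINT \<eta>|SO2_haar. ?g \<xi> \<eta>) \<le> C * rate h \<epsilon>"
      unfolding sw by (simp add: ennreal_le_iff)
  qed
  show thesis by (rule that[OF C(1) main])
qed

end

theorem theorem3p2:
  fixes \<Omega> :: "(real^2) set" and f :: "real^2 \<Rightarrow> real" and \<theta> :: "real \<Rightarrow> real"
    and \<kappa> \<alpha> :: real and q :: nat
  assumes "\<kappa> > 2"
    and "open \<Omega>" "\<Omega> \<noteq> {}" "bounded \<Omega>" "convex \<Omega>"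
    and "smooth_closed_curve (frontier \<Omega>)"
    and "finite {z \<in> frontier \<Omega>. boundary_curvature \<Omega> z = 0}"
    and "\<forall>z\<in>frontier \<Omega>. boundary_curvature \<Omega> z = 0 \<longrightarrow>
           (\<exists>\<kappa>'. 2 < \<kappa>' \<and> \<kappa>' \<le> \<kappa> \<and> curvature_vanishes_to_order (frontier \<Omega>) z (\<kappa>' - 2))"
    and "smooth_on_curve (frontier \<Omega>) f"
    and "weight_profile q \<theta>"
    and "0 \<le> \<alpha>" "\<alpha> \<le> 1"
  shows "\<exists>\<epsilon>\<^sub>0>0. \<forall>\<epsilon> :: real \<Rightarrow> real.
           (\<exists>c\<^sub>1>0. \<exists>c\<^sub>2>0. \<forall>\<^sub>F h in at_right 0.
              c\<^sub>1 * h powr \<alpha> \<le> \<epsilon> h \<and> \<epsilon> h \<le> c\<^sub>2 * h powr \<alpha>) \<and>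
           (\<forall>\<^sub>F h in at_right 0. \<epsilon> h \<le> \<epsilon>\<^sub>0 \<and> tube_admissible (frontier \<Omega>) (\<epsilon> h)) \<longrightarrow>
           (\<forall>\<^sub>F h in at_right 0.
              integrable (restrict_space lborel unit_square \<Otimes>\<^sub>M SO2_haar)
                (\<lambda>(\<xi>, \<eta>). \<bar>ibi \<Omega> f \<theta> (\<epsilon> h) h \<eta> \<xi> - curve_integral (frontier \<Omega>) f\<bar>\<^sup>2)) \<and>
           (\<lambda>h. LINT \<xi>|restrict_space lborel unit_square. LINT \<eta>|SO2_haar.
              \<bar>ibi \<Omega> f \<theta> (\<epsilon> h) h \<eta> \<xi> - curve_integral (frontier \<Omega>) f\<bar>\<^sup>2)
             \<in> O[at_right 0](\<lambda>h. h powr (1 + 2 * (real q + 1) * (1 - \<alpha>)))"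
proof -
  \<comment> \<open>The same choice as in \<open>curve_integral\<close>, so that both integrals run
    over one parametrization.\<close>
  define \<gamma> where "\<gamma> = (SOME \<gamma>. smooth_closed_param (frontier \<Omega>) \<gamma>)"
  have \<gamma>: "smooth_closed_param (frontier \<Omega>) \<gamma>"
    unfolding \<gamma>_def using assms(6) unfolding smooth_closed_curve_def by (rule someI_ex)
  interpret cc: convex_curve \<Omega> \<gamma> by unfold_locales (use assms(2-5) \<gamma> in auto)
  obtain b r e c0 where tc: "tube_chart \<Omega> \<gamma> b r e c0" using cc.exists_tube_chart by blast
  have fs: "smooth_on UNIV (f \<circ> \<gamma>)" using assms(9) \<gamma> by (simp add: smooth_on_curve_def)
  interpret ti: tube_integrand \<Omega> \<gamma> b r e c0 f \<theta> q
    by (rule tube_integrand.intro[OF tc]) (rule tube_integrand_axioms.intro[OF fs assms(10)])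
  have I: "curve_integral (frontier \<Omega>) f = ti.\<I>"
    unfolding curve_integral_def Let_def \<gamma>_def[symmetric] ti.\<I>_def ti.curve_dens_def cc.spd_norm
    using vector_derivative_at[OF cc.\<gamma>_deriv] by simp
  obtain C where C: "C \<ge> 0" "\<And>h \<epsilon>. 0 < h \<Longrightarrow> h \<le> 1 \<Longrightarrow> 0 < \<epsilon> \<Longrightarrow> \<epsilon> < e \<Longrightarrow>
      integrable (restrict_space lborel unit_square \<Otimes>\<^sub>M SO2_haar) (\<lambda>(\<xi>, \<eta>). \<bar>ibi \<Omega> f \<theta> \<epsilon> h \<eta> \<xi> - ti.\<I>\<bar>\<^sup>2) \<and>
      (LINT \<xi>|restrict_space lborel unit_square. LINT \<eta>|SO2_haar. \<bar>ibi \<Omega> f \<theta> \<epsilon> h \<eta> \<xi> - ti.\<I>\<bar>\<^sup>2) \<le> C * ti.rate h \<epsilon>"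
    using ti.mean_square_bound by blast
  show ?thesis
    unfolding I
  \<comment> \<open>Half of e, because the integrand is described in tubular coordinates for
    \<epsilon> strictly below e.\<close>
  proof (intro exI[of _ "e / 2"] conjI[of "e / 2 > 0"] allI impI)
    show "e / 2 > 0" using ti.e0 by simp
    fix \<epsilon> :: "real \<Rightarrow> real"
    assume "(\<exists>c\<^sub>1>0. \<exists>c\<^sub>2>0. \<forall>\<^sub>F h in at_right 0. c\<^sub>1 * h powr \<alpha> \<le> \<epsilon> h \<and> \<epsilon> h \<le> c\<^sub>2 * h powr \<alpha>) \<and>
           (\<forall>\<^sub>F h in at_right 0. \<epsilon> h \<le> e / 2 \<and> tube_admissible (frontier \<Omega>) (\<epsilon> h))"
    then obtain c1 c2 where c1: "c1 > 0" and ev: "\<forall>\<^sub>F h in at_right 0. c1 * h powr \<alpha> \<le> \<epsilon> h \<and> \<epsilon> h \<le> c2 * h powr \<alpha>"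
      "\<forall>\<^sub>F h in at_right 0. \<epsilon> h \<le> e / 2 \<and> tube_admissible (frontier \<Omega>) (\<epsilon> h)" by blast
    have "\<forall>\<^sub>F h in at_right (0::real). h < 1" by (rule eventually_at_right_real[of 0 1, THEN eventually_mono]) auto
    with ev eventually_at_right_less[of "0::real"]
    have good: "\<forall>\<^sub>F h in at_right 0. 0 < h \<and> h \<le> 1 \<and> c1 * h powr \<alpha> \<le> \<epsilon> h \<and> 0 < \<epsilon> h \<and> \<epsilon> h < e"
    proof eventually_elim
      case (elim h)
      have "0 < c1 * h powr \<alpha>" using c1 elim by simp
      then show ?case using elim ti.e0 by auto
    qed
    let ?L = "\<lambda>h. LINT \<xi>|restrict_space lborel unit_square. LINT \<eta>|SO2_haar. \<bar>ibi \<Omega> f \<theta> (\<epsilon> h) h \<eta> \<xi> - ti.\<I>\<bar>\<^sup>2"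
    let ?p = "1 + 2 * (real q + 1) * (1 - \<alpha>)"
    have "\<forall>\<^sub>F h in at_right 0. norm (?L h) \<le> (C * (1 / c1) ^ (2 * (q + 1))) * norm (h powr ?p)"
      using good
    proof eventually_elim
      case (elim h)
      then have h: "0 < h" "h \<le> 1" and \<epsilon>: "0 < \<epsilon> h" "\<epsilon> h < e" and le: "c1 * h powr \<alpha> \<le> \<epsilon> h" by auto
      have L0: "?L h \<ge> 0" by (intro Bochner_Integration.integral_nonneg) simp
      have "?L h \<le> C * ti.rate h (\<epsilon> h)" using C(2)[OF h \<epsilon>] by blast
      \<comment> \<open>A wide tube is favourable, so \<epsilon> is bounded below by c1 h^\<alpha>,
        and h / \<epsilon> is then at most h^(1 - \<alpha>) / c1.\<close>
      also have "\<dots> \<le> C * (h * ((1 / c1) * h powr (1 - \<alpha>)) ^ (2 * (q + 1)))"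
        unfolding ti.rate_def
      proof (intro mult_left_mono power_mono C(1))
        have "h / \<epsilon> h \<le> h / (c1 * h powr \<alpha>)" using h(1) c1 le \<epsilon>(1) by (intro divide_left_mono) auto
        also have "\<dots> = (1 / c1) * h powr (1 - \<alpha>)" using h(1) c1 by (simp add: powr_diff)
        finally show "h / \<epsilon> h \<le> (1 / c1) * h powr (1 - \<alpha>)" .
      qed (use h(1) \<epsilon>(1) in auto)
      also have "\<dots> = (C * (1 / c1) ^ (2 * (q + 1))) * (h * (h powr (1 - \<alpha>)) ^ (2 * (q + 1)))"
        unfolding power_mult_distrib by (simp only: mult_ac)
      also have "h * (h powr (1 - \<alpha>)) ^ (2 * (q + 1)) = h powr ?p"
      proof -
        have "(h powr (1 - \<alpha>)) ^ (2 * (q + 1)) = (h powr (1 - \<alpha>)) powr real (2 * (q + 1))"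
          using h(1) by (intro powr_realpow[symmetric]) simp
        also have "\<dots> = h powr ((1 - \<alpha>) * real (2 * (q + 1)))" by (rule powr_powr)
        also have "(1 - \<alpha>) * real (2 * (q + 1)) = 2 * (real q + 1) * (1 - \<alpha>)" by simp
        finally show ?thesis using h(1) by (simp add: powr_add)
      qed
      finally show ?case using L0 by simp
    qed
    then have "?L \<in> O[at_right 0](\<lambda>h. h powr ?p)" by (rule bigoI)
    moreover have "\<forall>\<^sub>F h in at_right 0. integrable (restrict_space lborel unit_square \<Otimes>\<^sub>M SO2_haar)
        (\<lambda>(\<xi>, \<eta>). \<bar>ibi \<Omega> f \<theta> (\<epsilon> h) h \<eta> \<xi> - ti.\<I>\<bar>\<^sup>2)"
      using good by eventually_elim (use C(2) in blast)
    ultimately show "(\<forall>\<^sub>F h in at_right 0. integrable (restrict_space lborel unit_square \<Otimes>\<^sub>M SO2_haar)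
        (\<lambda>(\<xi>, \<eta>). \<bar>ibi \<Omega> f \<theta> (\<epsilon> h) h \<eta> \<xi> - ti.\<I>\<bar>\<^sup>2)) \<and> ?L \<in> O[at_right 0](\<lambda>h. h powr ?p)" by blast
  qed
qed

end
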